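(* Fix a normalized reduced root system $R$ in $\mathbb R^N$ and a multiplicity function $k\ge 0$. Let $r>0$, let $f\in L^2(dw)$ with $\operatorname{supp} f\subseteq B(0,r)$, and let $\mathbf x\in\mathbb R^N$. Then $$\operatorname{supp}\,\tau_{\mathbf x}f(-\,\cdot)\subseteq \mathcal O(B(\mathbf x,r)),$$ where $\tau_{\mathbf x}f(-\,\cdot)$ denotes the function $\mathbf y\mapsto(\tau_{\mathbf x}f)(-\mathbf y)$ and $\mathcal O(B(\mathbf x,r))=\bigcup_{\sigma\in G}B(\sigma(\mathbf x),r)$.
   Context: Root system and measure. $R\subset\mathbb R^N\setminus\{0\}$ is a finite set with $\sigma_\alpha(R)=R$ for all $\alpha\in R$, where $\sigma_\alpha\mathbf x=\mathbf x-2\frac{\langle\mathbf x,\alpha\rangle}{\|\alpha\|^2}\alpha$; it is reduced ($R\cap\mathbb R\alpha=\{\pm\alpha\}$) and normalized ($\|\alpha\|^2=2$ for all $\alpha\in R$). $G$ is the finite group generated by the $\sigma_\alpha$, and $k:R\to[0,\infty)$ is $G$-invariant. $dw(\mathbf x)=\prod_{\alpha\in R}|\langle\mathbf x,\alpha\rangle|^{k(\alpha)}d\mathbf x$. $B(\mathbf x,r)=\{\mathbf y\in\mathbb R^N:\|\mathbf x-\mathbf y\|\le r\}$ is the closed Euclidean ball. Dunkl kernel and transform. For $\xi\in\mathbb R^N$ the Dunkl operator is $T_\xi f(\mathbf x)=\partial_\xi f(\mathbf x)+\sum_{\alpha\in R}\frac{k(\alpha)}2\langle\alpha,\xi\rangle\frac{f(\mathbf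 x)-f(\sigma_\alpha\mathbf x)}{\langle\alpha,\mathbf x\rangle}$. For fixed $\mathbf y\in\mathbb R^N$, $E(\cdot,\mathbf y)$ is the unique solution of $T_\xi f=\langle\xi,\mathbf y\rangle f$ (all $\xi\in\mathbb R^N$), $f(0)=1$; $E$ extends uniquely to a holomorphic function on $\mathbb C^N\times\mathbb C^N$. With $c_k=\int_{\mathbb R^N}e^{-\|\mathbf x\|^2/2}dw(\mathbf x)$, $$\mathcal Ff(\xi)=c_k^{-1}\int E(-i\xi,\mathbf x)f(\mathbf x)\,dw(\mathbf x),\qquad \mathcal F^{-1}g(\mathbf x)=c_k^{-1}\int E(i\xi,\mathbf x)g(\xi)\,dw(\xi).$$ $\mathcal F$ preserves the Schwartz class and extends to an isometry of $L^2(dw)$. Dunkl translation. $\tau_{\mathbf x}f(\mathbf y)=c_k^{-1}\int E(i\xi,\mathbf x)E(i\xi,\mathbf y)\mathcal Ff(\xi)\,dw(\xi)$ for Schwartz $f$; it extends to a contraction on $L^2(dw)$, namely $\tau_{\mathbf x}f=\mathcal F^{-1}(E(i\,\cdot,\mathbf x)\mathcal Ff)$. Supports of $L^2(dw)$-functions are essential supports. *)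

theory Defs
  imports "HOL-Analysis.Analysis"
begin

section \<open>Root systems and the associated measure\<close>

definition root_reflection :: "real ^ 'n \<Rightarrow> real ^ 'n \<Rightarrow> real ^ 'n" where
  "root_reflection \<alpha> x = x - (2 * (x \<bullet> \<alpha>) / (norm \<alpha>)\<^sup>2) *\<^sub>R \<alpha>"

definition normalized_reduced_root_system :: "(real ^ 'n) set \<Rightarrow> bool" where
  "normalized_reduced_root_system R \<longleftrightarrow>
     finite R \<and> 0 \<notin> R \<and>
     (\<forall>\<alpha>\<in>R. root_reflection \<alpha> ` R = R) \<and>
     (\<forall>\<alpha>\<in>R. R \<inter> range (\<lambda>c. c *\<^sub>R \<alpha>) = {\<alpha>, - \<alpha>}) \<and>
     (\<forall>\<alpha>\<in>R. (norm \<alpha>)\<^sup>2 = 2)"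

text \<open>Reflections are involutions, so closing under composition already yields the group
  they generate.\<close>

inductive_set reflection_group :: "(real ^ 'n) set \<Rightarrow> (real ^ 'n \<Rightarrow> real ^ 'n) set"
  for R where
  id: "id \<in> reflection_group R"
| comp: "\<alpha> \<in> R \<Longrightarrow> g \<in> reflection_group R \<Longrightarrow> root_reflection \<alpha> \<circ> g \<in> reflection_group R"

text \<open>Only the values of \<open>k\<close> on \<open>R\<close> matter.\<close>

definition multiplicity_function :: "(real ^ 'n) set \<Rightarrow> (real ^ 'n \<Rightarrow> real) \<Rightarrow> bool" where
  "multiplicity_function R k \<longleftrightarrow>
     (\<forall>\<alpha>\<in>R. 0 \<le> k \<alpha>) \<and> (\<forall>g\<in>reflection_group R. \<forall>\<alpha>\<in>R. k (g \<alpha>) = k \<alpha>)"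

text \<open>The case distinction is needed because \<open>0 powr 0 = 0\<close>, whereas \<open>t\<^sup>0 = 1\<close> is meant for
  all \<open>t \<ge> 0\<close>.\<close>

definition dunkl_weight :: "(real ^ 'n) set \<Rightarrow> (real ^ 'n \<Rightarrow> real) \<Rightarrow> real ^ 'n \<Rightarrow> real" where
  "dunkl_weight R k x = (\<Prod>\<alpha>\<in>R. if k \<alpha> = 0 then 1 else \<bar>x \<bullet> \<alpha>\<bar> powr k \<alpha>)"

definition dunkl_measure :: "(real ^ 'n) set \<Rightarrow> (real ^ 'n \<Rightarrow> real) \<Rightarrow> (real ^ 'n) measure" where
  "dunkl_measure R k = density lborel (\<lambda>x. ennreal (dunkl_weight R k x))"

definition dunkl_const :: "(real ^ 'n) set \<Rightarrow> (real ^ 'n \<Rightarrow> real) \<Rightarrow> real" where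
  "dunkl_const R k = (\<integral>x. exp (- (norm x)\<^sup>2 / 2) \<partial>dunkl_measure R k)"


section \<open>Dunkl operators and the Dunkl kernel\<close>

text \<open>The difference quotient \<open>(f x - f (\<sigma>\<^sub>\<alpha> x)) / \<langle>\<alpha>, x\<rangle>\<close>. On the hyperplane \<open>\<langle>\<alpha>, x\<rangle> = 0\<close>
  it is to be read as its continuous extension: there
  \<open>f x - f (x - s *\<^sub>R (2 / (norm \<alpha>)\<^sup>2) *\<^sub>R \<alpha>)\<close>, divided by \<open>s\<close>, tends to
  \<open>2 / (norm \<alpha>)\<^sup>2\<close> times the derivative of \<open>f\<close> in direction \<open>\<alpha>\<close>.\<close>

definition reflection_quotient ::
  "(real ^ 'n \<Rightarrow> complex) \<Rightarrow> real ^ 'n \<Rightarrow> real ^ 'n \<Rightarrow> complex" where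
  "reflection_quotient f \<alpha> x =
     (if \<alpha> \<bullet> x = 0 then of_real (2 / (norm \<alpha>)\<^sup>2) * frechet_derivative f (at x) \<alpha>
      else (f x - f (root_reflection \<alpha> x)) / of_real (\<alpha> \<bullet> x))"

definition dunkl_operator ::
  "(real ^ 'n) set \<Rightarrow> (real ^ 'n \<Rightarrow> real) \<Rightarrow> real ^ 'n \<Rightarrow>
   (real ^ 'n \<Rightarrow> complex) \<Rightarrow> real ^ 'n \<Rightarrow> complex" where
  "dunkl_operator R k \<xi> f x =
     frechet_derivative f (at x) \<xi> +
     (\<Sum>\<alpha>\<in>R. of_real (k \<alpha> / 2 * (\<alpha> \<bullet> \<xi>)) * reflection_quotient f \<alpha> x)"

definition C1_fun :: "(real ^ 'n \<Rightarrow> complex) \<Rightarrow> bool" where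
  "C1_fun f \<longleftrightarrow>
     (\<forall>x. f differentiable (at x)) \<and>
     (\<forall>v. continuous_on UNIV (\<lambda>x. frechet_derivative f (at x) v))"

definition dunkl_kernel_real ::
  "(real ^ 'n) set \<Rightarrow> (real ^ 'n \<Rightarrow> real) \<Rightarrow> real ^ 'n \<Rightarrow> real ^ 'n \<Rightarrow> complex" where
  "dunkl_kernel_real R k x y =
     (THE f. C1_fun f \<and> f 0 = 1 \<and>
        (\<forall>\<xi> z. dunkl_operator R k \<xi> f z = of_real (\<xi> \<bullet> y) * f z)) x"

definition complex_vec :: "real ^ 'n \<Rightarrow> complex ^ 'n" where
  "complex_vec x = (\<chi> i. of_real (x $ i))"

text \<open>Holomorphic on \<open>\<complex>\<^sup>N \<times> \<complex>\<^sup>N\<close>: the total derivative exists and is \<open>\<complex>\<close>-linear everywhere.\<close>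

definition entire_pair :: "(complex ^ 'n \<Rightarrow> complex ^ 'n \<Rightarrow> complex) \<Rightarrow> bool" where
  "entire_pair F \<longleftrightarrow>
     (\<forall>p. \<exists>D. ((\<lambda>(z, w). F z w) has_derivative D) (at p) \<and>
        (\<forall>c u v. D (c *s u, c *s v) = c * D (u, v)))"

definition dunkl_kernel ::
  "(real ^ 'n) set \<Rightarrow> (real ^ 'n \<Rightarrow> real) \<Rightarrow> complex ^ 'n \<Rightarrow> complex ^ 'n \<Rightarrow> complex" where
  "dunkl_kernel R k =
     (THE F. entire_pair F \<and>
        (\<forall>x y. F (complex_vec x) (complex_vec y) = dunkl_kernel_real R k x y))"


section \<open>The Dunkl transform and the Dunkl translation\<close>

definition dunkl_transform ::
  "(real ^ 'n) set \<Rightarrow> (real ^ 'n \<Rightarrow> real) \<Rightarrow> (real ^ 'n \<Rightarrow> complex) \<Rightarrow> real ^ 'n \<Rightarrow> complex" where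
  "dunkl_transform R k f \<xi> =
     inverse (of_real (dunkl_const R k)) *
     (\<integral>x. dunkl_kernel R k ((- \<i>) *s complex_vec \<xi>) (complex_vec x) * f x \<partial>dunkl_measure R k)"

definition dunkl_inverse_transform ::
  "(real ^ 'n) set \<Rightarrow> (real ^ 'n \<Rightarrow> real) \<Rightarrow> (real ^ 'n \<Rightarrow> complex) \<Rightarrow> real ^ 'n \<Rightarrow> complex" where
  "dunkl_inverse_transform R k g x =
     inverse (of_real (dunkl_const R k)) *
     (\<integral>\<xi>. dunkl_kernel R k (\<i> *s complex_vec \<xi>) (complex_vec x) * g \<xi> \<partial>dunkl_measure R k)"

fun iterated_partial ::
  "'n list \<Rightarrow> (real ^ 'n \<Rightarrow> complex) \<Rightarrow> real ^ 'n \<Rightarrow> complex" where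
  "iterated_partial [] f = f"
| "iterated_partial (j # js) f =
     (\<lambda>x. frechet_derivative (iterated_partial js f) (at x) (axis j 1))"

definition schwartz :: "(real ^ 'n \<Rightarrow> complex) \<Rightarrow> bool" where
  "schwartz f \<longleftrightarrow>
     (\<forall>js. (\<forall>x. iterated_partial js f differentiable (at x)) \<and>
        (\<forall>m::nat. bounded (range (\<lambda>x. (1 + norm x) ^ m *\<^sub>R iterated_partial js f x))))"

text \<open>Elements of \<open>L\<^sup>2(M)\<close> are handled through representatives.\<close>

definition L2_space :: "'a measure \<Rightarrow> ('a \<Rightarrow> complex) set" where
  "L2_space M = {f \<in> borel_measurable M. integrable M (\<lambda>x. (norm (f x))\<^sup>2)}"

definition L2_tendsto :: "'a measure \<Rightarrow> (nat \<Rightarrow> 'a \<Rightarrow> complex) \<Rightarrow> ('a \<Rightarrow> complex) \<Rightarrow> bool" where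
  "L2_tendsto M \<phi> f \<longleftrightarrow>
     (\<forall>n. \<phi> n \<in> L2_space M) \<and> f \<in> L2_space M \<and>
     (\<lambda>n. \<integral>x. (norm (\<phi> n x - f x))\<^sup>2 \<partial>M) \<longlonglongrightarrow> 0"

text \<open>The extension by continuity to \<open>L\<^sup>2(M)\<close> of an operator \<open>T\<close> given on the Schwartz class.
  The value is determined up to equality almost everywhere, and the choice operator picks one
  representative.\<close>

definition L2_extension ::
  "(real ^ 'n) measure \<Rightarrow> ((real ^ 'n \<Rightarrow> complex) \<Rightarrow> real ^ 'n \<Rightarrow> complex) \<Rightarrow>
   (real ^ 'n \<Rightarrow> complex) \<Rightarrow> real ^ 'n \<Rightarrow> complex" where
  "L2_extension M T f =
     (SOME g. \<exists>\<phi>. (\<forall>n. schwartz (\<phi> n)) \<and> L2_tendsto M \<phi> f \<and> L2_tendsto M (\<lambda>n. T (\<phi> n)) g)"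

definition dunkl_translation ::
  "(real ^ 'n) set \<Rightarrow> (real ^ 'n \<Rightarrow> real) \<Rightarrow> real ^ 'n \<Rightarrow>
   (real ^ 'n \<Rightarrow> complex) \<Rightarrow> real ^ 'n \<Rightarrow> complex" where
  "dunkl_translation R k x f =
     L2_extension (dunkl_measure R k) (dunkl_inverse_transform R k)
       (\<lambda>\<xi>. dunkl_kernel R k (\<i> *s complex_vec \<xi>) (complex_vec x) *
             L2_extension (dunkl_measure R k) (dunkl_transform R k) f \<xi>)"

definition ess_support :: "'a::topological_space measure \<Rightarrow> ('a \<Rightarrow> complex) \<Rightarrow> 'a set" where
  "ess_support M f = - \<Union>{U. open U \<and> (AE x in M. x \<in> U \<longrightarrow> f x = 0)}"

end

theory Submission
  imports Defs "HOL-Complex_Analysis.Complex_Analysis" "HOL-Real_Asymp.Real_Asymp"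
begin

text \<open>By duality and density, \<open>supp \<tau>\<^sub>x f(-\<cdot>) \<subseteq> \<O>(B(x, r))\<close> for all \<open>f\<close> supported in \<open>B(0, r)\<close> means the
  following: if \<open>\<psi>\<close> is square integrable with bounded support at distance at least \<open>\<rho> > r\<close> from the
  orbit of \<open>x\<close>, then the function \<open>h\<close> with \<open>\<integral> \<tau>\<^sub>x f(-y) \<psi>(y) dw(y) = \<integral> f h dw\<close> vanishes on
  \<open>B(0, r)\<close>.

  The translates of Gaussians are heat kernels: \<open>\<tau>\<^sub>x\<close> maps \<open>exp(-a \<parallel>\<cdot>\<parallel>\<^sup>2)\<close> to
  \<open>exp(-a (\<parallel>x\<parallel>\<^sup>2 + \<parallel>y\<parallel>\<^sup>2)) E(2 a x, y)\<close> at \<open>-y\<close>. A Gronwall argument on the orbit of \<open>x\<close> bounds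
  the kernel by \<open>\<bar>E(x, y)\<bar> \<le> \<bar>G\<bar>\<^sup>1\<^sup>/\<^sup>2 max exp \<langle>\<sigma> x, y\<rangle>\<close>, \<open>\<sigma> \<in> G\<close>, so this translate
  is \<open>O(exp(-a D\<^sup>2))\<close> at points whose distance from the orbit of \<open>x\<close> is at least \<open>D\<close>.
  Multiplying the Gaussian by a polynomial \<open>q\<close> costs only a power of \<open>a\<close>, because
  multiplication by coordinates can be traded for Dunkl operators, which commute with
  translations. Hence \<open>\<integral> h(z) q(z) exp(-a \<parallel>z\<parallel>\<^sup>2) dw(z) = O(a\<^sup>M exp(-a \<rho>\<^sup>2))\<close> for every \<open>q\<close>. As the Laplace
  transform of the radial distribution of \<open>h q\<close> decays at this rate, \<open>h q\<close> has integral zero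
  over every ball of radius less than \<open>\<rho>\<close>, and the density of polynomials times Gaussians in
  \<open>L\<^sup>2\<close> forces \<open>h = 0\<close> there.\<close>

text \<open>A function supported in a ball has no explicit translate, while Gaussians have one but
  vanish nowhere. Duality reconciles the two: the translation is moved to the test function, and
  what remains concerns a single function h, which may be tested against Gaussians. The sharp radius
  survives because 2 <sigma x, y> = |x|^2 + |y|^2 - |sigma x - y|^2 turns the kernel bound into
  exactly exp(-a D^2), and the Laplace criterion sees only this exponential rate: powers of a and
  constants depending on the group are lost without harm. The kernel, its holomorphic extension and
  the extensions to L^2 are given by descriptions and choice, so existence and uniqueness have to be
  established on the way. A chosen L^2 extension comes with an unknown sequence of Schwartz
  functions. About this sequence only the symmetric pairing is used, which Fubini gives for all
  Schwartz functions; the isometry enters just for polynomials times Gaussians, where it makes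
  approximating sequences converge.\<close>

lemma linear_root_reflection: "linear (root_reflection \<alpha>)"
  by (rule linearI) (simp_all add: root_reflection_def algebra_simps add_divide_distrib)

section \<open>The root system and its finite reflection group\<close>

locale dunkl =
  fixes R :: "(real ^ 'n) set" and k :: "real ^ 'n \<Rightarrow> real"
  assumes root_system: "normalized_reduced_root_system R"
    and multiplicity: "multiplicity_function R k"
begin

abbreviation \<sigma> :: "real ^ 'n \<Rightarrow> real ^ 'n \<Rightarrow> real ^ 'n" where "\<sigma> \<equiv> root_reflection"
abbreviation G :: "(real ^ 'n \<Rightarrow> real ^ 'n) set" where "G \<equiv> reflection_group R"

text \<open>R contains both \<alpha> and -\<alpha>, so a sum over all of R counts every reflection
  twice; the factor 1/2 compensates for this. With it, \<open>gam\<close> is the usual constant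
  \<gamma>, and the weight is homogeneous of degree \<open>2 * gam\<close>.\<close>

definition kp :: "real ^ 'n \<Rightarrow> real" where "kp \<alpha> = k \<alpha> / 2"
definition gam :: real where "gam = (\<Sum>\<alpha>\<in>R. kp \<alpha>)"

lemma finR [simp]: "finite R"
  using root_system by (simp add: normalized_reduced_root_system_def)

lemma root_inner [simp]: "\<alpha> \<in> R \<Longrightarrow> \<alpha> \<bullet> \<alpha> = 2"
  using root_system by (simp add: normalized_reduced_root_system_def power2_norm_eq_inner)

lemma root_norm: "\<alpha> \<in> R \<Longrightarrow> (norm \<alpha>)\<^sup>2 = 2"
  by (simp add: power2_norm_eq_inner)

lemma root_nz: "\<alpha> \<in> R \<Longrightarrow> \<alpha> \<noteq> 0"
  using root_system by (auto simp: normalized_reduced_root_system_def)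

lemma s_eq: "\<alpha> \<in> R \<Longrightarrow> \<sigma> \<alpha> x = x - (x \<bullet> \<alpha>) *\<^sub>R \<alpha>"
  by (simp add: root_reflection_def root_norm)

lemma s_s [simp]: "\<alpha> \<in> R \<Longrightarrow> \<sigma> \<alpha> (\<sigma> \<alpha> x) = x"
  by (simp add: s_eq inner_simps algebra_simps flip: scaleR_add_left)

lemma s_comp_s [simp]: "\<alpha> \<in> R \<Longrightarrow> \<sigma> \<alpha> \<circ> \<sigma> \<alpha> = id"
  by (auto simp: fun_eq_iff)

lemma s_fixed: "\<alpha> \<in> R \<Longrightarrow> \<alpha> \<bullet> x = 0 \<Longrightarrow> \<sigma> \<alpha> x = x"
  by (simp add: s_eq inner_commute)

lemma s_adj: "\<alpha> \<in> R \<Longrightarrow> \<sigma> \<alpha> x \<bullet> y = x \<bullet> \<sigma> \<alpha> y"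
  by (simp add: s_eq inner_simps inner_commute)

lemma inner_s: "\<alpha> \<in> R \<Longrightarrow> \<alpha> \<bullet> \<sigma> \<alpha> x = - (\<alpha> \<bullet> x)"
  by (simp add: s_eq inner_simps inner_commute)

lemma s_R: "\<alpha> \<in> R \<Longrightarrow> \<sigma> \<alpha> ` R = R"
  using root_system by (simp add: normalized_reduced_root_system_def)

lemma kp_nonneg: "\<alpha> \<in> R \<Longrightarrow> 0 \<le> kp \<alpha>"
  using multiplicity by (simp add: multiplicity_function_def kp_def)

lemma k_nonneg: "\<alpha> \<in> R \<Longrightarrow> 0 \<le> k \<alpha>"
  using multiplicity by (simp add: multiplicity_function_def)

lemma gam_nonneg: "0 \<le> gam"
  unfolding gam_def by (intro sum_nonneg kp_nonneg)

lemma s_in_G [simp]: "\<alpha> \<in> R \<Longrightarrow> \<sigma> \<alpha> \<in> G"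
  using reflection_group.comp[OF _ reflection_group.id, of \<alpha> R] by simp

lemma id_in_G [simp]: "id \<in> G"
  by (rule reflection_group.id)

lemma G_comp: "g \<in> G \<Longrightarrow> h \<in> G \<Longrightarrow> g \<circ> h \<in> G"
  by (induction rule: reflection_group.induct) (auto simp: comp_assoc intro: reflection_group.comp)

lemma G_linear: "g \<in> G \<Longrightarrow> linear g"
  by (induction rule: reflection_group.induct)
     (simp_all only: linear_compose linear_root_reflection linear_id)

lemma G_inner: "g \<in> G \<Longrightarrow> g x \<bullet> g y = x \<bullet> y"
proof (induction arbitrary: x y rule: reflection_group.induct)
  case (comp \<alpha> g)
  then show ?case by (simp add: s_adj)
qed simp

lemma G_norm: "g \<in> G \<Longrightarrow> norm (g x) = norm x"
  by (simp add: norm_eq_sqrt_inner G_inner)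

lemma G_R: "g \<in> G \<Longrightarrow> g ` R = R"
  by (induction rule: reflection_group.induct) (simp_all only: image_comp[symmetric] s_R, simp)

lemma G_inj: "g \<in> G \<Longrightarrow> inj g"
  by (metis G_linear G_norm linear_injective_0 norm_eq_zero)

lemma G_root [simp]: "g \<in> G \<Longrightarrow> \<alpha> \<in> R \<Longrightarrow> g \<alpha> \<in> R"
  using G_R by blast

lemma G_kp: "g \<in> G \<Longrightarrow> \<alpha> \<in> R \<Longrightarrow> kp (g \<alpha>) = kp \<alpha>"
  using multiplicity by (simp add: multiplicity_function_def kp_def)

lemma G_k: "g \<in> G \<Longrightarrow> \<alpha> \<in> R \<Longrightarrow> k (g \<alpha>) = k \<alpha>"
  using multiplicity by (simp add: multiplicity_function_def)

lemma G_inverse: assumes "g \<in> G" obtains h where "h \<in> G" "h \<circ> g = id" "g \<circ> h = id"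
proof -
  have "\<exists>h\<in>G. h \<circ> g = id \<and> g \<circ> h = id" using assms
  proof (induction rule: reflection_group.induct)
    case id show ?case by (rule bexI[of _ id]) auto
  next
    case (comp \<alpha> g)
    then obtain h where h: "h \<in> G" "h \<circ> g = id" "g \<circ> h = id" by blast
    have "(h \<circ> \<sigma> \<alpha>) \<circ> (\<sigma> \<alpha> \<circ> g) = h \<circ> (\<sigma> \<alpha> \<circ> \<sigma> \<alpha>) \<circ> g" by (simp only: comp_assoc)
    also have "\<dots> = id" using h comp by simp
    finally have 1: "(h \<circ> \<sigma> \<alpha>) \<circ> (\<sigma> \<alpha> \<circ> g) = id" .
    have "(\<sigma> \<alpha> \<circ> g) \<circ> (h \<circ> \<sigma> \<alpha>) = \<sigma> \<alpha> \<circ> (g \<circ> h) \<circ> \<sigma> \<alpha>" by (simp only: comp_assoc)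
    also have "\<dots> = id" using h comp by simp
    finally have 2: "(\<sigma> \<alpha> \<circ> g) \<circ> (h \<circ> \<sigma> \<alpha>) = id" .
    have "h \<circ> \<sigma> \<alpha> \<in> G" using h comp by (intro G_comp s_in_G)
    with 1 2 show ?case by blast
  qed
  then show ?thesis using that by blast
qed

lemma s_conj: "g \<in> G \<Longrightarrow> \<alpha> \<in> R \<Longrightarrow> \<sigma> (g \<alpha>) (g x) = g (\<sigma> \<alpha> x)"
  by (simp add: s_eq G_inner linear_diff[OF G_linear] linear_scale[OF G_linear])

text \<open>Every element of the group fixes the orthogonal complement of the span of R pointwise.
  Hence it is determined by its restriction to R, which maps the finite set R to itself.\<close>

lemma finite_G [simp]: "finite G"
proof -
  have eq: "g = h" if "g \<in> G" "h \<in> G" "\<And>\<alpha>. \<alpha> \<in> R \<Longrightarrow> g \<alpha> = h \<alpha>" for g h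
  proof
    fix x
    have fx: "g z = z" if "g \<in> G" "\<And>w. w \<in> span R \<Longrightarrow> orthogonal z w" for g z
      using that
    proof (induction rule: reflection_group.induct)
      case (comp \<alpha> g)
      then show ?case by (simp add: s_eq orthogonal_def span_base)
    qed simp
    obtain y z where yz: "y \<in> span R" "\<And>w. w \<in> span R \<Longrightarrow> orthogonal z w" "x = y + z"
      using orthogonal_subspace_decomp_exists by blast
    have "g y = h y"
      using linear_eq_on_span[OF G_linear[OF that(1)] G_linear[OF that(2)] that(3) yz(1)] .
    then show "g x = h x"
      using fx[OF that(1) yz(2)] fx[OF that(2) yz(2)] yz(3)
      by (simp add: linear_add[OF G_linear] that)
  qed
  have "inj_on (\<lambda>g. restrict g R) G"
  proof (rule inj_onI)
    fix g h assume *: "g \<in> G" "h \<in> G" "restrict g R = restrict h R"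
    show "g = h" by (rule eq[OF *(1,2)]) (metis *(3) restrict_apply')
  qed
  moreover have "(\<lambda>g. restrict g R) ` G \<subseteq> R \<rightarrow>\<^sub>E R" by auto
  ultimately show ?thesis
    using finite_PiE[OF finR, of "\<lambda>_. R"] finR by (metis finite_imageD finite_subset)
qed

lemma sum_R_reindex: "g \<in> G \<Longrightarrow> (\<Sum>\<alpha>\<in>R. f (g \<alpha>)) = (\<Sum>\<alpha>\<in>R. f \<alpha>)"
  using sum.reindex[of g R f] G_inj[of g] G_R[of g] by (simp add: inj_on_subset o_def)

lemma prod_R_reindex: "g \<in> G \<Longrightarrow> (\<Prod>\<alpha>\<in>R. f (g \<alpha>)) = (\<Prod>\<alpha>\<in>R. f \<alpha>)"
  using prod.reindex[of g R f] G_inj[of g] G_R[of g] by (simp add: inj_on_subset o_def)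

lemma sum_G_left: assumes "h \<in> G" shows "(\<Sum>g\<in>G. f (h \<circ> g)) = (\<Sum>g\<in>G. f g)"
proof -
  obtain h' where "h' \<in> G" "h' \<circ> h = id" "h \<circ> h' = id" using G_inverse assms by blast
  then show ?thesis using assms
    by (intro sum.reindex_bij_witness[of _ "\<lambda>g. h' \<circ> g" "\<lambda>g. h \<circ> g"])
       (auto simp: comp_assoc[symmetric] intro: G_comp)
qed

lemma sum_G_right: assumes "h \<in> G" shows "(\<Sum>g\<in>G. f (g \<circ> h)) = (\<Sum>g\<in>G. f g)"
proof -
  obtain h' where "h' \<in> G" "h' \<circ> h = id" "h \<circ> h' = id" using G_inverse assms by blast
  then show ?thesis using assms
    by (intro sum.reindex_bij_witness[of _ "\<lambda>g. g \<circ> h'" "\<lambda>g. g \<circ> h"])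
       (auto simp: comp_assoc intro: G_comp)
qed

end

section \<open>Complexification of the space and of the group action\<close>

definition cdot :: "complex ^ 'n \<Rightarrow> complex ^ 'n \<Rightarrow> complex" where
  "cdot z w = (\<Sum>i\<in>UNIV. z $ i * w $ i)"

definition vRe :: "complex ^ 'n \<Rightarrow> real ^ 'n" where "vRe z = (\<chi> i. Re (z $ i))"
definition vIm :: "complex ^ 'n \<Rightarrow> real ^ 'n" where "vIm z = (\<chi> i. Im (z $ i))"

lemma cdot_commute: "cdot z w = cdot w z"
  by (simp add: cdot_def mult.commute)

lemma cdot_add_left: "cdot (z + z') w = cdot z w + cdot z' w"
  and cdot_scale_left: "cdot (c *s z) w = c * cdot z w"
  by (simp_all add: cdot_def algebra_simps sum.distrib sum_distrib_left)

lemma cdot_add_right: "cdot w (z + z') = cdot w z + cdot w z'"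
  and cdot_scale_right: "cdot w (c *s z) = c * cdot w z"
  by (simp_all add: cdot_commute[of w] cdot_add_left cdot_scale_left)

lemma norm_cdot_le: "norm (cdot z w) \<le> norm z * norm w"
proof -
  have "norm (cdot z w) \<le> (\<Sum>i\<in>UNIV. \<bar>norm (z $ i)\<bar> * \<bar>norm (w $ i)\<bar>)"
    unfolding cdot_def by (rule order_trans[OF norm_sum]) (simp add: norm_mult)
  also have "\<dots> \<le> norm z * norm w"
    unfolding norm_vec_def by (rule L2_set_mult_ineq)
  finally show ?thesis .
qed

lemma bounded_bilinear_cdot: "bounded_bilinear cdot"
proof
  show "\<exists>K. \<forall>a b. norm (cdot a b) \<le> norm a * norm b * K"
    by (rule exI[of _ 1]) (simp add: norm_cdot_le)
next
  fix r :: real and a b :: "complex ^ 'a"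
  show "cdot (r *\<^sub>R a) b = r *\<^sub>R cdot a b"
    unfolding cdot_def by (simp add: scaleR_sum_right)
  show "cdot a (r *\<^sub>R b) = r *\<^sub>R cdot a b"
    unfolding cdot_def by (simp add: scaleR_sum_right)
qed (simp_all add: cdot_add_left cdot_add_right)

lemma complex_vec_add: "complex_vec (x + y) = complex_vec x + complex_vec y"
  and complex_vec_diff: "complex_vec (x - y) = complex_vec x - complex_vec y"
  and complex_vec_0 [simp]: "complex_vec 0 = 0"
  and complex_vec_scaleR: "complex_vec (r *\<^sub>R x) = complex_of_real r *s complex_vec x"
  by (simp_all add: complex_vec_def vec_eq_iff)

lemma cdot_complex_vec: "cdot (complex_vec x) (complex_vec y) = of_real (x \<bullet> y)"
  by (simp add: cdot_def complex_vec_def inner_vec_def)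

lemma norm_complex_vec [simp]: "norm (complex_vec x) = norm x"
  by (simp add: norm_vec_def complex_vec_def)

lemma linear_complex_vec: "linear complex_vec"
  by (rule linearI) (simp_all add: complex_vec_def vec_eq_iff complex_eq_iff)

lemma bounded_linear_complex_vec: "bounded_linear complex_vec"
  by (simp add: linear_complex_vec linear_linear)

lemma vec_Re_Im: "z = complex_vec (vRe z) + \<i> *s complex_vec (vIm z)"
  by (simp add: vec_eq_iff complex_vec_def vRe_def vIm_def complex_eq)

lemma vRe_simps [simp]: "vRe (complex_vec a + \<i> *s complex_vec b) = a"
  "vIm (complex_vec a + \<i> *s complex_vec b) = b" "vRe (complex_vec a) = a" "vIm (complex_vec a) = 0"
  by (simp_all add: vRe_def vIm_def complex_vec_def vec_eq_iff)

lemma vRe_add: "vRe (z + w) = vRe z + vRe w" and vIm_add: "vIm (z + w) = vIm z + vIm w"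
  and vRe_scale: "vRe (c *s z) = Re c *\<^sub>R vRe z - Im c *\<^sub>R vIm z"
  and vIm_scale: "vIm (c *s z) = Re c *\<^sub>R vIm z + Im c *\<^sub>R vRe z"
  by (simp_all add: vRe_def vIm_def vec_eq_iff)

lemma norm_vec_Re_Im: "(norm z)\<^sup>2 = (norm (vRe z))\<^sup>2 + (norm (vIm z))\<^sup>2"
  unfolding power2_norm_eq_inner inner_vec_def
  by (simp add: vRe_def vIm_def inner_complex_def sum.distrib)

text \<open>The complex linear extension of a real linear map. The form \<open>cdot\<close> that it
  respects is bilinear and not sesquilinear, because the kernel has to be holomorphic in both
  arguments.\<close>

definition cext :: "(real ^ 'n \<Rightarrow> real ^ 'n) \<Rightarrow> complex ^ 'n \<Rightarrow> complex ^ 'n" where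
  "cext g z = complex_vec (g (vRe z)) + \<i> *s complex_vec (g (vIm z))"

lemma cext_id [simp]: "cext id z = z"
  by (simp add: cext_def vec_Re_Im[symmetric])

lemma cext_comp: "cext (g \<circ> h) z = cext g (cext h z)"
  by (simp add: cext_def)

lemma cext_complex_vec: "linear g \<Longrightarrow> cext g (complex_vec x) = complex_vec (g x)"
  by (simp add: cext_def linear_0)

lemma cext_scale: "linear g \<Longrightarrow> cext g (c *s z) = c *s cext g z"
  by (simp add: cext_def vRe_scale vIm_scale linear_add linear_diff linear_scale
      complex_vec_add complex_vec_diff complex_vec_scaleR vec_eq_iff complex_eq_iff complex_vec_def)

lemma cext_add: "linear g \<Longrightarrow> cext g (z + w) = cext g z + cext g w"
  by (simp add: cext_def vRe_add vIm_add linear_add complex_vec_add vec_eq_iff algebra_simps)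

lemma cext_scaleR: "linear g \<Longrightarrow> cext g (r *\<^sub>R z) = r *\<^sub>R cext g z"
proof -
  have *: "r *\<^sub>R y = complex_of_real r *s y" for y :: "complex ^ 'n"
    by (simp add: vec_eq_iff complex_eq_iff)
  show "linear g \<Longrightarrow> ?thesis" unfolding * by (rule cext_scale)
qed

lemma bounded_linear_cext: "linear g \<Longrightarrow> bounded_linear (cext g)"
  by (rule linear_conv_bounded_linear[THEN iffD1]) (rule linearI; simp add: cext_add cext_scaleR)

context dunkl
begin

lemma norm_cext [simp]: "g \<in> G \<Longrightarrow> norm (cext g z) = norm z"
proof -
  assume "g \<in> G"
  then have "(norm (cext g z))\<^sup>2 = (norm z)\<^sup>2"
    by (simp add: norm_vec_Re_Im) (simp add: cext_def G_norm)
  then show ?thesis by simp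
qed

lemma cdot_cext: assumes "g \<in> G" shows "cdot (cext g z) (cext g w) = cdot z w"
proof -
  have "cdot (cext g z) (cext g w) = cdot (complex_vec (vRe z) + \<i> *s complex_vec (vIm z))
    (complex_vec (vRe w) + \<i> *s complex_vec (vIm w))"
    using assms unfolding cext_def
    by (simp only: cdot_add_left cdot_add_right cdot_scale_left cdot_scale_right cdot_complex_vec G_inner)
  then show ?thesis by (simp only: vec_Re_Im[symmetric])
qed

section \<open>The homogeneous components of the Dunkl kernel\<close>

text \<open>By Euler's formula the component \<open>E\<^sub>n(\<cdot>, w)\<close> of degree \<open>n\<close> of the kernel satisfies
  \<open>(n + \<gamma>) E\<^sub>n(z) - \<Sum>\<^sub>\<alpha> (k \<alpha> / 2) E\<^sub>n(\<sigma>\<^sub>\<alpha> z) = \<langle>z, w\<rangle> E\<^sub>n\<^sub>-\<^sub>1(z)\<close>, where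
  \<open>\<gamma> = \<Sum>\<^sub>\<alpha> k \<alpha> / 2\<close>. On an orbit of the group this is a linear system, and \<open>green n\<close> is the
  Neumann series of its inverse. Its positivity yields all estimates.\<close>

primrec walk :: "nat \<Rightarrow> (real ^ 'n \<Rightarrow> real ^ 'n) \<Rightarrow> real" where
  "walk 0 g = (if g = id then 1 else 0)"
| "walk (Suc j) g = (\<Sum>\<alpha>\<in>R. kp \<alpha> * walk j (g \<circ> \<sigma> \<alpha>))"

definition green :: "nat \<Rightarrow> (real ^ 'n \<Rightarrow> real ^ 'n) \<Rightarrow> real" where
  "green n g = (\<Sum>j. walk j g / (real n + gam) ^ Suc j)"

lemma walk_nonneg: "0 \<le> walk j g"
  by (induction j arbitrary: g) (auto intro!: sum_nonneg mult_nonneg_nonneg kp_nonneg)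

lemma walk_le: "walk j g \<le> gam ^ j"
proof (induction j arbitrary: g)
  case (Suc j)
  have "walk (Suc j) g \<le> (\<Sum>\<alpha>\<in>R. kp \<alpha> * gam ^ j)"
    by (auto intro!: sum_mono mult_left_mono Suc kp_nonneg)
  also have "\<dots> = gam ^ Suc j" by (simp add: gam_def sum_distrib_right)
  finally show ?case .
qed simp

text \<open>The Neumann series is dominated by a geometric series of ratio
  \<open>gam / (n + gam)\<close>; n > 0 makes this ratio less than 1.\<close>

lemma summable_green: assumes "n > 0"
  shows "summable (\<lambda>j. walk j g / (real n + gam) ^ Suc j)"
proof (rule summable_comparison_test)
  show "\<exists>N. \<forall>j\<ge>N. norm (walk j g / (real n + gam) ^ Suc j) \<le> (1 / (real n + gam)) * (gam / (real n + gam)) ^ j"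
    using walk_le walk_nonneg gam_nonneg assms
    by (intro exI[of _ 0]) (auto simp: power_divide divide_simps mult_ac)
  show "summable (\<lambda>j. (1 / (real n + gam)) * (gam / (real n + gam)) ^ j)"
    using gam_nonneg assms by (intro summable_mult summable_geometric) auto
qed

lemma green_nonneg: "n > 0 \<Longrightarrow> 0 \<le> green n g"
  unfolding green_def using summable_green[of n g] walk_nonneg gam_nonneg
  by (intro suminf_nonneg) auto

text \<open>Splitting off the zeroth term of the Neumann series shows that \<open>green n\<close> is
  the fundamental solution at \<open>id\<close> of the linear system on the orbit.\<close>

lemma green_eq: assumes "n > 0"
  shows "(real n + gam) * green n g = (if g = id then 1 else 0) + (\<Sum>\<alpha>\<in>R. kp \<alpha> * green n (g \<circ> \<sigma> \<alpha>))"
proof -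
  let ?c = "real n + gam"
  have c: "?c > 0" using assms gam_nonneg by simp
  have "?c * green n g = (\<Sum>j. walk j g / ?c ^ j)"
    unfolding green_def using c by (subst suminf_mult[symmetric, OF summable_green[OF assms]]) simp
  also have "\<dots> = walk 0 g + (\<Sum>j. walk (Suc j) g / ?c ^ Suc j)"
    by (subst suminf_split_head)
       (use summable_mult[OF summable_green[OF assms, of g], of ?c] c in \<open>simp_all\<close>)
  also have "(\<Sum>j. walk (Suc j) g / ?c ^ Suc j) = (\<Sum>j. \<Sum>\<alpha>\<in>R. kp \<alpha> * (walk j (g \<circ> \<sigma> \<alpha>) / ?c ^ Suc j))"
    by (simp add: sum_divide_distrib)
  also have "\<dots> = (\<Sum>\<alpha>\<in>R. kp \<alpha> * green n (g \<circ> \<sigma> \<alpha>))"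
    unfolding green_def
    by (subst suminf_sum) (intro summable_mult summable_green assms sum.cong refl suminf_mult)+
  finally show ?thesis by simp
qed

text \<open>When the equation of \<open>green\<close> is summed over the group, the reflections only
  permute the summands and \<open>gam\<close> cancels. This exact mass 1 / n is the source of the
  factorial in \<open>En_bound\<close>.\<close>

lemma sum_green: assumes "n > 0" shows "(\<Sum>g\<in>G. green n g) = 1 / real n"
proof -
  have "(real n + gam) * (\<Sum>g\<in>G. green n g)
    = (\<Sum>g\<in>G. (if g = id then 1 else 0) + (\<Sum>\<alpha>\<in>R. kp \<alpha> * green n (g \<circ> \<sigma> \<alpha>)))"
    by (simp add: sum_distrib_left green_eq[OF assms])
  also have "\<dots> = 1 + (\<Sum>\<alpha>\<in>R. kp \<alpha> * (\<Sum>g\<in>G. green n (g \<circ> \<sigma> \<alpha>)))"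
    by (simp add: sum.distrib sum.swap[of _ R] sum_distrib_left sum.delta)
  also have "\<dots> = 1 + gam * (\<Sum>g\<in>G. green n g)"
    by (simp add: sum_G_right gam_def sum_distrib_right)
  finally show ?thesis using assms by (simp add: field_simps)
qed

text \<open>Defined on complex arguments from the start, so that the series E is at once the
  holomorphic extension demanded by \<open>dunkl_kernel\<close>.\<close>

primrec En :: "nat \<Rightarrow> complex ^ 'n \<Rightarrow> complex ^ 'n \<Rightarrow> complex" where
  "En 0 z w = 1"
| "En (Suc n) z w = (\<Sum>g\<in>G. of_real (green (Suc n) g) * (cdot (cext g z) w * En n (cext g z) w))"

declare En.simps(2) [simp del]

lemma En_recursion:
  "(of_nat (Suc n) + of_real gam) * En (Suc n) z w
     = cdot z w * En n z w + (\<Sum>\<alpha>\<in>R. of_real (kp \<alpha>) * En (Suc n) (cext (\<sigma> \<alpha>) z) w)"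
proof -
  define u where "u z = cdot z w * En n z w" for z
  define c where "c g = complex_of_real (green (Suc n) g)" for g
  have E: "En (Suc n) z w = (\<Sum>g\<in>G. c g * u (cext g z))" for z
    by (simp add: u_def c_def En.simps)
  have "(\<Sum>g\<in>G. c g * u (cext g (cext (\<sigma> \<alpha>) z))) = (\<Sum>g\<in>G. c (g \<circ> \<sigma> \<alpha>) * u (cext g z))" if "\<alpha> \<in> R" for \<alpha>
    using sum_G_right[of "\<sigma> \<alpha>" "\<lambda>g. c (g \<circ> \<sigma> \<alpha>) * u (cext g z)"] that
    by (simp add: comp_assoc cext_comp)
  then have "(\<Sum>\<alpha>\<in>R. of_real (kp \<alpha>) * En (Suc n) (cext (\<sigma> \<alpha>) z) w)
     = (\<Sum>\<alpha>\<in>R. \<Sum>g\<in>G. of_real (kp \<alpha>) * c (g \<circ> \<sigma> \<alpha>) * u (cext g z))"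
    unfolding E by (intro sum.cong[OF refl]) (simp add: sum_distrib_left mult.assoc)
  also have "\<dots> = (\<Sum>g\<in>G. (\<Sum>\<alpha>\<in>R. of_real (kp \<alpha>) * c (g \<circ> \<sigma> \<alpha>)) * u (cext g z))"
    by (subst sum.swap) (simp add: sum_distrib_right)
  also have "\<dots> = (\<Sum>g\<in>G. ((of_nat (Suc n) + of_real gam) * c g - (if g = id then 1 else 0)) * u (cext g z))"
  proof (rule sum.cong[OF refl], goal_cases)
    case (1 g)
    have "complex_of_real ((real (Suc n) + gam) * green (Suc n) g)
      = of_real ((if g = id then 1 else 0) + (\<Sum>\<alpha>\<in>R. kp \<alpha> * green (Suc n) (g \<circ> \<sigma> \<alpha>)))"
      by (subst green_eq) auto
    then show ?case by (simp add: c_def)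
  qed
  also have "\<dots> = (of_nat (Suc n) + of_real gam) * En (Suc n) z w - u z"
    by (simp add: E left_diff_distrib sum_subtractf sum_distrib_left mult.assoc if_distrib[of "\<lambda>x. x * _"] sum.delta cong: if_cong)
  finally show ?thesis by (simp add: u_def)
qed

text \<open>A maximum principle: at a group element where \<open>norm (v g)\<close> is largest, the
  right side has norm at most \<open>gam\<close> times this maximum, which the factor n + gam on the
  left exceeds unless the maximum is 0.\<close>

lemma orbit_zero:
  fixes v :: "(real ^ 'n \<Rightarrow> real ^ 'n) \<Rightarrow> complex"
  assumes n: "n > 0" and eq: "\<And>g. g \<in> G \<Longrightarrow> (of_nat n + of_real gam) * v g = (\<Sum>\<alpha>\<in>R. of_real (kp \<alpha>) * v (\<sigma> \<alpha> \<circ> g))"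
    and g: "g \<in> G"
  shows "v g = 0"
proof -
  have fin: "finite ((\<lambda>g. norm (v g)) ` G)" "(\<lambda>g. norm (v g)) ` G \<noteq> {}" using g by auto
  obtain m where m0: "m \<in> G" "norm (v m) = Max ((\<lambda>g. norm (v g)) ` G)"
    using Max_in[OF fin] by auto
  then have m: "m \<in> G" "\<And>g. g \<in> G \<Longrightarrow> norm (v g) \<le> norm (v m)"
    using Max_ge[OF fin(1)] by auto
  have "(real n + gam) * norm (v m) = norm ((of_nat n + of_real gam) * v m)"
  proof -
    have "of_nat n + of_real gam = complex_of_real (real n + gam)" by simp
    then show ?thesis using gam_nonneg by (simp only: norm_mult norm_of_real)
  qed
  also have "\<dots> \<le> (\<Sum>\<alpha>\<in>R. kp \<alpha> * norm (v (\<sigma> \<alpha> \<circ> m)))"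
    unfolding eq[OF m(1)] by (rule order_trans[OF norm_sum]) (simp add: norm_mult kp_nonneg)
  also have "\<dots> \<le> (\<Sum>\<alpha>\<in>R. kp \<alpha> * norm (v m))"
    by (intro sum_mono mult_left_mono m kp_nonneg G_comp s_in_G)
  also have "\<dots> = gam * norm (v m)" by (simp add: gam_def sum_distrib_right)
  finally have "real n * norm (v m) \<le> 0" by (simp add: algebra_simps)
  then have "norm (v m) = 0" using n by (simp add: mult_le_0_iff)
  with m(2)[OF g] show ?thesis by simp
qed

text \<open>The difference of two solutions solves the homogeneous system on each orbit. V may be an
  arbitrary function, so identities for \<open>En\<close> can be proved by checking the recursion
  for the other side.\<close>

lemma En_unique:
  assumes "\<And>z. (of_nat (Suc n) + of_real gam) * V z
     = cdot z w * En n z w + (\<Sum>\<alpha>\<in>R. of_real (kp \<alpha>) * V (cext (\<sigma> \<alpha>) z))"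
  shows "V z = En (Suc n) z w"
proof -
  have "V (cext id z) - En (Suc n) (cext id z) w = 0"
  proof (rule orbit_zero[of "Suc n" "\<lambda>g. V (cext g z) - En (Suc n) (cext g z) w"])
    fix g assume "g \<in> G"
    show "(of_nat (Suc n) + of_real gam) * (V (cext g z) - En (Suc n) (cext g z) w) =
         (\<Sum>\<alpha>\<in>R. of_real (kp \<alpha>) * (V (cext (\<sigma> \<alpha> \<circ> g) z) - En (Suc n) (cext (\<sigma> \<alpha> \<circ> g) z) w))"
      unfolding right_diff_distrib assms En_recursion cext_comp sum_subtractf by simp
  qed auto
  then show ?thesis by simp
qed

text \<open>The left side satisfies the same recursion in z, because h permutes R, preserves the
  multiplicities and conjugates \<sigma> \<alpha> into \<sigma> (h \<alpha>).\<close>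

lemma En_equivariant: "h \<in> G \<Longrightarrow> En n (cext h z) (cext h w) = En n z w"
proof (induction n arbitrary: z)
  case (Suc n)
  show ?case
  proof (rule En_unique[of n "\<lambda>z. En (Suc n) (cext h z) (cext h w)"])
    fix z
    have "(\<Sum>\<alpha>\<in>R. complex_of_real (kp \<alpha>) * En (Suc n) (cext (\<sigma> \<alpha>) (cext h z)) (cext h w))
      = (\<Sum>\<alpha>\<in>R. complex_of_real (kp (h \<alpha>)) * En (Suc n) (cext (\<sigma> (h \<alpha>)) (cext h z)) (cext h w))"
      by (rule sum_R_reindex[symmetric]) fact
    also have "\<dots> = (\<Sum>\<alpha>\<in>R. complex_of_real (kp \<alpha>) * En (Suc n) (cext h (cext (\<sigma> \<alpha>) z)) (cext h w))"
    proof (rule sum.cong[OF refl], goal_cases)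
      case (1 \<alpha>)
      have "\<sigma> (h \<alpha>) \<circ> h = h \<circ> \<sigma> \<alpha>" using s_conj[OF Suc.prems 1] by (simp add: fun_eq_iff)
      then show ?case by (simp add: cext_comp[symmetric] G_kp Suc.prems 1)
    qed
    finally show "(of_nat (Suc n) + of_real gam) * En (Suc n) (cext h z) (cext h w)
      = cdot z w * En n z w + (\<Sum>\<alpha>\<in>R. of_real (kp \<alpha>) * En (Suc n) (cext h (cext (\<sigma> \<alpha>) z)) (cext h w))"
      unfolding En_recursion using Suc by (simp add: cdot_cext)
  qed
qed simp

text \<open>The recursion for \<open>En (Suc n) w z\<close> reflects w. Equivariance moves these
  reflections to z, and the result is the recursion that characterizes
  \<open>En (Suc n) z w\<close>.\<close>

lemma En_symmetric: "En n z w = En n w z"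
proof (induction n arbitrary: z)
  case (Suc n)
  show ?case
  proof (rule En_unique[of n "\<lambda>z. En (Suc n) w z", symmetric])
    fix z
    have "En (Suc n) (cext (\<sigma> \<alpha>) w) z = En (Suc n) w (cext (\<sigma> \<alpha>) z)" if "\<alpha> \<in> R" for \<alpha>
      using En_equivariant[of "\<sigma> \<alpha>" "Suc n" "cext (\<sigma> \<alpha>) w" z] that
      by (simp add: cext_comp[symmetric])
    then show "(of_nat (Suc n) + of_real gam) * En (Suc n) w z
      = cdot z w * En n z w + (\<Sum>\<alpha>\<in>R. of_real (kp \<alpha>) * En (Suc n) w (cext (\<sigma> \<alpha>) z))"
      unfolding En_recursion by (simp add: Suc cdot_commute)
  qed
qed simp

lemma En_scale_left: "En n (c *s z) w = c ^ n * En n z w"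
proof (induction n arbitrary: z)
  case (Suc n)
  show ?case unfolding En.simps sum_distrib_left
    by (intro sum.cong refl) (simp add: cext_scale G_linear cdot_scale_left Suc mult_ac)
qed simp

lemma En_scale_right: "En n z (c *s w) = c ^ n * En n z w"
  using En_scale_left[of n c w z] by (simp add: En_symmetric[of n z])

lemma En_bound: "norm (En n z w) \<le> (norm z * norm w) ^ n / fact n"
proof (induction n arbitrary: z)
  case (Suc n)
  have "norm (En (Suc n) z w) \<le> (\<Sum>g\<in>G. green (Suc n) g * (norm z * norm w * ((norm z * norm w) ^ n / fact n)))"
    unfolding En.simps
  proof (rule sum_norm_le)
    fix g assume g: "g \<in> G"
    show "norm (of_real (green (Suc n) g) * (cdot (cext g z) w * En n (cext g z) w))
      \<le> green (Suc n) g * (norm z * norm w * ((norm z * norm w) ^ n / fact n))"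
      unfolding norm_mult using norm_cdot_le[of "cext g z" w] Suc[of "cext g z"] g green_nonneg[of "Suc n" g]
      by (intro mult_left_mono mult_mono) auto
  qed
  also have "\<dots> = (norm z * norm w) ^ Suc n / fact (Suc n)"
    unfolding sum_distrib_right[symmetric] sum_green[OF zero_less_Suc] by (simp add: power_mult_distrib)
  finally show ?case .
qed simp

lemma En_real: "En n (complex_vec x) (complex_vec y) \<in> \<real>"
  by (induction n arbitrary: x) (auto simp: En.simps cext_complex_vec G_linear cdot_complex_vec)

end

section \<open>Calculus of Dunkl operators\<close>

abbreviation fder :: "(real ^ 'n \<Rightarrow> complex) \<Rightarrow> real ^ 'n \<Rightarrow> real ^ 'n \<Rightarrow> complex" where
  "fder f x \<equiv> frechet_derivative f (at x)"

lemmas scaleR_complex = scaleR_conv_of_real[where 'a = complex]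

lemma fder_eq: "(f has_derivative f') (at x) \<Longrightarrow> fder f x = f'"
  by (simp add: frechet_derivative_at[symmetric])

lemma fder_works: "f differentiable at x \<Longrightarrow> (f has_derivative fder f x) (at x)"
  by (simp add: frechet_derivative_works)

lemma fder_linear: "f differentiable at x \<Longrightarrow> linear (fder f x)"
  using fder_works has_derivative_linear by blast

lemma fder_add: "f differentiable at x \<Longrightarrow> g differentiable at x \<Longrightarrow>
    fder (\<lambda>x. f x + g x) x h = fder f x h + fder g x h"
  by (subst fder_eq[OF has_derivative_add]) (auto intro: fder_works)

lemma fder_mult: "f differentiable at x \<Longrightarrow> g differentiable at x \<Longrightarrow>
    fder (\<lambda>x. f x * g x) x h = f x * fder g x h + fder f x h * g x"
  by (subst fder_eq[OF has_derivative_mult]) (auto intro: fder_works)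

lemma fder_coord: "fder (\<lambda>x. of_real (x \<bullet> \<zeta>)) x h = of_real (h \<bullet> \<zeta>)"
  by (subst fder_eq[of _ "\<lambda>h. of_real (h \<bullet> \<zeta>)"]) (auto intro!: derivative_eq_intros)

lemma diff_coord: "(\<lambda>x. complex_of_real (x \<bullet> \<zeta>)) differentiable at x"
  unfolding differentiable_def by (rule exI[of _ "\<lambda>h. of_real (h \<bullet> \<zeta>)"]) (auto intro!: derivative_eq_intros)

lemma fder_comp: assumes "linear g" "f differentiable at (g x)"
  shows "fder (\<lambda>x. f (g x)) x h = fder f (g x) (g h)" "(\<lambda>x. f (g x)) differentiable at x"
proof -
  have "((\<lambda>x. f (g x)) has_derivative (\<lambda>h. fder f (g x) (g h))) (at x)"
    using has_derivative_compose[OF linear_imp_has_derivative[OF assms(1)] fder_works[OF assms(2)]]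
    by simp
  then show "fder (\<lambda>x. f (g x)) x h = fder f (g x) (g h)" "(\<lambda>x. f (g x)) differentiable at x"
    by (auto simp: fder_eq differentiable_def)
qed

text \<open>Euler's identity, from two ways to differentiate t \<mapsto> f (t x) at t = 1.\<close>

lemma fder_homogeneous:
  assumes "f differentiable at x" and hom: "\<And>t. t > 0 \<Longrightarrow> f (t *\<^sub>R x) = of_real t ^ m * f x"
  shows "fder f x x = of_nat m * f x"
proof -
  have "((\<lambda>t. f (t *\<^sub>R x)) has_vector_derivative fder f x x) (at 1)"
  proof -
    have "((\<lambda>t. f (t *\<^sub>R x)) has_derivative (\<lambda>h. fder f x (h *\<^sub>R x))) (at 1)"
    proof (rule has_derivative_compose[of "\<lambda>t. t *\<^sub>R x" "\<lambda>h. h *\<^sub>R x" 1 UNIV f "fder f x"])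
      show "((\<lambda>t. t *\<^sub>R x) has_derivative (\<lambda>h. h *\<^sub>R x)) (at 1)"
        by (auto intro!: derivative_eq_intros)
    qed (use fder_works[OF assms(1)] in simp)
    then show ?thesis
      by (simp add: has_vector_derivative_def linear_scale[OF fder_linear[OF assms(1)]])
  qed
  moreover have "((\<lambda>t. f (t *\<^sub>R x)) has_vector_derivative of_nat m * f x) (at 1)"
  proof (rule has_vector_derivative_transform_within_open[where S = "{0<..}" and f = "\<lambda>t. of_real t ^ m * f x"])
    show "((\<lambda>t. of_real t ^ m * f x) has_vector_derivative of_nat m * f x) (at 1)"
      by (auto intro!: derivative_eq_intros simp: has_vector_derivative_def fun_eq_iff scaleR_complex)
  qed (use hom in auto)
  ultimately show ?thesis by (rule vector_derivative_unique_at)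
qed

text \<open>Functions generated from a set \<open>B\<close> by sums, coefficients in \<open>A\<close> and multiplication with
  coordinates. The parameter of type \<open>'p\<close> makes it possible to keep track of how the coefficients
  depend on parameters that the Dunkl operators do not see.\<close>

inductive_set cspan :: "('p \<Rightarrow> complex) set \<Rightarrow> ('p \<Rightarrow> real ^ 'n \<Rightarrow> complex) set \<Rightarrow>
  ('p \<Rightarrow> real ^ 'n \<Rightarrow> complex) set" for A B where
  base: "u \<in> B \<Longrightarrow> u \<in> cspan A B"
| zero: "(\<lambda>p x. 0) \<in> cspan A B"
| add: "u \<in> cspan A B \<Longrightarrow> v \<in> cspan A B \<Longrightarrow> (\<lambda>p x. u p x + v p x) \<in> cspan A B"
| scale: "c \<in> A \<Longrightarrow> u \<in> cspan A B \<Longrightarrow> (\<lambda>p x. c p * u p x) \<in> cspan A B"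
| coord: "u \<in> cspan A B \<Longrightarrow> (\<lambda>p x. of_real (x \<bullet> \<zeta>) * u p x) \<in> cspan A B"

lemma cspan_sum: "(\<And>i. i \<in> I \<Longrightarrow> u i \<in> cspan A B) \<Longrightarrow> (\<lambda>p x. \<Sum>i\<in>I. u i p x) \<in> cspan A B"
  by (induction I rule: infinite_finite_induct) (auto intro: cspan.intros)

context dunkl
begin

abbreviation T :: "real ^ 'n \<Rightarrow> (real ^ 'n \<Rightarrow> complex) \<Rightarrow> real ^ 'n \<Rightarrow> complex" where
  "T \<equiv> dunkl_operator R k"

lemma T_def: "T \<eta> f x = fder f x \<eta> + (\<Sum>\<alpha>\<in>R. of_real (kp \<alpha> * (\<alpha> \<bullet> \<eta>)) * reflection_quotient f \<alpha> x)"
  by (simp add: dunkl_operator_def kp_def)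

lemma rq_def: "\<alpha> \<in> R \<Longrightarrow> reflection_quotient f \<alpha> x =
  (if \<alpha> \<bullet> x = 0 then fder f x \<alpha> else (f x - f (\<sigma> \<alpha> x)) / of_real (\<alpha> \<bullet> x))"
  by (simp add: reflection_quotient_def root_norm)

lemma rq_times: assumes "\<alpha> \<in> R"
  shows "of_real (\<alpha> \<bullet> x) * reflection_quotient f \<alpha> x = f x - f (\<sigma> \<alpha> x)"
  using assms by (simp add: rq_def s_fixed)

lemma T_const [simp]: "T \<eta> (\<lambda>x. c) x = 0"
  by (auto simp: T_def reflection_quotient_def intro!: sum.neutral)

lemma T_add: assumes "f differentiable at x" "g differentiable at x"
  shows "T \<eta> (\<lambda>x. f x + g x) x = T \<eta> f x + T \<eta> g x"
proof -
  have "reflection_quotient (\<lambda>x. f x + g x) \<alpha> x = reflection_quotient f \<alpha> x + reflection_quotient g \<alpha> x" if "\<alpha> \<in> R" for \<alpha>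
    using assms that by (simp add: rq_def fder_add diff_divide_distrib add_divide_distrib)
  then show ?thesis using assms
    by (simp add: T_def fder_add distrib_left sum.distrib)
qed

text \<open>The product rule in an asymmetric form, with g evaluated at reflected points. It is
  convenient when the reflection quotients of f are explicit: they are constants for coordinates and
  0 for Gaussians.\<close>

lemma T_mult: assumes "f differentiable at x" "g differentiable at x"
  shows "T \<eta> (\<lambda>x. f x * g x) x = f x * T \<eta> g x + fder f x \<eta> * g x
    + (\<Sum>\<alpha>\<in>R. of_real (kp \<alpha> * (\<alpha> \<bullet> \<eta>)) * reflection_quotient f \<alpha> x * g (\<sigma> \<alpha> x))"
proof -
  have "reflection_quotient (\<lambda>x. f x * g x) \<alpha> x =
    f x * reflection_quotient g \<alpha> x + reflection_quotient f \<alpha> x * g (\<sigma> \<alpha> x)" if "\<alpha> \<in> R" for \<alpha>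
    using assms that by (simp add: rq_def fder_mult s_fixed divide_simps) (simp add: algebra_simps)
  then show ?thesis using assms
    by (simp add: T_def fder_mult distrib_left sum.distrib sum_distrib_left mult_ac)
qed

lemma T_cmult: assumes "f differentiable at x"
  shows "T \<eta> (\<lambda>x. c * f x) x = c * T \<eta> f x"
proof -
  have "reflection_quotient (\<lambda>_. c) \<alpha> x = 0" for \<alpha> by (simp add: reflection_quotient_def)
  then show ?thesis using T_mult[of "\<lambda>_. c" x f \<eta>] assms by simp
qed

text \<open>The Dunkl counterpart of the canonical commutation relation between derivatives and
  coordinates; the inductions over the degree of polynomials run on it.\<close>

lemma T_coord: assumes "f differentiable at x"
  shows "T \<eta> (\<lambda>x. of_real (x \<bullet> \<zeta>) * f x) x = of_real (x \<bullet> \<zeta>) * T \<eta> f x + of_real (\<eta> \<bullet> \<zeta>) * f x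
    + (\<Sum>\<alpha>\<in>R. of_real (kp \<alpha> * (\<alpha> \<bullet> \<eta>) * (\<alpha> \<bullet> \<zeta>)) * f (\<sigma> \<alpha> x))"
proof -
  have "reflection_quotient (\<lambda>x. of_real (x \<bullet> \<zeta>)) \<alpha> x = of_real (\<alpha> \<bullet> \<zeta>)" if "\<alpha> \<in> R" for \<alpha>
    using that by (simp add: rq_def fder_coord s_eq inner_diff_left inner_commute[of x \<alpha>] flip: of_real_diff)
  then show ?thesis
    unfolding T_mult[OF diff_coord assms] by (simp add: fder_coord mult_ac)
qed

lemma T_sum: assumes "finite I" "\<And>i. i \<in> I \<Longrightarrow> f i differentiable at x"
  shows "T \<eta> (\<lambda>x. \<Sum>i\<in>I. f i x) x = (\<Sum>i\<in>I. T \<eta> (f i) x)"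
  using assms
proof (induction I rule: finite_induct)
  case (insert i I)
  then show ?case by (simp add: T_add)
qed simp

lemma T_linear: assumes "f differentiable at x" shows "linear (\<lambda>\<eta>. T \<eta> f x)"
proof (rule linearI)
  fix a b :: "real ^ 'n" and c :: real
  show "T (a + b) f x = T a f x + T b f x"
    using linear_add[OF fder_linear[OF assms]]
    by (simp add: T_def inner_add_right distrib_left distrib_right sum.distrib)
  show "T (c *\<^sub>R a) f x = c *\<^sub>R T a f x"
    using linear_scale[OF fder_linear[OF assms]]
    unfolding T_def
    by (simp add: scaleR_complex distrib_left sum_distrib_left)
       (intro sum.cong refl, simp add: mult_ac)
qed

lemma T_comp: assumes g: "g \<in> G" and "f differentiable at (g x)"
  shows "T \<eta> (\<lambda>x. f (g x)) x = T (g \<eta>) f (g x)"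
proof -
  note l = G_linear[OF g]
  have rq: "reflection_quotient (\<lambda>x. f (g x)) \<alpha> x = reflection_quotient f (g \<alpha>) (g x)" if "\<alpha> \<in> R" for \<alpha>
    using that g by (simp add: rq_def G_inner s_conj fder_comp[OF l assms(2)])
  have "(\<Sum>\<alpha>\<in>R. of_real (kp \<alpha> * (\<alpha> \<bullet> \<eta>)) * reflection_quotient (\<lambda>x. f (g x)) \<alpha> x)
    = (\<Sum>\<alpha>\<in>R. of_real (kp (g \<alpha>) * (g \<alpha> \<bullet> g \<eta>)) * reflection_quotient f (g \<alpha>) (g x))"
    using g by (intro sum.cong refl) (simp add: rq G_kp G_inner)
  then show ?thesis
    unfolding T_def fder_comp(1)[OF l assms(2)]
    using sum_R_reindex[OF g, of "\<lambda>\<alpha>. of_real (kp \<alpha> * (\<alpha> \<bullet> g \<eta>)) * reflection_quotient f \<alpha> (g x)"] by simp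
qed

text \<open>In the direction of the base point the singular factors cancel.\<close>

lemma T_euler: "T x f x = fder f x x + (\<Sum>\<alpha>\<in>R. of_real (kp \<alpha>) * (f x - f (\<sigma> \<alpha> x)))"
  by (simp add: T_def rq_times[symmetric] mult.assoc)

text \<open>T applied to a coordinate multiple of u produces reflected copies of u. Therefore
  differentiability, stability under the group and stability under T are proved in one joint
  induction.\<close>

lemma cspan_props:
  assumes const: "\<And>c. (\<lambda>_. c) \<in> A"
    and Bd: "\<And>u p x. u \<in> B \<Longrightarrow> u p differentiable at x"
    and BG: "\<And>u g. u \<in> B \<Longrightarrow> g \<in> G \<Longrightarrow> (\<lambda>p x. u p (g x)) \<in> cspan A B"
    and BT: "\<And>u \<eta>. u \<in> B \<Longrightarrow> (\<lambda>p. T \<eta> (u p)) \<in> cspan A B"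
    and u: "u \<in> cspan A B"
  shows "\<And>p x. u p differentiable at x" "\<And>g. g \<in> G \<Longrightarrow> (\<lambda>p x. u p (g x)) \<in> cspan A B"
    "\<And>\<eta>. (\<lambda>p. T \<eta> (u p)) \<in> cspan A B"
proof -
  have "(\<forall>p x. u p differentiable at x) \<and> (\<forall>g\<in>G. (\<lambda>p x. u p (g x)) \<in> cspan A B) \<and>
    (\<forall>\<eta>. (\<lambda>p. T \<eta> (u p)) \<in> cspan A B)" using u
  proof (induction rule: cspan.induct)
    case (base u)
    then show ?case using Bd BG BT by blast
  next
    case zero
    then show ?case by (auto intro: cspan.intros)
  next
    case (add u v)
    then have "(\<lambda>p. T \<eta> (\<lambda>x. u p x + v p x)) = (\<lambda>p x. T \<eta> (u p) x + T \<eta> (v p) x)" for \<eta>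
      by (auto simp: fun_eq_iff T_add)
    with add show ?case by (auto intro: cspan.add)
  next
    case (scale c u)
    then have "(\<lambda>p. T \<eta> (\<lambda>x. c p * u p x)) = (\<lambda>p x. c p * T \<eta> (u p) x)" for \<eta>
      by (auto simp: fun_eq_iff T_cmult)
    with scale show ?case by (auto intro: cspan.scale)
  next
    case (coord u \<zeta>)
    have g: "(\<lambda>p x. of_real (g x \<bullet> \<zeta>) * u p (g x)) \<in> cspan A B" if g: "g \<in> G" for g
    proof -
      obtain h where h: "h \<in> G" "h \<circ> g = id" using G_inverse[OF g] by blast
      have "g x \<bullet> \<zeta> = x \<bullet> h \<zeta>" for x
        using G_inner[OF h(1), of "g x" \<zeta>] h(2) by (metis comp_apply id_apply)
      then show ?thesis using coord.IH g by (auto intro: cspan.coord)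
    qed
    have "(\<lambda>p. T \<eta> (\<lambda>x. of_real (x \<bullet> \<zeta>) * u p x)) = (\<lambda>p x. (of_real (x \<bullet> \<zeta>) * T \<eta> (u p) x + of_real (\<eta> \<bullet> \<zeta>) * u p x)
      + (\<Sum>\<alpha>\<in>R. of_real (kp \<alpha> * (\<alpha> \<bullet> \<eta>) * (\<alpha> \<bullet> \<zeta>)) * u p (\<sigma> \<alpha> x)))" for \<eta>
      using coord.IH by (auto simp: fun_eq_iff T_coord)
    moreover have "\<dots> \<eta> \<in> cspan A B" for \<eta>
      using coord
      by (intro cspan.add cspan.coord cspan_sum cspan.scale[OF const]) auto
    moreover have "(\<lambda>x. of_real (x \<bullet> \<zeta>) * u p x) differentiable at x" for p x
      using coord.IH by (intro differentiable_mult diff_coord) auto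
    ultimately show ?case using g by auto
  qed
  then show "\<And>p x. u p differentiable at x" "\<And>g. g \<in> G \<Longrightarrow> (\<lambda>p x. u p (g x)) \<in> cspan A B"
    "\<And>\<eta>. (\<lambda>p. T \<eta> (u p)) \<in> cspan A B" by auto
qed

section \<open>Polynomials and commutativity of the Dunkl operators\<close>

text \<open>With the trivial parameter type \<open>unit\<close> and all constants as coefficients,
  \<open>cspan\<close> becomes an ordinary linear span, and \<open>Pol\<close> is the set of
  polynomial functions.\<close>

definition cone :: "(unit \<Rightarrow> real ^ 'n \<Rightarrow> complex) set" where "cone = {\<lambda>p x. 1}"
definition Pol :: "(real ^ 'n \<Rightarrow> complex) set" where "Pol = {f. (\<lambda>_. f) \<in> cspan UNIV cone}"

lemma Pol_props:
  assumes "f \<in> Pol"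
  shows Pol_diff: "f differentiable at x" and Pol_G: "g \<in> G \<Longrightarrow> (\<lambda>x. f (g x)) \<in> Pol" and Pol_T: "T \<eta> f \<in> Pol"
proof -
  note * = cspan_props[where A = UNIV and B = cone and u = "\<lambda>_. f"]
  have 1: "\<And>u p x. u \<in> cone \<Longrightarrow> u p differentiable at x"
    and 2: "\<And>u g. u \<in> cone \<Longrightarrow> g \<in> G \<Longrightarrow> (\<lambda>p x. u p (g x)) \<in> cspan UNIV cone"
    and 3: "\<And>u \<eta>. u \<in> cone \<Longrightarrow> (\<lambda>p. T \<eta> (u p)) \<in> cspan UNIV cone"
  proof -
    have "T \<eta> (\<lambda>x. 1) = (\<lambda>x. 0)" for \<eta> by (simp add: fun_eq_iff)
    then show "\<And>u \<eta>. u \<in> cone \<Longrightarrow> (\<lambda>p. T \<eta> (u p)) \<in> cspan UNIV cone"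
      by (auto simp: cone_def intro: cspan.zero)
  qed (auto simp: cone_def intro: cspan.base)
  show "f differentiable at x" "g \<in> G \<Longrightarrow> (\<lambda>x. f (g x)) \<in> Pol" "T \<eta> f \<in> Pol"
    using *(2) *(3) *(1) 1 2 3 assms
    unfolding Pol_def mem_Collect_eq by (blast, blast, blast)
qed

lemma Pol_one: "(\<lambda>x. 1) \<in> Pol" and Pol_zero: "(\<lambda>x. 0) \<in> Pol"
  and Pol_add: "f \<in> Pol \<Longrightarrow> g \<in> Pol \<Longrightarrow> (\<lambda>x. f x + g x) \<in> Pol"
  and Pol_scale: "f \<in> Pol \<Longrightarrow> (\<lambda>x. c * f x) \<in> Pol"
  and Pol_coord: "f \<in> Pol \<Longrightarrow> (\<lambda>x. of_real (x \<bullet> \<zeta>) * f x) \<in> Pol"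
  unfolding Pol_def by (auto intro: cspan.intros simp: cone_def)

lemma Pol_sum: "(\<And>i. i \<in> I \<Longrightarrow> u i \<in> Pol) \<Longrightarrow> (\<lambda>x. \<Sum>i\<in>I. u i x) \<in> Pol"
  unfolding Pol_def using cspan_sum[of I "\<lambda>i p. u i"] by auto

lemma Pol_induct [consumes 1, case_names one zero add scale coord]:
  assumes "f \<in> Pol" "P (\<lambda>x. 1)" "P (\<lambda>x. 0)"
    "\<And>f g. f \<in> Pol \<Longrightarrow> g \<in> Pol \<Longrightarrow> P f \<Longrightarrow> P g \<Longrightarrow> P (\<lambda>x. f x + g x)"
    "\<And>c f. f \<in> Pol \<Longrightarrow> P f \<Longrightarrow> P (\<lambda>x. c * f x)"
    "\<And>\<zeta> f. f \<in> Pol \<Longrightarrow> P f \<Longrightarrow> P (\<lambda>x. of_real (x \<bullet> \<zeta>) * f x)"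
  shows "P f"
proof -
  have "u () \<in> Pol \<and> P (u ())" if "u \<in> cspan UNIV cone" for u
    using that
    by (induction rule: cspan.induct)
       (auto simp: cone_def intro: assms(2-) Pol_one Pol_zero Pol_add Pol_scale Pol_coord)
  from this[of "\<lambda>_. f"] show ?thesis using assms(1) by (auto simp: Pol_def)
qed

text \<open>The commutator of two Dunkl operators commutes with the multiplication by coordinates,
  and it annihilates constants.\<close>

lemma T_commute: "f \<in> Pol \<Longrightarrow> T \<xi> (T \<eta> f) = T \<eta> (T \<xi> f)"
proof (induction f rule: Pol_induct)
  case one
  have "T \<eta> (\<lambda>x. 1) = (\<lambda>x. 0)" for \<eta> by (simp add: fun_eq_iff)
  then show ?case by simp
next
  case zero
  have "T \<eta> (\<lambda>x. 0) = (\<lambda>x. 0)" for \<eta> by (simp add: fun_eq_iff)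
  then show ?case by simp
next
  case (add f g)
  have "T \<eta> (\<lambda>x. f x + g x) = (\<lambda>x. T \<eta> f x + T \<eta> g x)" for \<eta>
    using add by (simp add: fun_eq_iff T_add Pol_diff)
  then show ?case using add by (simp add: fun_eq_iff T_add Pol_diff Pol_T)
next
  case (scale c f)
  have "T \<eta> (\<lambda>x. c * f x) = (\<lambda>x. c * T \<eta> f x)" for \<eta>
    using scale by (simp add: fun_eq_iff T_cmult Pol_diff)
  then show ?case using scale by (simp add: fun_eq_iff T_cmult Pol_diff Pol_T)
next
  case (coord \<zeta> f)
  note d = Pol_diff[OF coord(1)]
  have 1: "T \<eta> (\<lambda>x. of_real (x \<bullet> \<zeta>) * f x) = (\<lambda>x. (of_real (x \<bullet> \<zeta>) * T \<eta> f x + of_real (\<eta> \<bullet> \<zeta>) * f x)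
      + (\<Sum>\<alpha>\<in>R. of_real (kp \<alpha> * (\<alpha> \<bullet> \<eta>) * (\<alpha> \<bullet> \<zeta>)) * f (\<sigma> \<alpha> x)))" for \<eta>
    by (rule ext) (rule T_coord[OF d])
  have sP: "(\<lambda>x. f (\<sigma> \<alpha> x)) \<in> Pol" if "\<alpha> \<in> R" for \<alpha>
    by (rule Pol_G[OF coord(1) s_in_G[OF that]])
  have dd2: "(\<lambda>x. f (\<sigma> \<alpha> x)) differentiable at x" if "\<alpha> \<in> R" for \<alpha> x
    by (rule Pol_diff[OF sP[OF that]])
  have dd5: "(\<lambda>x. c * f (\<sigma> \<alpha> x)) differentiable at x" if "\<alpha> \<in> R" for \<alpha> x c
    by (rule Pol_diff[OF Pol_scale[OF sP[OF that]]])
  have e1: "(\<lambda>x. \<Sum>\<alpha>\<in>R. c' \<alpha> * f (\<sigma> \<alpha> x)) differentiable at x" for c' :: "_ \<Rightarrow> complex" and x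
    by (rule Pol_diff[OF Pol_sum[of R "\<lambda>\<alpha> x. c' \<alpha> * f (\<sigma> \<alpha> x)", OF Pol_scale[OF sP]]])
  have e2: "T \<eta> f differentiable at x" for \<eta> x
    by (rule Pol_diff[OF Pol_T[OF coord(1)]])
  have e3: "(\<lambda>x. complex_of_real (x \<bullet> \<zeta>) * T \<eta> f x) differentiable at x" for \<eta> x
    by (rule Pol_diff[OF Pol_coord[OF Pol_T[OF coord(1)]]])
  have e4: "(\<lambda>x. c * f x) differentiable at x" for c x
    by (rule Pol_diff[OF Pol_scale[OF coord(1)]])
  have e5: "(\<lambda>x. complex_of_real (x \<bullet> \<zeta>) * T \<eta> f x + c * f x) differentiable at x" for c \<eta> x
    by (rule Pol_diff[OF Pol_add[OF Pol_coord[OF Pol_T[OF coord(1)]] Pol_scale[OF coord(1)]]])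
  have 2: "T \<xi> (T \<eta> (\<lambda>x. of_real (x \<bullet> \<zeta>) * f x)) x = of_real (x \<bullet> \<zeta>) * T \<xi> (T \<eta> f) x
      + of_real (\<xi> \<bullet> \<zeta>) * T \<eta> f x + of_real (\<eta> \<bullet> \<zeta>) * T \<xi> f x
      + (\<Sum>\<alpha>\<in>R. of_real (kp \<alpha> * (\<alpha> \<bullet> \<zeta>)) * (of_real (\<alpha> \<bullet> \<xi>) * T \<eta> f (\<sigma> \<alpha> x)
           + of_real (\<alpha> \<bullet> \<eta>) * T (\<sigma> \<alpha> \<xi>) f (\<sigma> \<alpha> x)))" for \<xi> \<eta> x
  proof -
    have "T \<xi> (T \<eta> (\<lambda>x. of_real (x \<bullet> \<zeta>) * f x)) x = T \<xi> (\<lambda>x. of_real (x \<bullet> \<zeta>) * T \<eta> f x) x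
      + T \<xi> (\<lambda>x. of_real (\<eta> \<bullet> \<zeta>) * f x) x
      + (\<Sum>\<alpha>\<in>R. T \<xi> (\<lambda>x. of_real (kp \<alpha> * (\<alpha> \<bullet> \<eta>) * (\<alpha> \<bullet> \<zeta>)) * f (\<sigma> \<alpha> x)) x)"
      unfolding 1
      by (subst T_add[OF e5 e1], subst T_add[OF e3 e4], subst T_sum) (use finR dd5 in auto)
    also have "(\<Sum>\<alpha>\<in>R. T \<xi> (\<lambda>x. of_real (kp \<alpha> * (\<alpha> \<bullet> \<eta>) * (\<alpha> \<bullet> \<zeta>)) * f (\<sigma> \<alpha> x)) x)
      = (\<Sum>\<alpha>\<in>R. of_real (kp \<alpha> * (\<alpha> \<bullet> \<eta>) * (\<alpha> \<bullet> \<zeta>)) * T (\<sigma> \<alpha> \<xi>) f (\<sigma> \<alpha> x))"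
      by (intro sum.cong refl) (simp only: T_cmult dd2 T_comp[OF s_in_G d])
    finally show ?thesis
      unfolding T_coord[OF e2] T_cmult[OF d] distrib_left sum.distrib of_real_mult
      by (simp only: mult_ac add_ac)
  qed
  \<comment> \<open>The right side is symmetric in \<xi> and \<eta>, so the sum over the roots in
    \<open>2\<close> is as well.\<close>
  have 3: "of_real (\<alpha> \<bullet> \<xi>) * T \<eta> f y + of_real (\<alpha> \<bullet> \<eta>) * T (\<sigma> \<alpha> \<xi>) f y
     = of_real (\<alpha> \<bullet> \<xi>) * T \<eta> f y + of_real (\<alpha> \<bullet> \<eta>) * T \<xi> f y - of_real ((\<alpha> \<bullet> \<eta>) * (\<alpha> \<bullet> \<xi>)) * T \<alpha> f y"
    if "\<alpha> \<in> R" for \<alpha> \<xi> \<eta> y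
  proof -
    have "T (\<sigma> \<alpha> \<xi>) f y = T \<xi> f y - of_real (\<alpha> \<bullet> \<xi>) * T \<alpha> f y"
      unfolding s_eq[OF that] linear_diff[OF T_linear[OF d]] linear_scale[OF T_linear[OF d]]
      by (simp add: scaleR_complex inner_commute)
    then show ?thesis by (simp add: right_diff_distrib mult.assoc)
  qed
  show ?case
  proof
    fix x
    have "(\<Sum>\<alpha>\<in>R. of_real (kp \<alpha> * (\<alpha> \<bullet> \<zeta>)) * (of_real (\<alpha> \<bullet> \<xi>) * T \<eta> f (\<sigma> \<alpha> x)
           + of_real (\<alpha> \<bullet> \<eta>) * T (\<sigma> \<alpha> \<xi>) f (\<sigma> \<alpha> x)))
        = (\<Sum>\<alpha>\<in>R. of_real (kp \<alpha> * (\<alpha> \<bullet> \<zeta>)) * (of_real (\<alpha> \<bullet> \<eta>) * T \<xi> f (\<sigma> \<alpha> x)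
           + of_real (\<alpha> \<bullet> \<xi>) * T (\<sigma> \<alpha> \<eta>) f (\<sigma> \<alpha> x)))"
      by (intro sum.cong refl) (simp add: 3 mult_ac)
    then show "T \<xi> (T \<eta> (\<lambda>x. of_real (x \<bullet> \<zeta>) * f x)) x = T \<eta> (T \<xi> (\<lambda>x. of_real (x \<bullet> \<zeta>) * f x)) x"
      unfolding 2 coord.IH by simp
  qed
qed

lemma Pol_cdot: "f \<in> Pol \<Longrightarrow> (\<lambda>x. cdot (complex_vec x) w * f x) \<in> Pol"
proof -
  assume "f \<in> Pol"
  then have "(\<lambda>x. \<Sum>i\<in>UNIV. w $ i * (of_real (x \<bullet> axis i 1) * f x)) \<in> Pol"
    by (intro Pol_sum Pol_scale Pol_coord)
  also have "(\<lambda>x. \<Sum>i\<in>UNIV. w $ i * (of_real (x \<bullet> axis i 1) * f x)) = (\<lambda>x. cdot (complex_vec x) w * f x)"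
    by (simp add: fun_eq_iff cdot_def complex_vec_def inner_axis sum_distrib_right sum_distrib_left mult_ac)
  finally show ?thesis .
qed

lemma Pol_En: "(\<lambda>x. En n (complex_vec x) w) \<in> Pol"
proof (induction n)
  case (Suc n)
  have "(\<lambda>x. \<Sum>g\<in>G. of_real (green (Suc n) g) * (cdot (complex_vec (g x)) w * En n (complex_vec (g x)) w)) \<in> Pol"
    by (rule Pol_sum, rule Pol_scale, rule Pol_G[where f = "\<lambda>x. cdot (complex_vec x) w * En n (complex_vec x) w"])
       (rule Pol_cdot Suc | assumption)+
  then show ?case by (simp add: En.simps cext_complex_vec G_linear cong: sum.cong)
qed (simp add: Pol_one)

lemma T_homogeneous:
  assumes d: "\<And>x. f differentiable at x" and hom: "\<And>t x. t > 0 \<Longrightarrow> f (t *\<^sub>R x) = of_real t ^ Suc m * f x"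
    and t: "t > 0"
  shows "T \<eta> f (t *\<^sub>R x) = of_real t ^ m * T \<eta> f x"
proof -
  have lin: "linear (\<lambda>x. t *\<^sub>R (x :: real ^ 'n))" by (rule linear_scale_self)
  have fd: "fder f (t *\<^sub>R x) h = of_real t ^ m * fder f x h" for h
  proof -
    have "fder (\<lambda>x. f (t *\<^sub>R x)) x h = fder f (t *\<^sub>R x) (t *\<^sub>R h)"
      by (rule fder_comp[OF lin d])
    moreover have "(\<lambda>x. f (t *\<^sub>R x)) = (\<lambda>x. of_real t ^ Suc m * f x)" using hom t by auto
    moreover have "fder (\<lambda>x. of_real t ^ Suc m * f x) x h = of_real t ^ Suc m * fder f x h"
      by (subst fder_mult) (auto simp: d)
    moreover have "fder f (t *\<^sub>R x) (t *\<^sub>R h) = of_real t * fder f (t *\<^sub>R x) h"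
      by (simp only: linear_scale[OF fder_linear[OF d]] scaleR_complex)
    ultimately have "of_real t * fder f (t *\<^sub>R x) h = of_real t * (of_real t ^ m * fder f x h)"
      by (simp only: power_Suc mult.assoc)
    then show ?thesis using t by simp
  qed
  have "reflection_quotient f \<alpha> (t *\<^sub>R x) = of_real t ^ m * reflection_quotient f \<alpha> x" if "\<alpha> \<in> R" for \<alpha>
  proof -
    have "\<sigma> \<alpha> (t *\<^sub>R x) = t *\<^sub>R \<sigma> \<alpha> x" using linear_scale[OF linear_root_reflection] by blast
    then show ?thesis using that t by (simp add: rq_def fd hom divide_simps) (simp add: algebra_simps)
  qed
  then show ?thesis by (simp add: T_def fd distrib_left sum_distrib_left mult_ac)
qed

text \<open>The recursion only controls T in the direction of the base point. The defect
  \<open>e \<eta>\<close> of the claim therefore satisfies e x x = 0, and commutativity of the Dunkl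
  operators makes it closed: T \<eta> (e \<zeta>) = T \<zeta> (e \<eta>). Applying T \<eta> to the
  identity e x x = 0, expanded in coordinates, yields the homogeneous orbit system for g \<mapsto> e
  (g \<eta>) (g x), and the maximum principle gives e = 0.\<close>

lemma T_En: "T \<eta> (\<lambda>x. En (Suc n) (complex_vec x) w) x = cdot (complex_vec \<eta>) w * En n (complex_vec x) w"
proof (induction n arbitrary: \<eta> x rule: less_induct)
  case (less n)
  define f h where "f = (\<lambda>x. En (Suc n) (complex_vec x) w)" and "h = (\<lambda>x. En n (complex_vec x) w)"
  have f: "f \<in> Pol" and h: "h \<in> Pol" unfolding f_def h_def by (rule Pol_En)+
  have fh: "f (t *\<^sub>R x) = of_real t ^ Suc n * f x" "h (t *\<^sub>R x) = of_real t ^ n * h x" for t x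
    by (simp_all only: f_def h_def complex_vec_scaleR En_scale_left)
  define e where "e \<eta> x = T \<eta> f x - cdot (complex_vec \<eta>) w * h x" for \<eta> x
  have e_eq: "e \<eta> = (\<lambda>x. T \<eta> f x + (- cdot (complex_vec \<eta>) w) * h x)" for \<eta>
    by (simp add: e_def fun_eq_iff)
  have e: "e \<eta> \<in> Pol" for \<eta> unfolding e_eq
    by (intro Pol_add Pol_scale Pol_T f h)
  have e_lin: "linear (\<lambda>\<eta>. e \<eta> x)" for x
    unfolding e_def
    by (intro linear_compose_sub T_linear Pol_diff f
        bounded_linear.linear[OF bounded_linear_mult_left[THEN bounded_linear_compose]]
        bounded_linear_compose[OF bounded_bilinear.bounded_linear_left[OF bounded_bilinear_cdot] bounded_linear_complex_vec])
  have e_hom: "e \<eta> (t *\<^sub>R x) = of_real t ^ n * e \<eta> x" if "t > 0" for t \<eta> x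
    unfolding e_def by (subst T_homogeneous[where m = n]) (use that fh Pol_diff[OF f] in \<open>auto simp: algebra_simps\<close>)
  have e_self: "e x x = 0" for x
  proof -
    have "T x f x = of_nat (Suc n) * f x + (\<Sum>\<alpha>\<in>R. of_real (kp \<alpha>) * (f x - f (\<sigma> \<alpha> x)))"
      unfolding T_euler using fder_homogeneous[OF Pol_diff[OF f], of x "Suc n"] fh by simp
    also have "\<dots> = (of_nat (Suc n) + of_real gam) * f x - (\<Sum>\<alpha>\<in>R. of_real (kp \<alpha>) * f (\<sigma> \<alpha> x))"
      by (simp add: gam_def right_diff_distrib sum_subtractf distrib_right sum_distrib_right)
    also have "\<dots> = cdot (complex_vec x) w * h x"
      unfolding f_def h_def En_recursion
      by (simp add: cext_complex_vec linear_root_reflection cong: sum.cong)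
    finally show ?thesis by (simp add: e_def)
  qed
  have e_comm: "T \<eta> (e \<zeta>) x = T \<zeta> (e \<eta>) x" for \<eta> \<zeta> x
  proof -
    \<comment> \<open>The induction hypothesis enters here: it computes T of the component h, which
      has lower degree than f.\<close>
    have h': "cdot (complex_vec \<zeta>) w * T \<eta> h x = cdot (complex_vec \<eta>) w * T \<zeta> h x"
    proof (cases n)
      case 0
      then show ?thesis by (simp add: h_def)
    next
      case (Suc m)
      then show ?thesis using less[of m \<eta> x] less[of m \<zeta> x] by (simp add: h_def)
    qed
    have "T \<eta> (e \<zeta>) x = T \<eta> (T \<zeta> f) x - cdot (complex_vec \<zeta>) w * T \<eta> h x" for \<eta> \<zeta>
      unfolding e_eq
      by (simp only: T_add T_cmult Pol_diff[OF h] Pol_diff[OF Pol_T[OF f]]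
          Pol_diff[OF Pol_scale[OF h]]) simp
    then show ?thesis using h' by (simp add: T_commute[OF f, of \<eta> \<zeta>])
  qed
  have key: "(of_nat (Suc n) + of_real gam) * e \<eta> x = (\<Sum>\<alpha>\<in>R. of_real (kp \<alpha>) * e (\<sigma> \<alpha> \<eta>) (\<sigma> \<alpha> x))" for \<eta> x
  proof -
    let ?b = "\<lambda>i. axis i (1::real) :: real ^ 'n"
    have lin_sum: "F v = (\<Sum>i\<in>UNIV. of_real (v \<bullet> ?b i) * F (?b i))" if "linear F" for F :: "real ^ 'n \<Rightarrow> complex" and v
    proof -
      have "v = (\<Sum>i\<in>UNIV. (v \<bullet> ?b i) *\<^sub>R ?b i)"
        using basis_expansion[of v] by (simp add: inner_axis scalar_mult_eq_scaleR)
      then have "F v = F (\<Sum>i\<in>UNIV. (v \<bullet> ?b i) *\<^sub>R ?b i)" by simp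
      also have "\<dots> = (\<Sum>i\<in>UNIV. of_real (v \<bullet> ?b i) * F (?b i))"
        by (simp add: linear_sum[OF that] linear_scale[OF that] scaleR_complex)
      finally show ?thesis .
    qed
    have "(\<lambda>x. \<Sum>i\<in>UNIV. of_real (x \<bullet> ?b i) * e (?b i) x) = (\<lambda>x. 0)"
      using lin_sum[OF e_lin] e_self by metis
    then have "0 = T \<eta> (\<lambda>x. \<Sum>i\<in>UNIV. of_real (x \<bullet> ?b i) * e (?b i) x) x" by simp
    also have "\<dots> = (\<Sum>i\<in>UNIV. of_real (x \<bullet> ?b i) * T \<eta> (e (?b i)) x + of_real (\<eta> \<bullet> ?b i) * e (?b i) x
       + (\<Sum>\<alpha>\<in>R. of_real (kp \<alpha> * (\<alpha> \<bullet> \<eta>) * (\<alpha> \<bullet> ?b i)) * e (?b i) (\<sigma> \<alpha> x)))"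
      by (subst T_sum) (auto intro: Pol_diff Pol_coord e simp: T_coord[OF Pol_diff[OF e]])
    also have "\<dots> = (\<Sum>i\<in>UNIV. of_real (x \<bullet> ?b i) * T (?b i) (e \<eta>) x) + (\<Sum>i\<in>UNIV. of_real (\<eta> \<bullet> ?b i) * e (?b i) x)
       + (\<Sum>\<alpha>\<in>R. of_real (kp \<alpha> * (\<alpha> \<bullet> \<eta>)) * (\<Sum>i\<in>UNIV. of_real (\<alpha> \<bullet> ?b i) * e (?b i) (\<sigma> \<alpha> x)))"
      unfolding e_comm[of \<eta>] sum.distrib
      by (subst sum.swap[of _ R]) (simp add: sum_distrib_left mult.assoc)
    also have "\<dots> = T x (e \<eta>) x + e \<eta> x + (\<Sum>\<alpha>\<in>R. of_real (kp \<alpha> * (\<alpha> \<bullet> \<eta>)) * e \<alpha> (\<sigma> \<alpha> x))"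
      by (simp only: lin_sum[OF e_lin, symmetric] lin_sum[OF T_linear[OF Pol_diff[OF e]], symmetric])
    \<comment> \<open>Euler's identity contributes the degree n of \<open>e \<eta>\<close>. Together
      with the extra summand e \<eta> x the factor becomes Suc n + gam, as \<open>orbit_zero\<close>
      requires even for n = 0.\<close>
    also have "T x (e \<eta>) x = of_nat n * e \<eta> x + (\<Sum>\<alpha>\<in>R. of_real (kp \<alpha>) * (e \<eta> x - e \<eta> (\<sigma> \<alpha> x)))"
      unfolding T_euler using fder_homogeneous[OF Pol_diff[OF e], of \<eta> x n] e_hom by simp
    also have "\<dots> = (of_nat n + of_real gam) * e \<eta> x - (\<Sum>\<alpha>\<in>R. of_real (kp \<alpha>) * e \<eta> (\<sigma> \<alpha> x))"
      by (simp add: gam_def right_diff_distrib sum_subtractf distrib_right sum_distrib_right)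
    finally have "(of_nat (Suc n) + of_real gam) * e \<eta> x =
      (\<Sum>\<alpha>\<in>R. of_real (kp \<alpha>) * e \<eta> (\<sigma> \<alpha> x)) - (\<Sum>\<alpha>\<in>R. of_real (kp \<alpha> * (\<alpha> \<bullet> \<eta>)) * e \<alpha> (\<sigma> \<alpha> x))"
      by (simp add: algebra_simps)
    also have "\<dots> = (\<Sum>\<alpha>\<in>R. of_real (kp \<alpha>) * e (\<sigma> \<alpha> \<eta>) (\<sigma> \<alpha> x))"
      unfolding sum_subtractf[symmetric]
      by (intro sum.cong refl)
         (simp add: s_eq linear_diff[OF e_lin] linear_scale[OF e_lin] scaleR_complex right_diff_distrib inner_commute)
    finally show ?thesis .
  qed
  have "e (id \<eta>) (id x) = 0"
    by (rule orbit_zero[of "Suc n" "\<lambda>g. e (g \<eta>) (g x)"]) (simp_all only: key comp_apply id_in_G zero_less_Suc)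
  then show ?case by (simp add: e_def f_def h_def)
qed

end

section \<open>Entire functions of two vector variables\<close>

lemma entire_pair_slice:
  assumes "entire_pair F"
  shows "(\<lambda>t. F (z + t *s u) (w + t *s v)) holomorphic_on UNIV"
proof (rule holomorphic_onI, simp)
  fix t :: complex
  obtain D where D: "((\<lambda>(z, w). F z w) has_derivative D) (at (z + t *s u, w + t *s v))"
    "\<And>c u v. D (c *s u, c *s v) = c * D (u, v)"
    using assms unfolding entire_pair_def by metis
  have *: "((\<lambda>t. t *s u) has_derivative (\<lambda>h. h *s u)) (at t)" for u :: "complex ^ 'n" and t
    by (rule bounded_linear_imp_has_derivative)
       (auto intro!: linear_conv_bounded_linear[THEN iffD1] linearI simp: vec_eq_iff algebra_simps)
  have "((\<lambda>t. (z + t *s u, w + t *s v)) has_derivative (\<lambda>h. (h *s u, h *s v))) (at t)"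
    by (auto intro!: derivative_eq_intros *)
  from has_derivative_compose[OF this D(1)]
  have "((\<lambda>t. F (z + t *s u) (w + t *s v)) has_derivative (\<lambda>h. D (u, v) * h)) (at t)"
    by (simp add: D(2) mult.commute)
  then show "(\<lambda>t. F (z + t *s u) (w + t *s v)) field_differentiable at t"
    by (auto simp: field_differentiable_def has_field_derivative_def)
qed

lemma entire_pair_diff: "entire_pair F \<Longrightarrow> entire_pair H \<Longrightarrow> entire_pair (\<lambda>z w. F z w - H z w)"
  unfolding entire_pair_def
proof (intro allI)
  fix p assume "\<forall>p. \<exists>D. ((\<lambda>(z, w). F z w) has_derivative D) (at p) \<and> (\<forall>c u v. D (c *s u, c *s v) = c * D (u, v))"
    "\<forall>p. \<exists>D. ((\<lambda>(z, w). H z w) has_derivative D) (at p) \<and> (\<forall>c u v. D (c *s u, c *s v) = c * D (u, v))"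
  then obtain D D' where "((\<lambda>(z, w). F z w) has_derivative D) (at p)" "\<forall>c u v. D (c *s u, c *s v) = c * D (u, v)"
    "((\<lambda>(z, w). H z w) has_derivative D') (at p)" "\<forall>c u v. D' (c *s u, c *s v) = c * D' (u, v)" by metis
  then show "\<exists>D. ((\<lambda>(z, w). F z w - H z w) has_derivative D) (at p) \<and> (\<forall>c u v. D (c *s u, c *s v) = c * D (u, v))"
    by (intro exI[of _ "\<lambda>h. D h - D' h"])
       (auto simp: algebra_simps case_prod_unfold intro!: has_derivative_diff)
qed

text \<open>The identity theorem on a complex line: t \<mapsto> (Re z + t Im z, Re w + t Im w) runs
  through real points for real t and reaches (z, w) at t = \<i>.\<close>

lemma entire_pair_eq_0:
  fixes F :: "complex ^ 'n \<Rightarrow> complex ^ 'n \<Rightarrow> complex"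
  assumes F: "entire_pair F" and 0: "\<And>x y. F (complex_vec x) (complex_vec y) = 0"
  shows "F z w = 0"
proof -
  define f where "f t = F (complex_vec (vRe z) + t *s complex_vec (vIm z)) (complex_vec (vRe w) + t *s complex_vec (vIm w))" for t
  have "f holomorphic_on UNIV" unfolding f_def by (rule entire_pair_slice[OF F])
  moreover have "f t = 0" if "t \<in> \<real>" for t
    using that by (auto elim!: Reals_cases simp: f_def complex_vec_scaleR[symmetric] complex_vec_add[symmetric] 0)
  moreover have "(0::complex) islimpt \<real>"
  proof (rule islimptI)
    fix T :: "complex set" assume "0 \<in> T" "open T"
    then obtain e where "e > 0" "ball 0 e \<subseteq> T" by (meson openE)
    then show "\<exists>y\<in>\<real>. y \<in> T \<and> y \<noteq> 0"
      by (intro bexI[of _ "of_real (e / 2)"]) auto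
  qed
  ultimately have "f \<i> = 0"
    using analytic_continuation[of f UNIV \<real> 0 \<i>] by auto
  then show ?thesis by (simp add: f_def vec_Re_Im[symmetric])
qed

lemma cauchy_deriv_bound:
  assumes "f holomorphic_on UNIV" "r > 0" "\<And>t. norm t \<le> r \<Longrightarrow> norm (f t) \<le> B"
  shows "norm (deriv f (0::complex)) \<le> B / r"
  using Cauchy_inequality[of f 0 r B 1] assms
  by (auto intro: holomorphic_on_subset holomorphic_on_imp_continuous_on)

section \<open>The kernel as a power series and its differential equation\<close>

context dunkl
begin

definition E :: "complex ^ 'n \<Rightarrow> complex ^ 'n \<Rightarrow> complex" where "E z w = (\<Sum>n. En n z w)"

lemma summable_norm_En: "summable (\<lambda>n. norm (En n z w))"
  by (rule summable_comparison_test'[OF summable_exp_generic[of "norm z * norm w"]])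
     (use En_bound[of _ z w] in \<open>auto simp: field_simps\<close>)

lemma summable_En: "summable (\<lambda>n. En n z w)"
  by (rule summable_norm_cancel[OF summable_norm_En])

lemma En_sums: "(\<lambda>n. En n z w) sums E z w"
  unfolding E_def by (rule summable_sums[OF summable_En])

lemma E_bound: "norm (E z w) \<le> exp (norm z * norm w)"
proof -
  have "norm (E z w) \<le> (\<Sum>n. (norm z * norm w) ^ n /\<^sub>R fact n)"
    unfolding E_def
    by (rule norm_suminf_le) (use En_bound[of _ z w] summable_exp_generic[of "norm z * norm w"] in \<open>auto simp: field_simps\<close>)
  then show ?thesis by (simp add: exp_def)
qed

lemma E_symmetric: "E z w = E w z"
  by (simp add: E_def En_symmetric[of _ z])

lemma E_scale: "E (c *s z) w = E z (c *s w)"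
  by (simp add: E_def En_scale_left En_scale_right)

lemma En_Suc_0 [simp]: "En (Suc n) 0 w = 0" "En (Suc n) z 0 = 0"
  using En_bound[of "Suc n" 0 w] En_bound[of "Suc n" z 0] by auto

lemma E_0 [simp]: "E 0 w = 1" "E z 0 = 1"
proof -
  have "(\<lambda>n. En n 0 w) sums (\<Sum>n\<in>{0}. En n 0 w)"
  proof (rule sums_finite)
    show "En n 0 w = 0" if "n \<notin> {0}" for n using that by (cases n) auto
  qed auto
  from sums_unique2[OF En_sums this] show "E 0 w = 1" by simp
  have "(\<lambda>n. En n z 0) sums (\<Sum>n\<in>{0}. En n z 0)"
  proof (rule sums_finite)
    show "En n z 0 = 0" if "n \<notin> {0}" for n using that by (cases n) auto
  qed auto
  from sums_unique2[OF En_sums this] show "E z 0 = 1" by simp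
qed

text \<open>The derivative of \<open>En\<close>, built by the product rule. It is kept explicit
  because termwise differentiation of the series needs bounds that are uniform in the base
  point.\<close>

primrec dEn :: "nat \<Rightarrow> (complex ^ 'n) \<times> (complex ^ 'n) \<Rightarrow> (complex ^ 'n) \<times> (complex ^ 'n) \<Rightarrow> complex" where
  "dEn 0 p h = 0"
| "dEn (Suc n) p h = (\<Sum>g\<in>G. of_real (green (Suc n) g) *
     ((cdot (cext g (fst p)) (snd h) + cdot (cext g (fst h)) (snd p)) * En n (cext g (fst p)) (snd p)
      + cdot (cext g (fst p)) (snd p) * dEn n (cext g (fst p), snd p) (cext g (fst h), snd h)))"

lemma dEn: "((\<lambda>p. En n (fst p) (snd p)) has_derivative dEn n p) (at p)"
proof (induction n arbitrary: p)
  case (Suc n)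
  have "((\<lambda>p. of_real (green (Suc n) g) * (cdot (cext g (fst p)) (snd p) * En n (cext g (fst p)) (snd p)))
    has_derivative (\<lambda>h. of_real (green (Suc n) g) *
     ((cdot (cext g (fst p)) (snd h) + cdot (cext g (fst h)) (snd p)) * En n (cext g (fst p)) (snd p)
      + cdot (cext g (fst p)) (snd p) * dEn n (cext g (fst p), snd p) (cext g (fst h), snd h)))) (at p)"
    if g: "g \<in> G" for g
  proof -
    note cg = bounded_linear_cext[OF G_linear[OF g]]
    have 1: "((\<lambda>p. (cext g (fst p), snd p)) has_derivative (\<lambda>h. (cext g (fst h), snd h))) (at p)"
      by (intro has_derivative_Pair bounded_linear.has_derivative[OF cg] derivative_intros)
    have 2: "((\<lambda>p. En n (cext g (fst p)) (snd p)) has_derivative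
        (\<lambda>h. dEn n (cext g (fst p), snd p) (cext g (fst h), snd h))) (at p)"
      using has_derivative_compose[OF 1 Suc[of "(cext g (fst p), snd p)"]] by simp
    have 3: "((\<lambda>p. cdot (cext g (fst p)) (snd p)) has_derivative
        (\<lambda>h. cdot (cext g (fst p)) (snd h) + cdot (cext g (fst h)) (snd p))) (at p)"
      by (intro bounded_bilinear.FDERIV[OF bounded_bilinear_cdot] bounded_linear.has_derivative[OF cg] derivative_intros)
    show ?thesis
      by (rule has_derivative_eq_rhs[OF has_derivative_mult_right[OF has_derivative_mult[OF 3 2]]])
         (simp add: algebra_simps)
  qed
  then have "((\<lambda>p. \<Sum>g\<in>G. of_real (green (Suc n) g) * (cdot (cext g (fst p)) (snd p) * En n (cext g (fst p)) (snd p)))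
    has_derivative (\<lambda>h. \<Sum>g\<in>G. of_real (green (Suc n) g) *
     ((cdot (cext g (fst p)) (snd h) + cdot (cext g (fst h)) (snd p)) * En n (cext g (fst p)) (snd p)
      + cdot (cext g (fst p)) (snd p) * dEn n (cext g (fst p), snd p) (cext g (fst h), snd h)))) (at p)"
    by (rule has_derivative_sum)
  then show ?case by (simp add: En.simps)
next
  case 0
  have "dEn 0 p = (\<lambda>_. 0)" by (simp add: fun_eq_iff)
  then show ?case by simp
qed

lemma dEn_scale: "dEn n p (c *s u, c *s v) = c * dEn n p (u, v)"
proof (induction n arbitrary: p u v)
  case (Suc n)
  show ?case unfolding dEn.simps sum_distrib_left
    by (intro sum.cong refl)
       (simp add: cext_scale G_linear cdot_scale_left cdot_scale_right Suc algebra_simps)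
qed simp

text \<open>The base 2 * r^2 is twice the one in \<open>En_bound\<close>; the powers of 2 absorb the
  additional terms of the product rule, and the factorial still makes the bounds summable.\<close>

lemma dEn_bound:
  assumes "r \<ge> 1"
  shows "norm (fst p) \<le> r \<Longrightarrow> norm (snd p) \<le> r \<Longrightarrow> norm (fst h) \<le> m \<Longrightarrow> norm (snd h) \<le> m \<Longrightarrow>
    norm (dEn n p h) \<le> 2 * (2 * r\<^sup>2) ^ n / fact n * m"
proof (induction n arbitrary: p h)
  case 0
  then have "0 \<le> m" using norm_ge_zero order_trans by blast
  then show ?case by simp
next
  case (Suc n)
  have m: "0 \<le> m" using Suc.prems(3) norm_ge_zero order_trans by blast
  define A where "A = 2 * (r * m) * ((r * r) ^ n / fact n) + r * r * (2 * (2 * r\<^sup>2) ^ n / fact n * m)"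
  have "norm (dEn (Suc n) p h) \<le> (\<Sum>g\<in>G. green (Suc n) g * A)"
    unfolding dEn.simps
  proof (rule sum_norm_le)
    fix g assume g: "g \<in> G"
    have a: "norm (cdot u v) \<le> a * b" if "norm u \<le> a" "norm v \<le> b" "0 \<le> a" "0 \<le> b" for u v :: "complex ^ 'n" and a b
      using norm_cdot_le[of u v] mult_mono[OF that(1,2)] that by simp
    have e: "norm (En n (cext g (fst p)) (snd p)) \<le> (r * r) ^ n / fact n"
      using En_bound[of n "cext g (fst p)" "snd p"] Suc.prems g assms
      by (intro order_trans[OF En_bound] divide_right_mono power_mono mult_mono) auto
    have d: "norm (dEn n (cext g (fst p), snd p) (cext g (fst h), snd h)) \<le> 2 * (2 * r\<^sup>2) ^ n / fact n * m"
      using Suc.prems g by (intro Suc.IH) auto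
    have "norm ((cdot (cext g (fst p)) (snd h) + cdot (cext g (fst h)) (snd p)) * En n (cext g (fst p)) (snd p)
      + cdot (cext g (fst p)) (snd p) * dEn n (cext g (fst p), snd p) (cext g (fst h), snd h)) \<le>
      norm (cdot (cext g (fst p)) (snd h) + cdot (cext g (fst h)) (snd p)) * norm (En n (cext g (fst p)) (snd p))
      + norm (cdot (cext g (fst p)) (snd p)) * norm (dEn n (cext g (fst p), snd p) (cext g (fst h), snd h))"
      by (rule order_trans[OF norm_triangle_ineq]) (simp add: norm_mult)
    also have "\<dots> \<le> A"
      unfolding A_def
    proof (intro add_mono mult_mono e d a)
      show "norm (cdot (cext g (fst p)) (snd h) + cdot (cext g (fst h)) (snd p)) \<le> 2 * (r * m)"
        using norm_triangle_ineq[of "cdot (cext g (fst p)) (snd h)" "cdot (cext g (fst h)) (snd p)"]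
          a[of "cext g (fst p)" r "snd h" m] a[of "cext g (fst h)" m "snd p" r] Suc.prems g assms m
        by (simp add: mult.commute)
    qed (use Suc.prems g assms m in auto)
    finally have "norm ((cdot (cext g (fst p)) (snd h) + cdot (cext g (fst h)) (snd p)) * En n (cext g (fst p)) (snd p)
      + cdot (cext g (fst p)) (snd p) * dEn n (cext g (fst p), snd p) (cext g (fst h), snd h)) \<le> A" .
    then show "norm (of_real (green (Suc n) g) *
     ((cdot (cext g (fst p)) (snd h) + cdot (cext g (fst h)) (snd p)) * En n (cext g (fst p)) (snd p)
      + cdot (cext g (fst p)) (snd p) * dEn n (cext g (fst p), snd p) (cext g (fst h), snd h))) \<le> green (Suc n) g * A"
      unfolding norm_mult using green_nonneg[of "Suc n" g] by (simp add: mult_left_mono)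
  qed
  also have "\<dots> = A / real (Suc n)"
    unfolding sum_distrib_right[symmetric] sum_green[OF zero_less_Suc] by simp
  also have "\<dots> \<le> 2 * (2 * r\<^sup>2) ^ Suc n / fact (Suc n) * m"
  proof -
    have "r * m * (r * r) ^ n \<le> r\<^sup>2 * m * (2 * r\<^sup>2) ^ n"
    proof (rule mult_mono)
      have "r \<le> r\<^sup>2" using assms by (simp add: power2_eq_square)
      then show "r * m \<le> r\<^sup>2 * m" using m by (rule mult_right_mono)
      show "(r * r) ^ n \<le> (2 * r\<^sup>2) ^ n" using assms by (intro power_mono) (auto simp: power2_eq_square)
    qed (use assms m in auto)
    then have "A \<le> 2 * (2 * r\<^sup>2) ^ Suc n / fact n * m"
      by (simp add: A_def divide_simps power2_eq_square) (simp add: algebra_simps)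
    then show ?thesis by (simp add: divide_simps)
  qed
  finally show ?case .
qed

definition dE :: "(complex ^ 'n) \<times> (complex ^ 'n) \<Rightarrow> (complex ^ 'n) \<times> (complex ^ 'n) \<Rightarrow> complex" where
  "dE p h = (\<Sum>n. dEn n p h)"

lemma summable_dEn_majorant: "summable (\<lambda>n. 2 * (2 * r\<^sup>2) ^ n / fact n :: real)"
  using summable_mult[OF summable_exp_generic[of "2 * r\<^sup>2 :: real"], of 2] by (simp add: field_simps)

lemma dEn_bound': "norm (dEn n p h) \<le> 2 * (2 * (1 + norm p)\<^sup>2) ^ n / fact n * norm h"
  by (rule dEn_bound) (use norm_fst_le[of "fst p" "snd p"] norm_snd_le[of "snd p" "fst p"]
      norm_fst_le[of "fst h" "snd h"] norm_snd_le[of "snd h" "fst h"] in auto)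

lemma dEn_sums: "(\<lambda>n. dEn n p h) sums dE p h"
  unfolding dE_def
  by (rule summable_sums, rule summable_comparison_test'[OF summable_mult2[OF summable_dEn_majorant]])
     (rule dEn_bound')

lemma dE_scale: "dE p (c *s u, c *s v) = c * dE p (u, v)"
  by (simp add: dE_def dEn_scale suminf_mult sums_summable[OF dEn_sums])

lemma has_derivative_E: "((\<lambda>p. E (fst p) (snd p)) has_derivative dE p) (at p)"
proof -
  define r where "r = 1 + norm p"
  define M where "M n = 2 * (2 * r\<^sup>2) ^ n / fact n" for n
  have sM: "summable M" unfolding M_def by (rule summable_dEn_majorant)
  have r: "r \<ge> 1" by (simp add: r_def)
  have b: "norm (dEn n q h) \<le> M n * norm h" if "q \<in> ball 0 r" for n q h
    unfolding M_def using that
    by (intro dEn_bound[OF r]) (use norm_fst_le[of "fst q" "snd q"] norm_snd_le[of "snd q" "fst q"]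
      norm_fst_le[of "fst h" "snd h"] norm_snd_le[of "snd h" "fst h"] in auto)
  have "\<exists>g. \<forall>x\<in>ball 0 r. (\<lambda>n. En n (fst x) (snd x)) sums (g x) \<and> (g has_derivative dE x) (at x within ball 0 r)"
  proof (rule has_derivative_series[where x = 0 and l = "E 0 0"])
    show "((\<lambda>p. En n (fst p) (snd p)) has_derivative dEn n x) (at x within ball 0 r)" for n x
      using dEn has_derivative_at_withinI by blast
    fix e :: real assume e: "e > 0"
    have "(\<lambda>n. \<Sum>i. M (i + n)) \<longlonglongrightarrow> 0"
      by (rule suminf_exist_split2[OF sM])
    then have "\<forall>\<^sub>F n in sequentially. (\<Sum>i. M (i + n)) < e"
      using e by (auto dest!: order_tendstoD)
    then show "\<forall>\<^sub>F n in sequentially. \<forall>x\<in>ball 0 r. \<forall>h. norm ((\<Sum>i<n. dEn i x h) - dE x h) \<le> e * norm h"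
    proof eventually_elim
      case (elim n)
      show ?case
      proof (intro ballI allI)
        fix x h assume x: "x \<in> ball (0 :: (complex ^ 'n) \<times> (complex ^ 'n)) r"
        have "dE x h - (\<Sum>i<n. dEn i x h) = (\<Sum>i. dEn (i + n) x h)"
          unfolding dE_def by (subst suminf_split_initial_segment[OF sums_summable[OF dEn_sums], of _ _ n]) simp
        also have "norm \<dots> \<le> (\<Sum>i. M (i + n) * norm h)"
          by (rule norm_suminf_le) (use b[OF x] sM in \<open>auto intro!: summable_mult2 simp: summable_iff_shift\<close>)
        also have "\<dots> = (\<Sum>i. M (i + n)) * norm h"
          using sM by (intro suminf_mult2[symmetric]) (simp add: summable_iff_shift)
        also have "\<dots> \<le> e * norm h" using elim by (intro mult_right_mono) auto
        finally show "norm ((\<Sum>i<n. dEn i x h) - dE x h) \<le> e * norm h"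
          by (simp add: norm_minus_commute)
      qed
    qed
  next
    show "0 \<in> ball (0 :: (complex ^ 'n) \<times> (complex ^ 'n)) r" using r by simp
    show "(\<lambda>n. En n (fst 0) (snd 0)) sums E 0 0" using En_sums[of 0 0] by simp
  qed (rule convex_ball)
  then obtain g where g: "\<And>x. x \<in> ball 0 r \<Longrightarrow> (\<lambda>n. En n (fst x) (snd x)) sums (g x)"
    "\<And>x. x \<in> ball 0 r \<Longrightarrow> (g has_derivative dE x) (at x within ball 0 r)" by blast
  have p: "p \<in> ball 0 r" by (simp add: r_def)
  have "(g has_derivative dE p) (at p)" using g(2)[OF p] unfolding at_within_open[OF p open_ball] .
  then show ?thesis
    by (rule has_derivative_transform_within_open[OF _ open_ball p])
       (use g(1) En_sums sums_unique2 in blast)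
qed

lemma entire_E: "entire_pair E"
  unfolding entire_pair_def
proof
  fix p
  show "\<exists>D. ((\<lambda>(z, w). E z w) has_derivative D) (at p) \<and> (\<forall>c u v. D (c *s u, c *s v) = c * D (u, v))"
    using has_derivative_E[of p] by (intro exI[of _ "dE p"]) (simp add: case_prod_unfold dE_scale)
qed

lemma continuous_E: "continuous_on UNIV (\<lambda>p. E (fst p) (snd p))"
  by (intro continuous_at_imp_continuous_on ballI has_derivative_continuous[OF has_derivative_E])

lemma fder_En: "fder (\<lambda>x. En n (complex_vec x) w) x h = dEn n (complex_vec x, w) (complex_vec h, 0)"
  and fder_E: "fder (\<lambda>x. E (complex_vec x) w) x h = dE (complex_vec x, w) (complex_vec h, 0)"
  and diff_E: "(\<lambda>x. E (complex_vec x) w) differentiable at x"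
proof -
  have 1: "((\<lambda>x. (complex_vec x, w)) has_derivative (\<lambda>h. (complex_vec h, 0))) (at x)"
    by (intro has_derivative_Pair bounded_linear_imp_has_derivative bounded_linear_complex_vec has_derivative_const)
  show "fder (\<lambda>x. En n (complex_vec x) w) x h = dEn n (complex_vec x, w) (complex_vec h, 0)"
    using has_derivative_compose[OF 1 dEn[of n "(complex_vec x, w)"]] by (simp add: fder_eq)
  have 2: "((\<lambda>x. E (complex_vec x) w) has_derivative (\<lambda>h. dE (complex_vec x, w) (complex_vec h, 0))) (at x)"
    using has_derivative_compose[OF 1 has_derivative_E[of "(complex_vec x, w)"]] by simp
  show "fder (\<lambda>x. E (complex_vec x) w) x h = dE (complex_vec x, w) (complex_vec h, 0)"
    "(\<lambda>x. E (complex_vec x) w) differentiable at x"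
    using 2 by (auto simp add: fder_eq differentiable_def)
qed

lemma T_E: "T \<eta> (\<lambda>x. E (complex_vec x) w) x = cdot (complex_vec \<eta>) w * E (complex_vec x) w"
proof -
  have fd: "(\<lambda>n. fder (\<lambda>x. En n (complex_vec x) w) x h) sums fder (\<lambda>x. E (complex_vec x) w) x h" for h
    unfolding fder_En fder_E by (rule dEn_sums)
  have rq: "(\<lambda>n. reflection_quotient (\<lambda>x. En n (complex_vec x) w) \<alpha> x) sums reflection_quotient (\<lambda>x. E (complex_vec x) w) \<alpha> x"
    if "\<alpha> \<in> R" for \<alpha>
    using that by (auto simp: rq_def intro!: fd sums_divide sums_diff En_sums)
  have "(\<lambda>n. T \<eta> (\<lambda>x. En n (complex_vec x) w) x) sums T \<eta> (\<lambda>x. E (complex_vec x) w) x"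
    unfolding T_def by (intro sums_add sums_sum sums_mult fd rq)
  \<comment> \<open>T annihilates the constant component of degree 0, so shifting the index leaves
    the sum unchanged.\<close>
  then have "(\<lambda>n. T \<eta> (\<lambda>x. En (Suc n) (complex_vec x) w) x) sums T \<eta> (\<lambda>x. E (complex_vec x) w) x"
    by (subst sums_Suc_iff) simp
  moreover have "(\<lambda>n. T \<eta> (\<lambda>x. En (Suc n) (complex_vec x) w) x) sums (cdot (complex_vec \<eta>) w * E (complex_vec x) w)"
    unfolding T_En by (intro sums_mult En_sums)
  ultimately show ?thesis by (rule sums_unique2)
qed

section \<open>Growth along rays\<close>

text \<open>The reflection terms form a positive semidefinite operator on functions on the group, so they
  only improve a Gronwall estimate for the sum over the orbit.\<close>

lemma orbit_growth:
  fixes \<phi> \<phi>' :: "(real ^ 'n \<Rightarrow> real ^ 'n) \<Rightarrow> real \<Rightarrow> complex"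
  assumes der: "\<And>g t. g \<in> G \<Longrightarrow> 0 < t \<Longrightarrow> t < 1 \<Longrightarrow> (\<phi> g has_vector_derivative \<phi>' g t) (at t)"
    and cont: "\<And>g. g \<in> G \<Longrightarrow> continuous_on {0..1} (\<phi> g)"
    and eq: "\<And>g t. g \<in> G \<Longrightarrow> 0 < t \<Longrightarrow> t < 1 \<Longrightarrow>
      of_real t * \<phi>' g t + (\<Sum>\<alpha>\<in>R. of_real (kp \<alpha>) * (\<phi> g t - \<phi> (\<sigma> \<alpha> \<circ> g) t)) = of_real t * lam g * \<phi> g t"
    and M: "\<And>g. g \<in> G \<Longrightarrow> Re (lam g) \<le> M"
  shows "(\<Sum>g\<in>G. (norm (\<phi> g 1))\<^sup>2) \<le> exp (2 * M) * (\<Sum>g\<in>G. (norm (\<phi> g 0))\<^sup>2)"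
proof -
  define N where "N t = exp (- 2 * M * t) * (\<Sum>g\<in>G. (norm (\<phi> g t))\<^sup>2)" for t
  have "N 1 \<le> N 0"
  proof (rule DERIV_nonpos_imp_decreasing_open[where f = N and a = 0 and b = 1])
    fix t :: real assume t: "0 < t" "t < 1"
    have d: "((\<lambda>t. (norm (\<phi> g t))\<^sup>2) has_real_derivative 2 * (\<phi> g t \<bullet> \<phi>' g t)) (at t)" if "g \<in> G" for g
    proof -
      have "((\<lambda>t. \<phi> g t \<bullet> \<phi> g t) has_vector_derivative (\<phi> g t \<bullet> \<phi>' g t + \<phi>' g t \<bullet> \<phi> g t)) (at t)"
        by (rule bounded_bilinear.has_vector_derivative[OF bounded_bilinear_inner der der]) (use that t in auto)
      then show ?thesis by (simp add: power2_norm_eq_inner inner_commute has_real_derivative_iff_has_vector_derivative)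
    qed
    have "(N has_real_derivative (exp (- 2 * M * t) * (\<Sum>g\<in>G. 2 * (\<phi> g t \<bullet> \<phi>' g t))
       + (- 2 * M) * exp (- 2 * M * t) * (\<Sum>g\<in>G. (norm (\<phi> g t))\<^sup>2))) (at t)"
    proof -
      have s: "((\<lambda>t. \<Sum>g\<in>G. (norm (\<phi> g t))\<^sup>2) has_real_derivative (\<Sum>g\<in>G. 2 * (\<phi> g t \<bullet> \<phi>' g t))) (at t)"
        by (rule DERIV_sum) (rule d)
      have e: "((\<lambda>t. exp (- 2 * M * t)) has_real_derivative (- 2 * M) * exp (- 2 * M * t)) (at t)"
        by (auto intro!: derivative_eq_intros)
      show ?thesis unfolding N_def by (rule DERIV_cong[OF DERIV_mult[OF e s]]) simp
    qed
    moreover have "(\<Sum>g\<in>G. \<phi> g t \<bullet> \<phi>' g t) \<le> M * (\<Sum>g\<in>G. (norm (\<phi> g t))\<^sup>2)"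
    proof -
      \<comment> \<open>By the inequality between arithmetic and geometric means, \<open>b\<close>
        bounds the reflection term from below. Its sum over the group vanishes, since g \<mapsto>
        \<sigma> \<alpha> \<circ> g permutes the group.\<close>
      define b where "b g \<alpha> = (norm (\<phi> g t))\<^sup>2 - ((norm (\<phi> g t))\<^sup>2 + (norm (\<phi> (\<sigma> \<alpha> \<circ> g) t))\<^sup>2) / 2" for g \<alpha>
      have one: "t * (\<phi> g t \<bullet> \<phi>' g t) \<le> t * (M * (norm (\<phi> g t))\<^sup>2)
         - (\<Sum>\<alpha>\<in>R. kp \<alpha> * b g \<alpha>)"
        if g: "g \<in> G" for g
      proof -
        have "t * (\<phi> g t \<bullet> \<phi>' g t) = \<phi> g t \<bullet> (of_real t * \<phi>' g t)"
          by (simp add: scaleR_complex[symmetric])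
        also have "of_real t * \<phi>' g t = of_real t * (lam g * \<phi> g t) - (\<Sum>\<alpha>\<in>R. of_real (kp \<alpha>) * (\<phi> g t - \<phi> (\<sigma> \<alpha> \<circ> g) t))"
          using eq[OF g t] by (simp add: algebra_simps)
        also have "\<phi> g t \<bullet> \<dots> = t * (\<phi> g t \<bullet> (lam g * \<phi> g t)) - (\<Sum>\<alpha>\<in>R. kp \<alpha> * (\<phi> g t \<bullet> \<phi> g t - \<phi> g t \<bullet> \<phi> (\<sigma> \<alpha> \<circ> g) t))"
          by (simp add: scaleR_complex[symmetric] inner_diff_right inner_sum_right)
        also have "\<phi> g t \<bullet> (lam g * \<phi> g t) = Re (lam g) * (norm (\<phi> g t))\<^sup>2"
          unfolding inner_complex_def cmod_power2 by (simp add: power2_eq_square algebra_simps)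
        finally have eq': "t * (\<phi> g t \<bullet> \<phi>' g t) = t * (Re (lam g) * (norm (\<phi> g t))\<^sup>2)
          - (\<Sum>\<alpha>\<in>R. kp \<alpha> * (\<phi> g t \<bullet> \<phi> g t - \<phi> g t \<bullet> \<phi> (\<sigma> \<alpha> \<circ> g) t))" .
        have le1: "t * (Re (lam g) * (norm (\<phi> g t))\<^sup>2) \<le> t * (M * (norm (\<phi> g t))\<^sup>2)"
          using M[OF g] t by (intro mult_left_mono mult_right_mono) auto
        have le2: "(\<Sum>\<alpha>\<in>R. kp \<alpha> * b g \<alpha>)
          \<le> (\<Sum>\<alpha>\<in>R. kp \<alpha> * (\<phi> g t \<bullet> \<phi> g t - \<phi> g t \<bullet> \<phi> (\<sigma> \<alpha> \<circ> g) t))"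
        proof (intro sum_mono mult_left_mono kp_nonneg)
          fix \<alpha>
          have "0 \<le> (\<phi> g t - \<phi> (\<sigma> \<alpha> \<circ> g) t) \<bullet> (\<phi> g t - \<phi> (\<sigma> \<alpha> \<circ> g) t)" by (rule inner_ge_zero)
          then show "b g \<alpha> \<le> \<phi> g t \<bullet> \<phi> g t - \<phi> g t \<bullet> \<phi> (\<sigma> \<alpha> \<circ> g) t"
            by (simp add: b_def power2_norm_eq_inner inner_diff_left inner_diff_right inner_commute)
        qed
        show ?thesis using eq' le1 le2 by linarith
      qed
      have "t * (\<Sum>g\<in>G. \<phi> g t \<bullet> \<phi>' g t) \<le> (\<Sum>g\<in>G. t * (M * (norm (\<phi> g t))\<^sup>2)
         - (\<Sum>\<alpha>\<in>R. kp \<alpha> * b g \<alpha>))"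
        unfolding sum_distrib_left by (rule sum_mono[OF one])
      also have "\<dots> = t * (M * (\<Sum>g\<in>G. (norm (\<phi> g t))\<^sup>2)) - (\<Sum>\<alpha>\<in>R. kp \<alpha> * (\<Sum>g\<in>G. b g \<alpha>))"
        unfolding sum_subtractf sum_distrib_left by (subst sum.swap[of _ R]) simp
      also have "(\<Sum>\<alpha>\<in>R. kp \<alpha> * (\<Sum>g\<in>G. b g \<alpha>)) = 0"
      proof (intro sum.neutral ballI)
        fix \<alpha> assume "\<alpha> \<in> R"
        then have "(\<Sum>g\<in>G. (norm (\<phi> (\<sigma> \<alpha> \<circ> g) t))\<^sup>2) = (\<Sum>g\<in>G. (norm (\<phi> g t))\<^sup>2)"
          by (intro sum_G_left[of "\<sigma> \<alpha>" "\<lambda>g. (norm (\<phi> g t))\<^sup>2"] s_in_G)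
        then show "kp \<alpha> * (\<Sum>g\<in>G. b g \<alpha>) = 0"
          by (simp add: b_def sum_subtractf sum.distrib flip: sum_divide_distrib)
      qed
      finally show ?thesis using t by simp
    qed
    ultimately show "\<exists>y. (N has_real_derivative y) (at t) \<and> y \<le> 0"
      by (intro exI[of _ "exp (- 2 * M * t) * (\<Sum>g\<in>G. 2 * (\<phi> g t \<bullet> \<phi>' g t))
       + (- 2 * M) * exp (- 2 * M * t) * (\<Sum>g\<in>G. (norm (\<phi> g t))\<^sup>2)"])
        (simp add: sum_distrib_left[symmetric] mult_le_cancel_left_pos)
  qed (auto simp: N_def intro!: continuous_intros cont)
  then show ?thesis by (simp add: N_def exp_minus field_simps)
qed

text \<open>The Gronwall estimate applied to the power series \<open>t \<mapsto> E (t z) w\<close>; the differential equation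
  is the recursion of the homogeneous components.\<close>

lemma E_growth:
  assumes "\<And>g. g \<in> G \<Longrightarrow> Re (cdot (cext g z) w) \<le> M"
  shows "norm (E z w) \<le> sqrt (card G) * exp M"
proof -
  define a where "a g n = En n (cext g z) w" for g n
  define \<phi> where "\<phi> g t = (\<Sum>n. a g n * of_real t ^ n)" for g and t :: real
  define \<phi>' where "\<phi>' g t = (\<Sum>n. diffs (a g) n * of_real t ^ n)" for g and t :: real
  have sm: "summable (\<lambda>n. a g n * y ^ n)" for g y
    using summable_En[of "y *s cext g z" w] by (simp add: a_def En_scale_left mult.commute)
  note sums = summable_sums[OF sm]
  have der: "(\<phi> g has_vector_derivative \<phi>' g t) (at t)" for g t
    unfolding \<phi>_def \<phi>'_def
    by (rule has_vector_derivative_real_field[OF termdiffs_strong_converges_everywhere[OF sm]])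
  have sums': "(\<lambda>n. of_nat n * a g n * of_real t ^ n) sums (of_real t * \<phi>' g t)" for g t
  proof -
    have "(\<lambda>n. of_real t * (diffs (a g) n * of_real t ^ n)) sums (of_real t * \<phi>' g t)"
      unfolding \<phi>'_def by (intro sums_mult summable_sums termdiff_converges_all sm)
    then show ?thesis
      by (subst sums_Suc_iff[symmetric, of "\<lambda>n. of_nat n * a g n * of_real t ^ n", simplified])
         (simp add: diffs_def mult_ac)
  qed
  have growth: "(\<Sum>g\<in>G. (norm (\<phi> g 1))\<^sup>2) \<le> exp (2 * M) * (\<Sum>g\<in>G. (norm (\<phi> g 0))\<^sup>2)"
  proof (rule orbit_growth[of \<phi> \<phi>' "\<lambda>g. cdot (cext g z) w"])
    fix g :: "real ^ 'n \<Rightarrow> real ^ 'n" and t :: real assume g: "g \<in> G"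
    show "(\<phi> g has_vector_derivative \<phi>' g t) (at t)" by (rule der)
    show "Re (cdot (cext g z) w) \<le> M" by (rule assms[OF g])
    have "(\<lambda>n. of_nat n * a g n * of_real t ^ n + (\<Sum>\<alpha>\<in>R. of_real (kp \<alpha>) * (a g n * of_real t ^ n - a (\<sigma> \<alpha> \<circ> g) n * of_real t ^ n)))
      sums (of_real t * \<phi>' g t + (\<Sum>\<alpha>\<in>R. of_real (kp \<alpha>) * (\<phi> g t - \<phi> (\<sigma> \<alpha> \<circ> g) t)))"
      unfolding \<phi>_def by (intro sums_add sums_sum sums_mult sums_diff sums sums')
    moreover have "of_nat n * a g n * of_real t ^ n + (\<Sum>\<alpha>\<in>R. of_real (kp \<alpha>) * (a g n * of_real t ^ n - a (\<sigma> \<alpha> \<circ> g) n * of_real t ^ n))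
       = ((of_nat n + of_real gam) * a g n - (\<Sum>\<alpha>\<in>R. of_real (kp \<alpha>) * a (\<sigma> \<alpha> \<circ> g) n)) * of_real t ^ n" for n
      by (simp add: gam_def algebra_simps sum_subtractf sum_distrib_left sum_distrib_right)
    moreover have "((of_nat n + of_real gam) * a g n - (\<Sum>\<alpha>\<in>R. of_real (kp \<alpha>) * a (\<sigma> \<alpha> \<circ> g) n))
       = (case n of 0 \<Rightarrow> 0 | Suc m \<Rightarrow> cdot (cext g z) w * a g m)" for n
    proof (cases n)
      case 0
      then show ?thesis by (simp add: a_def gam_def)
    next
      case (Suc m)
      then show ?thesis using En_recursion[of m "cext g z" w] by (simp add: a_def cext_comp)
    qed
    ultimately have "(\<lambda>n. (case n of 0 \<Rightarrow> 0 | Suc m \<Rightarrow> cdot (cext g z) w * a g m) * of_real t ^ n)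
      sums (of_real t * \<phi>' g t + (\<Sum>\<alpha>\<in>R. of_real (kp \<alpha>) * (\<phi> g t - \<phi> (\<sigma> \<alpha> \<circ> g) t)))" by simp
    then have 1: "(\<lambda>n. of_real t * cdot (cext g z) w * (a g n * of_real t ^ n))
      sums (of_real t * \<phi>' g t + (\<Sum>\<alpha>\<in>R. of_real (kp \<alpha>) * (\<phi> g t - \<phi> (\<sigma> \<alpha> \<circ> g) t)))"
      by (subst (asm) sums_Suc_iff[symmetric, of "\<lambda>n. (case n of 0 \<Rightarrow> 0 | Suc m \<Rightarrow> _ m) * of_real t ^ n", simplified])
         (simp add: mult_ac)
    have 2: "(\<lambda>n. of_real t * cdot (cext g z) w * (a g n * of_real t ^ n)) sums (of_real t * cdot (cext g z) w * \<phi> g t)"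
      unfolding \<phi>_def by (intro sums_mult sums)
    show "of_real t * \<phi>' g t + (\<Sum>\<alpha>\<in>R. of_real (kp \<alpha>) * (\<phi> g t - \<phi> (\<sigma> \<alpha> \<circ> g) t)) = of_real t * cdot (cext g z) w * \<phi> g t"
      by (rule sums_unique2[OF 1 2])
  next
    show "continuous_on {0..1} (\<phi> g)" for g
      by (intro continuous_at_imp_continuous_on ballI has_vector_derivative_continuous[OF der])
  qed
  have 0: "\<phi> g 0 = 1" for g using powser_zero[of "a g"] by (simp add: \<phi>_def a_def)
  have 1: "\<phi> g 1 = E (cext g z) w" for g by (simp add: \<phi>_def a_def E_def)
  have "(norm (E (cext id z) w))\<^sup>2 \<le> (\<Sum>g\<in>G. (norm (E (cext g z) w))\<^sup>2)"
    by (rule member_le_sum[OF id_in_G]) auto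
  also have "\<dots> \<le> exp (2 * M) * (\<Sum>g\<in>G. (norm (1 :: complex))\<^sup>2)"
    using growth unfolding 0 1 .
  finally have "(norm (E (cext id z) w))\<^sup>2 \<le> exp (2 * M) * (\<Sum>g\<in>G. (norm (1 :: complex))\<^sup>2)" .
  then have "(norm (E z w))\<^sup>2 \<le> (sqrt (card G) * exp M)\<^sup>2"
    by (simp add: power_mult_distrib exp_double mult.commute[of "(exp M)\<^sup>2"])
  then show ?thesis by (rule power2_le_imp_le) simp
qed

text \<open>On the rays through the orbit of x, T in the direction of the base point gives exactly
  the system of \<open>orbit_growth\<close>, which bounds f by a multiple of its value at the
  origin.\<close>

lemma T_eigenfunction_0:
  assumes d: "\<And>x. f differentiable at x" and T: "\<And>\<eta> x. T \<eta> f x = cdot (complex_vec \<eta>) w * f x"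
    and 0: "f 0 = 0"
  shows "f x = 0"
proof -
  define \<phi> where "\<phi> g t = f (t *\<^sub>R g x)" for g and t :: real
  define \<phi>' where "\<phi>' g t = fder f (t *\<^sub>R g x) (g x)" for g and t :: real
  have der: "(\<phi> g has_vector_derivative \<phi>' g t) (at t)" for g t
  proof -
    have "((\<lambda>t. t *\<^sub>R g x) has_derivative (\<lambda>h. h *\<^sub>R g x)) (at t)" by (auto intro!: derivative_eq_intros)
    from has_derivative_compose[OF this fder_works[OF d]]
    have "((\<lambda>t. f (t *\<^sub>R g x)) has_vector_derivative \<phi>' g t) (at t)"
      by (simp add: has_vector_derivative_def \<phi>'_def linear_scale[OF fder_linear[OF d]])
    moreover have "\<phi> g = (\<lambda>t. f (t *\<^sub>R g x))" by (simp add: \<phi>_def fun_eq_iff)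
    ultimately show ?thesis by simp
  qed
  have growth: "(\<Sum>g\<in>G. (norm (\<phi> g 1))\<^sup>2) \<le> exp (2 * (norm x * norm w)) * (\<Sum>g\<in>G. (norm (\<phi> g 0))\<^sup>2)"
  proof (rule orbit_growth[of \<phi> \<phi>' "\<lambda>g. cdot (complex_vec (g x)) w"])
    fix g :: "real ^ 'n \<Rightarrow> real ^ 'n" and t :: real assume g: "g \<in> G"
    show "(\<phi> g has_vector_derivative \<phi>' g t) (at t)" by (rule der)
    show "Re (cdot (complex_vec (g x)) w) \<le> norm x * norm w"
      using complex_Re_le_cmod[of "cdot (complex_vec (g x)) w"] norm_cdot_le[of "complex_vec (g x)" w] g
      by (simp add: G_norm)
    have "\<sigma> \<alpha> (t *\<^sub>R g x) = t *\<^sub>R (\<sigma> \<alpha> \<circ> g) x" for \<alpha> using linear_scale[OF linear_root_reflection] by simp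
    then have "of_real t * \<phi>' g t + (\<Sum>\<alpha>\<in>R. of_real (kp \<alpha>) * (\<phi> g t - \<phi> (\<sigma> \<alpha> \<circ> g) t)) = T (t *\<^sub>R g x) f (t *\<^sub>R g x)"
      unfolding T_euler \<phi>_def \<phi>'_def by (simp add: linear_scale[OF fder_linear[OF d]] scaleR_complex)
    also have "\<dots> = of_real t * cdot (complex_vec (g x)) w * \<phi> g t"
      unfolding T \<phi>_def by (simp add: complex_vec_scaleR cdot_scale_left)
    finally show "of_real t * \<phi>' g t + (\<Sum>\<alpha>\<in>R. of_real (kp \<alpha>) * (\<phi> g t - \<phi> (\<sigma> \<alpha> \<circ> g) t)) = of_real t * cdot (complex_vec (g x)) w * \<phi> g t" .
  next
    show "continuous_on {0..1} (\<phi> g)" for g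
      by (intro continuous_at_imp_continuous_on ballI has_vector_derivative_continuous[OF der])
  qed
  have 00: "\<phi> g 0 = 0" for g by (simp add: \<phi>_def 0)
  have "(norm (\<phi> id 1))\<^sup>2 \<le> (\<Sum>g\<in>G. (norm (\<phi> g 1))\<^sup>2)"
    by (rule member_le_sum[OF id_in_G]) auto
  also have "\<dots> \<le> exp (2 * (norm x * norm w)) * (\<Sum>g\<in>G. (norm (0 :: complex))\<^sup>2)"
    using growth unfolding 00 .
  finally have "\<phi> id 1 = 0" by simp
  then show ?thesis by (simp add: \<phi>_def)
qed

lemma T_eigenfunction:
  assumes d: "\<And>x. f differentiable at x" and T: "\<And>\<eta> x. T \<eta> f x = cdot (complex_vec \<eta>) w * f x"
  shows "f x = f 0 * E (complex_vec x) w"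
proof -
  define h where "h x = f x + (- f 0) * E (complex_vec x) w" for x
  have "h x = 0"
  proof (rule T_eigenfunction_0)
    show "h differentiable at x" for x unfolding h_def by (intro derivative_intros d diff_E)
    show "T \<eta> h x = cdot (complex_vec \<eta>) w * h x" for \<eta> x
      unfolding h_def
      by (subst T_add[OF d differentiable_mult[OF differentiable_const diff_E]])
         (simp only: T_cmult[OF diff_E] T T_E, simp add: algebra_simps)
    show "h 0 = 0" by (simp add: h_def)
  qed
  then show ?thesis by (simp add: h_def)
qed

end

section \<open>Cauchy estimates and identification of the kernel\<close>

lemma linearI_bound_scale:
  fixes f :: "'a::real_normed_vector \<Rightarrow> 'b::real_normed_vector"
  assumes "linear f" "\<And>u. norm u = 1 \<Longrightarrow> norm (f u) \<le> C"
  shows "norm (f h) \<le> C * norm h"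
proof (cases "h = 0")
  case True
  then show ?thesis using linear_0[OF assms(1)] by simp
next
  case False
  have "norm (f ((1 / norm h) *\<^sub>R h)) \<le> C"
    using False by (intro assms) auto
  then show ?thesis using False unfolding linear_scale[OF assms(1)] by (simp add: field_simps)
qed

context dunkl
begin

lemma dE_linear: "linear (dE p)"
  using has_derivative_E has_derivative_linear by blast

lemma dE_real_linear: "linear (\<lambda>h. dE p (complex_vec h, 0))"
  using linear_compose[OF _ dE_linear, of "\<lambda>h. (complex_vec h, 0)" p]
  by (simp add: o_def linear_iff complex_vec_add linear_scale[OF linear_complex_vec])

lemma E_slice: "(\<lambda>t. E (z + t *s u) w) holomorphic_on UNIV"
  and deriv_E_slice: "deriv (\<lambda>t. E (z + t *s u) w) 0 = dE (z, w) (u, 0)"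
proof -
  show "(\<lambda>t. E (z + t *s u) w) holomorphic_on UNIV"
    using entire_pair_slice[OF entire_E, of z u w 0] by (simp add: vec_eq_iff)
  have *: "((\<lambda>t. t *s u) has_derivative (\<lambda>h. h *s u)) (at (0::complex))"
    by (rule bounded_linear_imp_has_derivative)
       (auto intro!: linear_conv_bounded_linear[THEN iffD1] linearI simp: vec_eq_iff algebra_simps)
  have "((\<lambda>t. (z + t *s u, w)) has_derivative (\<lambda>h. (h *s u, 0))) (at (0::complex))"
    by (auto intro!: derivative_eq_intros *)
  from has_derivative_compose[OF this has_derivative_E]
  have "((\<lambda>t. E (z + t *s u) w) has_derivative (\<lambda>h. dE (z, w) (h *s u, 0))) (at 0)"
    by simp
  moreover have "dE (z, w) (h *s u, 0) = dE (z, w) (u, 0) * h" for h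
    using dE_scale[of "(z, w)" h u 0] by (simp add: mult.commute vec_eq_iff)
  ultimately show "deriv (\<lambda>t. E (z + t *s u) w) 0 = dE (z, w) (u, 0)"
    by (intro DERIV_imp_deriv) (simp add: has_field_derivative_def)
qed

text \<open>Cauchy estimates: a bound for \<open>E\<close> on complex balls controls first and second derivatives.\<close>

lemma fder_E_bounds:
  assumes S: "convex S" and \<delta>: "\<delta> > 0"
    and B: "\<And>a z. a \<in> S \<Longrightarrow> norm z \<le> 2 * \<delta> \<Longrightarrow> norm (E (complex_vec a + z) w) \<le> B"
  shows "x \<in> S \<Longrightarrow> norm (fder (\<lambda>x. E (complex_vec x) w) x h) \<le> B / \<delta> * norm h"
    and "x \<in> S \<Longrightarrow> y \<in> S \<Longrightarrow> norm (fder (\<lambda>x. E (complex_vec x) w) x h - fder (\<lambda>x. E (complex_vec x) w) y h)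
      \<le> B / \<delta>\<^sup>2 * norm (x - y) * norm h"
proof -
  \<comment> \<open>The room 2 * \<delta> is spent in two halves: a circle of radius \<delta> for
    the first derivative, around centres that may already be displaced by z with norm z \<le>
    \<delta>, as the second derivative needs.\<close>
  have 1: "norm (dE (complex_vec a + z, w) (complex_vec h, 0)) \<le> B / \<delta> * norm h" if "a \<in> S" "norm z \<le> \<delta>" for a z h
  proof (rule linearI_bound_scale[OF dE_real_linear])
    fix u :: "real ^ 'n" assume u: "norm u = 1"
    have "norm (deriv (\<lambda>t. E ((complex_vec a + z) + t *s complex_vec u) w) 0) \<le> B / \<delta>"
    proof (rule cauchy_deriv_bound[OF E_slice \<delta>])
      fix t :: complex assume t: "norm t \<le> \<delta>"
      have "norm (t *s complex_vec u) = norm t"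
        using u by (simp add: norm_vec_def norm_mult L2_set_right_distrib[symmetric] complex_vec_def)
      then have "norm (z + t *s complex_vec u) \<le> 2 * \<delta>"
        using norm_triangle_ineq[of z "t *s complex_vec u"] that t by linarith
      from B[OF that(1) this] show "norm (E ((complex_vec a + z) + t *s complex_vec u) w) \<le> B"
        by (simp add: add.assoc)
    qed
    then show "norm (dE (complex_vec a + z, w) (complex_vec u, 0)) \<le> B / \<delta>"
      unfolding deriv_E_slice .
  qed
  show "x \<in> S \<Longrightarrow> norm (fder (\<lambda>x. E (complex_vec x) w) x h) \<le> B / \<delta> * norm h"
    unfolding fder_E using 1[of x 0 h] \<delta> by simp
  assume xy: "x \<in> S" "y \<in> S"
  show "norm (fder (\<lambda>x. E (complex_vec x) w) x h - fder (\<lambda>x. E (complex_vec x) w) y h) \<le> B / \<delta>\<^sup>2 * norm (x - y) * norm h"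
    unfolding fder_E
  proof (rule linearI_bound_scale[OF linear_compose_sub[OF dE_real_linear dE_real_linear]])
    fix u :: "real ^ 'n" assume u: "norm u = 1"
    let ?f = "\<lambda>x t. E (complex_vec x + t *s complex_vec u) w"
    have "norm (deriv (\<lambda>t. ?f x t - ?f y t) 0) \<le> (B / \<delta> * norm (x - y)) / \<delta>"
    proof (rule cauchy_deriv_bound[OF holomorphic_on_diff[OF E_slice E_slice] \<delta>])
      fix t :: complex assume t: "norm t \<le> \<delta>"
      have nt: "norm (t *s complex_vec u) \<le> \<delta>"
        using u t by (simp add: norm_vec_def norm_mult L2_set_right_distrib[symmetric] complex_vec_def)
      show "norm (?f x t - ?f y t) \<le> B / \<delta> * norm (x - y)"
      proof (rule differentiable_bound[OF S _ _ xy])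
        fix a assume a: "a \<in> S"
        have "((\<lambda>x. (complex_vec x + t *s complex_vec u, w)) has_derivative (\<lambda>h. (complex_vec h, 0))) (at a within S)"
          by (auto intro!: derivative_eq_intros bounded_linear_imp_has_derivative bounded_linear_complex_vec)
        from has_derivative_compose[OF this has_derivative_E]
        show "((\<lambda>x. ?f x t) has_derivative (\<lambda>h. dE (complex_vec a + t *s complex_vec u, w) (complex_vec h, 0))) (at a within S)"
          by simp
        have B0: "0 \<le> B" using B[OF a, of 0] \<delta> norm_ge_zero order_trans by (metis mult_nonneg_nonneg norm_zero less_imp_le zero_le_numeral)
        show "onorm (\<lambda>h. dE (complex_vec a + t *s complex_vec u, w) (complex_vec h, 0)) \<le> B / \<delta>"
          by (rule onorm_bound) (use B0 \<delta> 1[OF a nt] in auto)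
      qed
    qed
    also have "deriv (\<lambda>t. ?f x t - ?f y t) 0 = dE (complex_vec x, w) (complex_vec u, 0) - dE (complex_vec y, w) (complex_vec u, 0)"
      using E_slice by (subst deriv_diff) (auto simp: deriv_E_slice holomorphic_on_def)
    finally show "norm (dE (complex_vec x, w) (complex_vec u, 0) - dE (complex_vec y, w) (complex_vec u, 0)) \<le> B / \<delta>\<^sup>2 * norm (x - y)"
      by (simp add: power2_eq_square)
  qed
qed

lemma C1_E: "C1_fun (\<lambda>x. E (complex_vec x) w)"
  unfolding C1_fun_def
proof (intro conjI allI)
  fix x v :: "real ^ 'n"
  show "(\<lambda>x. E (complex_vec x) w) differentiable at x" by (rule diff_E)
  show "continuous_on UNIV (\<lambda>x. fder (\<lambda>x. E (complex_vec x) w) x v)"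
  proof (rule continuous_at_imp_continuous_on, rule ballI)
    fix x :: "real ^ 'n"
    define B where "B = exp ((norm x + 3) * norm w)"
    have lip: "norm (fder (\<lambda>x. E (complex_vec x) w) y v - fder (\<lambda>x. E (complex_vec x) w) x v) \<le> B / 1\<^sup>2 * norm (y - x) * norm v"
      if "y \<in> ball x 1" for y
    proof (rule fder_E_bounds(2)[OF convex_ball])
      fix a z assume a: "a \<in> ball x 1" and z: "norm (z :: complex ^ 'n) \<le> 2 * 1"
      have "norm (complex_vec a + z) \<le> norm x + 3"
        using norm_triangle_ineq[of "complex_vec a" z] norm_triangle_ineq[of x "a - x"] a z
        by (simp add: dist_norm norm_minus_commute)
      then show "norm (E (complex_vec a + z) w) \<le> B"
        unfolding B_def by (intro order_trans[OF E_bound] iffD2[OF exp_le_cancel_iff] mult_right_mono) auto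
    qed (use that in auto)
    have "((\<lambda>y. B / 1\<^sup>2 * norm (y - x) * norm v) \<longlongrightarrow> B / 1\<^sup>2 * norm (x - x) * norm v) (at x)"
      by (intro tendsto_intros)
    then have lim: "((\<lambda>y. B / 1\<^sup>2 * norm (y - x) * norm v) \<longlongrightarrow> 0) (at x)"
      by simp
    have "\<forall>\<^sub>F y in at x. y \<in> ball x 1" by (rule eventually_at_in_open') auto
    then have "\<forall>\<^sub>F y in at x. norm (fder (\<lambda>x. E (complex_vec x) w) y v - fder (\<lambda>x. E (complex_vec x) w) x v)
        \<le> B / 1\<^sup>2 * norm (y - x) * norm v"
      by (rule eventually_mono) (rule lip)
    from Lim_null_comparison[OF this lim] show "isCont (\<lambda>x. fder (\<lambda>x. E (complex_vec x) w) x v) x"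
      by (simp add: isCont_def LIM_zero_iff)
  qed
qed

text \<open>The definite description denotes E because \<open>C1_E\<close> and \<open>T_E\<close>
  provide existence and \<open>T_eigenfunction\<close> provides uniqueness.\<close>

lemma dunkl_kernel_real_eq: "dunkl_kernel_real R k x y = E (complex_vec x) (complex_vec y)"
proof -
  have "(THE f. C1_fun f \<and> f 0 = 1 \<and> (\<forall>\<xi> z. T \<xi> f z = of_real (\<xi> \<bullet> y) * f z)) = (\<lambda>x. E (complex_vec x) (complex_vec y))"
  proof (rule the_equality)
    show "C1_fun (\<lambda>x. E (complex_vec x) (complex_vec y)) \<and> E (complex_vec 0) (complex_vec y) = 1 \<and>
      (\<forall>\<xi> z. T \<xi> (\<lambda>x. E (complex_vec x) (complex_vec y)) z = of_real (\<xi> \<bullet> y) * E (complex_vec z) (complex_vec y))"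
      by (simp add: C1_E T_E cdot_complex_vec)
  next
    fix f :: "real ^ 'n \<Rightarrow> complex" assume "C1_fun f \<and> f 0 = 1 \<and> (\<forall>\<xi> z. T \<xi> f z = of_real (\<xi> \<bullet> y) * f z)"
    then show "f = (\<lambda>x. E (complex_vec x) (complex_vec y))"
      using T_eigenfunction[of f "complex_vec y"] by (auto simp: C1_fun_def cdot_complex_vec fun_eq_iff)
  qed
  then show ?thesis by (simp add: dunkl_kernel_real_def)
qed

lemma dunkl_kernel_eq: "dunkl_kernel R k = E"
  unfolding dunkl_kernel_def dunkl_kernel_real_eq
proof (rule the_equality)
  show "entire_pair E \<and> (\<forall>x y. E (complex_vec x) (complex_vec y) = E (complex_vec x) (complex_vec y))"
    by (simp add: entire_E)
  fix F :: "complex ^ 'n \<Rightarrow> complex ^ 'n \<Rightarrow> complex"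
  assume "entire_pair F \<and> (\<forall>x y. F (complex_vec x) (complex_vec y) = E (complex_vec x) (complex_vec y))"
  then show "F = E"
    using entire_pair_eq_0[OF entire_pair_diff[OF _ entire_E, of F]] by (auto simp: fun_eq_iff)
qed

section \<open>The kernel at imaginary arguments\<close>

text \<open>The generalized exponential in place of \<open>exp (\<i> * (x \<bullet> \<xi>))\<close>,
  to which it reduces for k = 0.\<close>

definition e :: "real ^ 'n \<Rightarrow> real ^ 'n \<Rightarrow> complex" where "e x \<xi> = E (complex_vec x) (\<i> *s complex_vec \<xi>)"
definition cG :: real where "cG = sqrt (card G)"

lemma cG_pos: "cG > 0"
  using id_in_G finite_G by (auto simp: cG_def card_gt_0_iff simp del: id_in_G)

lemma e_symmetric: "e x \<xi> = e \<xi> x"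
  unfolding e_def by (metis E_scale E_symmetric)

lemma dunkl_kernel_e: "dunkl_kernel R k (\<i> *s complex_vec \<xi>) (complex_vec x) = e \<xi> x"
  "dunkl_kernel R k ((- \<i>) *s complex_vec \<xi>) (complex_vec x) = e (- \<xi>) x"
proof -
  have "(- \<i>) *s complex_vec \<xi> = \<i> *s complex_vec (- \<xi>)" by (simp add: vec_eq_iff complex_vec_def)
  then show "dunkl_kernel R k (\<i> *s complex_vec \<xi>) (complex_vec x) = e \<xi> x"
    "dunkl_kernel R k ((- \<i>) *s complex_vec \<xi>) (complex_vec x) = e (- \<xi>) x"
    by (simp_all add: dunkl_kernel_eq e_def E_scale)
qed

lemma e_0 [simp]: "e 0 \<xi> = 1" "e x 0 = 1"
  by (simp_all add: e_def)

lemma e_uminus: "e (- x) \<xi> = e x (- \<xi>)"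
proof -
  have "complex_vec (- x) = (- 1) *s complex_vec x" "\<i> *s complex_vec (- \<xi>) = (- 1) *s (\<i> *s complex_vec \<xi>)"
    by (simp_all add: vec_eq_iff complex_vec_def)
  then show ?thesis unfolding e_def by (simp only: E_scale)
qed

lemma e_cnj: "cnj (e x \<xi>) = e x (- \<xi>)"
proof -
  have "(\<lambda>n. cnj (En n (complex_vec x) (\<i> *s complex_vec \<xi>))) sums cnj (e x \<xi>)"
    unfolding e_def by (rule bounded_linear.sums[OF bounded_linear_cnj En_sums])
  moreover have "cnj (En n (complex_vec x) (\<i> *s complex_vec \<xi>)) = En n (complex_vec x) (\<i> *s complex_vec (- \<xi>))" for n
  proof -
    have "\<i> *s complex_vec (- \<xi>) = (- \<i>) *s complex_vec \<xi>" by (simp add: vec_eq_iff complex_vec_def)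
    then show ?thesis using En_real[of n x \<xi>] by (simp only: En_scale_right Reals_cnj_iff) simp
  qed
  ultimately have "(\<lambda>n. En n (complex_vec x) (\<i> *s complex_vec (- \<xi>))) sums cnj (e x \<xi>)" by simp
  then show ?thesis unfolding e_def using En_sums sums_unique2 by blast
qed

lemma norm_i_cvec: "norm (\<i> *s complex_vec \<xi>) = norm \<xi>"
  by (simp add: norm_vec_def norm_mult complex_vec_def)

text \<open>For real x the numbers <g x, \<i> \<xi>> are purely imaginary, so in
  \<open>E_growth\<close> only the complex displacement z contributes to the exponent.\<close>

lemma E_imag_bound: "norm (E (complex_vec x + z) (\<i> *s complex_vec \<xi>)) \<le> cG * exp (norm z * norm \<xi>)"
  unfolding cG_def
proof (rule E_growth)
  fix g assume g: "g \<in> G"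
  have "cdot (cext g (complex_vec x + z)) (\<i> *s complex_vec \<xi>) = \<i> * of_real (g x \<bullet> \<xi>) + cdot (cext g z) (\<i> *s complex_vec \<xi>)"
    using g by (simp add: cext_add G_linear cext_complex_vec cdot_add_left cdot_complex_vec cdot_scale_right distrib_left)
  also have "Re \<dots> \<le> norm (cdot (cext g z) (\<i> *s complex_vec \<xi>))"
    using complex_Re_le_cmod by simp
  also have "\<dots> \<le> norm z * norm \<xi>"
    using norm_cdot_le[of "cext g z" "\<i> *s complex_vec \<xi>"] g by (simp add: norm_i_cvec)
  finally show "Re (cdot (cext g (complex_vec x + z)) (\<i> *s complex_vec \<xi>)) \<le> norm z * norm \<xi>" .
qed

lemma e_bound: "norm (e x \<xi>) \<le> cG"
  using E_imag_bound[of x 0 \<xi>] by (simp add: e_def)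

lemma e_diff: "(\<lambda>x. e x \<xi>) differentiable at x"
  unfolding e_def by (rule diff_E)

lemma T_e: "T \<eta> (\<lambda>x. e x \<xi>) x = \<i> * of_real (\<eta> \<bullet> \<xi>) * e x \<xi>"
  unfolding e_def T_E by (simp add: cdot_scale_right cdot_complex_vec)

text \<open>The factor \<open>exp 2\<close> stems from Cauchy estimates with radius \<delta> = 1 /
  (1 + norm \<xi>): for norm z \<le> 2 * \<delta> the exponent norm z * norm \<xi> is at most
  2.\<close>

definition cE :: real where "cE = cG * exp 2"

lemma cE_pos: "cE > 0" by (simp add: cE_def cG_pos)

lemma fder_e_bound: "norm (fder (\<lambda>x. e x \<xi>) x h) \<le> cE * (1 + norm \<xi>) * norm h"
  and fder_e_lipschitz: "norm (fder (\<lambda>x. e x \<xi>) x h - fder (\<lambda>x. e x \<xi>) y h) \<le> cE * (1 + norm \<xi>)\<^sup>2 * norm (x - y) * norm h"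
proof -
  define \<delta> where "\<delta> = 1 / (1 + norm \<xi>)"
  have \<delta>: "\<delta> > 0" by (simp add: \<delta>_def add_pos_nonneg)
  have B: "norm (E (complex_vec a + z) (\<i> *s complex_vec \<xi>)) \<le> cE" if "norm z \<le> 2 * \<delta>" for a z
  proof -
    have "norm z * norm \<xi> \<le> 2 * \<delta> * (1 + norm \<xi>)" using that \<delta> by (intro mult_mono) auto
    also have "\<dots> = 2"
    proof -
      have "1 + norm \<xi> \<noteq> 0" using norm_ge_zero[of \<xi>] by linarith
      then show ?thesis unfolding \<delta>_def by (simp add: divide_eq_eq)
    qed
    finally have "cG * exp (norm z * norm \<xi>) \<le> cE" using cG_pos by (simp add: cE_def)
    then show ?thesis using E_imag_bound order_trans by blast
  qed
  note * = fder_E_bounds[OF convex_UNIV \<delta>, of "\<i> *s complex_vec \<xi>" cE, OF B]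
  show "norm (fder (\<lambda>x. e x \<xi>) x h) \<le> cE * (1 + norm \<xi>) * norm h"
    using *(1)[of x h] unfolding e_def by (simp add: \<delta>_def)
  show "norm (fder (\<lambda>x. e x \<xi>) x h - fder (\<lambda>x. e x \<xi>) y h) \<le> cE * (1 + norm \<xi>)\<^sup>2 * norm (x - y) * norm h"
    using *(2)[of x y h] unfolding e_def by (simp add: \<delta>_def power_divide)
qed

text \<open>A remainder uniform in x and y that grows only polynomially in \<xi>. Against rapidly
  decreasing functions of \<xi> it justifies differentiation under the integral.\<close>

lemma e_taylor: "norm (e y \<xi> - e x \<xi> - fder (\<lambda>x. e x \<xi>) x (y - x)) \<le> cE * (1 + norm \<xi>)\<^sup>2 * (norm (y - x))\<^sup>2"
proof -
  let ?D = "\<lambda>x. fder (\<lambda>x. e x \<xi>) x"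
  define C where "C = cE * (1 + norm \<xi>)\<^sup>2 * norm (y - x)"
  have "norm ((e y \<xi> - ?D x y) - (e x \<xi> - ?D x x)) \<le> C * norm (y - x)"
  proof (rule differentiable_bound[of "closed_segment x y" _ "\<lambda>z h. ?D z h - ?D x h"])
    fix z assume z: "z \<in> closed_segment x y"
    have "(?D x has_derivative ?D x) (at z)"
      by (rule bounded_linear_imp_has_derivative[OF has_derivative_bounded_linear[OF fder_works[OF e_diff]]])
    then show "((\<lambda>z. e z \<xi> - ?D x z) has_derivative (\<lambda>h. ?D z h - ?D x h)) (at z within closed_segment x y)"
      by (rule has_derivative_at_withinI[OF has_derivative_diff[OF fder_works[OF e_diff]]])
    have "norm (z - x) \<le> norm (y - x)"
      using segment_bound(1)[OF z] by (simp add: norm_minus_commute)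
    then have "cE * (1 + norm \<xi>)\<^sup>2 * norm (z - x) * norm h \<le> C * norm h" for h
      unfolding C_def using cE_pos by (intro mult_right_mono mult_left_mono) auto
    then have "norm (?D z h - ?D x h) \<le> C * norm h" for h
      using fder_e_lipschitz[of \<xi> z h x] order_trans by blast
    then show "onorm (\<lambda>h. ?D z h - ?D x h) \<le> C"
      by (intro onorm_bound) (use cE_pos in \<open>auto simp: C_def\<close>)
  qed auto
  then show ?thesis
    by (simp add: C_def power2_eq_square linear_diff[OF fder_linear[OF e_diff]] algebra_simps)
qed

lemma continuous_e: "continuous_on UNIV (\<lambda>p. e (fst p) (snd p))"
proof -
  have i: "continuous_on UNIV (\<lambda>x. \<i> *s complex_vec x)"
    by (rule linear_continuous_on, rule linear_conv_bounded_linear[THEN iffD1])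
       (auto intro!: linearI simp: vec_eq_iff complex_vec_def algebra_simps complex_eq_iff)
  have c: "continuous_on UNIV (\<lambda>p. (complex_vec (fst p), \<i> *s complex_vec (snd p)))"
    by (intro continuous_on_Pair continuous_on_compose2[OF linear_continuous_on[OF bounded_linear_complex_vec]]
        continuous_on_compose2[OF i] continuous_intros) auto
  have "continuous_on UNIV ((\<lambda>p. E (fst p) (snd p)) \<circ> (\<lambda>p. (complex_vec (fst p), \<i> *s complex_vec (snd p))))"
    by (rule continuous_on_compose[OF c continuous_on_subset[OF continuous_E]]) auto
  then show ?thesis by (simp add: e_def o_def)
qed

lemma continuous_e1: "continuous_on UNIV (\<lambda>x. e x \<xi>)"
  using continuous_on_compose2[OF continuous_e, of UNIV "\<lambda>x. (x, \<xi>)"]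
  by (simp add: continuous_on_Pair continuous_on_id continuous_on_const)

lemma measurable_e [measurable]: "(\<lambda>p. e (fst p) (snd p)) \<in> borel_measurable (borel \<Otimes>\<^sub>M borel)"
  unfolding borel_prod by (rule borel_measurable_continuous_onI[OF continuous_e])

lemma measurable_e1 [measurable]: "(\<lambda>x. e x \<xi>) \<in> borel_measurable borel"
  "(\<lambda>x. e \<xi> x) \<in> borel_measurable borel"
  using borel_measurable_continuous_onI[OF continuous_e1, of \<xi>] by (simp_all only: e_symmetric[of \<xi>])

end

lemma lborel_uminus: "distr lborel borel uminus = (lborel :: 'a::euclidean_space measure)"
  using lborel_affine[of "-1" "0::'a"] by (simp add: density_1)

lemma nn_integral_lborel_shift:
  fixes f :: "'a::euclidean_space \<Rightarrow> ennreal"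
  assumes [measurable]: "f \<in> borel_measurable borel"
  shows "(\<integral>\<^sup>+x. f (c + x) \<partial>lborel) = (\<integral>\<^sup>+x. f x \<partial>lborel)"
  by (subst (2) lborel_distr_plus[symmetric, of c]) (simp add: nn_integral_distr)

lemma not_AE_lborel_False: "\<not> (AE x in (lborel :: 'a::euclidean_space measure). False)"
  by (subst AE_iff_null) (auto simp: null_sets_def)

section \<open>Rapidly decreasing functions\<close>

text \<open>Comparison with balls of radius 1 + n: their volume consumes the power DIM('a), and the
  remaining exponent 2 makes the sum over n finite.\<close>

lemma nn_integral_decay_finite:
  "(\<integral>\<^sup>+x. ennreal (1 / (1 + norm (x :: 'a::euclidean_space)) ^ (DIM('a) + 2)) \<partial>lborel) < (\<infinity> :: ennreal)"
proof -
  let ?N = "DIM('a)"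
  have pw: "ennreal (1 / (1 + norm x) ^ (?N + 2)) \<le>
     (\<Sum>n. ennreal (1 / (1 + real n) ^ (?N + 2)) * indicator (cball 0 (1 + real n)) x)" (is "_ \<le> (\<Sum>n. ?F n x)") for x :: 'a
  proof -
    define n where "n = nat \<lfloor>norm x\<rfloor>"
    have n: "real n \<le> norm x" "norm x \<le> 1 + real n"
      unfolding n_def by (auto simp: of_nat_nat) linarith
    have "1 / (1 + norm x) ^ (?N + 2) \<le> 1 / (1 + real n) ^ (?N + 2)"
      using n by (intro divide_left_mono power_mono mult_pos_pos zero_less_power) (auto simp: add_pos_nonneg)
    then have "ennreal (1 / (1 + norm x) ^ (?N + 2)) \<le> ?F n x"
      using n by (simp add: ennreal_leI)
    also have "\<dots> \<le> (\<Sum>n. ?F n x)"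
    proof -
      have "(\<Sum>m\<in>{n}. ?F m x) \<le> (\<Sum>n. ?F n x)" by (rule sum_le_suminf) auto
      then show ?thesis by (simp only: sum.insert finite.emptyI sum.empty empty_iff not_False_eq_True add_0_right)
    qed
    finally show ?thesis .
  qed
  have "(\<integral>\<^sup>+x. ennreal (1 / (1 + norm (x :: 'a)) ^ (?N + 2)) \<partial>lborel) \<le> (\<integral>\<^sup>+x. (\<Sum>n. ?F n (x :: 'a)) \<partial>lborel)"
    by (rule nn_integral_mono) (rule pw)
  also have "\<dots> = (\<Sum>n. (\<integral>\<^sup>+x. ?F n (x :: 'a) \<partial>lborel))"
    by (intro nn_integral_suminf borel_measurable_times_ennreal borel_measurable_const borel_measurable_indicator) auto
  also have "\<dots> = (\<Sum>n. ennreal (unit_ball_vol ?N * (1 / (1 + real n)\<^sup>2)))"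
  proof (rule suminf_cong)
    fix n
    have "(\<integral>\<^sup>+x. ?F n (x :: 'a) \<partial>lborel) = ennreal (1 / (1 + real n) ^ (?N + 2)) * ennreal (unit_ball_vol ?N * (1 + real n) ^ ?N)"
      by (subst nn_integral_cmult_indicator) (auto simp: emeasure_cball)
    also have "\<dots> = ennreal (1 / (1 + real n) ^ (?N + 2) * (unit_ball_vol ?N * (1 + real n) ^ ?N))"
      by (intro ennreal_mult[symmetric]) auto
    also have "1 / (1 + real n) ^ (?N + 2) * (unit_ball_vol ?N * (1 + real n) ^ ?N) = unit_ball_vol ?N * (1 / (1 + real n)\<^sup>2)"
    proof -
      have "1 / y ^ (?N + 2) * (v * y ^ ?N) = v * (1 / y\<^sup>2)" if "y \<noteq> 0" for y v :: real
        using that unfolding power_add by simp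
      then show ?thesis by (simp only: of_nat_0_le_iff add_nonneg_eq_0_iff zero_le_one one_neq_zero simp_thms)
    qed
    finally show "(\<integral>\<^sup>+x. ?F n (x :: 'a) \<partial>lborel) = ennreal (unit_ball_vol ?N * (1 / (1 + real n)\<^sup>2))" .
  qed
  also have "\<dots> < \<infinity>"
  proof -
    have s: "summable (\<lambda>n. 1 / (1 + real n)\<^sup>2)"
      using summable_Suc_iff[of "\<lambda>n. inverse ((real n)\<^sup>2)"] inverse_power_summable[of 2, where 'a = real]
      by (simp add: inverse_eq_divide add.commute)
    show ?thesis
      using summable_mult[OF s, of "unit_ball_vol ?N"] by (subst suminf_ennreal2) (auto simp: less_top)
  qed
  finally show ?thesis .
qed

definition rap :: "('a::real_normed_vector \<Rightarrow> complex) \<Rightarrow> bool" where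
  "rap f \<longleftrightarrow> (\<forall>m. \<exists>C. \<forall>x. (1 + norm x) ^ m * norm (f x) \<le> C)"

lemma rapD: "rap f \<Longrightarrow> \<exists>C\<ge>0. \<forall>x. norm (f x) \<le> C / (1 + norm x) ^ m"
proof -
  assume "rap f"
  then obtain C where C: "\<And>x. (1 + norm x) ^ m * norm (f x) \<le> C" unfolding rap_def by metis
  have "norm (f x) \<le> C / (1 + norm x) ^ m" for x
  proof -
    have "0 < (1 + norm x) ^ m" by (intro zero_less_power add_pos_nonneg) auto
    then show ?thesis using C[of x] by (simp add: pos_le_divide_eq mult.commute)
  qed
  moreover have "0 \<le> C" using C[of 0] by (rule order_trans[rotated]) simp
  ultimately show ?thesis by blast
qed

lemma rapI: "(\<And>m. \<exists>C. \<forall>x. (1 + norm x) ^ m * norm (f x) \<le> C) \<Longrightarrow> rap f"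
  by (simp add: rap_def)

lemma rap_mult_poly:
  assumes f: "rap f" and g: "\<And>x. norm (g x) \<le> c * (1 + norm x) ^ j * norm (f x)" "c \<ge> 0"
  shows "rap g"
proof (rule rapI)
  fix m
  obtain C where C: "\<And>x. (1 + norm x) ^ (m + j) * norm (f x) \<le> C" using f unfolding rap_def by metis
  have "(1 + norm x) ^ m * norm (g x) \<le> c * C" for x
  proof -
    have "(1 + norm x) ^ m * norm (g x) \<le> (1 + norm x) ^ m * (c * (1 + norm x) ^ j * norm (f x))"
      by (intro mult_left_mono g) auto
    also have "\<dots> = c * ((1 + norm x) ^ (m + j) * norm (f x))" by (simp add: power_add)
    also have "\<dots> \<le> c * C" by (intro mult_left_mono C g)
    finally show ?thesis .
  qed
  then show "\<exists>C. \<forall>x. (1 + norm x) ^ m * norm (g x) \<le> C" by blast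
qed

lemma rap_add: assumes "rap f" "rap g" shows "rap (\<lambda>x. f x + g x)"
proof (rule rapI)
  fix m
  obtain C D where C: "\<And>x. (1 + norm x) ^ m * norm (f x) \<le> C" and D: "\<And>x. (1 + norm x) ^ m * norm (g x) \<le> D"
    using assms unfolding rap_def by metis
  have "(1 + norm x) ^ m * norm (f x + g x) \<le> C + D" for x
  proof -
    have "(1 + norm x) ^ m * norm (f x + g x) \<le> (1 + norm x) ^ m * (norm (f x) + norm (g x))"
      by (intro mult_left_mono norm_triangle_ineq) auto
    then show ?thesis using C[of x] D[of x] by (simp add: distrib_left)
  qed
  then show "\<exists>C. \<forall>x. (1 + norm x) ^ m * norm (f x + g x) \<le> C" by blast
qed

lemma rap_cmult: "rap f \<Longrightarrow> rap (\<lambda>x. c * f x)"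
  by (rule rap_mult_poly[of f _ "norm c" 0]) (auto simp: norm_mult)

lemma rap_zero [simp]: "rap (\<lambda>x. 0)"
  by (auto simp: rap_def)

lemma rap_sum: "(\<And>i. i \<in> I \<Longrightarrow> rap (f i)) \<Longrightarrow> rap (\<lambda>x. \<Sum>i\<in>I. f i x)"
  by (induction I rule: infinite_finite_induct) (auto intro: rap_add)

lemma rap_mult_bounded: "rap f \<Longrightarrow> (\<And>x. norm (g x) \<le> c) \<Longrightarrow> rap (\<lambda>x. g x * f x)"
proof -
  assume f: "rap f" and g: "\<And>x. norm (g x) \<le> c"
  have "0 \<le> c" using g[of undefined] norm_ge_zero order_trans by blast
  then show ?thesis
    by (intro rap_mult_poly[OF f, of _ c 0]) (auto simp: norm_mult intro!: mult_right_mono g)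
qed

lemma rap_coord: "rap f \<Longrightarrow> rap (\<lambda>x. of_real (x \<bullet> \<zeta>) * f x)"
proof (rule rap_mult_poly[of f _ "norm \<zeta>" 1])
  fix x
  have "\<bar>x \<bullet> \<zeta>\<bar> \<le> norm \<zeta> * (1 + norm x)"
    using Cauchy_Schwarz_ineq2[of x \<zeta>] by (simp add: algebra_simps) (smt (verit) norm_ge_zero)
  then show "norm (of_real (x \<bullet> \<zeta>) * f x) \<le> norm \<zeta> * (1 + norm x) ^ 1 * norm (f x)"
    by (simp add: norm_mult mult_right_mono)
qed auto

lemma rap_comp_isometry: "rap f \<Longrightarrow> (\<And>x. norm (g x) = norm x) \<Longrightarrow> rap (\<lambda>x. f (g x))"
  unfolding rap_def by metis

lemma rap_bounded: "rap f \<Longrightarrow> \<exists>C. \<forall>x. norm (f x) \<le> C"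
  using rapD[of f 0] by auto

lemma integrable_lborel_decay:
  fixes f :: "'a::euclidean_space \<Rightarrow> complex"
  assumes [measurable]: "f \<in> borel_measurable borel" and f: "\<And>x. norm (f x) \<le> C / (1 + norm x) ^ (DIM('a) + 2)"
  shows "integrable lborel f"
proof (rule integrableI_bounded)
  have C: "0 \<le> C" using order_trans[OF norm_ge_zero f[of 0]] by simp
  have "(\<integral>\<^sup>+x. ennreal (norm (f x)) \<partial>lborel) \<le> (\<integral>\<^sup>+x. ennreal C * ennreal (1 / (1 + norm (x::'a)) ^ (DIM('a) + 2)) \<partial>lborel)"
    by (rule nn_integral_mono) (use f C in \<open>simp add: ennreal_mult[symmetric] ennreal_leI\<close>)
  also have "\<dots> = ennreal C * (\<integral>\<^sup>+x. ennreal (1 / (1 + norm (x::'a)) ^ (DIM('a) + 2)) \<partial>lborel)"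
    by (rule nn_integral_cmult) measurable
  also have "\<dots> < \<infinity>" using nn_integral_decay_finite[where 'a = 'a] by (simp add: ennreal_mult_less_top)
  finally show "(\<integral>\<^sup>+x. ennreal (norm (f x)) \<partial>lborel) < \<infinity>" .
qed simp

definition gauss :: "real \<Rightarrow> 'a::real_inner \<Rightarrow> complex" where
  "gauss a x = of_real (exp (- a * (norm x)\<^sup>2))"

lemma rap_gauss: assumes "a > 0" shows "rap (gauss a)"
proof (rule rapI)
  fix m :: nat
  have "((\<lambda>t::real. (1 + t) ^ m * exp (- a * t\<^sup>2)) \<longlongrightarrow> 0) at_top"
    using assms by real_asymp
  then have "\<forall>\<^sub>F t in at_top. (1 + t) ^ m * exp (- a * t\<^sup>2) < 1" by (rule order_tendstoD(2)) simp
  then obtain K where K: "\<And>t. t \<ge> K \<Longrightarrow> (1 + t) ^ m * exp (- a * t\<^sup>2) < 1"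
    unfolding eventually_at_top_linorder by blast
  have "(1 + norm x) ^ m * norm (gauss a x) \<le> (1 + \<bar>K\<bar>) ^ m + 1" for x :: 'a
  proof (cases "norm x \<ge> K")
    case True
    then have "(1 + norm x) ^ m * norm (gauss a x) < 1" using K by (simp add: gauss_def)
    then show ?thesis by (smt (verit) zero_le_power abs_ge_zero)
  next
    case False
    have "(1 + norm x) ^ m * norm (gauss a x) \<le> (1 + \<bar>K\<bar>) ^ m * 1"
      using False assms by (intro mult_mono power_mono) (auto simp: gauss_def)
    then show ?thesis by simp
  qed
  then show "\<exists>C. \<forall>x::'a. (1 + norm x) ^ m * norm (gauss a x) \<le> C" by blast
qed

lemma measurable_gauss [measurable]: "gauss a \<in> borel_measurable (borel :: 'a::euclidean_space measure)"
  unfolding gauss_def by measurable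

text \<open>Comparing the two sides of Fubini's theorem for \<open>(x, y) \<mapsto> exp (- (norm y)\<^sup>2) * indicator A (g x + y)\<close>
  shows that a linear isometry preserves Lebesgue measure; the library only has this for
  well-ordered index types.\<close>

lemma lborel_isometry:
  fixes g :: "'a::euclidean_space \<Rightarrow> 'a"
  assumes lin: "linear g" "linear g'" and inv: "\<And>x. g (g' x) = x" and iso: "\<And>x. norm (g x) = norm x"
  shows "distr lborel borel g = lborel"
proof (rule measure_eqI)
  have [measurable]: "g \<in> borel_measurable borel" "g' \<in> borel_measurable borel"
    using lin by (auto intro!: borel_measurable_continuous_onI linear_continuous_on linear_conv_bounded_linear[THEN iffD1])
  fix A assume "A \<in> sets (distr lborel borel g)"
  then have [measurable]: "A \<in> sets borel" by simp
  \<comment> \<open>A strictly positive integrable weight: its total mass c is neither 0 nor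
    infinite and can be cancelled at the end.\<close>
  define h where "h x = ennreal (exp (- (norm x)\<^sup>2))" for x :: 'a
  have [measurable]: "h \<in> borel_measurable borel" unfolding h_def by measurable
  define c where "c = (\<integral>\<^sup>+x. h x \<partial>lborel)"
  have "integrable lborel (gauss 1 :: 'a \<Rightarrow> complex)"
    using rapD[OF rap_gauss[of 1]] by (metis integrable_lborel_decay measurable_gauss zero_less_one)
  then have "c < \<infinity>"
    unfolding c_def h_def by (auto simp: integrable_iff_bounded gauss_def)
  moreover have "c \<noteq> 0"
    unfolding c_def by (subst nn_integral_0_iff_AE) (auto simp: h_def not_AE_lborel_False)
  ultimately have c: "c \<noteq> 0" "c \<noteq> \<infinity>" by auto
  have "c * emeasure (distr lborel borel g) A = (\<integral>\<^sup>+y. h y * (\<integral>\<^sup>+x. indicator A (g x) \<partial>lborel) \<partial>lborel)"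
  proof -
    have "emeasure (distr lborel borel g) A = (\<integral>\<^sup>+x. indicator A x \<partial>distr lborel borel g)" by simp
    also have "\<dots> = (\<integral>\<^sup>+x. indicator A (g x) \<partial>lborel)" by (rule nn_integral_distr) auto
    finally show ?thesis unfolding c_def by (simp add: nn_integral_multc)
  qed
  also have "\<dots> = (\<integral>\<^sup>+y. (\<integral>\<^sup>+x. h y * indicator A (g x + y) \<partial>lborel) \<partial>lborel)"
  proof (rule nn_integral_cong)
    fix y
    have "(\<integral>\<^sup>+x. indicator A (g x) \<partial>lborel) = (\<integral>\<^sup>+x. indicator A (g (g' y + x)) \<partial>lborel :: ennreal)"
      by (rule nn_integral_lborel_shift[symmetric]) measurable
    then show "h y * (\<integral>\<^sup>+x. indicator A (g x) \<partial>lborel) = (\<integral>\<^sup>+x. h y * indicator A (g x + y) \<partial>lborel)"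
      by (simp add: nn_integral_cmult linear_add[OF lin(1)] inv add.commute)
  qed
  also have "\<dots> = (\<integral>\<^sup>+x. (\<integral>\<^sup>+y. h y * indicator A (g x + y) \<partial>lborel) \<partial>lborel)"
    by (rule lborel_pair.Fubini') measurable
  also have "\<dots> = (\<integral>\<^sup>+x. (\<integral>\<^sup>+y. h (y - g x) * indicator A y \<partial>lborel) \<partial>lborel)"
  proof (rule nn_integral_cong)
    fix x
    show "(\<integral>\<^sup>+y. h y * indicator A (g x + y) \<partial>lborel) = (\<integral>\<^sup>+y. h (y - g x) * indicator A y \<partial>lborel)"
      using nn_integral_lborel_shift[of "\<lambda>y. h (y - g x) * indicator A y" "g x"] by simp
  qed
  also have "\<dots> = (\<integral>\<^sup>+y. (\<integral>\<^sup>+x. h (y - g x) * indicator A y \<partial>lborel) \<partial>lborel)"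
    by (rule lborel_pair.Fubini') measurable
  also have "\<dots> = (\<integral>\<^sup>+y. c * indicator A y \<partial>lborel)"
  proof (rule nn_integral_cong)
    fix y
    have "h (y - g x) = h (- g' y + x)" for x
      using iso[of "g' y - x"] by (simp add: h_def linear_diff[OF lin(1)] inv norm_minus_commute)
    then have "(\<integral>\<^sup>+x. h (y - g x) \<partial>lborel) = c"
      unfolding c_def using nn_integral_lborel_shift[of h "- g' y"] by simp
    then show "(\<integral>\<^sup>+x. h (y - g x) * indicator A y \<partial>lborel) = c * indicator A y"
      by (simp add: nn_integral_multc)
  qed
  also have "\<dots> = c * emeasure lborel A" by (simp add: nn_integral_cmult)
  finally show "emeasure (distr lborel borel g) A = emeasure lborel A"
    using c by (simp add: ennreal_mult_cancel_left)
qed simp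

section \<open>The weighted measure and its invariance\<close>

context dunkl
begin

abbreviation mu :: "(real ^ 'n) measure" where "mu \<equiv> dunkl_measure R k"
abbreviation wt :: "real ^ 'n \<Rightarrow> real" where "wt \<equiv> dunkl_weight R k"

lemma sets_mu [simp, measurable_cong]: "sets mu = sets borel" and space_mu [simp]: "space mu = UNIV"
  by (simp_all add: dunkl_measure_def)

lemma wt_measurable [measurable]: "wt \<in> borel_measurable borel"
  unfolding dunkl_weight_def by measurable

lemma wt_nonneg: "0 \<le> wt x"
  unfolding dunkl_weight_def by (intro prod_nonneg) auto

lemma AE_hyperplane: "\<alpha> \<in> R \<Longrightarrow> AE x in lborel. \<alpha> \<bullet> x \<noteq> 0"
proof -
  assume "\<alpha> \<in> R"
  then have "{x. \<alpha> \<bullet> x = 0} \<in> null_sets lebesgue"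
    using negligible_hyperplane[of \<alpha> 0] root_nz by (simp add: negligible_iff_null_sets)
  then have "{x. \<alpha> \<bullet> x = 0} \<in> null_sets lborel"
    by (subst (asm) null_sets_completion_iff) auto
  then show ?thesis by (auto dest: AE_not_in)
qed

lemma AE_hyperplanes: "AE x in lborel. \<forall>\<alpha>\<in>R. \<alpha> \<bullet> x \<noteq> 0"
  by (rule AE_finite_allI) (auto intro: AE_hyperplane)

lemma wt_pos: "(\<And>\<alpha>. \<alpha> \<in> R \<Longrightarrow> \<alpha> \<bullet> x \<noteq> 0) \<Longrightarrow> wt x > 0"
  unfolding dunkl_weight_def by (intro prod_pos) (auto simp: inner_commute)

text \<open>The weight can vanish only on the hyperplanes orthogonal to the roots, which form a
  Lebesgue null set; hence both measures have the same null sets.\<close>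

lemma AE_mu: "(AE x in mu. P x) \<longleftrightarrow> (AE x in lborel. P x)"
proof -
  have "(AE x in mu. P x) \<longleftrightarrow> (AE x in lborel. 0 < wt x \<longrightarrow> P x)"
    unfolding dunkl_measure_def by (subst AE_density) auto
  also have "\<dots> \<longleftrightarrow> (AE x in lborel. P x)"
  proof
    assume "AE x in lborel. 0 < wt x \<longrightarrow> P x"
    with AE_hyperplanes show "AE x in lborel. P x" by eventually_elim (use wt_pos in auto)
  qed auto
  finally show ?thesis .
qed

lemma wt_G: assumes "g \<in> G" shows "wt (g x) = wt x"
proof -
  have "wt (g x) = (\<Prod>\<alpha>\<in>R. if k (g \<alpha>) = 0 then 1 else \<bar>g x \<bullet> g \<alpha>\<bar> powr k (g \<alpha>))"
    unfolding dunkl_weight_def using prod_R_reindex[OF assms] by (rule sym)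
  also have "\<dots> = wt x"
    unfolding dunkl_weight_def by (intro prod.cong refl) (simp add: G_k G_inner assms)
  finally show ?thesis .
qed

lemma wt_uminus: "wt (- x) = wt x"
  by (simp add: dunkl_weight_def cong: if_cong)

lemma distr_mu:
  assumes [measurable]: "g \<in> borel_measurable borel" and g: "distr lborel borel g = lborel" and w: "\<And>x. wt (g x) = wt x"
  shows "distr mu borel g = mu"
proof -
  have "distr (density lborel (\<lambda>x. ennreal (wt (g x)))) borel g = density (distr lborel borel g) (\<lambda>x. ennreal (wt x))"
    by (subst density_distr) auto
  then show ?thesis by (simp add: dunkl_measure_def g w)
qed

lemma measurable_G: "g \<in> G \<Longrightarrow> g \<in> borel_measurable borel"
  by (intro borel_measurable_continuous_onI linear_continuous_on linear_conv_bounded_linear[THEN iffD1] G_linear)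

lemma distr_mu_G: assumes "g \<in> G" shows "distr mu borel g = mu"
proof (rule distr_mu[OF measurable_G[OF assms] _ wt_G[OF assms]])
  obtain h where h: "h \<in> G" "g \<circ> h = id" using G_inverse assms by blast
  then have "g (h x) = x" for x by (metis comp_apply id_apply)
  then show "distr lborel borel g = lborel"
    using lborel_isometry[OF G_linear[OF assms] G_linear[OF h(1)]] assms G_norm by blast
qed

lemma integral_mu_G:
  fixes f :: "real ^ 'n \<Rightarrow> 'b::{banach, second_countable_topology}"
  assumes "g \<in> G" "f \<in> borel_measurable borel"
  shows "(\<integral>x. f (g x) \<partial>mu) = (\<integral>x. f x \<partial>mu)"
proof -
  have "(\<integral>x. f x \<partial>mu) = (\<integral>x. f x \<partial>distr mu borel g)" using distr_mu_G[OF assms(1)] by simp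
  also have "\<dots> = (\<integral>x. f (g x) \<partial>mu)" using assms measurable_G[OF assms(1)]
    by (subst integral_distr) (auto simp: measurable_cong_sets[OF sets_mu refl])
  finally show ?thesis by simp
qed

lemma distr_mu_uminus: "distr mu borel uminus = mu"
  by (rule distr_mu) (auto simp: lborel_uminus wt_uminus)

lemma integral_mu_uminus:
  fixes f :: "real ^ 'n \<Rightarrow> 'b::{banach, second_countable_topology}"
  assumes "f \<in> borel_measurable borel"
  shows "(\<integral>x. f (- x) \<partial>mu) = (\<integral>x. f x \<partial>mu)"
proof -
  have "(\<integral>x. f x \<partial>mu) = (\<integral>x. f x \<partial>distr mu borel uminus)" using distr_mu_uminus by simp
  also have "\<dots> = (\<integral>x. f (- x) \<partial>mu)" using assms by (subst integral_distr) auto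
  finally show ?thesis by simp
qed

lemma integrable_mu_uminus:
  fixes f :: "real ^ 'n \<Rightarrow> 'b::{banach, second_countable_topology}"
  assumes "integrable mu f"
  shows "integrable mu (\<lambda>x. f (- x))"
proof -
  have "integrable (distr mu borel uminus) f" using assms distr_mu_uminus by simp
  then show ?thesis using assms by (subst (asm) integrable_distr_eq) (auto dest: borel_measurable_integrable)
qed

lemma AE_mu_uminus: assumes "AE x in mu. P x" and [measurable]: "Measurable.pred borel P" shows "AE x in mu. P (- x)"
proof -
  have "AE x in distr mu borel uminus. P x" unfolding distr_mu_uminus by (rule assms)
  then show ?thesis by (subst (asm) AE_distr_iff) auto
qed

text \<open>The homogeneity degree of the weight, rounded up to an integer so that growth can be
  measured in natural powers.\<close>

definition L0 :: nat where "L0 = nat \<lceil>\<Sum>\<alpha>\<in>R. k \<alpha>\<rceil>"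

text \<open>One bound for all \<epsilon> between 0 and 1: \<epsilon> = 0 yields the weight almost
  everywhere, \<epsilon> > 0 its regularization \<open>wteps\<close>, so the same majorant serves
  the limit \<epsilon> to 0.\<close>

lemma wt_eps_bound:
  assumes "0 \<le> \<epsilon>" "\<epsilon> \<le> 1"
  shows "(\<Prod>\<alpha>\<in>R. ((x \<bullet> \<alpha>)\<^sup>2 + \<epsilon>) powr (k \<alpha> / 2)) \<le> 2 ^ L0 * (1 + norm x) ^ L0"
proof -
  let ?b = "2 * (1 + norm x)"
  have b: "?b \<ge> 1" by simp
  have b0: "?b \<noteq> 0"
  proof
    assume "?b = 0"
    with b show False by linarith
  qed
  have "(\<Prod>\<alpha>\<in>R. ((x \<bullet> \<alpha>)\<^sup>2 + \<epsilon>) powr (k \<alpha> / 2)) \<le> (\<Prod>\<alpha>\<in>R. ?b powr k \<alpha>)"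
  proof (rule prod_mono, safe)
    fix \<alpha> assume \<alpha>: "\<alpha> \<in> R"
    have "(x \<bullet> \<alpha>)\<^sup>2 \<le> (norm x)\<^sup>2 * (norm \<alpha>)\<^sup>2"
      using Cauchy_Schwarz_ineq[of x \<alpha>] by (simp add: power2_norm_eq_inner)
    moreover have "?b\<^sup>2 = 4 + 8 * norm x + 4 * (norm x)\<^sup>2" by (simp add: power2_eq_square algebra_simps)
    ultimately have "(x \<bullet> \<alpha>)\<^sup>2 + \<epsilon> \<le> ?b\<^sup>2"
      using assms norm_ge_zero[of x] zero_le_power2[of "norm x"] unfolding root_norm[OF \<alpha>] by linarith
    then have "((x \<bullet> \<alpha>)\<^sup>2 + \<epsilon>) powr (k \<alpha> / 2) \<le> (?b\<^sup>2) powr (k \<alpha> / 2)"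
      using assms k_nonneg[OF \<alpha>] by (intro powr_mono2) auto
    also have "(?b\<^sup>2) powr (k \<alpha> / 2) = ?b powr k \<alpha>"
    proof -
      have "?b\<^sup>2 = ?b powr 2" using b by (subst powr_numeral) auto
      then show ?thesis by (simp only: powr_powr) simp
    qed
    finally show "((x \<bullet> \<alpha>)\<^sup>2 + \<epsilon>) powr (k \<alpha> / 2) \<le> ?b powr k \<alpha>" .
  qed simp
  also have "\<dots> = ?b powr (\<Sum>\<alpha>\<in>R. k \<alpha>)" using b0 by (rule powr_sum[symmetric])
  also have "\<dots> \<le> ?b powr real L0" using b by (intro powr_mono) (simp_all add: L0_def real_nat_ceiling_ge)
  also have "\<dots> = 2 ^ L0 * (1 + norm x) ^ L0" 
  proof -
    have "?b > 0" using b by linarith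
    then show ?thesis by (simp only: powr_realpow power_mult_distrib)
  qed
  finally show ?thesis .
qed

text \<open>Equality may fail on a hyperplane whose root has k \<alpha> = 0: there
  \<open>0 powr 0\<close> is 0, while \<open>dunkl_weight\<close> has the factor 1.\<close>

lemma wt_eq_eps: "AE x in lborel. wt x = (\<Prod>\<alpha>\<in>R. ((x \<bullet> \<alpha>)\<^sup>2 + 0) powr (k \<alpha> / 2))"
  using AE_hyperplanes
proof eventually_elim
  case (elim x)
  have "\<bar>x \<bullet> \<alpha>\<bar> powr k \<alpha> = (x \<bullet> \<alpha>)\<^sup>2 powr (k \<alpha> / 2)" if "\<alpha> \<in> R" for \<alpha>
  proof -
    have "(x \<bullet> \<alpha>)\<^sup>2 = \<bar>x \<bullet> \<alpha>\<bar> powr 2"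
      using elim that by (subst powr_numeral) (auto simp: inner_commute)
    then show ?thesis by (simp only: powr_powr) simp
  qed
  then show ?case unfolding dunkl_weight_def
    using elim by (intro prod.cong refl) (auto simp: inner_commute)
qed

lemma AE_wt_bound: "AE x in lborel. wt x \<le> 2 ^ L0 * (1 + norm x) ^ L0"
  using wt_eq_eps by eventually_elim (use wt_eps_bound[of 0] in simp)

lemma integral_mu:
  fixes f :: "real ^ 'n \<Rightarrow> 'b::{banach, second_countable_topology}"
  assumes "f \<in> borel_measurable borel"
  shows "(\<integral>x. f x \<partial>mu) = (\<integral>x. wt x *\<^sub>R f x \<partial>lborel)"
  unfolding dunkl_measure_def using assms by (subst integral_density) (auto simp: wt_nonneg)

lemma integrable_mu_iff:
  fixes f :: "real ^ 'n \<Rightarrow> 'b::{banach, second_countable_topology}"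
  assumes "f \<in> borel_measurable borel"
  shows "integrable mu f \<longleftrightarrow> integrable lborel (\<lambda>x. wt x *\<^sub>R f x)"
  unfolding dunkl_measure_def using assms by (subst integrable_density) (auto simp: wt_nonneg)

text \<open>The exponent CARD('n) + 2 ensures Lebesgue integrability, and L0 compensates the growth
  of the weight.\<close>

definition M0 :: nat where "M0 = CARD('n) + 2 + L0"

lemma integrable_mu_decay:
  fixes f :: "real ^ 'n \<Rightarrow> complex"
  assumes [measurable]: "f \<in> borel_measurable borel" and f: "\<And>x. norm (f x) \<le> C / (1 + norm x) ^ M0"
  shows "integrable mu f"
proof -
  have C: "0 \<le> C" using order_trans[OF norm_ge_zero f[of 0]] by simp
  define h where "h x = complex_of_real (2 ^ L0 * (1 + norm x) ^ L0 * (C / (1 + norm x) ^ M0))" for x :: "real ^ 'n"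
  have "integrable lborel h"
  proof (rule integrable_lborel_decay)
    show "h \<in> borel_measurable borel" unfolding h_def by measurable
    have "1 + norm x \<noteq> 0" for x :: "real ^ 'n" by (smt (verit) norm_ge_zero)
    then show "norm (h x) \<le> (2 ^ L0 * C) / (1 + norm x) ^ (DIM(real ^ 'n) + 2)" for x
      unfolding h_def norm_of_real M0_def power_add using C by (simp add: abs_mult)
  qed
  then show ?thesis
    unfolding integrable_mu_iff[OF assms(1)]
  proof (rule Bochner_Integration.integrable_bound)
    show "AE x in lborel. norm (wt x *\<^sub>R f x) \<le> norm (h x)"
      using AE_wt_bound
    proof eventually_elim
      case (elim x)
      have "norm (wt x *\<^sub>R f x) \<le> 2 ^ L0 * (1 + norm x) ^ L0 * (C / (1 + norm x) ^ M0)"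
        using elim f[of x] wt_nonneg[of x] C by (simp del: times_divide_eq_right add: mult_mono)
      also have "\<dots> = norm (h x)" unfolding h_def norm_of_real using C by (simp add: abs_of_nonneg)
      finally show ?case .
    qed
  qed measurable
qed

lemma integrable_rap: "rap f \<Longrightarrow> f \<in> borel_measurable borel \<Longrightarrow> integrable mu f"
  using rapD[of f M0] integrable_mu_decay by blast

lemma integrable_rap_poly: "rap f \<Longrightarrow> f \<in> borel_measurable borel \<Longrightarrow> integrable mu (\<lambda>x. (1 + norm x) ^ j * norm (f x))"
proof -
  assume f: "rap f" and [measurable]: "f \<in> borel_measurable borel"
  have "rap (\<lambda>x. complex_of_real ((1 + norm x) ^ j * norm (f x)))"
    by (rule rap_mult_poly[OF f, of _ 1 j]) (simp_all only: norm_of_real, simp_all add: abs_mult)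
  from integrable_norm[OF integrable_rap[OF this]] show ?thesis
    unfolding norm_of_real by (simp add: abs_mult)
qed

sublocale mu: sigma_finite_measure mu
proof -
  show "sigma_finite_measure mu"
    unfolding dunkl_measure_def by (subst sigma_finite_measure.sigma_finite_iff_density_finite[OF sigma_finite_lborel]) auto
qed

lemma wt_scale: assumes "c > 0" shows "wt (c *\<^sub>R x) = c powr (2 * gam) * wt x"
proof -
  have "wt (c *\<^sub>R x) = (\<Prod>\<alpha>\<in>R. c powr k \<alpha> * (if k \<alpha> = 0 then 1 else \<bar>x \<bullet> \<alpha>\<bar> powr k \<alpha>))"
    unfolding dunkl_weight_def using assms by (intro prod.cong refl) (simp add: abs_mult powr_mult)
  also have "\<dots> = c powr (2 * gam) * wt x"
    using assms by (simp add: prod.distrib dunkl_weight_def gam_def kp_def powr_sum[symmetric] sum_divide_distrib[symmetric])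
  finally show ?thesis .
qed

lemma integral_mu_scale:
  fixes f :: "real ^ 'n \<Rightarrow> complex"
  assumes [measurable]: "f \<in> borel_measurable borel" and c: "c > 0"
  shows "(\<integral>x. f x \<partial>mu) = (c ^ CARD('n) * c powr (2 * gam)) *\<^sub>R (\<integral>x. f (c *\<^sub>R x) \<partial>mu)"
proof -
  have "(\<integral>x. f x \<partial>mu) = (\<integral>x. wt x *\<^sub>R f x \<partial>lborel)" by (rule integral_mu) measurable
  also have "\<dots> = (\<integral>x. wt x *\<^sub>R f x \<partial>density (distr lborel borel (\<lambda>x. 0 + c *\<^sub>R x)) (\<lambda>_. ennreal (\<bar>c\<bar> ^ DIM(real ^ 'n))))"
    using lborel_affine[of c "0 :: real ^ 'n"] c by simp
  also have "\<dots> = (\<integral>x. \<bar>c\<bar> ^ DIM(real ^ 'n) *\<^sub>R (wt x *\<^sub>R f x) \<partial>distr lborel borel (\<lambda>x. 0 + c *\<^sub>R x))"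
    by (subst integral_density) auto
  also have "\<dots> = (\<integral>x. \<bar>c\<bar> ^ DIM(real ^ 'n) *\<^sub>R (wt (c *\<^sub>R x) *\<^sub>R f (c *\<^sub>R x)) \<partial>lborel)"
    by (subst integral_distr) auto
  also have "\<dots> = (\<integral>x. (c ^ CARD('n) * c powr (2 * gam)) *\<^sub>R (wt x *\<^sub>R f (c *\<^sub>R x)) \<partial>lborel)"
    using c by (simp add: wt_scale mult_ac)
  also have "\<dots> = (c ^ CARD('n) * c powr (2 * gam)) *\<^sub>R (\<integral>x. wt x *\<^sub>R f (c *\<^sub>R x) \<partial>lborel)"
    by (simp del: scaleR_scaleR)
  also have "(\<integral>x. wt x *\<^sub>R f (c *\<^sub>R x) \<partial>lborel) = (\<integral>x. f (c *\<^sub>R x) \<partial>mu)"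
    by (rule integral_mu[symmetric]) measurable
  finally show ?thesis .
qed

abbreviation ck :: real where "ck \<equiv> dunkl_const R k"

lemma ck_eq: "of_real ck = (\<integral>x. gauss (1/2) x \<partial>mu)"
  unfolding dunkl_const_def gauss_def by (subst integral_complex_of_real[symmetric]) simp

lemma ck_pos: "ck > 0"
proof -
  have i: "integrable mu (\<lambda>x. exp (- (norm x)\<^sup>2 / 2))"
    using integrable_norm[OF integrable_rap[OF rap_gauss[of "1/2"] measurable_gauss]] by (simp add: gauss_def)
  have "ck \<noteq> 0"
  proof
    assume "ck = 0"
    then have "AE x in mu. exp (- (norm x)\<^sup>2 / 2) = (0::real)"
      unfolding dunkl_const_def by (subst (asm) integral_nonneg_eq_0_iff_AE[OF i]) auto
    then have "AE x in (lborel :: (real ^ 'n) measure). False" unfolding AE_mu by simp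
    then show False by (simp add: not_AE_lborel_False)
  qed
  moreover have "ck \<ge> 0" unfolding dunkl_const_def by simp
  ultimately show ?thesis by simp
qed

lemma integral_gauss: assumes "a > 0"
  shows "(\<integral>x. gauss a x \<partial>mu) = of_real ((1 / sqrt (2 * a)) ^ CARD('n) * (1 / sqrt (2 * a)) powr (2 * gam)) * of_real ck"
proof -
  define c where "c = 1 / sqrt (2 * a)"
  have c: "c > 0" using assms by (simp add: c_def)
  have "a * (norm (c *\<^sub>R x))\<^sup>2 = (norm x)\<^sup>2 / 2" for x :: "real ^ 'n"
    using assms by (simp add: c_def power_mult_distrib power_divide)
  then have "gauss a (c *\<^sub>R x) = gauss (1/2) x" for x :: "real ^ 'n" by (simp add: gauss_def)
  then show ?thesis
    unfolding c_def[symmetric] by (subst integral_mu_scale[OF _ c]) (auto simp: ck_eq scaleR_complex)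
qed

end

section \<open>Integrals of derivatives; classes of decaying and slowly growing functions\<close>

lemma fder_LIMSEQ:
  fixes f :: "real ^ 'n \<Rightarrow> complex"
  assumes "f differentiable at x"
  shows "(\<lambda>n. of_nat (Suc n) * (f (x + (1 / real (Suc n)) *\<^sub>R h) - f x)) \<longlonglongrightarrow> fder f x h"
proof -
  have "((\<lambda>t. x + t *\<^sub>R h) has_derivative (\<lambda>t. t *\<^sub>R h)) (at 0)"
    by (auto intro!: derivative_eq_intros)
  from has_derivative_compose[OF this, of f "fder f x"] fder_works[OF assms]
  have "((\<lambda>t. f (x + t *\<^sub>R h)) has_vector_derivative fder f x h) (at 0)"
    by (simp add: has_vector_derivative_def linear_scale[OF fder_linear[OF assms]])
  then have "((\<lambda>t. norm (f (x + (0 + t) *\<^sub>R h) - f (x + 0 *\<^sub>R h) - t *\<^sub>R fder f x h) / norm t) \<longlongrightarrow> 0) (at 0)"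
    unfolding has_vector_derivative_def has_derivative_at by blast
  then have "((\<lambda>t. norm ((f (x + t *\<^sub>R h) - f x) /\<^sub>R t - fder f x h)) \<longlongrightarrow> 0) (at 0)"
  proof (rule Lim_transform_eventually)
    show "\<forall>\<^sub>F t in at 0. norm (f (x + (0 + t) *\<^sub>R h) - f (x + 0 *\<^sub>R h) - t *\<^sub>R fder f x h) / norm t =
        norm ((f (x + t *\<^sub>R h) - f x) /\<^sub>R t - fder f x h)"
    proof (rule eventually_at_filter[THEN iffD2], intro always_eventually allI impI)
      fix t :: real assume t: "t \<noteq> 0"
      have "(f (x + t *\<^sub>R h) - f x) /\<^sub>R t - fder f x h = (f (x + t *\<^sub>R h) - f x - t *\<^sub>R fder f x h) /\<^sub>R t"
        using t by (simp add: scaleR_diff_right)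
      then show "norm (f (x + (0 + t) *\<^sub>R h) - f (x + 0 *\<^sub>R h) - t *\<^sub>R fder f x h) / norm t =
        norm ((f (x + t *\<^sub>R h) - f x) /\<^sub>R t - fder f x h)"
        by (simp add: divide_inverse mult.commute)
    qed
  qed
  then have "((\<lambda>t. (f (x + t *\<^sub>R h) - f x) /\<^sub>R t) \<longlongrightarrow> fder f x h) (at 0)"
    by (simp only: tendsto_norm_zero_iff LIM_zero_iff)
  moreover have "filterlim (\<lambda>n. 1 / real (Suc n)) (at 0) sequentially"
    unfolding filterlim_at using LIMSEQ_Suc[OF lim_1_over_n[where 'a = real]] by simp
  ultimately have "(\<lambda>n. (f (x + (1 / real (Suc n)) *\<^sub>R h) - f x) /\<^sub>R (1 / real (Suc n))) \<longlonglongrightarrow> fder f x h"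
    by (rule filterlim_compose)
  then show ?thesis by (simp add: scaleR_complex)
qed

text \<open>\<open>fder_LIMSEQ\<close> exhibits the derivative as the limit of a sequence of
  measurable difference quotients.\<close>

lemma measurable_fder:
  fixes f :: "real ^ 'n \<Rightarrow> complex"
  assumes "\<And>x. f differentiable at x"
  shows "(\<lambda>x. fder f x h) \<in> borel_measurable borel"
proof (rule borel_measurable_LIMSEQ_metric)
  have [measurable]: "f \<in> borel_measurable borel"
    using assms by (intro borel_measurable_continuous_onI continuous_at_imp_continuous_on)
      (auto intro: differentiable_imp_continuous_within)
  show "(\<lambda>x. of_nat (Suc i) * (f (x + (1 / real (Suc i)) *\<^sub>R h) - f x)) \<in> borel_measurable borel" for i
    by measurable
  show "(\<lambda>i. of_nat (Suc i) * (f (x + (1 / real (Suc i)) *\<^sub>R h) - f x)) \<longlonglongrightarrow> fder f x h" for x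
    by (rule fder_LIMSEQ[OF assms])
qed

lemma differentiable_measurable:
  fixes f :: "real ^ 'n \<Rightarrow> complex"
  assumes "\<And>x. f differentiable at x"
  shows "f \<in> borel_measurable borel"
  using assms by (intro borel_measurable_continuous_onI continuous_at_imp_continuous_on)
    (auto intro: differentiable_imp_continuous_within)

lemma segment_diff_bound:
  fixes f :: "real ^ 'n \<Rightarrow> complex"
  assumes d: "\<And>x. f differentiable at x"
    and b: "\<And>z h. z \<in> closed_segment x y \<Longrightarrow> norm (fder f z h) \<le> B * norm h"
  shows "norm (f y - f x) \<le> B * norm (y - x)"
proof (rule differentiable_bound[of "closed_segment x y" f "fder f"])
  fix z assume z: "z \<in> closed_segment x y"
  show "(f has_derivative fder f z) (at z within closed_segment x y)"
    by (rule has_derivative_at_withinI[OF fder_works[OF d]])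
  have "0 \<le> B"
  proof -
    have "0 \<le> B * norm (axis undefined 1 :: real ^ 'n)" by (rule order_trans[OF norm_ge_zero b[OF z]])
    then show ?thesis by simp
  qed
  then show "onorm (fder f z) \<le> B" by (rule onorm_bound) (rule b[OF z])
qed auto

lemma one_plus_norm_shift: "1 + norm x \<le> (1 + norm (x + v)) * (1 + norm v)" for x v :: "'a::real_normed_vector"
proof -
  have "norm x \<le> norm (x + v) + norm v" using norm_triangle_ineq4[of "x + v" v] by simp
  then show ?thesis by (simp add: algebra_simps) (smt (verit) mult_nonneg_nonneg norm_ge_zero)
qed

lemma decay_shift:
  fixes x v :: "'a::real_normed_vector"
  assumes "C \<ge> 0" "norm v \<le> c"
  shows "C / (1 + norm (x + v)) ^ m \<le> (C * (1 + c) ^ m) / (1 + norm x) ^ m"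
proof -
  have p: "0 < 1 + norm x" "0 < 1 + norm (x + v)" by (simp_all add: add_pos_nonneg)
  have "(1 + norm x) ^ m \<le> ((1 + norm (x + v)) * (1 + norm v)) ^ m"
    by (intro power_mono one_plus_norm_shift) auto
  also have "\<dots> \<le> (1 + norm (x + v)) ^ m * (1 + c) ^ m"
    unfolding power_mult_distrib using assms by (intro mult_left_mono power_mono) auto
  finally have "C * (1 + norm x) ^ m \<le> C * ((1 + norm (x + v)) ^ m * (1 + c) ^ m)"
    using assms by (intro mult_left_mono) auto
  then show ?thesis using p by (simp add: divide_simps mult_ac)
qed

lemma integrable_lborel_decay_real:
  fixes f :: "'a::euclidean_space \<Rightarrow> real"
  assumes [measurable]: "f \<in> borel_measurable borel" and f: "\<And>x. \<bar>f x\<bar> \<le> C / (1 + norm x) ^ (DIM('a) + 2)"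
  shows "integrable lborel f"
proof -
  have "integrable lborel (\<lambda>x. complex_of_real (f x))"
    by (rule integrable_lborel_decay[of _ C]) (use f in \<open>simp_all only: norm_of_real, measurable\<close>)
  from integrable_Re[OF this] show ?thesis by simp
qed

text \<open>By translation invariance every difference quotient has integral 0. Dominated
  convergence passes this on to the derivative, so neither boundary terms nor iterated integrals
  occur.\<close>

lemma integral_lborel_fder_0:
  fixes f :: "real ^ 'n \<Rightarrow> complex"
  assumes d: "\<And>x. f differentiable at x"
    and f: "\<And>x. norm (f x) \<le> C / (1 + norm x) ^ (CARD('n) + 2)"
    and f': "\<And>x h. norm (fder f x h) \<le> C / (1 + norm x) ^ (CARD('n) + 2) * norm h"
  shows "(\<integral>x. fder f x \<eta> \<partial>lborel) = 0"
proof -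
  let ?M = "CARD('n) + 2"
  have C: "C \<ge> 0" using order_trans[OF norm_ge_zero f[of 0]] by simp
  have [measurable]: "f \<in> borel_measurable borel" by (rule differentiable_measurable[OF d])
  define S where "S n x = of_nat (Suc n) * (f (x + (1 / real (Suc n)) *\<^sub>R \<eta>) - f x)" for n x
  define K where "K = C * (1 + norm \<eta>) ^ ?M * norm \<eta>"
  define w where "w x = K / (1 + norm x) ^ ?M" for x :: "real ^ 'n"
  have [measurable]: "w \<in> borel_measurable borel" unfolding w_def by measurable
  have iw: "integrable lborel w"
    by (rule integrable_lborel_decay_real[of _ K]) (use C in \<open>simp_all add: w_def K_def\<close>)
  have intf: "integrable lborel f"
    by (rule integrable_lborel_decay[of f C]) (use f in auto)
  have S: "norm (S n x) \<le> w x" for n x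
  proof -
    let ?t = "1 / real (Suc n)"
    have "norm (f (x + ?t *\<^sub>R \<eta>) - f x) \<le> C * (1 + norm \<eta>) ^ ?M / (1 + norm x) ^ ?M * norm ((x + ?t *\<^sub>R \<eta>) - x)"
    proof (rule segment_diff_bound[OF d])
      fix z h assume "z \<in> closed_segment x (x + ?t *\<^sub>R \<eta>)"
      then have z: "norm (z - x) \<le> norm \<eta>"
        using segment_bound(1)[of z x "x + ?t *\<^sub>R \<eta>"] mult_right_mono[of "?t" 1 "norm \<eta>"] by (simp add: norm_minus_commute)
      have "norm (fder f z h) \<le> C / (1 + norm (x + (z - x))) ^ ?M * norm h" using f'[of z h] by simp
      also have "\<dots> \<le> C * (1 + norm \<eta>) ^ ?M / (1 + norm x) ^ ?M * norm h"
        by (intro mult_right_mono decay_shift C z) auto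
      finally show "norm (fder f z h) \<le> C * (1 + norm \<eta>) ^ ?M / (1 + norm x) ^ ?M * norm h" .
    qed
    then have "real (Suc n) * norm (f (x + ?t *\<^sub>R \<eta>) - f x) \<le> real (Suc n) * (C * (1 + norm \<eta>) ^ ?M / (1 + norm x) ^ ?M * (?t * norm \<eta>))"
      by (intro mult_left_mono) auto
    also have "\<dots> = w x" unfolding w_def K_def by (simp add: divide_simps del: of_nat_Suc)
    finally show ?thesis unfolding S_def norm_mult by (simp del: of_nat_Suc)
  qed
  have "(\<lambda>n. \<integral>x. S n x \<partial>lborel) \<longlonglongrightarrow> (\<integral>x. fder f x \<eta> \<partial>lborel)"
  proof (rule integral_dominated_convergence[where w = w])
    show "(\<lambda>x. fder f x \<eta>) \<in> borel_measurable lborel" using measurable_fder[OF d] by simp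
    show "S n \<in> borel_measurable lborel" for n unfolding S_def by measurable
    show "AE x in lborel. (\<lambda>n. S n x) \<longlonglongrightarrow> fder f x \<eta>" unfolding S_def by (intro AE_I2 fder_LIMSEQ d)
  qed (use iw S in auto)
  moreover have "(\<integral>x. S n x \<partial>lborel) = 0" for n
  proof -
    let ?c = "(1 / real (Suc n)) *\<^sub>R \<eta>"
    have 1: "(\<integral>x. f (?c + x) \<partial>lborel) = (\<integral>x. f x \<partial>lborel)" "integrable lborel (\<lambda>x. f (?c + x))"
    proof -
      have "(\<integral>x. f x \<partial>lborel) = (\<integral>x. f x \<partial>distr lborel borel ((+) ?c))" by (simp only: lborel_distr_plus)
      then show "(\<integral>x. f (?c + x) \<partial>lborel) = (\<integral>x. f x \<partial>lborel)" by (simp add: integral_distr)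
      have "integrable (distr lborel borel ((+) ?c)) f" by (simp only: lborel_distr_plus intf)
      then show "integrable lborel (\<lambda>x. f (?c + x))" by (subst (asm) integrable_distr_eq) auto
    qed
    show ?thesis unfolding S_def
      using 1 intf by (simp add: add.commute[of _ ?c] del: of_nat_Suc)
  qed
  ultimately have "(\<lambda>n. 0 :: complex) \<longlonglongrightarrow> (\<integral>x. fder f x \<eta> \<partial>lborel)" by simp
  then show ?thesis using LIMSEQ_unique[OF tendsto_const] by metis
qed

text \<open>The bound on the derivative is linear in h and thus uniform in the direction, as mean
  value estimates along segments to reflected points require. Products of a function of polynomial
  growth, \<open>polyg\<close>, with one in \<open>rapd\<close> stay in \<open>rapd\<close>.\<close>

definition rapd :: "(real ^ 'n \<Rightarrow> complex) \<Rightarrow> bool" where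
  "rapd f \<longleftrightarrow> (\<forall>x. f differentiable at x) \<and> rap f \<and>
     (\<forall>m. \<exists>C. \<forall>x h. (1 + norm x) ^ m * norm (fder f x h) \<le> C * norm h)"

definition polyg :: "(real ^ 'n \<Rightarrow> complex) \<Rightarrow> bool" where
  "polyg f \<longleftrightarrow> (\<forall>x. f differentiable at x) \<and>
     (\<exists>C j. \<forall>x. norm (f x) \<le> C * (1 + norm x) ^ j \<and> (\<forall>h. norm (fder f x h) \<le> C * (1 + norm x) ^ j * norm h))"

lemma rapd_diff: "rapd f \<Longrightarrow> f differentiable at x" and rapd_rap: "rapd f \<Longrightarrow> rap f"
  by (simp_all add: rapd_def)

lemma polyg_diff: "polyg f \<Longrightarrow> f differentiable at x"
  by (simp add: polyg_def)

lemma rapd_measurable: "rapd f \<Longrightarrow> f \<in> borel_measurable borel"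
  by (rule differentiable_measurable) (rule rapd_diff)

lemma polyg_measurable: "polyg f \<Longrightarrow> f \<in> borel_measurable borel"
  by (rule differentiable_measurable) (rule polyg_diff)

lemma rapd_fder: assumes "rapd f" shows "\<exists>C\<ge>0. \<forall>x h. norm (fder f x h) \<le> C / (1 + norm x) ^ m * norm h"
proof -
  obtain C where C: "\<And>x h. (1 + norm x) ^ m * norm (fder f x h) \<le> C * norm h" using assms unfolding rapd_def by metis
  have "norm (fder f x h) \<le> \<bar>C\<bar> / (1 + norm x) ^ m * norm h" for x h
  proof -
    have p: "0 < (1 + norm x) ^ m" by (intro zero_less_power add_pos_nonneg) auto
    have "(1 + norm x) ^ m * norm (fder f x h) \<le> \<bar>C\<bar> * norm h"
      by (rule order_trans[OF C]) (intro mult_right_mono, auto)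
    then show ?thesis using p by (simp add: pos_le_divide_eq mult.commute)
  qed
  then show ?thesis by (intro exI[of _ "\<bar>C\<bar>"]) auto
qed

lemma rapd_fder_rap: "rapd f \<Longrightarrow> rap (\<lambda>x. fder f x h)"
  unfolding rapd_def rap_def by meson

lemma rapd_zero: "rapd (\<lambda>x. 0)"
  by (auto simp: rapd_def intro!: exI[of _ 0])

lemma rapd_add: assumes "rapd f" "rapd g" shows "rapd (\<lambda>x. f x + g x)"
  unfolding rapd_def
proof (intro conjI allI)
  show "(\<lambda>x. f x + g x) differentiable at x" for x by (intro differentiable_add rapd_diff assms)
  show "rap (\<lambda>x. f x + g x)" by (intro rap_add rapd_rap assms)
  fix m
  obtain C D where C: "\<And>x h. (1 + norm x) ^ m * norm (fder f x h) \<le> C * norm h"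
    and D: "\<And>x h. (1 + norm x) ^ m * norm (fder g x h) \<le> D * norm h"
    using assms unfolding rapd_def by metis
  have "(1 + norm x) ^ m * norm (fder (\<lambda>x. f x + g x) x h) \<le> (C + D) * norm h" for x h
  proof -
    have "(1 + norm x) ^ m * norm (fder f x h + fder g x h) \<le> (1 + norm x) ^ m * (norm (fder f x h) + norm (fder g x h))"
      by (intro mult_left_mono norm_triangle_ineq) auto
    then show ?thesis using C[of x h] D[of x h] by (simp add: fder_add rapd_diff assms algebra_simps)
  qed
  then show "\<exists>C. \<forall>x h. (1 + norm x) ^ m * norm (fder (\<lambda>x. f x + g x) x h) \<le> C * norm h" by blast
qed

lemma rapd_mult: assumes f: "polyg f" and g: "rapd g" shows "rapd (\<lambda>x. f x * g x)"
  unfolding rapd_def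
proof (intro conjI allI)
  obtain C j where C: "\<And>x. norm (f x) \<le> C * (1 + norm x) ^ j" "\<And>x h. norm (fder f x h) \<le> C * (1 + norm x) ^ j * norm h"
    using f unfolding polyg_def by metis
  have C0: "0 \<le> C" using order_trans[OF norm_ge_zero C(1)[of 0]] by simp
  show "(\<lambda>x. f x * g x) differentiable at x" for x 
    by (rule differentiable_mult[OF polyg_diff[OF f] rapd_diff[OF g]])
  show "rap (\<lambda>x. f x * g x)"
    by (rule rap_mult_poly[OF rapd_rap[OF g] _ C0, of _ j]) (simp add: norm_mult mult_right_mono C)
  fix m
  obtain D where D: "\<And>x. (1 + norm x) ^ (m + j) * norm (g x) \<le> D" using rapd_rap[OF g] unfolding rap_def by metis
  obtain D' where D': "\<And>x h. (1 + norm x) ^ (m + j) * norm (fder g x h) \<le> D' * norm h" using g unfolding rapd_def by metis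
  have "(1 + norm x) ^ m * norm (fder (\<lambda>x. f x * g x) x h) \<le> (C * D' + C * D) * norm h" for x h
  proof -
    have "norm (fder (\<lambda>x. f x * g x) x h) \<le> norm (f x) * norm (fder g x h) + norm (fder f x h) * norm (g x)"
      unfolding fder_mult[OF polyg_diff[OF f] rapd_diff[OF g]] by (rule order_trans[OF norm_triangle_ineq]) (simp add: norm_mult)
    also have "\<dots> \<le> C * (1 + norm x) ^ j * norm (fder g x h) + C * (1 + norm x) ^ j * norm h * norm (g x)"
      by (intro add_mono mult_right_mono C) auto
    finally have "(1 + norm x) ^ m * norm (fder (\<lambda>x. f x * g x) x h) \<le>
      (1 + norm x) ^ m * (C * (1 + norm x) ^ j * norm (fder g x h) + C * (1 + norm x) ^ j * norm h * norm (g x))"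
      by (intro mult_left_mono) auto
    also have "\<dots> = C * ((1 + norm x) ^ (m + j) * norm (fder g x h)) + C * norm h * ((1 + norm x) ^ (m + j) * norm (g x))"
      by (simp add: power_add algebra_simps)
    also have "\<dots> \<le> C * (D' * norm h) + C * norm h * D"
      by (intro add_mono mult_left_mono D D' mult_nonneg_nonneg C0) auto
    finally show ?thesis by (simp add: algebra_simps)
  qed
  then show "\<exists>C. \<forall>x h. (1 + norm x) ^ m * norm (fder (\<lambda>x. f x * g x) x h) \<le> C * norm h" by blast
qed

lemma polyg_const: "polyg (\<lambda>x. c)"
  unfolding polyg_def by (intro conjI allI exI[of _ "norm c"] exI[of _ 0]) auto

lemma polyg_coord: "polyg (\<lambda>x. of_real (x \<bullet> \<zeta>))"
  unfolding polyg_def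
proof (intro conjI allI diff_coord exI[of _ "norm \<zeta>"] exI[of _ "1::nat"])
  fix x h :: "real ^ 'a"
  have "norm \<zeta> * norm x \<le> norm \<zeta> * (1 + norm x) ^ 1" by (intro mult_left_mono) auto
  then show "norm (complex_of_real (x \<bullet> \<zeta>)) \<le> norm \<zeta> * (1 + norm x) ^ 1"
    using Cauchy_Schwarz_ineq2[of x \<zeta>] by (simp add: mult.commute)
  have "norm \<zeta> * norm h * 1 \<le> norm \<zeta> * norm h * (1 + norm x)" by (intro mult_left_mono) auto
  then show "norm (fder (\<lambda>x. complex_of_real (x \<bullet> \<zeta>)) x h) \<le> norm \<zeta> * (1 + norm x) ^ 1 * norm h"
    using Cauchy_Schwarz_ineq2[of h \<zeta>] by (simp add: fder_coord mult_ac)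
qed

lemma rapd_cmult: "rapd f \<Longrightarrow> rapd (\<lambda>x. c * f x)"
  by (rule rapd_mult[OF polyg_const])

lemma has_derivative_gauss:
  "(gauss a has_derivative (\<lambda>h. of_real (- 2 * a * (x \<bullet> h)) * gauss a x)) (at x)" for x :: "real ^ 'n"
proof -
  have "((\<lambda>x. x \<bullet> x) has_derivative (\<lambda>h. x \<bullet> h + h \<bullet> x)) (at x)"
    by (rule has_derivative_inner[OF has_derivative_ident has_derivative_ident])
  from has_derivative_of_real[OF has_derivative_exp[OF has_derivative_mult_right[OF this, of "- a"]], where 'a = complex]
  show ?thesis
    unfolding gauss_def power2_norm_eq_inner
  proof (rule has_derivative_eq_rhs, intro ext)
    fix h
    show "complex_of_real (- a * (x \<bullet> h + h \<bullet> x) * exp (- a * (x \<bullet> x))) = of_real (- 2 * a * (x \<bullet> h)) * of_real (exp (- a * (x \<bullet> x)))"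
      by (simp add: inner_commute[of h x])
  qed
qed

lemma fder_gauss: "fder (gauss a) x h = of_real (- 2 * a * (x \<bullet> h)) * gauss a x"
  and diff_gauss: "gauss a differentiable at (x :: real ^ 'n)"
  using has_derivative_gauss[of a x] by (auto simp: fder_eq differentiable_def)

lemma rapd_gauss: assumes "a > 0" shows "rapd (gauss a :: real ^ 'n \<Rightarrow> complex)"
  unfolding rapd_def
proof (intro conjI allI diff_gauss rap_gauss assms)
  fix m
  obtain C where C: "\<And>x :: real ^ 'n. (1 + norm x) ^ (m + 1) * norm (gauss a x) \<le> C"
    using rap_gauss[OF assms] unfolding rap_def by metis
  have "(1 + norm x) ^ m * norm (fder (gauss a) x h) \<le> (2 * a * C) * norm h" for x h :: "real ^ 'n"
  proof -
    have xh: "\<bar>x \<bullet> h\<bar> \<le> (1 + norm x) * norm h"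
      by (rule order_trans[OF Cauchy_Schwarz_ineq2]) (intro mult_right_mono, auto)
    have "(1 + norm x) ^ m * norm (fder (gauss a) x h) \<le> (1 + norm x) ^ m * (2 * a * ((1 + norm x) * norm h) * norm (gauss a x))"
    proof -
      have "norm (fder (gauss a) x h) = 2 * a * \<bar>x \<bullet> h\<bar> * norm (gauss a x)"
        unfolding fder_gauss norm_mult norm_of_real using assms by (simp add: abs_mult)
      also have "\<dots> \<le> 2 * a * ((1 + norm x) * norm h) * norm (gauss a x)"
        using assms xh by (intro mult_right_mono mult_left_mono) auto
      finally show ?thesis by (rule mult_left_mono) simp
    qed
    also have "\<dots> = 2 * a * norm h * ((1 + norm x) ^ (m + 1) * norm (gauss a x))"
      by (simp add: algebra_simps)
    also have "\<dots> \<le> 2 * a * norm h * C" using assms by (intro mult_left_mono C) auto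
    finally show ?thesis by (simp add: mult_ac)
  qed
  then show "\<exists>C. \<forall>x h :: real ^ 'n. (1 + norm x) ^ m * norm (fder (gauss a) x h) \<le> C * norm h" by blast
qed

section \<open>Growth and decay of reflection quotients\<close>

context dunkl
begin

lemma norm_root_le: "\<alpha> \<in> R \<Longrightarrow> norm \<alpha> \<le> 2"
  by (rule power2_le_imp_le) (simp_all add: root_norm)

lemma s_diff: "\<alpha> \<in> R \<Longrightarrow> norm (x - \<sigma> \<alpha> x) \<le> 2 * \<bar>\<alpha> \<bullet> x\<bar>"
  using mult_left_mono[OF norm_root_le[of \<alpha>], of "\<bar>\<alpha> \<bullet> x\<bar>"] by (simp add: s_eq inner_commute mult.commute)

lemma norm_s [simp]: "\<alpha> \<in> R \<Longrightarrow> norm (\<sigma> \<alpha> x) = norm x"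
  by (rule G_norm[OF s_in_G])

text \<open>Where \<bar>\<alpha> \<bullet> x\<bar> \<ge> 1 the decay of f itself suffices. Near the
  hyperplane the mean value theorem is used on the segment from \<sigma> \<alpha> x to x, whose
  length is at most 2, so that decay at its points is comparable to decay at x.\<close>

lemma rapd_reflection_diff:
  assumes f: "rapd f" and \<alpha>: "\<alpha> \<in> R"
  shows "\<exists>C\<ge>0. \<forall>x. norm (f x - f (\<sigma> \<alpha> x)) \<le> C / (1 + norm x) ^ m * \<bar>\<alpha> \<bullet> x\<bar>"
proof -
  obtain C where C: "C \<ge> 0" "\<And>x. norm (f x) \<le> C / (1 + norm x) ^ m" using rapD[OF rapd_rap[OF f]] by blast
  obtain D where D: "D \<ge> 0" "\<And>x h. norm (fder f x h) \<le> D / (1 + norm x) ^ m * norm h" using rapd_fder[OF f] by blast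
  define K where "K = 2 * C + (D * (1 + 2) ^ m) * 2"
  have "norm (f x - f (\<sigma> \<alpha> x)) \<le> K / (1 + norm x) ^ m * \<bar>\<alpha> \<bullet> x\<bar>" for x
  proof -
    have p: "0 < (1 + norm x) ^ m" by (intro zero_less_power add_pos_nonneg) auto
    show ?thesis
    proof (cases "\<bar>\<alpha> \<bullet> x\<bar> \<ge> 1")
      case True
      have "norm (f x - f (\<sigma> \<alpha> x)) \<le> 2 * C / (1 + norm x) ^ m * 1"
        using norm_triangle_ineq4[of "f x" "f (\<sigma> \<alpha> x)"] C(2)[of x] C(2)[of "\<sigma> \<alpha> x"] \<alpha> by simp
      also have "\<dots> \<le> K / (1 + norm x) ^ m * \<bar>\<alpha> \<bullet> x\<bar>"
        using True p C D unfolding K_def by (intro mult_mono divide_right_mono) auto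
      finally show ?thesis .
    next
      case False
      have "norm (f x - f (\<sigma> \<alpha> x)) \<le> (D * (1 + 2) ^ m) / (1 + norm x) ^ m * norm (x - \<sigma> \<alpha> x)"
      proof (rule segment_diff_bound[OF rapd_diff[OF f]])
        fix z h assume "z \<in> closed_segment (\<sigma> \<alpha> x) x"
        then have "norm (z - x) \<le> norm (x - \<sigma> \<alpha> x)"
          using segment_bound(2)[of z "\<sigma> \<alpha> x" x] by (simp add: norm_minus_commute)
        then have z: "norm (z - x) \<le> 2" using s_diff[OF \<alpha>, of x] False by linarith
        have "norm (fder f z h) \<le> D / (1 + norm (x + (z - x))) ^ m * norm h" using D(2)[of z h] by simp
        also have "\<dots> \<le> (D * (1 + 2) ^ m) / (1 + norm x) ^ m * norm h"
          by (intro mult_right_mono decay_shift D z) auto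
        finally show "norm (fder f z h) \<le> (D * (1 + 2) ^ m) / (1 + norm x) ^ m * norm h" .
      qed
      also have "\<dots> \<le> (D * (1 + 2) ^ m) / (1 + norm x) ^ m * (2 * \<bar>\<alpha> \<bullet> x\<bar>)"
        using D p by (intro mult_left_mono s_diff \<alpha>) auto
      also have "\<dots> \<le> K / (1 + norm x) ^ m * \<bar>\<alpha> \<bullet> x\<bar>"
      proof -
        have "(D * (1 + 2) ^ m) * 2 / (1 + norm x) ^ m * \<bar>\<alpha> \<bullet> x\<bar> \<le> K / (1 + norm x) ^ m * \<bar>\<alpha> \<bullet> x\<bar>"
          unfolding K_def using C p by (intro mult_right_mono divide_right_mono) auto
        then show ?thesis by simp
      qed
      finally show ?thesis .
    qed
  qed
  moreover have "K \<ge> 0" unfolding K_def using C D by simp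
  ultimately show ?thesis by blast
qed

lemma rap_rq: assumes f: "rapd f" and \<alpha>: "\<alpha> \<in> R" shows "rap (reflection_quotient f \<alpha>)"
proof (rule rapI)
  fix m
  obtain C where C: "C \<ge> 0" "\<And>x. norm (f x - f (\<sigma> \<alpha> x)) \<le> C / (1 + norm x) ^ m * \<bar>\<alpha> \<bullet> x\<bar>"
    using rapd_reflection_diff[OF assms] by blast
  obtain D where D: "D \<ge> 0" "\<And>x h. norm (fder f x h) \<le> D / (1 + norm x) ^ m * norm h" using rapd_fder[OF f] by blast
  have "(1 + norm x) ^ m * norm (reflection_quotient f \<alpha> x) \<le> C + D * norm \<alpha>" for x
  proof -
    have p: "0 < (1 + norm x) ^ m" by (intro zero_less_power add_pos_nonneg) auto
    show ?thesis
    proof (cases "\<alpha> \<bullet> x = 0")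
      case True
      then have "(1 + norm x) ^ m * norm (reflection_quotient f \<alpha> x) \<le> D * norm \<alpha>"
        using D(2)[of x \<alpha>] \<alpha> p by (simp add: rq_def field_simps)
      then show ?thesis using C by linarith
    next
      case False
      then have "(1 + norm x) ^ m * norm (reflection_quotient f \<alpha> x) \<le> C"
        using C(2)[of x] \<alpha> p by (simp add: rq_def norm_divide divide_simps mult_ac)
      moreover have "0 \<le> D * norm \<alpha>" using D by simp
      ultimately show ?thesis by linarith
    qed
  qed
  then show "\<exists>C. \<forall>x. (1 + norm x) ^ m * norm (reflection_quotient f \<alpha> x) \<le> C" by blast
qed

text \<open>The segment from \<sigma> \<alpha> x to x stays in the ball of radius
  \<open>norm x\<close>, so the growth bound of the derivative at x is valid along the whole
  segment.\<close>

lemma polyg_rq: assumes f: "polyg f" and \<alpha>: "\<alpha> \<in> R"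
  shows "\<exists>C\<ge>0. \<exists>j. \<forall>x. norm (reflection_quotient f \<alpha> x) \<le> C * (1 + norm x) ^ j"
proof -
  obtain C j where C: "\<And>x h. norm (fder f x h) \<le> C * (1 + norm x) ^ j * norm h" and C1: "\<And>x. norm (f x) \<le> C * (1 + norm x) ^ j"
    using f unfolding polyg_def by metis
  have C0: "0 \<le> C" using order_trans[OF norm_ge_zero C1[of 0]] by simp
  have "norm (reflection_quotient f \<alpha> x) \<le> (2 * C) * (1 + norm x) ^ j" for x
  proof (cases "\<alpha> \<bullet> x = 0")
    case True
    have "norm (fder f x \<alpha>) \<le> C * (1 + norm x) ^ j * 2"
      by (rule order_trans[OF C]) (intro mult_left_mono norm_root_le \<alpha> mult_nonneg_nonneg C0, auto)
    then show ?thesis using \<alpha> True by (simp add: rq_def mult_ac)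
  next
    case False
    have "norm (f x - f (\<sigma> \<alpha> x)) \<le> C * (1 + norm x) ^ j * norm (x - \<sigma> \<alpha> x)"
    proof (rule segment_diff_bound[OF polyg_diff[OF f]])
      fix z h :: "real ^ 'n" assume "z \<in> closed_segment (\<sigma> \<alpha> x) x"
      moreover have "closed_segment (\<sigma> \<alpha> x) x \<subseteq> cball 0 (norm x)"
        using \<alpha> by (intro closed_segment_subset) auto
      ultimately have "norm z \<le> norm x" by auto
      then have "C * (1 + norm z) ^ j * norm h \<le> C * (1 + norm x) ^ j * norm h"
        using C0 by (intro mult_right_mono mult_left_mono power_mono) auto
      then show "norm (fder f z h) \<le> C * (1 + norm x) ^ j * norm h" by (rule order_trans[OF C])
    qed
    also have "\<dots> \<le> C * (1 + norm x) ^ j * (2 * \<bar>\<alpha> \<bullet> x\<bar>)"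
      using C0 by (intro mult_left_mono s_diff \<alpha>) auto
    finally show ?thesis using \<alpha> False by (simp add: rq_def norm_divide divide_simps mult_ac)
  qed
  then show ?thesis using C0 by (intro exI[of _ "2 * C"]) auto
qed

lemma rq_measurable: assumes "\<And>x. f differentiable at x" "\<alpha> \<in> R"
  shows "reflection_quotient f \<alpha> \<in> borel_measurable borel"
proof -
  have [measurable]: "f \<in> borel_measurable borel" "\<sigma> \<alpha> \<in> borel_measurable borel" "(\<lambda>x. fder f x \<alpha>) \<in> borel_measurable borel"
    using assms by (auto intro: differentiable_measurable measurable_fder measurable_G)
  have "(\<lambda>x. if \<alpha> \<bullet> x = 0 then fder f x \<alpha> else (f x - f (\<sigma> \<alpha> x)) / of_real (\<alpha> \<bullet> x)) \<in> borel_measurable borel"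
  proof (rule measurable_If)
    show "{x \<in> space borel. \<alpha> \<bullet> x = 0} \<in> sets borel"
      using borel_closed[OF closed_hyperplane[of \<alpha> 0]] by simp
  qed measurable
  then show ?thesis by (subst measurable_cong[OF rq_def[OF assms(2)]])
qed

lemma T_measurable: assumes "\<And>x. f differentiable at x" shows "T \<eta> f \<in> borel_measurable borel"
  unfolding T_def[abs_def] using assms
  by (intro borel_measurable_add borel_measurable_sum borel_measurable_times borel_measurable_const measurable_fder rq_measurable)

lemma rap_T: "rapd f \<Longrightarrow> rap (T \<eta> f)"
  unfolding T_def[abs_def] by (intro rap_add rap_sum rap_cmult rap_rq rapd_fder_rap)

section \<open>Integration by parts\<close>

text \<open>For \<epsilon> > 0 a smooth, positive and group invariant substitute for the weight.
  Writing it as the exponential of a sum makes its logarithmic derivative explicit.\<close>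

definition wteps :: "real \<Rightarrow> real ^ 'n \<Rightarrow> real" where
  "wteps \<epsilon> x = exp (\<Sum>\<alpha>\<in>R. k \<alpha> / 2 * ln ((x \<bullet> \<alpha>)\<^sup>2 + \<epsilon>))"

lemma wteps_eq: "\<epsilon> > 0 \<Longrightarrow> wteps \<epsilon> x = (\<Prod>\<alpha>\<in>R. ((x \<bullet> \<alpha>)\<^sup>2 + \<epsilon>) powr (k \<alpha> / 2))"
  unfolding wteps_def by (subst exp_sum) (auto intro!: prod.cong simp: powr_def add_nonneg_eq_0_iff)

lemma wteps_bound: "0 < \<epsilon> \<Longrightarrow> \<epsilon> \<le> 1 \<Longrightarrow> wteps \<epsilon> x \<le> 2 ^ L0 * (1 + norm x) ^ L0"
  using wt_eps_bound[of \<epsilon> x] by (simp add: wteps_eq)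

lemma wteps_G: assumes "g \<in> G" shows "wteps \<epsilon> (g x) = wteps \<epsilon> x"
proof -
  have "(\<Sum>\<alpha>\<in>R. k \<alpha> / 2 * ln ((g x \<bullet> \<alpha>)\<^sup>2 + \<epsilon>)) = (\<Sum>\<alpha>\<in>R. k (g \<alpha>) / 2 * ln ((g x \<bullet> g \<alpha>)\<^sup>2 + \<epsilon>))"
    using sum_R_reindex[OF assms] by (rule sym)
  then show ?thesis unfolding wteps_def by (simp add: G_k G_inner assms cong: sum.cong)
qed

text \<open>A bounded substitute, for \<epsilon> > 0, of 1 / (\<alpha> \<bullet> x) that is still
  odd under \<sigma> \<alpha>. It arises from the logarithmic derivative of
  \<open>wteps\<close>.\<close>

definition mom :: "real \<Rightarrow> real ^ 'n \<Rightarrow> real ^ 'n \<Rightarrow> real" where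
  "mom \<epsilon> \<alpha> x = (\<alpha> \<bullet> x) / ((\<alpha> \<bullet> x)\<^sup>2 + \<epsilon>)"

lemma wteps_derivative: assumes "\<epsilon> > 0"
  shows "(wteps \<epsilon> has_derivative (\<lambda>h. wteps \<epsilon> x * (\<Sum>\<alpha>\<in>R. k \<alpha> * (\<alpha> \<bullet> h) * mom \<epsilon> \<alpha> x))) (at x)"
proof -
  have p: "(x \<bullet> \<alpha>)\<^sup>2 + \<epsilon> > 0" for x \<alpha> using assms by (simp add: add_nonneg_pos)
  have *: "((\<lambda>x. k \<alpha> / 2 * ln ((x \<bullet> \<alpha>)\<^sup>2 + \<epsilon>)) has_derivative (\<lambda>h. k \<alpha> * (\<alpha> \<bullet> h) * mom \<epsilon> \<alpha> x)) (at x)" for \<alpha>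
    using p[of x \<alpha>] by (auto intro!: derivative_eq_intros simp: mom_def inner_commute field_simps)
  have "((\<lambda>x. \<Sum>\<alpha>\<in>R. k \<alpha> / 2 * ln ((x \<bullet> \<alpha>)\<^sup>2 + \<epsilon>)) has_derivative (\<lambda>h. \<Sum>\<alpha>\<in>R. k \<alpha> * (\<alpha> \<bullet> h) * mom \<epsilon> \<alpha> x)) (at x)"
    by (rule has_derivative_sum) (rule *)
  from has_derivative_exp[OF this] show ?thesis
    unfolding wteps_def by (rule has_derivative_eq_rhs) (simp add: mult.commute)
qed

lemma mom_bound: "0 < \<epsilon> \<Longrightarrow> \<epsilon> \<le> 1 \<Longrightarrow> \<bar>mom \<epsilon> \<alpha> x\<bar> \<le> 1 / \<epsilon>"
proof -
  assume e: "0 < \<epsilon>" "\<epsilon> \<le> 1"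
  let ?t = "\<alpha> \<bullet> x"
  have p: "0 < ?t\<^sup>2 + \<epsilon>" using e by (simp add: add_nonneg_pos)
  have "0 \<le> (\<bar>?t\<bar> - 1)\<^sup>2" by simp
  then have "\<bar>?t\<bar> \<le> ?t\<^sup>2 + 1" by (simp add: power2_diff)
  then have "\<epsilon> * \<bar>?t\<bar> \<le> \<epsilon> * (?t\<^sup>2 + 1)" using e by (intro mult_left_mono) auto
  also have "\<dots> \<le> ?t\<^sup>2 + \<epsilon>" using e mult_right_mono[of \<epsilon> 1 "?t\<^sup>2"] by (simp add: algebra_simps)
  finally show ?thesis using e p unfolding mom_def abs_divide
    by (simp add: abs_of_pos divide_simps mult.commute)
qed

text \<open>In contrast to \<open>mom_bound\<close> this estimate is uniform in \<epsilon>; it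
  provides the majorant when \<epsilon> tends to 0.\<close>

lemma mom_le: "0 < \<epsilon> \<Longrightarrow> \<bar>\<alpha> \<bullet> x\<bar> * \<bar>mom \<epsilon> \<alpha> x\<bar> \<le> 1"
  by (simp add: mom_def abs_mult[symmetric] power2_eq_square[symmetric] add_nonneg_pos divide_le_eq)

lemma mom_odd: "\<alpha> \<in> R \<Longrightarrow> mom \<epsilon> \<alpha> (\<sigma> \<alpha> x) = - mom \<epsilon> \<alpha> x"
  by (simp add: mom_def inner_s)

lemma integral_lborel_G: assumes "g \<in> G" "f \<in> borel_measurable borel"
  shows "(\<integral>x. f (g x) \<partial>lborel) = (\<integral>x. f x \<partial>lborel :: complex)"
proof -
  obtain h where h: "h \<in> G" "g \<circ> h = id" using G_inverse assms by blast
  then have "g (h x) = x" for x by (metis comp_apply id_apply)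
  then have "distr lborel borel g = lborel"
    using lborel_isometry[OF G_linear[OF assms(1)] G_linear[OF h(1)]] assms G_norm by blast
  then have "(\<integral>x. f x \<partial>lborel) = (\<integral>x. f x \<partial>distr lborel borel g)" by simp
  also have "\<dots> = (\<integral>x. f (g x) \<partial>lborel)" using assms measurable_G[OF assms(1)]
    by (subst integral_distr) auto
  finally show ?thesis by simp
qed

text \<open>The weight need not be differentiable on the hyperplanes, so it is regularized; the invariance of
  the regularized weight turns its logarithmic derivative into difference quotients, which stay
  bounded in the limit.\<close>

lemma integral_T_eps:
  assumes f: "rapd f" and \<epsilon>: "0 < \<epsilon>" "\<epsilon> \<le> 1"
  shows "(\<integral>x. of_real (wteps \<epsilon> x) * (fder f x \<eta> + (\<Sum>\<alpha>\<in>R. of_real (kp \<alpha> * (\<alpha> \<bullet> \<eta>)) * (of_real (mom \<epsilon> \<alpha> x) * (f x - f (\<sigma> \<alpha> x))))) \<partial>lborel) = 0"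
proof -
  define W where "W x = complex_of_real (wteps \<epsilon> x)" for x
  define m where "m \<alpha> x = complex_of_real (mom \<epsilon> \<alpha> x)" for \<alpha> x
  have dW: "(W has_derivative (\<lambda>h. W x * (\<Sum>\<alpha>\<in>R. of_real (k \<alpha> * (\<alpha> \<bullet> h)) * m \<alpha> x))) (at x)" for x
    using has_derivative_of_real[OF wteps_derivative[OF \<epsilon>(1)], where 'a = complex, of x] unfolding W_def m_def by simp
  have Wp: "polyg W"
    unfolding polyg_def
  proof (intro conjI allI)
    show "W differentiable at x" for x using dW by (auto simp: differentiable_def)
    \<comment> \<open>One constant for both bounds of \<open>polyg\<close>: the summand 1 covers W,
      the sum covers its derivative through \<open>mom_bound\<close>. It may depend on \<epsilon>,
      which is fixed here.\<close>
    define c where "c = 1 + (\<Sum>\<alpha>\<in>R. k \<alpha> * norm \<alpha> * (1 / \<epsilon>))"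
    have c: "c \<ge> 1" unfolding c_def using k_nonneg \<epsilon> by (auto intro!: sum_nonneg)
    have W0: "norm (W x) \<le> 2 ^ L0 * (1 + norm x) ^ L0" for x
      using wteps_bound[OF \<epsilon>, of x] unfolding W_def by (simp add: wteps_def)
    have "norm (W x) \<le> (2 ^ L0 * c) * (1 + norm x) ^ L0" for x
      by (rule order_trans[OF W0]) (use c in \<open>simp add: mult_right_mono mult_le_cancel_left1\<close>)
    moreover have "norm (fder W x h) \<le> (2 ^ L0 * c) * (1 + norm x) ^ L0 * norm h" for x h
    proof -
      have "norm (\<Sum>\<alpha>\<in>R. of_real (k \<alpha> * (\<alpha> \<bullet> h)) * m \<alpha> x) \<le> (\<Sum>\<alpha>\<in>R. k \<alpha> * norm \<alpha> * (1 / \<epsilon>) * norm h)"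
      proof (rule sum_norm_le)
        fix \<alpha> assume "\<alpha> \<in> R"
        have "norm (of_real (k \<alpha> * (\<alpha> \<bullet> h)) * m \<alpha> x) = k \<alpha> * \<bar>\<alpha> \<bullet> h\<bar> * \<bar>mom \<epsilon> \<alpha> x\<bar>"
          unfolding norm_mult m_def norm_of_real using k_nonneg[OF \<open>\<alpha> \<in> R\<close>] by (simp add: abs_mult)
        also have "\<dots> \<le> k \<alpha> * (norm \<alpha> * norm h) * (1 / \<epsilon>)"
          using k_nonneg[OF \<open>\<alpha> \<in> R\<close>] Cauchy_Schwarz_ineq2[of \<alpha> h] mom_bound[OF \<epsilon>, of \<alpha> x]
          by (intro mult_mono mult_left_mono mult_nonneg_nonneg) auto
        finally show "norm (of_real (k \<alpha> * (\<alpha> \<bullet> h)) * m \<alpha> x) \<le> k \<alpha> * norm \<alpha> * (1 / \<epsilon>) * norm h" by (simp add: mult_ac)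
      qed
      also have "\<dots> \<le> c * norm h" unfolding c_def sum_distrib_right[symmetric] by (intro mult_right_mono) auto
      finally have "norm (fder W x h) \<le> (2 ^ L0 * (1 + norm x) ^ L0) * (c * norm h)"
        unfolding fder_eq[OF dW] norm_mult using W0[of x] c by (intro mult_mono) auto
      then show ?thesis by (simp add: mult_ac)
    qed
    ultimately show "\<exists>C j. \<forall>x. norm (W x) \<le> C * (1 + norm x) ^ j \<and> (\<forall>h. norm (fder W x h) \<le> C * (1 + norm x) ^ j * norm h)"
      by blast
  qed
  have Wf: "rapd (\<lambda>x. W x * f x)" by (rule rapd_mult[OF Wp f])
  have [measurable]: "f \<in> borel_measurable borel" "W \<in> borel_measurable borel" "m \<alpha> \<in> borel_measurable borel"
      "(\<lambda>x. fder f x \<eta>) \<in> borel_measurable borel" for \<alpha>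
    using f Wp unfolding m_def[abs_def] mom_def[abs_def]
    by (auto intro: rapd_measurable polyg_measurable measurable_fder[OF rapd_diff])
  have [measurable]: "\<sigma> \<alpha> \<in> borel_measurable borel" for \<alpha>
    using linear_root_reflection by (intro borel_measurable_continuous_onI linear_continuous_on linear_conv_bounded_linear[THEN iffD1])
  have int_rap: "integrable lborel F" if "rap F" "F \<in> borel_measurable borel" for F :: "real ^ 'n \<Rightarrow> complex"
    using rapD[OF that(1), of "CARD('n) + 2"] integrable_lborel_decay[OF that(2)] by auto
  have rW: "rap (\<lambda>x. W x * F x)" if F: "rap F" for F
  proof -
    obtain C j where "\<And>x. norm (W x) \<le> C * (1 + norm x) ^ j" using Wp unfolding polyg_def by metis
    moreover have "0 \<le> C" using order_trans[OF norm_ge_zero calculation[of 0]] by simp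
    ultimately show ?thesis by (intro rap_mult_poly[OF F, of _ C j]) (auto simp: norm_mult mult_right_mono)
  qed
  have m_b: "norm (m \<alpha> x) \<le> 1 / \<epsilon>" for \<alpha> x using mom_bound[OF \<epsilon>] by (simp add: m_def)
  have fs: "rap (\<lambda>x. f (\<sigma> \<alpha> x))" if "\<alpha> \<in> R" for \<alpha>
    by (rule rap_comp_isometry[OF rapd_rap[OF f]]) (simp add: that)
  have i1: "integrable lborel (\<lambda>x. W x * fder f x \<eta>)"
    by (intro int_rap rW rapd_fder_rap f) measurable
  have i2: "integrable lborel (\<lambda>x. W x * (m \<alpha> x * f x))" for \<alpha>
    by (intro int_rap rW rap_mult_bounded[OF rapd_rap[OF f] m_b]) measurable
  have i3: "integrable lborel (\<lambda>x. W x * (m \<alpha> x * f (\<sigma> \<alpha> x)))" if "\<alpha> \<in> R" for \<alpha>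
    by (intro int_rap rW rap_mult_bounded[OF fs[OF that] m_b]) measurable
  \<comment> \<open>As W is invariant and \<open>m \<alpha>\<close> is odd, k \<alpha> times the
    integral of W m f equals kp \<alpha> times the integral of W m (f - f \<circ> \<sigma>
    \<alpha>). In this way the derivative of the weight becomes the reflection part of T.\<close>
  have odd: "(\<integral>x. W x * (m \<alpha> x * f (\<sigma> \<alpha> x)) \<partial>lborel) = - (\<integral>x. W x * (m \<alpha> x * f x) \<partial>lborel)" if "\<alpha> \<in> R" for \<alpha>
  proof -
    have "(\<integral>x. W x * (m \<alpha> x * f x) \<partial>lborel) = (\<integral>x. W (\<sigma> \<alpha> x) * (m \<alpha> (\<sigma> \<alpha> x) * f (\<sigma> \<alpha> x)) \<partial>lborel)"
      by (rule integral_lborel_G[symmetric]) (use that in auto)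
    also have "\<dots> = (\<integral>x. - (W x * (m \<alpha> x * f (\<sigma> \<alpha> x))) \<partial>lborel)"
      using that by (simp add: W_def m_def wteps_G mom_odd)
    finally show ?thesis by simp
  qed
  have "0 = (\<integral>x. fder (\<lambda>x. W x * f x) x \<eta> \<partial>lborel)"
  proof -
    obtain C where C: "C \<ge> 0" "\<And>x. norm (W x * f x) \<le> C / (1 + norm x) ^ (CARD('n) + 2)" using rapD[OF rapd_rap[OF Wf]] by blast
    obtain D where D: "D \<ge> 0" "\<And>x h. norm (fder (\<lambda>x. W x * f x) x h) \<le> D / (1 + norm x) ^ (CARD('n) + 2) * norm h" using rapd_fder[OF Wf] by blast
    have p: "0 < (1 + norm x) ^ (CARD('n) + 2)" for x :: "real ^ 'n" by (intro zero_less_power add_pos_nonneg) auto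
    show ?thesis
    proof (rule integral_lborel_fder_0[symmetric, of _ "C + D"])
      show "(\<lambda>x. W x * f x) differentiable at x" for x by (rule rapd_diff[OF Wf])
      show "norm (W x * f x) \<le> (C + D) / (1 + norm x) ^ (CARD('n) + 2)" for x
        by (rule order_trans[OF C(2)]) (use D p[of x] in \<open>simp add: divide_right_mono\<close>)
      show "norm (fder (\<lambda>x. W x * f x) x h) \<le> (C + D) / (1 + norm x) ^ (CARD('n) + 2) * norm h" for x h
        by (rule order_trans[OF D(2)]) (use C p[of x] in \<open>intro mult_right_mono divide_right_mono, auto\<close>)
    qed
  qed
  also have "\<dots> = (\<integral>x. W x * fder f x \<eta> + (\<Sum>\<alpha>\<in>R. of_real (k \<alpha> * (\<alpha> \<bullet> \<eta>)) * (W x * (m \<alpha> x * f x))) \<partial>lborel)"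
    by (rule Bochner_Integration.integral_cong[OF refl], subst fder_mult[OF polyg_diff[OF Wp] rapd_diff[OF f]], subst fder_eq[OF dW])
       (simp add: sum_distrib_left sum_distrib_right mult_ac)
  also have "\<dots> = (\<integral>x. W x * fder f x \<eta> \<partial>lborel) + (\<Sum>\<alpha>\<in>R. of_real (k \<alpha> * (\<alpha> \<bullet> \<eta>)) * (\<integral>x. W x * (m \<alpha> x * f x) \<partial>lborel))"
    using i1 i2 by (subst Bochner_Integration.integral_add) (auto simp: Bochner_Integration.integral_sum)
  also have "(\<Sum>\<alpha>\<in>R. of_real (k \<alpha> * (\<alpha> \<bullet> \<eta>)) * (\<integral>x. W x * (m \<alpha> x * f x) \<partial>lborel)) =
    (\<Sum>\<alpha>\<in>R. of_real (kp \<alpha> * (\<alpha> \<bullet> \<eta>)) * (\<integral>x. W x * (m \<alpha> x * f x) - W x * (m \<alpha> x * f (\<sigma> \<alpha> x)) \<partial>lborel))"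
    by (intro sum.cong refl, subst Bochner_Integration.integral_diff[OF i2 i3], assumption)
       (simp add: odd kp_def field_simps)
  also have "(\<integral>x. W x * fder f x \<eta> \<partial>lborel) + \<dots> =
    (\<integral>x. W x * fder f x \<eta> + (\<Sum>\<alpha>\<in>R. of_real (kp \<alpha> * (\<alpha> \<bullet> \<eta>)) * (W x * (m \<alpha> x * f x) - W x * (m \<alpha> x * f (\<sigma> \<alpha> x)))) \<partial>lborel)"
    using i1 i2 i3 by (subst Bochner_Integration.integral_add) (auto simp: Bochner_Integration.integral_sum)
  also have "\<dots> = (\<integral>x. W x * (fder f x \<eta> + (\<Sum>\<alpha>\<in>R. of_real (kp \<alpha> * (\<alpha> \<bullet> \<eta>)) * (m \<alpha> x * (f x - f (\<sigma> \<alpha> x))))) \<partial>lborel)"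
    by (rule Bochner_Integration.integral_cong[OF refl])
       (simp add: distrib_left sum_distrib_left right_diff_distrib mult_ac)
  finally show ?thesis unfolding W_def m_def by simp
qed

text \<open>The limit \<epsilon> to 0 in \<open>integral_T_eps\<close>: the estimate of f x - f
  (\<sigma> \<alpha> x) by a multiple of \<bar>\<alpha> \<bullet> x\<bar> cancels the singularity of
  \<open>mom\<close> and gives a majorant independent of \<epsilon>.\<close>

lemma integral_T_0: assumes f: "rapd f" shows "(\<integral>x. T \<eta> f x \<partial>mu) = 0"
proof -
  define \<epsilon> where "\<epsilon> n = 1 / real (Suc n)" for n
  have \<epsilon>: "0 < \<epsilon> n" "\<epsilon> n \<le> 1" for n by (auto simp: \<epsilon>_def)
  have \<epsilon>0: "\<epsilon> \<longlonglongrightarrow> 0" unfolding \<epsilon>_def by (rule LIMSEQ_Suc[OF lim_1_over_n])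
  define S where "S n x = of_real (wteps (\<epsilon> n) x) * (fder f x \<eta> + (\<Sum>\<alpha>\<in>R. of_real (kp \<alpha> * (\<alpha> \<bullet> \<eta>)) * (of_real (mom (\<epsilon> n) \<alpha> x) * (f x - f (\<sigma> \<alpha> x)))))" for n x
  let ?m = "L0 + (CARD('n) + 2)"
  obtain D where D: "D \<ge> 0" "\<And>x h. norm (fder f x h) \<le> D / (1 + norm x) ^ ?m * norm h" using rapd_fder[OF f] by blast
  have "\<forall>\<alpha>\<in>R. \<exists>C\<ge>0. \<forall>x. norm (f x - f (\<sigma> \<alpha> x)) \<le> C / (1 + norm x) ^ ?m * \<bar>\<alpha> \<bullet> x\<bar>"
    using rapd_reflection_diff[OF f] by blast
  then obtain C where C: "\<And>\<alpha>. \<alpha> \<in> R \<Longrightarrow> C \<alpha> \<ge> 0" "\<And>\<alpha> x. \<alpha> \<in> R \<Longrightarrow> norm (f x - f (\<sigma> \<alpha> x)) \<le> C \<alpha> / (1 + norm x) ^ ?m * \<bar>\<alpha> \<bullet> x\<bar>"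
    by metis
  define K where "K = D * norm \<eta> + (\<Sum>\<alpha>\<in>R. \<bar>kp \<alpha> * (\<alpha> \<bullet> \<eta>)\<bar> * C \<alpha>)"
  define w where "w x = (2 ^ L0 * K) / (1 + norm x) ^ (CARD('n) + 2)" for x :: "real ^ 'n"
  have K: "K \<ge> 0" unfolding K_def using D C by (auto intro!: add_nonneg_nonneg sum_nonneg)
  have [measurable]: "w \<in> borel_measurable borel" unfolding w_def by measurable
  have iw: "integrable lborel w"
    by (rule integrable_lborel_decay_real[of _ "2 ^ L0 * K"]) (use K in \<open>simp_all add: w_def\<close>)
  have p: "0 < 1 + norm x" for x :: "real ^ 'n" by (simp add: add_pos_nonneg)
  have Sw: "norm (S n x) \<le> w x" for n x
  proof -
    have "norm (fder f x \<eta> + (\<Sum>\<alpha>\<in>R. of_real (kp \<alpha> * (\<alpha> \<bullet> \<eta>)) * (of_real (mom (\<epsilon> n) \<alpha> x) * (f x - f (\<sigma> \<alpha> x)))))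
      \<le> D / (1 + norm x) ^ ?m * norm \<eta> + (\<Sum>\<alpha>\<in>R. \<bar>kp \<alpha> * (\<alpha> \<bullet> \<eta>)\<bar> * (C \<alpha> / (1 + norm x) ^ ?m))"
    proof (rule order_trans[OF norm_triangle_ineq], rule add_mono[OF D(2)], rule sum_norm_le)
      fix \<alpha> assume \<alpha>: "\<alpha> \<in> R"
      have "norm (of_real (mom (\<epsilon> n) \<alpha> x) * (f x - f (\<sigma> \<alpha> x))) \<le> \<bar>mom (\<epsilon> n) \<alpha> x\<bar> * (C \<alpha> / (1 + norm x) ^ ?m * \<bar>\<alpha> \<bullet> x\<bar>)"
        unfolding norm_mult norm_of_real by (intro mult_left_mono C(2) \<alpha>) auto
      also have "\<dots> = C \<alpha> / (1 + norm x) ^ ?m * (\<bar>\<alpha> \<bullet> x\<bar> * \<bar>mom (\<epsilon> n) \<alpha> x\<bar>)" by (simp add: mult_ac)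
      also have "\<dots> \<le> C \<alpha> / (1 + norm x) ^ ?m * 1"
        using C(1)[OF \<alpha>] p[of x] mom_le[OF \<epsilon>(1)] by (intro mult_left_mono) auto
      finally show "norm (of_real (kp \<alpha> * (\<alpha> \<bullet> \<eta>)) * (of_real (mom (\<epsilon> n) \<alpha> x) * (f x - f (\<sigma> \<alpha> x)))) \<le> \<bar>kp \<alpha> * (\<alpha> \<bullet> \<eta>)\<bar> * (C \<alpha> / (1 + norm x) ^ ?m)"
        unfolding norm_mult[of "of_real (kp \<alpha> * (\<alpha> \<bullet> \<eta>))"] norm_of_real by (intro mult_left_mono) auto
    qed
    also have "\<dots> = K / (1 + norm x) ^ ?m"
      by (simp add: K_def add_divide_distrib sum_divide_distrib)
    finally have "norm (S n x) \<le> (2 ^ L0 * (1 + norm x) ^ L0) * (K / (1 + norm x) ^ ?m)"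
      unfolding S_def norm_mult using wteps_bound[OF \<epsilon>, of n x]
      by (intro mult_mono) (auto simp: wteps_def)
    also have "\<dots> = w x" using p[of x] by (simp add: w_def power_add)
    finally show ?thesis .
  qed
  have [measurable]: "f \<in> borel_measurable borel" "(\<lambda>x. fder f x \<eta>) \<in> borel_measurable borel"
    using f by (auto intro: rapd_measurable measurable_fder[OF rapd_diff])
  have [measurable]: "\<sigma> \<alpha> \<in> borel_measurable borel" for \<alpha>
    using linear_root_reflection by (intro borel_measurable_continuous_onI linear_continuous_on linear_conv_bounded_linear[THEN iffD1])
  have [measurable]: "T \<eta> f \<in> borel_measurable borel" by (rule T_measurable[OF rapd_diff[OF f]])
  have "(\<lambda>n. \<integral>x. S n x \<partial>lborel) \<longlonglongrightarrow> (\<integral>x. wt x *\<^sub>R T \<eta> f x \<partial>lborel)"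
  proof (rule integral_dominated_convergence[where w = w])
    show "AE x in lborel. (\<lambda>n. S n x) \<longlonglongrightarrow> wt x *\<^sub>R T \<eta> f x"
      using AE_hyperplanes wt_eq_eps
    proof eventually_elim
      case (elim x)
      have "(\<lambda>n. \<Prod>\<alpha>\<in>R. ((x \<bullet> \<alpha>)\<^sup>2 + \<epsilon> n) powr (k \<alpha> / 2)) \<longlonglongrightarrow> wt x"
        unfolding elim(2) using elim(1)
        by (intro tendsto_prod tendsto_powr tendsto_add tendsto_const \<epsilon>0) (auto simp: inner_commute)
      then have w: "(\<lambda>n. wteps (\<epsilon> n) x) \<longlonglongrightarrow> wt x" by (simp add: wteps_eq \<epsilon>)
      have m: "(\<lambda>n. mom (\<epsilon> n) \<alpha> x) \<longlonglongrightarrow> 1 / (\<alpha> \<bullet> x)" if "\<alpha> \<in> R" for \<alpha>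
      proof -
        have "(\<lambda>n. mom (\<epsilon> n) \<alpha> x) \<longlonglongrightarrow> (\<alpha> \<bullet> x) / ((\<alpha> \<bullet> x)\<^sup>2 + 0)"
          unfolding mom_def using elim(1) that by (intro tendsto_divide tendsto_add tendsto_const \<epsilon>0) auto
        then show ?thesis using elim(1) that by (simp add: power2_eq_square)
      qed
      have "(\<lambda>n. S n x) \<longlonglongrightarrow> of_real (wt x) * (fder f x \<eta> + (\<Sum>\<alpha>\<in>R. of_real (kp \<alpha> * (\<alpha> \<bullet> \<eta>)) * (of_real (1 / (\<alpha> \<bullet> x)) * (f x - f (\<sigma> \<alpha> x)))))"
        unfolding S_def by (intro tendsto_mult tendsto_add tendsto_sum tendsto_const tendsto_of_real w m)
      also have "(\<Sum>\<alpha>\<in>R. of_real (kp \<alpha> * (\<alpha> \<bullet> \<eta>)) * (of_real (1 / (\<alpha> \<bullet> x)) * (f x - f (\<sigma> \<alpha> x)))) =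
         (\<Sum>\<alpha>\<in>R. of_real (kp \<alpha> * (\<alpha> \<bullet> \<eta>)) * reflection_quotient f \<alpha> x)"
        using elim(1) by (intro sum.cong refl) (simp add: rq_def)
      finally show ?case by (simp add: T_def scaleR_complex)
    qed
    show "S n \<in> borel_measurable lborel" for n
      unfolding S_def wteps_def mom_def by measurable
  qed (use iw Sw in auto)
  moreover have "(\<integral>x. S n x \<partial>lborel) = 0" for n
    unfolding S_def by (rule integral_T_eps[OF f \<epsilon>])
  ultimately have "(\<lambda>n. 0 :: complex) \<longlonglongrightarrow> (\<integral>x. wt x *\<^sub>R T \<eta> f x \<partial>lborel)" by simp
  then have "(\<integral>x. wt x *\<^sub>R T \<eta> f x \<partial>lborel) = 0" using LIMSEQ_unique[OF tendsto_const] by metis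
  then show ?thesis by (subst integral_mu) auto
qed

lemma integral_odd_0:
  fixes f :: "real ^ 'n \<Rightarrow> complex"
  assumes "f \<in> borel_measurable borel" "\<alpha> \<in> R" "\<And>x. f (\<sigma> \<alpha> x) = - f x"
  shows "(\<integral>x. f x \<partial>mu) = 0"
  using integral_mu_G[OF s_in_G[OF assms(2)] assms(1)] assms(3) by simp

text \<open>T \<eta> (f g) has integral 0. Besides the two expected terms, the product rule leaves
  multiples of \<open>Q \<alpha>\<close>, the quotient of f times g - g \<circ> \<sigma> \<alpha>,
  which are odd under \<sigma> \<alpha> and integrate to 0. Polynomial growth of f is allowed so
  that f can be the kernel.\<close>

lemma T_antisymmetric:
  assumes f: "polyg f" and g: "rapd g"
  shows "integrable mu (\<lambda>x. T \<eta> f x * g x)" "integrable mu (\<lambda>x. f x * T \<eta> g x)"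
    "(\<integral>x. T \<eta> f x * g x \<partial>mu) = - (\<integral>x. f x * T \<eta> g x \<partial>mu)"
proof -
  note df = polyg_diff[OF f] and dg = rapd_diff[OF g]
  have [measurable]: "f \<in> borel_measurable borel" "g \<in> borel_measurable borel" "T \<eta> f \<in> borel_measurable borel"
    "T \<eta> g \<in> borel_measurable borel" "(\<lambda>x. fder f x \<eta>) \<in> borel_measurable borel"
    using df dg by (auto intro: differentiable_measurable T_measurable measurable_fder)
  have rqm: "reflection_quotient f \<alpha> \<in> borel_measurable borel" if "\<alpha> \<in> R" for \<alpha>
    using df that by (rule rq_measurable)
  have sm [measurable]: "\<sigma> \<alpha> \<in> borel_measurable borel" for \<alpha>
    using linear_root_reflection by (intro borel_measurable_continuous_onI linear_continuous_on linear_conv_bounded_linear[THEN iffD1])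
  obtain C j where C: "\<And>x. norm (f x) \<le> C * (1 + norm x) ^ j" "\<And>x h. norm (fder f x h) \<le> C * (1 + norm x) ^ j * norm h"
    using f unfolding polyg_def by metis
  have C0: "0 \<le> C" using order_trans[OF norm_ge_zero C(1)[of 0]] by simp
  have i_rap: "rap F \<Longrightarrow> F \<in> borel_measurable borel \<Longrightarrow> integrable mu F" for F by (rule integrable_rap)
  have r1: "rap (\<lambda>x. fder f x \<eta> * g x)"
    by (rule rap_mult_poly[OF rapd_rap[OF g], of _ "C * norm \<eta>" j])
       (use mult_right_mono[OF C(2), of "norm (g _)" _ \<eta>] C0 in \<open>simp_all add: norm_mult mult_ac\<close>)
  have rq: "rap (\<lambda>x. reflection_quotient f \<alpha> x * F x)" if \<alpha>: "\<alpha> \<in> R" and F: "rap F" for \<alpha> F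
  proof -
    obtain D l where D: "D \<ge> 0" "\<And>x. norm (reflection_quotient f \<alpha> x) \<le> D * (1 + norm x) ^ l"
      using polyg_rq[OF f \<alpha>] by blast
    show ?thesis
      by (rule rap_mult_poly[OF F _ D(1), of _ l]) (use D in \<open>auto simp: norm_mult intro!: mult_right_mono\<close>)
  qed
  have Tf: "T \<eta> f x * g x = fder f x \<eta> * g x + (\<Sum>\<alpha>\<in>R. of_real (kp \<alpha> * (\<alpha> \<bullet> \<eta>)) * (reflection_quotient f \<alpha> x * g x))" for x
    by (simp only: T_def distrib_right sum_distrib_right mult.assoc)
  have "rap (\<lambda>x. T \<eta> f x * g x)"
    unfolding Tf by (intro rap_add r1 rap_sum rap_cmult rq rapd_rap g)
  then show i1: "integrable mu (\<lambda>x. T \<eta> f x * g x)" by (rule i_rap) measurable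
  have "rap (\<lambda>x. f x * T \<eta> g x)"
    by (rule rap_mult_poly[OF rap_T[OF g] _ C0, of _ j]) (use C in \<open>auto simp: norm_mult intro!: mult_right_mono\<close>)
  then show i2: "integrable mu (\<lambda>x. f x * T \<eta> g x)" by (rule i_rap) measurable
  have fg: "rapd (\<lambda>x. f x * g x)" by (rule rapd_mult[OF f g])
  have gs: "rap (\<lambda>x. g x - g (\<sigma> \<alpha> x))" if "\<alpha> \<in> R" for \<alpha>
    using rap_add[OF rapd_rap[OF g] rap_cmult[OF rap_comp_isometry[OF rapd_rap[OF g], of "\<sigma> \<alpha>"], of "- 1"]] that by simp
  define Q where "Q \<alpha> x = reflection_quotient f \<alpha> x * (g x - g (\<sigma> \<alpha> x))" for \<alpha> x
  have Qm: "Q \<alpha> \<in> borel_measurable borel" if "\<alpha> \<in> R" for \<alpha>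
    using rqm[OF that] unfolding Q_def by measurable
  have iQ: "integrable mu (Q \<alpha>)" if "\<alpha> \<in> R" for \<alpha>
    using i_rap[OF rq[OF that gs[OF that]]] Qm[OF that] unfolding Q_def by simp
  have Q0: "(\<integral>x. Q \<alpha> x \<partial>mu) = 0" if "\<alpha> \<in> R" for \<alpha>
  proof (rule integral_odd_0[OF Qm[OF that] that])
    fix x
    show "Q \<alpha> (\<sigma> \<alpha> x) = - Q \<alpha> x"
    proof (cases "\<alpha> \<bullet> x = 0")
      case True
      then show ?thesis using that by (simp add: Q_def s_fixed)
    next
      case False
      then show ?thesis using that
        by (simp add: Q_def rq_def inner_s divide_simps) (simp add: algebra_simps)
    qed
  qed
  have "T \<eta> f x * g x = T \<eta> (\<lambda>x. f x * g x) x - f x * T \<eta> g x + (\<Sum>\<alpha>\<in>R. of_real (kp \<alpha> * (\<alpha> \<bullet> \<eta>)) * Q \<alpha> x)" for x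
    unfolding Tf T_mult[OF df dg] Q_def
    by (simp add: right_diff_distrib sum_subtractf mult_ac)
  then have "(\<integral>x. T \<eta> f x * g x \<partial>mu) = (\<integral>x. (T \<eta> (\<lambda>x. f x * g x) x - f x * T \<eta> g x) + (\<Sum>\<alpha>\<in>R. of_real (kp \<alpha> * (\<alpha> \<bullet> \<eta>)) * Q \<alpha> x) \<partial>mu)"
    by simp
  also have "\<dots> = (\<integral>x. T \<eta> (\<lambda>x. f x * g x) x \<partial>mu) - (\<integral>x. f x * T \<eta> g x \<partial>mu) + (\<Sum>\<alpha>\<in>R. of_real (kp \<alpha> * (\<alpha> \<bullet> \<eta>)) * (\<integral>x. Q \<alpha> x \<partial>mu))"
  proof -
    have iT: "integrable mu (\<lambda>x. T \<eta> (\<lambda>x. f x * g x) x)"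
      using i_rap[OF rap_T[OF fg] T_measurable[OF rapd_diff[OF fg]]] by simp
    have iS: "integrable mu (\<lambda>x. \<Sum>\<alpha>\<in>R. of_real (kp \<alpha> * (\<alpha> \<bullet> \<eta>)) * Q \<alpha> x)"
      using iQ by (intro Bochner_Integration.integrable_sum integrable_mult_right) auto
    show ?thesis
      using iT i2 iS iQ by (simp add: Bochner_Integration.integral_add Bochner_Integration.integral_diff Bochner_Integration.integral_sum)
  qed
  also have "\<dots> = - (\<integral>x. f x * T \<eta> g x \<partial>mu)"
    using integral_T_0[OF fg] Q0 by simp
  finally show "(\<integral>x. T \<eta> f x * g x \<partial>mu) = - (\<integral>x. f x * T \<eta> g x \<partial>mu)" .
qed

end

lemma fder_quadratic:
  fixes f :: "real ^ 'n \<Rightarrow> complex"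
  assumes D: "bounded_linear D" and b: "\<And>y. norm (f y - f x - D (y - x)) \<le> C * (norm (y - x))\<^sup>2"
  shows "(f has_derivative D) (at x)"
proof (rule has_derivativeI[OF D])
  have "((\<lambda>y. C * norm (y - x)) \<longlongrightarrow> C * norm (x - x)) (at x)" by (intro tendsto_intros)
  then have lim: "((\<lambda>y. C * norm (y - x)) \<longlongrightarrow> 0) (at x)" by simp
  have ev: "\<forall>\<^sub>F y in at x. norm ((f y - f x - D (y - x)) /\<^sub>R norm (y - x)) \<le> C * norm (y - x)"
  proof (rule eventually_at_filter[THEN iffD2], intro always_eventually allI impI)
    fix y assume "y \<noteq> x"
    then have p: "norm (y - x) > 0" by simp
    have "norm ((f y - f x - D (y - x)) /\<^sub>R norm (y - x)) = norm (f y - f x - D (y - x)) / norm (y - x)"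
      by (simp add: divide_inverse mult.commute)
    also have "\<dots> \<le> C * norm (y - x)"
      unfolding pos_divide_le_eq[OF p] using b[of y] by (simp add: power2_eq_square mult.assoc)
    finally show "norm ((f y - f x - D (y - x)) /\<^sub>R norm (y - x)) \<le> C * norm (y - x)" .
  qed
  show "((\<lambda>y. ((f y - f x) - D (y - x)) /\<^sub>R norm (y - x)) \<longlongrightarrow> 0) (at x)"
    by (rule Lim_null_comparison[OF ev lim])
qed

context dunkl
begin

section \<open>Integrals against the kernel\<close>

lemma polyg_e: "polyg (\<lambda>x. e x \<xi>)"
  unfolding polyg_def
proof (intro conjI allI e_diff exI[of _ "cG + cE * (1 + norm \<xi>)"] exI[of _ 0])
  fix x h :: "real ^ 'n"
  have p: "0 \<le> cE * (1 + norm \<xi>)" using cE_pos by simp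
  show "norm (e x \<xi>) \<le> (cG + cE * (1 + norm \<xi>)) * (1 + norm x) ^ 0"
    using e_bound[of x \<xi>] p by simp
  have "cE * (1 + norm \<xi>) * norm h \<le> (cG + cE * (1 + norm \<xi>)) * norm h"
    using cG_pos by (intro mult_right_mono) auto
  then show "norm (fder (\<lambda>x. e x \<xi>) x h) \<le> (cG + cE * (1 + norm \<xi>)) * (1 + norm x) ^ 0 * norm h"
    using fder_e_bound[of \<xi> x h] by simp
qed

lemma measurable_e_comp [measurable (raw)]:
  assumes [measurable]: "f \<in> borel_measurable M" "g \<in> borel_measurable M"
  shows "(\<lambda>p. e (f p) (g p)) \<in> borel_measurable M"
  using measurable_compose[OF measurable_Pair[OF assms] measurable_e] by simp

lemma fder_e_measurable [measurable]: "(\<lambda>\<xi>. fder (\<lambda>x. e x \<xi>) x h) \<in> borel_measurable borel"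
proof (rule borel_measurable_LIMSEQ_metric)
  show "(\<lambda>\<xi>. of_nat (Suc i) * (e (x + (1 / real (Suc i)) *\<^sub>R h) \<xi> - e x \<xi>)) \<in> borel_measurable borel" for i
    by measurable
  show "(\<lambda>i. of_nat (Suc i) * (e (x + (1 / real (Suc i)) *\<^sub>R h) \<xi> - e x \<xi>)) \<longlonglongrightarrow> fder (\<lambda>x. e x \<xi>) x h" for \<xi>
    by (rule fder_LIMSEQ[OF e_diff])
qed

definition eint :: "(real ^ 'n \<Rightarrow> complex) \<Rightarrow> real ^ 'n \<Rightarrow> complex" where
  "eint u x = (\<integral>\<xi>. e x \<xi> * u \<xi> \<partial>mu)"

text \<open>\<open>e_taylor\<close> bounds the remainder by a multiple of
  \<open>(norm (y - x))\<^sup>2\<close> whose coefficient is integrable against u, so the derivative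
  passes under the integral without a dominated convergence argument. The reflection quotients
  follow, and T acts on the kernel by \<open>T_e\<close>.\<close>

lemma
  assumes u: "rap u" and um [measurable]: "u \<in> borel_measurable borel"
  shows integrable_eint: "integrable mu (\<lambda>\<xi>. e x \<xi> * u \<xi>)"
    and eint_has_derivative: "(eint u has_derivative (\<lambda>h. \<integral>\<xi>. fder (\<lambda>x. e x \<xi>) x h * u \<xi> \<partial>mu)) (at x)"
    and polyg_eint: "polyg (eint u)"
    and T_eint: "T \<eta> (eint u) x = eint (\<lambda>\<xi>. \<i> * of_real (\<eta> \<bullet> \<xi>) * u \<xi>) x"
proof -
  have iu: "integrable mu (\<lambda>\<xi>. (1 + norm \<xi>) ^ j * norm (u \<xi>))" for j
    by (rule integrable_rap_poly[OF u um])
  have ib: "integrable mu (\<lambda>\<xi>. K \<xi> * u \<xi>)"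
    and nb: "norm (\<integral>\<xi>. K \<xi> * u \<xi> \<partial>mu) \<le> C * (\<integral>\<xi>. (1 + norm \<xi>) ^ j * norm (u \<xi>) \<partial>mu)"
    if [measurable]: "K \<in> borel_measurable borel" and K: "\<And>\<xi>. norm (K \<xi>) \<le> C * (1 + norm \<xi>) ^ j" for K C j
  proof -
    have C: "C \<ge> 0" using order_trans[OF norm_ge_zero K[of 0]] by simp
    have le: "norm (K \<xi> * u \<xi>) \<le> C * ((1 + norm \<xi>) ^ j * norm (u \<xi>))" for \<xi>
      using mult_right_mono[OF K[of \<xi>], of "norm (u \<xi>)"] by (simp add: norm_mult mult.assoc)
    have i2: "integrable mu (\<lambda>\<xi>. C * ((1 + norm \<xi>) ^ j * norm (u \<xi>)))" by (intro integrable_mult_right iu)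
    show i1: "integrable mu (\<lambda>\<xi>. K \<xi> * u \<xi>)"
    proof (rule Bochner_Integration.integrable_bound[OF i2])
      show "AE \<xi> in mu. norm (K \<xi> * u \<xi>) \<le> norm (C * ((1 + norm \<xi>) ^ j * norm (u \<xi>)))"
      proof (rule AE_I2)
        fix \<xi>
        show "norm (K \<xi> * u \<xi>) \<le> norm (C * ((1 + norm \<xi>) ^ j * norm (u \<xi>)))"
          unfolding real_norm_def by (rule order_trans[OF le abs_ge_self])
      qed
    qed measurable
    have "norm (\<integral>\<xi>. K \<xi> * u \<xi> \<partial>mu) \<le> (\<integral>\<xi>. C * ((1 + norm \<xi>) ^ j * norm (u \<xi>)) \<partial>mu)"
      by (rule Bochner_Integration.integral_norm_bound_integral[OF i1 i2]) (rule le)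
    then show "norm (\<integral>\<xi>. K \<xi> * u \<xi> \<partial>mu) \<le> C * (\<integral>\<xi>. (1 + norm \<xi>) ^ j * norm (u \<xi>) \<partial>mu)" by simp
  qed
  show i0: "integrable mu (\<lambda>\<xi>. e x \<xi> * u \<xi>)" for x
    by (rule ib[of "\<lambda>\<xi>. e x \<xi>" cG 0]) (use e_bound in auto)
  define D where "D x h = (\<integral>\<xi>. fder (\<lambda>x. e x \<xi>) x h * u \<xi> \<partial>mu)" for x h
  have fb: "norm (fder (\<lambda>x. e x \<xi>) x h) \<le> (cE * norm h) * (1 + norm \<xi>) ^ 1" for x h \<xi>
    using fder_e_bound[of \<xi> x h] by (simp add: mult_ac)
  have iD: "integrable mu (\<lambda>\<xi>. fder (\<lambda>x. e x \<xi>) x h * u \<xi>)" for x h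
    by (rule ib[OF _ fb]) measurable
  have Db: "norm (D x h) \<le> (cE * (\<integral>\<xi>. (1 + norm \<xi>) ^ 1 * norm (u \<xi>) \<partial>mu)) * norm h" for x h
    using nb[OF fder_e_measurable fb, of x h] unfolding D_def by (simp add: mult_ac)
  have Dl: "bounded_linear (D x)" for x
  proof (rule bounded_linear_intro[where K = "cE * (\<integral>\<xi>. (1 + norm \<xi>) ^ 1 * norm (u \<xi>) \<partial>mu)"])
    note l = fder_linear[OF e_diff]
    show "D x (a + b) = D x a + D x b" for a b
      unfolding D_def linear_add[OF l] distrib_right by (rule Bochner_Integration.integral_add[OF iD iD])
    show "D x (r *\<^sub>R a) = r *\<^sub>R D x a" for r a
      unfolding D_def linear_scale[OF l] by simp
    show "norm (D x h) \<le> norm h * (cE * (\<integral>\<xi>. (1 + norm \<xi>) ^ 1 * norm (u \<xi>) \<partial>mu))" for h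
      using Db[of x h] by (simp add: mult.commute)
  qed
  have der: "(eint u has_derivative D x) (at x)" for x
  proof (rule fder_quadratic[OF Dl])
    fix y
    have "eint u y - eint u x - D x (y - x) = (\<integral>\<xi>. (e y \<xi> - e x \<xi> - fder (\<lambda>x. e x \<xi>) x (y - x)) * u \<xi> \<partial>mu)"
      unfolding eint_def D_def left_diff_distrib
      using i0 iD by (simp add: Bochner_Integration.integral_diff)
    also have "norm \<dots> \<le> (cE * (norm (y - x))\<^sup>2) * (\<integral>\<xi>. (1 + norm \<xi>) ^ 2 * norm (u \<xi>) \<partial>mu)"
      by (rule nb) (use e_taylor[of y _ x] in \<open>auto simp: mult_ac\<close>)
    finally show "norm (eint u y - eint u x - D x (y - x)) \<le> cE * (\<integral>\<xi>. (1 + norm \<xi>) ^ 2 * norm (u \<xi>) \<partial>mu) * (norm (y - x))\<^sup>2"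
      by (simp add: mult_ac)
  qed
  then show "(eint u has_derivative (\<lambda>h. \<integral>\<xi>. fder (\<lambda>x. e x \<xi>) x h * u \<xi> \<partial>mu)) (at x)"
    unfolding D_def by simp
  have fd: "fder (eint u) x h = D x h" for x h using fder_eq[OF der] by simp
  have U0: "norm (eint u x) \<le> cG * (\<integral>\<xi>. (1 + norm \<xi>) ^ 0 * norm (u \<xi>) \<partial>mu)" for x
    unfolding eint_def by (rule nb) (use e_bound in auto)
  define C where "C = cG * (\<integral>\<xi>. (1 + norm \<xi>) ^ 0 * norm (u \<xi>) \<partial>mu) + cE * (\<integral>\<xi>. (1 + norm \<xi>) ^ 1 * norm (u \<xi>) \<partial>mu)"
  have n0: "0 \<le> cG * (\<integral>\<xi>. (1 + norm \<xi>) ^ 0 * norm (u \<xi>) \<partial>mu)" "0 \<le> cE * (\<integral>\<xi>. (1 + norm \<xi>) ^ 1 * norm (u \<xi>) \<partial>mu)"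
    using cG_pos cE_pos by (auto intro!: mult_nonneg_nonneg Bochner_Integration.integral_nonneg)
  show "polyg (eint u)"
    unfolding polyg_def
  proof (intro conjI allI exI[of _ C] exI[of _ 0])
    show "eint u differentiable at x" for x using der by (auto simp: differentiable_def)
    show "norm (eint u x) \<le> C * (1 + norm x) ^ 0" for x
      using U0[of x] n0 by (simp add: C_def)
    have Ch: "(cE * (\<integral>\<xi>. (1 + norm \<xi>) ^ 1 * norm (u \<xi>) \<partial>mu)) * norm h \<le> C * norm h" for h :: "real ^ 'n"
      using n0 by (intro mult_right_mono) (auto simp: C_def)
    show "norm (fder (eint u) x h) \<le> C * (1 + norm x) ^ 0 * norm h" for x h
      unfolding fd using order_trans[OF Db Ch, of x h] by simp
  qed
  have rq: "reflection_quotient (eint u) \<alpha> x = (\<integral>\<xi>. reflection_quotient (\<lambda>x. e x \<xi>) \<alpha> x * u \<xi> \<partial>mu)"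
    and irq: "integrable mu (\<lambda>\<xi>. reflection_quotient (\<lambda>x. e x \<xi>) \<alpha> x * u \<xi>)" if "\<alpha> \<in> R" for \<alpha>
  proof -
    show "reflection_quotient (eint u) \<alpha> x = (\<integral>\<xi>. reflection_quotient (\<lambda>x. e x \<xi>) \<alpha> x * u \<xi> \<partial>mu)"
    proof (cases "\<alpha> \<bullet> x = 0")
      case True
      then show ?thesis using that by (simp add: rq_def fd D_def)
    next
      case False
      have "(\<integral>\<xi>. reflection_quotient (\<lambda>x. e x \<xi>) \<alpha> x * u \<xi> \<partial>mu) = (\<integral>\<xi>. (e x \<xi> * u \<xi> - e (\<sigma> \<alpha> x) \<xi> * u \<xi>) / of_real (\<alpha> \<bullet> x) \<partial>mu)"
        using that False by (intro Bochner_Integration.integral_cong refl) (simp add: rq_def left_diff_distrib)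
      also have "\<dots> = (eint u x - eint u (\<sigma> \<alpha> x)) / of_real (\<alpha> \<bullet> x)"
        unfolding eint_def using i0 by (simp add: Bochner_Integration.integral_diff)
      finally show ?thesis using that False by (simp add: rq_def)
    qed
    show "integrable mu (\<lambda>\<xi>. reflection_quotient (\<lambda>x. e x \<xi>) \<alpha> x * u \<xi>)"
    proof (cases "\<alpha> \<bullet> x = 0")
      case True
      then show ?thesis using that iD by (simp add: rq_def)
    next
      case False
      have "integrable mu (\<lambda>\<xi>. (e x \<xi> * u \<xi> - e (\<sigma> \<alpha> x) \<xi> * u \<xi>) / of_real (\<alpha> \<bullet> x))"
        using i0 by simp
      then show ?thesis using that False by (simp add: rq_def left_diff_distrib)
    qed
  qed
  have "T \<eta> (eint u) x = (\<integral>\<xi>. fder (\<lambda>x. e x \<xi>) x \<eta> * u \<xi> \<partial>mu) + (\<Sum>\<alpha>\<in>R. of_real (kp \<alpha> * (\<alpha> \<bullet> \<eta>)) * (\<integral>\<xi>. reflection_quotient (\<lambda>x. e x \<xi>) \<alpha> x * u \<xi> \<partial>mu))"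
    unfolding T_def fd D_def using rq by simp
  also have "\<dots> = (\<integral>\<xi>. fder (\<lambda>x. e x \<xi>) x \<eta> * u \<xi> + (\<Sum>\<alpha>\<in>R. of_real (kp \<alpha> * (\<alpha> \<bullet> \<eta>)) * (reflection_quotient (\<lambda>x. e x \<xi>) \<alpha> x * u \<xi>)) \<partial>mu)"
  proof -
    have "integrable mu (\<lambda>\<xi>. \<Sum>\<alpha>\<in>R. of_real (kp \<alpha> * (\<alpha> \<bullet> \<eta>)) * (reflection_quotient (\<lambda>x. e x \<xi>) \<alpha> x * u \<xi>))"
      using irq by (intro Bochner_Integration.integrable_sum integrable_mult_right)
    then show ?thesis using iD[of x \<eta>] irq
      by (simp add: Bochner_Integration.integral_add Bochner_Integration.integral_sum)
  qed
  also have "\<dots> = (\<integral>\<xi>. T \<eta> (\<lambda>x. e x \<xi>) x * u \<xi> \<partial>mu)"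
    by (intro Bochner_Integration.integral_cong refl) (simp only: T_def distrib_right sum_distrib_right mult.assoc)
  also have "\<dots> = eint (\<lambda>\<xi>. \<i> * of_real (\<eta> \<bullet> \<xi>) * u \<xi>) x"
    unfolding eint_def T_e by (intro Bochner_Integration.integral_cong refl) (simp only: mult_ac)
  finally show "T \<eta> (eint u) x = eint (\<lambda>\<xi>. \<i> * of_real (\<eta> \<bullet> \<xi>) * u \<xi>) x" .
qed

lemma rq_gauss: "\<alpha> \<in> R \<Longrightarrow> reflection_quotient (gauss a) \<alpha> x = 0"
  by (simp add: rq_def fder_gauss) (simp add: gauss_def inner_commute)

lemma T_gauss_mult: "f differentiable at x \<Longrightarrow>
  T \<eta> (\<lambda>x. gauss a x * f x) x = gauss a x * (T \<eta> f x - of_real (2 * a * (x \<bullet> \<eta>)) * f x)"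
  by (simp add: T_mult[OF diff_gauss] fder_gauss rq_gauss right_diff_distrib)

lemma gauss_mult: "gauss a x * gauss b x = gauss (a + b) x"
  by (simp add: gauss_def algebra_simps flip: of_real_mult exp_add)

lemma gauss_zero [simp]: "gauss 0 x = 1" "gauss a 0 = 1" by (simp_all add: gauss_def)

lemma gauss_uminus [simp]: "gauss a (- x) = gauss a x" by (simp add: gauss_def)

lemma gauss_G: "g \<in> G \<Longrightarrow> gauss a (g x) = gauss a x" by (simp add: gauss_def G_norm)

section \<open>The heat kernel\<close>

text \<open>Up to a factor depending on \<open>a\<close> only, this is the heat kernel at time \<open>1 / (4 a)\<close>.\<close>

definition Kern :: "real \<Rightarrow> real ^ 'n \<Rightarrow> real ^ 'n \<Rightarrow> complex" where
  "Kern a x y = gauss a x * (gauss a y * E (complex_vec x) (of_real (2 * a) *s complex_vec y))"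

definition Z :: "real \<Rightarrow> complex" where "Z b = (\<integral>x. gauss b x \<partial>mu)"

lemma diff_Kern: "(\<lambda>x. Kern a x y) differentiable at x"
  unfolding Kern_def
  by (rule differentiable_mult[OF diff_gauss differentiable_mult[OF differentiable_const diff_E]])

lemma T_Kern: "T \<eta> (\<lambda>x. Kern a x y) x = of_real (- 2 * a) * (of_real (x \<bullet> \<eta>) * Kern a x y) + of_real (2 * a * (\<eta> \<bullet> y)) * Kern a x y"
proof -
  have "T \<eta> (\<lambda>x. gauss a y * E (complex_vec x) (of_real (2 * a) *s complex_vec y)) x
    = of_real (2 * a * (\<eta> \<bullet> y)) * (gauss a y * E (complex_vec x) (of_real (2 * a) *s complex_vec y))"
    by (simp add: T_cmult[OF diff_E] T_E cdot_scale_right cdot_complex_vec)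
  then show ?thesis unfolding Kern_def
    by (subst T_gauss_mult[OF differentiable_mult[OF differentiable_const diff_E]]) (simp add: algebra_simps)
qed

lemma rapd_e_gauss: "b > 0 \<Longrightarrow> rapd (\<lambda>\<xi>. e \<xi> v * gauss b \<xi>)"
  by (rule rapd_mult[OF polyg_e rapd_gauss])

text \<open>T in x brings down the factor \<i> (\<eta> \<bullet> \<xi>). Integration by parts in
  \<xi> trades this factor against the Gaussian: T of the Gaussian produces it once more, while T of
  the two kernels produces \<eta> \<bullet> x and - \<eta> \<bullet> y. Solving for the integral J
  closes the equation.\<close>

lemma heat_kernel_T:
  assumes b: "b > 0"
  shows "T \<eta> (eint (\<lambda>\<xi>. e \<xi> (- y) * gauss b \<xi>)) x = - of_real (\<eta> \<bullet> (x - y) / (2 * b)) * eint (\<lambda>\<xi>. e \<xi> (- y) * gauss b \<xi>) x"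
proof -
  define u where "u = (\<lambda>\<xi>. e \<xi> (- y) * gauss b \<xi>)"
  have u: "rapd u" unfolding u_def by (rule rapd_e_gauss[OF b])
  have um [measurable]: "u \<in> borel_measurable borel" by (rule rapd_measurable[OF u])
  define J where "J = (\<integral>\<xi>. of_real (\<eta> \<bullet> \<xi>) * (e x \<xi> * u \<xi>) \<partial>mu)"
  have iJ: "integrable mu (\<lambda>\<xi>. of_real (\<eta> \<bullet> \<xi>) * (e x \<xi> * u \<xi>))"
    using integrable_eint[OF rap_coord[OF rapd_rap[OF u]], of \<eta> x] by (simp add: mult_ac inner_commute)
  have iI: "integrable mu (\<lambda>\<xi>. e x \<xi> * u \<xi>)" by (rule integrable_eint[OF rapd_rap[OF u] um])
  have Tu: "T \<eta> u \<xi> = - \<i> * of_real (\<eta> \<bullet> y) * u \<xi> - of_real (2 * b * (\<eta> \<bullet> \<xi>)) * u \<xi>" for \<xi>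
    unfolding u_def mult.commute[of "e _ (- y)"] T_gauss_mult[OF e_diff] T_e
    by (simp add: inner_commute algebra_simps)
  have "(\<integral>\<xi>. T \<eta> (\<lambda>\<xi>. e \<xi> x) \<xi> * u \<xi> \<partial>mu) = - (\<integral>\<xi>. e \<xi> x * T \<eta> u \<xi> \<partial>mu)"
    by (rule T_antisymmetric(3)[OF polyg_e u])
  also have "(\<integral>\<xi>. T \<eta> (\<lambda>\<xi>. e \<xi> x) \<xi> * u \<xi> \<partial>mu) = \<i> * of_real (\<eta> \<bullet> x) * eint u x"
    unfolding T_e eint_def e_symmetric[of x] by (simp add: mult.assoc)
  also have "(\<integral>\<xi>. e \<xi> x * T \<eta> u \<xi> \<partial>mu) = (\<integral>\<xi>. - \<i> * of_real (\<eta> \<bullet> y) * (e x \<xi> * u \<xi>) - of_real (2 * b) * (of_real (\<eta> \<bullet> \<xi>) * (e x \<xi> * u \<xi>)) \<partial>mu)"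
    unfolding Tu e_symmetric[of x] by (intro Bochner_Integration.integral_cong refl) (simp add: algebra_simps)
  also have "\<dots> = - \<i> * of_real (\<eta> \<bullet> y) * eint u x - of_real (2 * b) * J"
    unfolding eint_def J_def
    by (subst Bochner_Integration.integral_diff[OF integrable_mult_right[OF iI] integrable_mult_right[OF iJ]]) simp
  finally have "of_real (2 * b) * J = \<i> * of_real (\<eta> \<bullet> (x - y)) * eint u x"
    by (simp add: inner_diff_right algebra_simps)
  then have J: "J = \<i> * of_real (\<eta> \<bullet> (x - y) / (2 * b)) * eint u x"
    using b by (simp add: field_simps)
  have "T \<eta> (eint u) x = \<i> * J"
    unfolding T_eint[OF rapd_rap[OF u] um] unfolding eint_def J_def
    by (subst integral_mult_right_zero[symmetric]) (intro Bochner_Integration.integral_cong refl, simp only: mult_ac)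
  also have "\<dots> = - of_real (\<eta> \<bullet> (x - y) / (2 * b)) * eint u x"
    unfolding J by (simp flip: mult.assoc)
  finally show ?thesis unfolding u_def .
qed

text \<open>Multiplication by \<open>gauss (- a)\<close> turns the equation of
  \<open>heat_kernel_T\<close> into the eigenvalue equation of the kernel. By
  \<open>T_eigenfunction\<close> only the value at x = 0 remains open.\<close>

lemma heat_kernel_aux:
  assumes b: "b > 0"
  shows "eint (\<lambda>\<xi>. e \<xi> (- y) * gauss b \<xi>) x = gauss (1 / (4 * b)) x * (eint (\<lambda>\<xi>. e \<xi> (- y) * gauss b \<xi>) 0
     * E (complex_vec x) (of_real (2 * (1 / (4 * b))) *s complex_vec y))"
proof -
  define u where "u = (\<lambda>\<xi>. e \<xi> (- y) * gauss b \<xi>)"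
  define a where "a = 1 / (4 * b)"
  have u: "rapd u" unfolding u_def by (rule rapd_e_gauss[OF b])
  have d: "eint u differentiable at x" for x
    by (rule polyg_diff[OF polyg_eint[OF rapd_rap[OF u] rapd_measurable[OF u]]])
  have dh: "(\<lambda>x. gauss (- a) x * eint u x) differentiable at x" for x
    by (rule differentiable_mult[OF diff_gauss d])
  have Th: "T \<eta> (\<lambda>x. gauss (- a) x * eint u x) x = cdot (complex_vec \<eta>) (of_real (2 * a) *s complex_vec y) * (gauss (- a) x * eint u x)" for \<eta> x
    unfolding T_gauss_mult[OF d] unfolding u_def heat_kernel_T[OF b] cdot_scale_right cdot_complex_vec a_def
    using b by (simp add: inner_diff_right inner_commute field_simps)
  have "gauss (- a) x * eint u x = (gauss (- a) (0 :: real ^ 'n) * eint u 0) * E (complex_vec x) (of_real (2 * a) *s complex_vec y)"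
    using T_eigenfunction[of "\<lambda>x. gauss (- a) x * eint u x", OF dh Th] .
  then have "gauss a x * (gauss (- a) x * eint u x) = gauss a x * (eint u 0 * E (complex_vec x) (of_real (2 * a) *s complex_vec y))"
    by simp
  then show ?thesis unfolding u_def a_def mult.assoc[symmetric] gauss_mult by simp
qed

text \<open>By symmetry of e the open value at x = 0 is the value at - y of the same integral with y
  = 0, to which \<open>heat_kernel_aux\<close> applies again.\<close>

lemma heat_kernel:
  assumes b: "b > 0"
  shows "eint (\<lambda>\<xi>. e \<xi> (- y) * gauss b \<xi>) x = Z b * Kern (1 / (4 * b)) x y"
proof -
  have "eint (\<lambda>\<xi>. e \<xi> (- y) * gauss b \<xi>) 0 = eint (\<lambda>\<xi>. e \<xi> (- 0) * gauss b \<xi>) (- y)"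
    by (simp add: eint_def e_symmetric[of "- y"])
  also have "\<dots> = gauss (1 / (4 * b)) y * Z b"
    by (subst heat_kernel_aux[OF b, of 0]) (simp add: eint_def Z_def)
  finally have "eint (\<lambda>\<xi>. e \<xi> (- y) * gauss b \<xi>) 0 = gauss (1 / (4 * b)) y * Z b" .
  then show ?thesis
    by (subst heat_kernel_aux[OF b]) (simp add: Kern_def)
qed

text \<open>By homogeneity of the measure both factors are \<open>ck\<close> times powers of scales
  c and d with c * d = 1. This is the inversion formula of the transform on Gaussians.\<close>

lemma Z_mult: "b > 0 \<Longrightarrow> Z b * Z (1 / (4 * b)) = (of_real ck)\<^sup>2"
proof -
  assume b: "b > 0"
  define c d where "c = 1 / sqrt (2 * b)" and "d = 1 / sqrt (2 * (1 / (4 * b)))"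
  have cd: "c * d = 1" 
  proof -
    have "sqrt (2 * b) * sqrt (2 * (1 / (4 * b))) = sqrt ((2 * b) * (2 * (1 / (4 * b))))" by (rule real_sqrt_mult[symmetric])
    also have "\<dots> = 1" using b by simp
    finally have "1 / (sqrt (2 * b) * sqrt (2 * (1 / (4 * b)))) = 1" by simp
    then show ?thesis unfolding c_def d_def times_divide_times_eq by simp
  qed
  have c: "c > 0" "d > 0" using b by (simp_all add: c_def d_def)
  have "(c ^ CARD('n) * c powr (2 * gam)) * (d ^ CARD('n) * d powr (2 * gam)) = (c * d) ^ CARD('n) * (c * d) powr (2 * gam)"
    using c by (simp add: power_mult_distrib powr_mult mult_ac)
  then have "(c ^ CARD('n) * c powr (2 * gam)) * (d ^ CARD('n) * d powr (2 * gam)) = 1" by (simp add: cd)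
  then have *: "complex_of_real (c ^ CARD('n) * c powr (2 * gam)) * of_real (d ^ CARD('n) * d powr (2 * gam)) = 1"
    by (simp only: of_real_1 flip: of_real_mult)
  have "Z b = of_real (c ^ CARD('n) * c powr (2 * gam)) * of_real ck" "Z (1 / (4 * b)) = of_real (d ^ CARD('n) * d powr (2 * gam)) * of_real ck"
    using integral_gauss[OF b] integral_gauss[of "1 / (4 * b)"] b unfolding Z_def c_def d_def by simp_all
  then have "Z b * Z (1 / (4 * b)) = (complex_of_real (c ^ CARD('n) * c powr (2 * gam)) * of_real (d ^ CARD('n) * d powr (2 * gam))) * (of_real ck)\<^sup>2"
    by (simp only: power2_eq_square mult_ac)
  then show ?thesis unfolding * by simp
qed

section \<open>The Dunkl transform on polynomials times Gaussians\<close>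

abbreviation F :: "(real ^ 'n \<Rightarrow> complex) \<Rightarrow> real ^ 'n \<Rightarrow> complex" where "F \<equiv> dunkl_transform R k"
abbreviation Finv :: "(real ^ 'n \<Rightarrow> complex) \<Rightarrow> real ^ 'n \<Rightarrow> complex" where "Finv \<equiv> dunkl_inverse_transform R k"

lemma F_def: "F f \<xi> = inverse (of_real ck) * (\<integral>x. e (- \<xi>) x * f x \<partial>mu)"
  unfolding dunkl_transform_def dunkl_kernel_e ..

lemma Finv_eq: "Finv f x = F f (- x)"
  unfolding F_def dunkl_inverse_transform_def dunkl_kernel_e e_symmetric[of _ x] by simp

lemma F_eint: "f \<in> borel_measurable borel \<Longrightarrow> F f \<xi> = inverse (of_real ck) * eint (\<lambda>x. f (- x)) \<xi>"
  unfolding F_def eint_def using integral_mu_uminus[of "\<lambda>x. e \<xi> x * f (- x)"]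
  by (simp add: e_uminus)

lemma F_eint': "F f \<xi> = inverse (of_real ck) * eint f (- \<xi>)"
  by (simp add: F_def eint_def)

definition gbase :: "(unit \<Rightarrow> real ^ 'n \<Rightarrow> complex) set" where "gbase = {\<lambda>_. gauss a | a. a > 0}"
definition Dcl :: "(real ^ 'n \<Rightarrow> complex) set" where "Dcl = {f. (\<lambda>_. f) \<in> cspan UNIV gbase}"

lemma Dcl_gauss: "a > 0 \<Longrightarrow> gauss a \<in> Dcl" and Dcl_zero: "(\<lambda>x. 0) \<in> Dcl"
  and Dcl_add: "f \<in> Dcl \<Longrightarrow> g \<in> Dcl \<Longrightarrow> (\<lambda>x. f x + g x) \<in> Dcl"
  and Dcl_scale: "f \<in> Dcl \<Longrightarrow> (\<lambda>x. c * f x) \<in> Dcl"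
  and Dcl_coord: "f \<in> Dcl \<Longrightarrow> (\<lambda>x. of_real (x \<bullet> \<zeta>) * f x) \<in> Dcl"
  unfolding Dcl_def by (auto intro: cspan.intros simp: gbase_def)

lemma Dcl_induct [consumes 1, case_names gauss zero add scale coord]:
  assumes "f \<in> Dcl" "\<And>a. a > 0 \<Longrightarrow> P (gauss a)" "P (\<lambda>x. 0)"
    "\<And>f g. f \<in> Dcl \<Longrightarrow> g \<in> Dcl \<Longrightarrow> P f \<Longrightarrow> P g \<Longrightarrow> P (\<lambda>x. f x + g x)"
    "\<And>c f. f \<in> Dcl \<Longrightarrow> P f \<Longrightarrow> P (\<lambda>x. c * f x)"
    "\<And>\<zeta> f. f \<in> Dcl \<Longrightarrow> P f \<Longrightarrow> P (\<lambda>x. of_real (x \<bullet> \<zeta>) * f x)"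
  shows "P f"
proof -
  have "u () \<in> Dcl \<and> P (u ())" if "u \<in> cspan UNIV gbase" for u
    using that
    by (induction rule: cspan.induct)
       (auto simp: gbase_def intro: assms(2-) Dcl_gauss Dcl_zero Dcl_add Dcl_scale Dcl_coord)
  from this[of "\<lambda>_. f"] show ?thesis using assms(1) by (auto simp: Dcl_def)
qed

lemma Dcl_rapd: "f \<in> Dcl \<Longrightarrow> rapd f"
  by (induction rule: Dcl_induct) (auto intro: rapd_gauss rapd_zero rapd_add rapd_cmult rapd_mult[OF polyg_coord])

lemma Dcl_rap: "f \<in> Dcl \<Longrightarrow> rap f" and Dcl_diff: "f \<in> Dcl \<Longrightarrow> f differentiable at x"
  and Dcl_measurable: "f \<in> Dcl \<Longrightarrow> f \<in> borel_measurable borel"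
  using Dcl_rapd rapd_rap rapd_diff rapd_measurable by blast+

lemma Dcl_integrable: "f \<in> Dcl \<Longrightarrow> integrable mu f"
  by (rule integrable_rap[OF Dcl_rap Dcl_measurable])

lemma Dcl_T: assumes "f \<in> Dcl" shows "T \<eta> f \<in> Dcl"
proof -
  have "(\<lambda>p::unit. T \<eta> ((\<lambda>_. f) p)) \<in> cspan UNIV gbase"
  proof (rule cspan_props(3)[where u = "\<lambda>_. f"])
    fix u :: "unit \<Rightarrow> real ^ 'n \<Rightarrow> complex" and p x \<eta> g assume "u \<in> gbase"
    then obtain a where a: "a > 0" "u = (\<lambda>_. gauss a)" by (auto simp: gbase_def)
    show "u p differentiable at x" by (simp add: a diff_gauss)
    show "(\<lambda>p x. u p (g x)) \<in> cspan UNIV gbase" if "g \<in> G"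
      using a that by (auto simp: gauss_G gbase_def intro!: cspan.base)
    have "T \<eta> (gauss a) x = of_real (- 2 * a) * (of_real (x \<bullet> \<eta>) * gauss a x)" for x
      using T_gauss_mult[of "\<lambda>_. 1" x \<eta> a] by simp
    then have "(\<lambda>p::unit. T \<eta> (gauss a)) = (\<lambda>p x. of_real (- 2 * a) * (of_real (x \<bullet> \<eta>) * gauss a x))"
      by (simp add: fun_eq_iff)
    also have "\<dots> \<in> cspan UNIV gbase"
    proof -
      have "(\<lambda>_. gauss a) \<in> cspan UNIV gbase" using a by (auto simp: gbase_def intro!: cspan.base)
      from cspan.scale[OF UNIV_I cspan.coord[OF this]] show ?thesis .
    qed
    finally show "(\<lambda>p. T \<eta> (u p)) \<in> cspan UNIV gbase" by (simp add: a)
  qed (use assms in \<open>auto simp: Dcl_def\<close>)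
  then show ?thesis by (simp add: Dcl_def)
qed

lemma F_add: "rap f \<Longrightarrow> f \<in> borel_measurable borel \<Longrightarrow> rap g \<Longrightarrow> g \<in> borel_measurable borel \<Longrightarrow>
   F (\<lambda>x. f x + g x) \<xi> = F f \<xi> + F g \<xi>"
  unfolding F_def distrib_left by (simp add: integrable_eint distrib_left)

lemma F_cmult: "F (\<lambda>x. c * f x) \<xi> = c * F f \<xi>"
  unfolding F_def by (subst mult.left_commute) simp

lemma F_gauss: "a > 0 \<Longrightarrow> F (gauss a) \<xi> = (Z a / of_real ck) * gauss (1 / (4 * a)) \<xi>"
proof -
  assume a: "a > 0"
  have "Kern b x 0 = gauss b x" for b x by (simp add: Kern_def)
  then have "eint (gauss a) (- \<xi>) = Z a * gauss (1 / (4 * a)) \<xi>"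
    using heat_kernel[OF a, of 0 "- \<xi>"] by simp
  then show ?thesis unfolding F_eint' by (simp add: field_simps)
qed

lemma F_coord: assumes "rap f" and [measurable]: "f \<in> borel_measurable borel"
  shows "F (\<lambda>x. of_real (x \<bullet> \<zeta>) * f x) \<xi> = \<i> * T \<zeta> (F f) \<xi>"
proof -
  have r: "rap (\<lambda>x. f (- x))" by (rule rap_comp_isometry[OF assms(1)]) simp
  have m: "(\<lambda>x. f (- x)) \<in> borel_measurable borel" by measurable
  have "F f = (\<lambda>\<xi>. inverse (of_real ck) * eint (\<lambda>x. f (- x)) \<xi>)" by (rule ext) (rule F_eint, measurable)
  then have "T \<zeta> (F f) \<xi> = inverse (of_real ck) * eint (\<lambda>x. \<i> * of_real (\<zeta> \<bullet> x) * f (- x)) \<xi>"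
    by (simp add: T_cmult polyg_diff[OF polyg_eint[OF r m]] T_eint[OF r m])
  moreover have "eint (\<lambda>x. \<i> * of_real (\<zeta> \<bullet> x) * f (- x)) \<xi> = - \<i> * eint (\<lambda>x. of_real ((- x) \<bullet> \<zeta>) * f (- x)) \<xi>"
    unfolding eint_def by (subst integral_mult_right_zero[symmetric]) (intro Bochner_Integration.integral_cong refl, simp add: inner_commute mult_ac)
  moreover have "F (\<lambda>x. of_real (x \<bullet> \<zeta>) * f x) \<xi> = inverse (of_real ck) * eint (\<lambda>x. of_real ((- x) \<bullet> \<zeta>) * f (- x)) \<xi>"
    by (rule F_eint) measurable
  ultimately show ?thesis by (simp add: mult.left_commute)
qed

lemma F_T: assumes "rapd f" shows "F (T \<eta> f) \<xi> = \<i> * of_real (\<eta> \<bullet> \<xi>) * F f \<xi>"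
proof -
  have "(\<integral>x. e x (- \<xi>) * T \<eta> f x \<partial>mu) = - (\<integral>x. T \<eta> (\<lambda>x. e x (- \<xi>)) x * f x \<partial>mu)"
    using T_antisymmetric(3)[OF polyg_e assms, of \<eta> "- \<xi>"] by simp
  also have "\<dots> = \<i> * of_real (\<eta> \<bullet> \<xi>) * (\<integral>x. e x (- \<xi>) * f x \<partial>mu)"
    unfolding T_e by (simp add: mult.assoc)
  finally show ?thesis unfolding F_def e_symmetric[of "- \<xi>"] by (simp add: mult_ac)
qed

lemma F_Dcl: "f \<in> Dcl \<Longrightarrow> F f \<in> Dcl"
proof (induction rule: Dcl_induct)
  case (gauss a)
  have "F (gauss a) = (\<lambda>\<xi>. (Z a / of_real ck) * gauss (1 / (4 * a)) \<xi>)" using gauss by (simp add: fun_eq_iff F_gauss)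
  then show ?case using gauss Dcl_scale[OF Dcl_gauss[of "1 / (4 * a)"], of "Z a / of_real ck"] by (simp only:) simp
next
  case zero
  have "F (\<lambda>x. 0) = (\<lambda>\<xi>. 0)" by (simp add: fun_eq_iff F_def)
  then show ?case by (simp add: Dcl_zero)
next
  case (add f g)
  have "F (\<lambda>x. f x + g x) = (\<lambda>\<xi>. F f \<xi> + F g \<xi>)" using add by (simp add: fun_eq_iff F_add Dcl_rap Dcl_measurable)
  then show ?case using add by (simp add: Dcl_add)
next
  case (scale c f)
  have "F (\<lambda>x. c * f x) = (\<lambda>\<xi>. c * F f \<xi>)" by (simp add: fun_eq_iff F_cmult)
  then show ?case using scale by (simp add: Dcl_scale)
next
  case (coord \<zeta> f)
  have "F (\<lambda>x. of_real (x \<bullet> \<zeta>) * f x) = (\<lambda>\<xi>. \<i> * T \<zeta> (F f) \<xi>)"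
    by (rule ext) (rule F_coord[OF Dcl_rap[OF coord(1)] Dcl_measurable[OF coord(1)]])
  then show ?case using coord by (simp add: Dcl_scale Dcl_T)
qed

text \<open>For Gaussians this is \<open>Z_mult\<close>. It spreads over the class since F turns a
  coordinate into \<i> T and T back into \<i> times a coordinate; the product of the two factors
  \<i> accounts for the sign in f (- x).\<close>

lemma F_F: "f \<in> Dcl \<Longrightarrow> F (F f) x = f (- x)"
proof (induction arbitrary: x rule: Dcl_induct)
  case (gauss a)
  have "F (gauss a) = (\<lambda>\<xi>. (Z a / of_real ck) * gauss (1 / (4 * a)) \<xi>)" using gauss by (simp add: fun_eq_iff F_gauss)
  then have "F (F (gauss a)) x = (Z a * Z (1 / (4 * a))) / (of_real ck)\<^sup>2 * gauss (1 / (4 * (1 / (4 * a)))) x"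
    using gauss by (simp only: F_cmult) (simp add: F_gauss power2_eq_square)
  also have "\<dots> = gauss a x" using gauss ck_pos by (simp add: Z_mult)
  finally show ?case by simp
next
  case zero
  have "F (\<lambda>x. 0) = (\<lambda>\<xi>. 0)" by (simp add: fun_eq_iff F_def)
  then show ?case by simp
next
  case (add f g)
  have "F (\<lambda>x. f x + g x) = (\<lambda>\<xi>. F f \<xi> + F g \<xi>)" using add by (simp add: fun_eq_iff F_add Dcl_rap Dcl_measurable)
  then show ?case using add by (simp add: F_add Dcl_rap Dcl_measurable F_Dcl)
next
  case (scale c f)
  have "F (\<lambda>x. c * f x) = (\<lambda>\<xi>. c * F f \<xi>)" by (simp add: fun_eq_iff F_cmult)
  then show ?case using scale by (simp add: F_cmult)
next
  case (coord \<zeta> f)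
  have "F (\<lambda>x. of_real (x \<bullet> \<zeta>) * f x) = (\<lambda>\<xi>. \<i> * T \<zeta> (F f) \<xi>)"
    by (rule ext) (rule F_coord[OF Dcl_rap[OF coord(1)] Dcl_measurable[OF coord(1)]])
  then show ?case using coord by (simp add: F_cmult F_T[OF Dcl_rapd[OF F_Dcl]] inner_commute flip: mult.assoc)
qed

lemma Dcl_cnj: "f \<in> Dcl \<Longrightarrow> (\<lambda>x. cnj (f x)) \<in> Dcl"
proof (induction rule: Dcl_induct)
  case (gauss a)
  have "cnj (gauss a x) = gauss a x" for x :: "real ^ 'n" by (simp add: gauss_def)
  then show ?case using gauss by (simp add: Dcl_gauss)
qed (auto intro: Dcl_zero Dcl_add Dcl_scale Dcl_coord)

lemma Dcl_uminus: "f \<in> Dcl \<Longrightarrow> (\<lambda>x. f (- x)) \<in> Dcl"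
proof (induction rule: Dcl_induct)
  case (coord \<zeta> f)
  then show ?case using Dcl_scale[OF Dcl_coord[OF coord.IH, of \<zeta>], of "- 1"] by simp
qed (auto intro: Dcl_gauss Dcl_zero Dcl_add Dcl_scale)

lemma Dcl_gauss_mult: "f \<in> Dcl \<Longrightarrow> a > 0 \<Longrightarrow> (\<lambda>x. gauss a x * f x) \<in> Dcl"
proof (induction rule: Dcl_induct)
  case (gauss b)
  then show ?case by (simp add: gauss_mult Dcl_gauss)
next
  case (add f g)
  then show ?case by (simp add: distrib_left Dcl_add)
next
  case (scale c f)
  then show ?case by (simp add: mult.left_commute[of "gauss a _"] Dcl_scale)
next
  case (coord \<zeta> f)
  then show ?case by (simp add: mult.left_commute[of "gauss a _"] Dcl_coord)
qed (simp add: Dcl_zero)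

end

section \<open>Square integrable functions\<close>

abbreviation sqint :: "'a measure \<Rightarrow> ('a \<Rightarrow> complex) \<Rightarrow> real" where
  "sqint M f \<equiv> (\<integral>x. (norm (f x))\<^sup>2 \<partial>M)"

lemma L2_D: assumes "f \<in> L2_space M" shows L2_measurable: "f \<in> borel_measurable M"
    and L2_integrable: "integrable M (\<lambda>x. (norm (f x))\<^sup>2)"
  using assms by (auto simp: L2_space_def)

lemma L2_bound:
  assumes f: "f \<in> borel_measurable M" and g: "g \<in> L2_space M"
    and b: "AE x in M. norm (f x) \<le> c * norm (g x)"
  shows "f \<in> L2_space M"
proof -
  note [measurable] = f L2_measurable[OF g]
  have "integrable M (\<lambda>x. (norm (f x))\<^sup>2)"
  proof (rule Bochner_Integration.integrable_bound[OF integrable_mult_right[OF L2_integrable[OF g], of "c\<^sup>2"]])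
    show "AE x in M. norm ((norm (f x))\<^sup>2) \<le> norm (c\<^sup>2 * (norm (g x))\<^sup>2)"
      using b
    proof eventually_elim
      case (elim x)
      have "(norm (f x))\<^sup>2 \<le> (c * norm (g x))\<^sup>2" using elim by (intro power_mono) auto
      then show ?case by (simp add: power_mult_distrib)
    qed
  qed measurable
  then show ?thesis using f by (simp add: L2_space_def)
qed

lemma sq_norm_add: "(norm (a + b))\<^sup>2 \<le> 2 * (norm a)\<^sup>2 + 2 * (norm b)\<^sup>2" for a b :: complex
proof -
  have "(norm (a + b))\<^sup>2 \<le> (norm a + norm b)\<^sup>2" by (intro power_mono norm_triangle_ineq) auto
  also have "\<dots> \<le> 2 * (norm a)\<^sup>2 + 2 * (norm b)\<^sup>2" using sum_squares_bound[of "norm a" "norm b"] by (simp add: power2_sum)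
  finally show ?thesis .
qed

lemma L2_add: assumes f: "f \<in> L2_space M" and g: "g \<in> L2_space M"
  shows "(\<lambda>x. f x + g x) \<in> L2_space M" "sqint M (\<lambda>x. f x + g x) \<le> 2 * sqint M f + 2 * sqint M g"
proof -
  note [measurable] = L2_measurable[OF f] L2_measurable[OF g]
  have i: "integrable M (\<lambda>x. 2 * (norm (f x))\<^sup>2 + 2 * (norm (g x))\<^sup>2)"
    using L2_integrable[OF f] L2_integrable[OF g] by auto
  have "integrable M (\<lambda>x. (norm (f x + g x))\<^sup>2)"
    by (rule Bochner_Integration.integrable_bound[OF i]) (use sq_norm_add in auto)
  then show L: "(\<lambda>x. f x + g x) \<in> L2_space M" by (simp add: L2_space_def)
  have "sqint M (\<lambda>x. f x + g x) \<le> (\<integral>x. 2 * (norm (f x))\<^sup>2 + 2 * (norm (g x))\<^sup>2 \<partial>M)"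
    by (rule integral_mono[OF L2_integrable[OF L] i]) (rule sq_norm_add)
  also have "\<dots> = 2 * sqint M f + 2 * sqint M g"
    using L2_integrable[OF f] L2_integrable[OF g] by simp
  finally show "sqint M (\<lambda>x. f x + g x) \<le> 2 * sqint M f + 2 * sqint M g" .
qed

lemma L2_cmult: assumes f: "f \<in> L2_space M"
  shows "(\<lambda>x. c * f x) \<in> L2_space M" "sqint M (\<lambda>x. c * f x) = (norm c)\<^sup>2 * sqint M f"
  using L2_D[OF f] by (auto simp: L2_space_def norm_mult power_mult_distrib)

lemma L2_cnj: "f \<in> L2_space M \<Longrightarrow> (\<lambda>x. cnj (f x)) \<in> L2_space M"
  by (auto simp: L2_space_def intro: measurable_compose[OF _ borel_measurable_continuous_onI[OF continuous_on_cnj[OF continuous_on_id]]])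

lemma L2_diff: assumes f: "f \<in> L2_space M" and g: "g \<in> L2_space M"
  shows "(\<lambda>x. f x - g x) \<in> L2_space M"
  using L2_add(1)[OF f L2_cmult(1)[OF g, of "- 1"]] by simp

lemma L2_triangle:
  assumes "f \<in> L2_space M" "g \<in> L2_space M" "h \<in> L2_space M"
  shows "sqint M (\<lambda>x. f x - h x) \<le> 2 * sqint M (\<lambda>x. f x - g x) + 2 * sqint M (\<lambda>x. g x - h x)"
  using L2_add(2)[OF L2_diff[OF assms(1,2)] L2_diff[OF assms(2,3)]] by simp

lemma L2_minus_sym: "sqint M (\<lambda>x. f x - g x) = sqint M (\<lambda>x. g x - f x)"
  by (simp add: norm_minus_commute)

text \<open>The free parameter t lets the weighted inequality between arithmetic and geometric means
  play the part of Cauchy-Schwarz without square roots of integrals.\<close>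

lemma L2_mult: assumes f: "f \<in> L2_space M" and g: "g \<in> L2_space M"
  shows "integrable M (\<lambda>x. f x * g x)"
    "t > 0 \<Longrightarrow> norm (\<integral>x. f x * g x \<partial>M) \<le> t * sqint M f + sqint M g / t"
proof -
  note [measurable] = L2_measurable[OF f] L2_measurable[OF g]
  have le: "norm (f x * g x) \<le> t * (norm (f x))\<^sup>2 + (norm (g x))\<^sup>2 / t" if "t > 0" for t x
  proof -
    have "0 \<le> (t * norm (f x) - norm (g x))\<^sup>2" by simp
    then have "2 * (t * (norm (f x) * norm (g x))) \<le> t * (t * (norm (f x))\<^sup>2) + (norm (g x))\<^sup>2"
      by (simp add: power2_diff power2_eq_square algebra_simps)
    moreover have "0 \<le> t * (norm (f x) * norm (g x))" using that by simp
    ultimately have "t * (norm (f x) * norm (g x)) \<le> t * (t * (norm (f x))\<^sup>2) + (norm (g x))\<^sup>2" by linarith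
    then have "t * (norm (f x) * norm (g x)) \<le> t * (t * (norm (f x))\<^sup>2 + (norm (g x))\<^sup>2 / t)"
      using that by (simp add: distrib_left)
    then show ?thesis using that by (simp add: norm_mult)
  qed
  have i: "integrable M (\<lambda>x. t * (norm (f x))\<^sup>2 + (norm (g x))\<^sup>2 / t)" for t
    using L2_integrable[OF f] L2_integrable[OF g] by auto
  show ifg: "integrable M (\<lambda>x. f x * g x)"
    by (rule Bochner_Integration.integrable_bound[OF i[of 1]]) (use le[of 1] in auto)
  assume t: "t > 0"
  have "norm (\<integral>x. f x * g x \<partial>M) \<le> (\<integral>x. t * (norm (f x))\<^sup>2 + (norm (g x))\<^sup>2 / t \<partial>M)"
    by (rule order_trans[OF Bochner_Integration.integral_norm_bound integral_mono[OF integrable_norm[OF ifg] i[of t]]]) (rule le[OF t])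
  then show "norm (\<integral>x. f x * g x \<partial>M) \<le> t * sqint M f + sqint M g / t"
    using L2_integrable[OF f] L2_integrable[OF g] by simp
qed

lemma sqint_nonneg: "0 \<le> sqint M f" by simp

lemma L2_tendsto_pairing:
  assumes \<phi>: "L2_tendsto M \<phi> f" and h: "h \<in> L2_space M"
  shows "(\<lambda>n. \<integral>x. h x * \<phi> n x \<partial>M) \<longlonglongrightarrow> (\<integral>x. h x * f x \<partial>M)"
proof (rule LIMSEQ_I)
  fix r :: real assume r: "r > 0"
  have L: "\<phi> n \<in> L2_space M" "f \<in> L2_space M" for n using \<phi> by (auto simp: L2_tendsto_def)
  \<comment> \<open>This weight makes the contribution of h at most r / 2 independently of n; the
    summand 1 keeps the denominator positive.\<close>
  define t where "t = r / (2 * (sqint M h + 1))"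
  have t: "t > 0" "t * sqint M h \<le> r / 2"
  proof -
    have p: "sqint M h + 1 > 0" using sqint_nonneg[of M h] by linarith
    show "t > 0" using r p by (simp add: t_def)
    have "t * sqint M h \<le> t * (sqint M h + 1)" using \<open>t > 0\<close> by simp
    also have "\<dots> = r / 2"
    proof -
      have "r / (2 * c) * c = r / 2" if "c \<noteq> 0" for c :: real using that by simp
      from this[of "sqint M h + 1"] p show ?thesis unfolding t_def by linarith
    qed
    finally show "t * sqint M h \<le> r / 2" .
  qed
  have "(\<lambda>n. sqint M (\<lambda>x. \<phi> n x - f x)) \<longlonglongrightarrow> 0" using \<phi> by (simp add: L2_tendsto_def)
  from LIMSEQ_D[OF this, of "t * (r / 2)"] obtain N where
    N: "\<And>n. n \<ge> N \<Longrightarrow> sqint M (\<lambda>x. \<phi> n x - f x) < t * (r / 2)" using t r by auto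
  have "norm ((\<integral>x. h x * \<phi> n x \<partial>M) - (\<integral>x. h x * f x \<partial>M)) < r" if "n \<ge> N" for n
  proof -
    have "(\<integral>x. h x * \<phi> n x \<partial>M) - (\<integral>x. h x * f x \<partial>M) = (\<integral>x. h x * (\<phi> n x - f x) \<partial>M)"
      using L2_mult(1)[OF h L(1)] L2_mult(1)[OF h L(2)] by (simp add: right_diff_distrib Bochner_Integration.integral_diff)
    also have "norm \<dots> \<le> t * sqint M h + sqint M (\<lambda>x. \<phi> n x - f x) / t"
      by (rule L2_mult(2)[OF h L2_diff[OF L] t(1)])
    also have "\<dots> < r / 2 + r / 2"
    proof (rule add_le_less_mono)
      show "t * sqint M h \<le> r / 2" by (rule t(2))
      show "sqint M (\<lambda>x. \<phi> n x - f x) / t < r / 2" using N[OF that] t(1) by (simp add: divide_less_eq mult.commute)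
    qed
    finally show ?thesis by simp
  qed
  then show "\<exists>no. \<forall>n\<ge>no. norm ((\<integral>x. h x * \<phi> n x \<partial>M) - (\<integral>x. h x * f x \<partial>M)) < r" by blast
qed

lemma L2_tendsto_dominated:
  assumes m: "\<And>n. f n \<in> borel_measurable M" "g \<in> borel_measurable M" and w: "integrable M (\<lambda>x. (w x)\<^sup>2)"
    and b: "\<And>n. AE x in M. norm (f n x) \<le> w x" and lim: "AE x in M. (\<lambda>n. f n x) \<longlonglongrightarrow> g x"
  shows "L2_tendsto M f g"
proof -
  note [measurable] = m
  have bg: "AE x in M. norm (g x) \<le> w x"
  proof -
    have "AE x in M. \<forall>n. norm (f n x) \<le> w x" using b by (simp add: AE_all_countable)
    with lim show ?thesis
    proof eventually_elim
      case (elim x)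
      then show ?case by (intro Lim_bounded[OF tendsto_norm[OF elim(1)]]) auto
    qed
  qed
  have L: "h \<in> L2_space M" if [measurable]: "h \<in> borel_measurable M" and h: "AE x in M. norm (h x) \<le> w x" for h
  proof -
    have "integrable M (\<lambda>x. (norm (h x))\<^sup>2)"
    proof (rule Bochner_Integration.integrable_bound[OF w])
      show "AE x in M. norm ((norm (h x))\<^sup>2) \<le> norm ((w x)\<^sup>2)"
        using h by eventually_elim (auto intro!: power_mono)
    qed measurable
    then show ?thesis by (simp add: L2_space_def that)
  qed
  have "(\<lambda>n. sqint M (\<lambda>x. f n x - g x)) \<longlonglongrightarrow> (\<integral>x. 0 \<partial>M)"
  proof (rule integral_dominated_convergence[where w = "\<lambda>x. 4 * (w x)\<^sup>2"])
    show "integrable M (\<lambda>x. 4 * (w x)\<^sup>2)" using w by simp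
    show "AE x in M. (\<lambda>n. (norm (f n x - g x))\<^sup>2) \<longlonglongrightarrow> 0"
      using lim
    proof eventually_elim
      case (elim x)
      then have "(\<lambda>n. f n x - g x) \<longlonglongrightarrow> 0" by (simp add: LIM_zero)
      from tendsto_power[OF tendsto_norm[OF this], of 2] show ?case by simp
    qed
    show "AE x in M. norm ((norm (f n x - g x))\<^sup>2) \<le> 4 * (w x)\<^sup>2" for n
      using b[of n] bg
    proof eventually_elim
      case (elim x)
      have "(norm (f n x - g x))\<^sup>2 \<le> 2 * (norm (f n x))\<^sup>2 + 2 * (norm (g x))\<^sup>2"
        using sq_norm_add[of "f n x" "- g x"] by simp
      also have "\<dots> \<le> 2 * (w x)\<^sup>2 + 2 * (w x)\<^sup>2"
        using elim by (intro add_mono mult_left_mono power_mono) auto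
      finally show ?case by simp
    qed
  qed measurable
  then show ?thesis using L[OF m(1) b] L[OF m(2) bg] by (simp add: L2_tendsto_def)
qed

text \<open>The weights \<open>2 ^ k\<close> make almost everywhere convergence of a
  fast subsequence visible in a single monotone convergence argument.\<close>

lemma L2_complete:
  assumes L: "\<And>n. \<phi> n \<in> L2_space M"
    and C: "\<And>\<epsilon>. \<epsilon> > 0 \<Longrightarrow> \<exists>N. \<forall>m\<ge>N. \<forall>n\<ge>N. sqint M (\<lambda>x. \<phi> m x - \<phi> n x) < \<epsilon>"
  shows "\<exists>g. L2_tendsto M \<phi> g"
proof -
  have "\<exists>N. \<forall>m\<ge>N. \<forall>n\<ge>N. sqint M (\<lambda>x. \<phi> m x - \<phi> n x) < (1/8) ^ k" for k :: nat
    by (rule C) simp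
  then obtain N where N: "\<And>k m n. m \<ge> N k \<Longrightarrow> n \<ge> N k \<Longrightarrow> sqint M (\<lambda>x. \<phi> m x - \<phi> n x) < (1/8) ^ k"
    by metis
  \<comment> \<open>The sum dominates every N i with i \<le> k, so consecutive indices are both
    beyond N k. The summand k makes the indices unbounded, which the argument with Fatou's lemma
    needs.\<close>
  define r where "r k = k + (\<Sum>i\<le>k. N i)" for k
  have r1: "N k \<le> r k" for k using member_le_sum[of k "{..k}" N] by (simp add: r_def)
  have r2: "N k \<le> r (Suc k)" for k using r1[of k] by (simp add: r_def)
  have r3: "k \<le> r k" for k by (simp add: r_def)
  have [measurable]: "\<phi> n \<in> borel_measurable M" for n by (rule L2_measurable[OF L])
  define d where "d k x = \<phi> (r (Suc k)) x - \<phi> (r k) x" for k x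
  have [measurable]: "d k \<in> borel_measurable M" for k unfolding d_def by measurable
  have dL: "d k \<in> L2_space M" for k unfolding d_def by (intro L2_diff L)
  have ds: "sqint M (d k) \<le> (1/8) ^ k" for k
    unfolding d_def using N[OF r2 r1, of k] by simp
  have nn: "(\<integral>\<^sup>+x. ennreal ((norm (d k x))\<^sup>2) \<partial>M) = ennreal (sqint M (d k))" for k
    by (rule nn_integral_eq_integral[OF L2_integrable[OF dL]]) simp
  have "(\<integral>\<^sup>+x. (\<Sum>k. ennreal (2 ^ k) * ennreal ((norm (d k x))\<^sup>2)) \<partial>M) = (\<Sum>k. ennreal (2 ^ k) * ennreal (sqint M (d k)))"
    by (subst nn_integral_suminf) (auto simp: nn_integral_cmult nn)
  also have "\<dots> \<le> (\<Sum>k. ennreal ((1/4) ^ k))"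
  proof (rule suminf_le)
    fix k
    have "2 ^ k * sqint M (d k) \<le> 2 ^ k * (1/8) ^ k" by (intro mult_left_mono ds) auto
    also have "\<dots> = (1/4) ^ k" by (simp flip: power_mult_distrib)
    finally show "ennreal (2 ^ k) * ennreal (sqint M (d k)) \<le> ennreal ((1/4) ^ k)"
      by (simp add: ennreal_mult[symmetric] ennreal_leI)
  qed auto
  also have "\<dots> < \<infinity>"
    by (subst suminf_ennreal2) (simp_all add: summable_geometric)
  finally have "(\<integral>\<^sup>+x. (\<Sum>k. ennreal (2 ^ k) * ennreal ((norm (d k x))\<^sup>2)) \<partial>M) \<noteq> \<infinity>" by simp
  then have "AE x in M. (\<Sum>k. ennreal (2 ^ k) * ennreal ((norm (d k x))\<^sup>2)) \<noteq> \<infinity>"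
    by (intro nn_integral_noteq_infinite) auto
  then have conv: "AE x in M. convergent (\<lambda>k. \<phi> (r k) x)"
  proof eventually_elim
    case (elim x)
    define c where "c = enn2real (\<Sum>k. ennreal (2 ^ k) * ennreal ((norm (d k x))\<^sup>2))"
    have c: "ennreal c = (\<Sum>k. ennreal (2 ^ k) * ennreal ((norm (d k x))\<^sup>2))" and c0: "c \<ge> 0"
      using elim unfolding c_def by (auto simp: less_top)
    have db: "norm (d k x) \<le> sqrt c * (sqrt (1/2)) ^ k" for k
    proof -
      have "ennreal (2 ^ k * (norm (d k x))\<^sup>2) \<le> ennreal c"
      proof -
        have "(\<Sum>j\<in>{k}. ennreal (2 ^ j) * ennreal ((norm (d j x))\<^sup>2)) \<le> (\<Sum>k. ennreal (2 ^ k) * ennreal ((norm (d k x))\<^sup>2))"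
          by (rule sum_le_suminf) auto
        then show ?thesis unfolding c by (simp add: ennreal_mult)
      qed
      then have "2 ^ k * (norm (d k x))\<^sup>2 \<le> c" using c0 by (simp add: ennreal_le_iff)
      then have "(norm (d k x))\<^sup>2 \<le> c * (1/2) ^ k" by (simp add: field_simps power_divide)
      then have "sqrt ((norm (d k x))\<^sup>2) \<le> sqrt (c * (1/2) ^ k)" by (rule real_sqrt_le_mono)
      then show ?thesis by (simp add: real_sqrt_mult real_sqrt_power)
    qed
    have "summable (\<lambda>k. d k x)"
    proof (rule summable_comparison_test'[of "\<lambda>k. sqrt c * (sqrt (1/2)) ^ k"])
      show "summable (\<lambda>k. sqrt c * (sqrt (1/2)) ^ k)"
        by (intro summable_mult summable_geometric) simp
    qed (rule db)
    moreover have "(\<lambda>n. \<phi> (r n) x) = (\<lambda>n. (\<Sum>k<n. d k x) + \<phi> (r 0) x)"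
    proof
      fix n show "\<phi> (r n) x = (\<Sum>k<n. d k x) + \<phi> (r 0) x"
        by (induction n) (auto simp: d_def)
    qed
    ultimately show ?case
      by (simp add: summable_iff_convergent convergent_add_const_right_iff)
  qed
  define g where "g x = lim (\<lambda>k. \<phi> (r k) x)" for x
  have gm [measurable]: "g \<in> borel_measurable M" unfolding g_def by measurable
  have lim: "AE x in M. (\<lambda>k. \<phi> (r k) x) \<longlonglongrightarrow> g x"
    using conv by eventually_elim (simp add: g_def convergent_LIMSEQ_iff)
  \<comment> \<open>Almost everywhere convergence holds along \<open>r\<close> only. Fatou's lemma
    for fixed n turns the Cauchy condition into a bound for g - \<phi> n, and as n is arbitrary the
    whole sequence converges in mean.\<close>
  have fatou: "(\<integral>\<^sup>+x. ennreal ((norm (g x - \<phi> n x))\<^sup>2) \<partial>M) \<le> ennreal \<epsilon>"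
    if \<epsilon>: "\<epsilon> > 0" and K: "\<And>m. m \<ge> K \<Longrightarrow> sqint M (\<lambda>x. \<phi> m x - \<phi> n x) < \<epsilon>" for n K \<epsilon>
  proof -
    have "(\<integral>\<^sup>+x. ennreal ((norm (g x - \<phi> n x))\<^sup>2) \<partial>M) = (\<integral>\<^sup>+x. liminf (\<lambda>k. ennreal ((norm (\<phi> (r k) x - \<phi> n x))\<^sup>2)) \<partial>M)"
    proof (rule nn_integral_cong_AE)
      show "AE x in M. ennreal ((norm (g x - \<phi> n x))\<^sup>2) = liminf (\<lambda>k. ennreal ((norm (\<phi> (r k) x - \<phi> n x))\<^sup>2))"
        using lim
      proof eventually_elim
        case (elim x)
        have "(\<lambda>k. ennreal ((norm (\<phi> (r k) x - \<phi> n x))\<^sup>2)) \<longlonglongrightarrow> ennreal ((norm (g x - \<phi> n x))\<^sup>2)"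
          by (intro tendsto_ennrealI tendsto_intros elim)
        then show ?case by (rule lim_imp_Liminf[OF sequentially_bot, symmetric])
      qed
    qed
    also have "\<dots> \<le> liminf (\<lambda>k. \<integral>\<^sup>+x. ennreal ((norm (\<phi> (r k) x - \<phi> n x))\<^sup>2) \<partial>M)"
      by (rule nn_integral_liminf) measurable
    also have "\<dots> = liminf (\<lambda>k. ennreal (sqint M (\<lambda>x. \<phi> (r k) x - \<phi> n x)))"
      by (subst nn_integral_eq_integral[OF L2_integrable[OF L2_diff[OF L L]]]) auto
    also have "\<dots> \<le> limsup (\<lambda>k. ennreal (sqint M (\<lambda>x. \<phi> (r k) x - \<phi> n x)))"
      by (rule Liminf_le_Limsup) simp
    also have "\<dots> \<le> ennreal \<epsilon>"
    proof (rule Limsup_bounded)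
      show "\<forall>\<^sub>F k in sequentially. ennreal (sqint M (\<lambda>x. \<phi> (r k) x - \<phi> n x)) \<le> ennreal \<epsilon>"
        using eventually_ge_at_top[of K]
      proof eventually_elim
        case (elim k)
        then have "K \<le> r k" using r3[of k] by linarith
        from K[OF this] show ?case by (intro ennreal_leI) simp
      qed
    qed
    finally show ?thesis .
  qed
  have gd: "(\<lambda>x. g x - \<phi> n x) \<in> L2_space M \<and> sqint M (\<lambda>x. g x - \<phi> n x) \<le> \<epsilon>"
    if \<epsilon>: "\<epsilon> > 0" and K: "\<And>m. m \<ge> K \<Longrightarrow> sqint M (\<lambda>x. \<phi> m x - \<phi> n x) < \<epsilon>" for n K \<epsilon>
  proof -
    have i: "integrable M (\<lambda>x. (norm (g x - \<phi> n x))\<^sup>2)"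
    proof (rule integrableI_nonneg)
      show "(\<integral>\<^sup>+x. ennreal ((norm (g x - \<phi> n x))\<^sup>2) \<partial>M) < \<infinity>"
        by (rule order_le_less_trans[OF fatou[OF that]]) simp_all
    qed auto
    have "ennreal (sqint M (\<lambda>x. g x - \<phi> n x)) \<le> ennreal \<epsilon>"
      using fatou[OF that] nn_integral_eq_integral[OF i] by simp
    then show ?thesis using i \<epsilon> by (simp add: L2_space_def ennreal_le_iff)
  qed
  obtain N1 where N1: "\<And>m n. m \<ge> N1 \<Longrightarrow> n \<ge> N1 \<Longrightarrow> sqint M (\<lambda>x. \<phi> m x - \<phi> n x) < 1" using C[of 1] by auto
  have "(\<lambda>x. g x - \<phi> N1 x) \<in> L2_space M" using gd[of 1 N1 N1] N1 by auto
  from L2_add(1)[OF this L[of N1]] have gL: "g \<in> L2_space M" by simp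
  have "(\<lambda>n. sqint M (\<lambda>x. \<phi> n x - g x)) \<longlonglongrightarrow> 0"
  proof (rule LIMSEQ_I)
    fix e :: real assume e: "e > 0"
    obtain K where K: "\<And>m n. m \<ge> K \<Longrightarrow> n \<ge> K \<Longrightarrow> sqint M (\<lambda>x. \<phi> m x - \<phi> n x) < e / 2" using C[of "e / 2"] e by auto
    have "norm (sqint M (\<lambda>x. \<phi> n x - g x) - 0) < e" if "n \<ge> K" for n
    proof -
      have "sqint M (\<lambda>x. g x - \<phi> n x) \<le> e / 2" using gd[of "e / 2" K n] K that e by auto
      then show ?thesis using e L2_minus_sym[of M "\<phi> n" g] by simp
    qed
    then show "\<exists>no. \<forall>n\<ge>no. norm (sqint M (\<lambda>x. \<phi> n x - g x) - 0) < e" by blast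
  qed
  then show ?thesis using L gL by (auto simp: L2_tendsto_def)
qed

definition L2_closure :: "'a measure \<Rightarrow> ('a \<Rightarrow> complex) set \<Rightarrow> ('a \<Rightarrow> complex) set" where
  "L2_closure M D = {f \<in> L2_space M. \<forall>\<epsilon>>0. \<exists>\<phi>\<in>D. sqint M (\<lambda>x. f x - \<phi> x) < \<epsilon>}"

lemma L2_closure_add:
  assumes D: "D \<subseteq> L2_space M" and add: "\<And>f g. f \<in> D \<Longrightarrow> g \<in> D \<Longrightarrow> (\<lambda>x. f x + g x) \<in> D"
    and f: "f \<in> L2_closure M D" and g: "g \<in> L2_closure M D"
  shows "(\<lambda>x. f x + g x) \<in> L2_closure M D"
proof -
  have fg: "f \<in> L2_space M" "g \<in> L2_space M" using f g by (auto simp: L2_closure_def)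
  have "\<exists>\<phi>\<in>D. sqint M (\<lambda>x. f x + g x - \<phi> x) < \<epsilon>" if "\<epsilon> > 0" for \<epsilon>
  proof -
    have e: "\<epsilon> / 4 > 0" using that by simp
    obtain \<phi> where \<phi>: "\<phi> \<in> D" "sqint M (\<lambda>x. f x - \<phi> x) < \<epsilon> / 4"
      using f e unfolding L2_closure_def by blast
    obtain \<psi> where \<psi>: "\<psi> \<in> D" "sqint M (\<lambda>x. g x - \<psi> x) < \<epsilon> / 4"
      using g e unfolding L2_closure_def by blast
    have "sqint M (\<lambda>x. f x + g x - (\<phi> x + \<psi> x)) \<le> 2 * sqint M (\<lambda>x. f x - \<phi> x) + 2 * sqint M (\<lambda>x. g x - \<psi> x)"
      using L2_add(2)[OF L2_diff[OF fg(1)] L2_diff[OF fg(2)], of \<phi> \<psi>] \<phi> \<psi> D by (auto simp: algebra_simps)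
    then show ?thesis using add[OF \<phi>(1) \<psi>(1)] \<phi> \<psi> by (intro bexI[of _ "\<lambda>x. \<phi> x + \<psi> x"]) auto
  qed
  then show ?thesis using L2_add(1)[OF fg] by (auto simp: L2_closure_def)
qed

lemma L2_closure_cmult:
  assumes D: "D \<subseteq> L2_space M" and sc: "\<And>f. f \<in> D \<Longrightarrow> (\<lambda>x. c * f x) \<in> D"
    and f: "f \<in> L2_closure M D"
  shows "(\<lambda>x. c * f x) \<in> L2_closure M D"
proof -
  have fL: "f \<in> L2_space M" using f by (auto simp: L2_closure_def)
  have "\<exists>\<phi>\<in>D. sqint M (\<lambda>x. c * f x - \<phi> x) < \<epsilon>" if "\<epsilon> > 0" for \<epsilon>
  proof -
    have p: "(norm c)\<^sup>2 + 1 > 0" using zero_le_power2[of "norm c"] by linarith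
    then have e: "\<epsilon> / ((norm c)\<^sup>2 + 1) > 0" using that by (rule divide_pos_pos[rotated])
    obtain \<phi> where \<phi>: "\<phi> \<in> D" "sqint M (\<lambda>x. f x - \<phi> x) < \<epsilon> / ((norm c)\<^sup>2 + 1)"
      using f e unfolding L2_closure_def by blast
    have "sqint M (\<lambda>x. c * f x - c * \<phi> x) = (norm c)\<^sup>2 * sqint M (\<lambda>x. f x - \<phi> x)"
      using L2_cmult(2)[OF L2_diff[OF fL], of \<phi> c] \<phi> D by (auto simp: right_diff_distrib)
    also have "\<dots> \<le> ((norm c)\<^sup>2 + 1) * sqint M (\<lambda>x. f x - \<phi> x)" by (intro mult_right_mono) auto
    also have "\<dots> < \<epsilon>" using \<phi>(2) p by (simp add: pos_less_divide_eq mult.commute)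
    finally show ?thesis using sc[OF \<phi>(1)] by (intro bexI[of _ "\<lambda>x. c * \<phi> x"]) auto
  qed
  then show ?thesis using L2_cmult(1)[OF fL] by (auto simp: L2_closure_def)
qed

lemma L2_closure_lim:
  assumes D: "D \<subseteq> L2_space M" and f: "\<And>n. f n \<in> L2_closure M D" and lim: "L2_tendsto M f g"
  shows "g \<in> L2_closure M D"
proof -
  have L: "f n \<in> L2_space M" "g \<in> L2_space M" for n using lim by (auto simp: L2_tendsto_def)
  have "\<exists>\<phi>\<in>D. sqint M (\<lambda>x. g x - \<phi> x) < \<epsilon>" if e: "\<epsilon> > 0" for \<epsilon>
  proof -
    have "(\<lambda>n. sqint M (\<lambda>x. f n x - g x)) \<longlonglongrightarrow> 0" using lim by (simp add: L2_tendsto_def)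
    from LIMSEQ_D[OF this, of "\<epsilon> / 4"] obtain n where n: "sqint M (\<lambda>x. f n x - g x) < \<epsilon> / 4" using e by auto
    have "\<epsilon> / 4 > 0" using e by simp
    then obtain \<phi> where \<phi>: "\<phi> \<in> D" "sqint M (\<lambda>x. f n x - \<phi> x) < \<epsilon> / 4" using f[of n] unfolding L2_closure_def by blast
    have "sqint M (\<lambda>x. g x - \<phi> x) \<le> 2 * sqint M (\<lambda>x. g x - f n x) + 2 * sqint M (\<lambda>x. f n x - \<phi> x)"
      using \<phi> D by (intro L2_triangle L) auto
    then show ?thesis using \<phi> n L2_minus_sym[of M g "f n"] by (intro bexI[of _ \<phi>]) auto
  qed
  then show ?thesis using L by (auto simp: L2_closure_def)
qed

lemma L2_closure_seq:
  assumes D: "D \<subseteq> L2_space M" and f: "f \<in> L2_closure M D"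
  shows "\<exists>\<phi>. (\<forall>n. \<phi> n \<in> D) \<and> L2_tendsto M \<phi> f"
proof -
  have "\<forall>n. \<exists>\<phi>\<in>D. sqint M (\<lambda>x. f x - \<phi> x) < 1 / real (Suc n)"
    using f by (simp add: L2_closure_def)
  then obtain \<phi> where \<phi>: "\<And>n. \<phi> n \<in> D" "\<And>n. sqint M (\<lambda>x. f x - \<phi> n x) < 1 / real (Suc n)" by metis
  have "(\<lambda>n. sqint M (\<lambda>x. \<phi> n x - f x)) \<longlonglongrightarrow> 0"
  proof (rule tendsto_sandwich[OF _ _ tendsto_const LIMSEQ_Suc[OF lim_1_over_n]])
    show "\<forall>\<^sub>F n in sequentially. sqint M (\<lambda>x. \<phi> n x - f x) \<le> 1 / of_nat (Suc n)"
      using \<phi>(2) L2_minus_sym[of M _ f] by (intro always_eventually allI) (simp add: less_imp_le)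
  qed auto
  then show ?thesis using \<phi> f D by (intro exI[of _ \<phi>]) (auto simp: L2_tendsto_def L2_closure_def)
qed

section \<open>Density of the Gaussian class\<close>

text \<open>Measurability in the sense of \<open>measurable_on\<close> is by definition
  approximation by continuous functions off a negligible set.\<close>

lemma AE_limit_of_continuous:
  fixes f :: "'a::euclidean_space \<Rightarrow> real"
  assumes f: "f \<in> borel_measurable borel"
  shows "\<exists>g. (\<forall>n. continuous_on UNIV (g n)) \<and> (AE x in lborel. (\<lambda>n. g n x) \<longlonglongrightarrow> f x)"
proof -
  have "f \<in> borel_measurable lebesgue" using f by (intro measurable_completion) simp
  then have "f measurable_on UNIV" by (rule lebesgue_measurable_imp_measurable_on) simp
  then obtain N g where N: "negligible N" "\<And>n. continuous_on UNIV (g n)"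
    "\<And>x. x \<notin> N \<Longrightarrow> (\<lambda>n. g n x) \<longlonglongrightarrow> f x"
    unfolding measurable_on_def by auto
  have "AE x in lebesgue. (\<lambda>n. g n x) \<longlonglongrightarrow> f x"
    unfolding eventually_ae_filter_negligible using N by blast
  then show ?thesis using N(2) unfolding AE_completion_iff by blast
qed

context dunkl
begin

lemma L2_rap: assumes "rap f" and [measurable]: "f \<in> borel_measurable borel" shows "f \<in> L2_space mu"
proof -
  obtain C where C: "\<And>x. norm (f x) \<le> C" using rap_bounded[OF assms(1)] by blast
  have "rap (\<lambda>x. f x * f x)" by (rule rap_mult_bounded[OF assms(1) C])
  then have "integrable mu (\<lambda>x. f x * f x)" by (rule integrable_rap) measurable
  from integrable_norm[OF this] show ?thesis
    by (simp add: L2_space_def norm_mult power2_eq_square)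
qed

lemma Dcl_L2: "Dcl \<subseteq> L2_space mu"
  by (auto intro: L2_rap Dcl_rap Dcl_measurable)

text \<open>The map sending x to \<open>exp (- (norm x)\<^sup>2)\<close> and
  \<open>exp (- (norm x)\<^sup>2) *\<^sub>R x\<close> takes the whole space into a compact ball,
  where the Stone-Weierstrass theorem is available. Since every component is a Gaussian times a
  polynomial, polynomials in these components preserve the class.\<close>

lemma Dcl_polynomial:
  fixes P :: "real \<times> (real ^ 'n) \<Rightarrow> real"
  assumes "real_polynomial_function P"
  shows "\<forall>\<phi>\<in>Dcl. (\<lambda>x. of_real (P (exp (- (norm x)\<^sup>2), exp (- (norm x)\<^sup>2) *\<^sub>R x)) * \<phi> x) \<in> Dcl"
  using assms
proof (induction P rule: real_polynomial_function.induct)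
  case (linear f)
  interpret f: bounded_linear f by fact
  define \<eta> where "\<eta> = adjoint (\<lambda>x. f (0, x)) 1"
  have l: "linear (\<lambda>x. f (0, x))"
  proof (rule linearI)
    show "f (0, x + y) = f (0, x) + f (0, y)" for x y using f.add[of "(0, x)" "(0, y)"] by simp
    show "f (0, c *\<^sub>R x) = c *\<^sub>R f (0, x)" for c x using f.scaleR[of c "(0, x)"] by simp
  qed
  have e: "f (0, x) = x \<bullet> \<eta>" for x using adjoint_works[OF l, of x 1] by (simp add: \<eta>_def)
  have "f (t, t *\<^sub>R x) = t * (f (1, 0) + x \<bullet> \<eta>)" for t x
  proof -
    have "f (t, t *\<^sub>R x) = f (t *\<^sub>R ((1, 0) + (0, x)))" by simp
    then show ?thesis unfolding f.scaleR f.add e by simp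
  qed
  then have eq: "of_real (f (exp (- (norm x)\<^sup>2), exp (- (norm x)\<^sup>2) *\<^sub>R x)) * \<phi> x
      = gauss 1 x * (of_real (f (1, 0)) * \<phi> x + of_real (x \<bullet> \<eta>) * \<phi> x)" for \<phi> :: "real ^ 'n \<Rightarrow> complex" and x
    by (simp add: gauss_def power2_norm_eq_inner algebra_simps)
  show ?case unfolding eq
    by (intro ballI Dcl_gauss_mult Dcl_add Dcl_scale Dcl_coord) auto
next
  case (const c)
  show ?case by (auto intro: Dcl_scale)
next
  case (add f g)
  then show ?case by (auto simp: distrib_right intro: Dcl_add)
next
  case (mult f g)
  show ?case unfolding of_real_mult mult.assoc
  proof
    fix \<phi> assume "\<phi> \<in> Dcl"
    from bspec[OF mult.IH(1) bspec[OF mult.IH(2) this]] show "(\<lambda>x. complex_of_real (f (exp (- (norm x)\<^sup>2), exp (- (norm x)\<^sup>2) *\<^sub>R x)) *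
      (complex_of_real (g (exp (- (norm x)\<^sup>2), exp (- (norm x)\<^sup>2) *\<^sub>R x)) * \<phi> x)) \<in> Dcl" .
  qed
qed

text \<open>With g = C * gauss 1, uniform approximation of C by polynomials in the components of
  \<open>Dcl_polynomial\<close> becomes approximation in L^2, as the factor \<open>gauss 1\<close>
  is square integrable.\<close>

lemma closure_continuous:
  fixes g :: "real ^ 'n \<Rightarrow> real"
  assumes g: "continuous_on UNIV g" and supp: "\<And>x. \<rho> < norm x \<Longrightarrow> g x = 0" and \<rho>: "\<rho> > 0"
  shows "(\<lambda>x. of_real (g x)) \<in> L2_closure mu Dcl"
proof -
  have gm [measurable]: "g \<in> borel_measurable borel" by (rule borel_measurable_continuous_onI[OF g])
  obtain B where B: "\<And>x. norm x \<le> \<rho> \<Longrightarrow> \<bar>g x\<bar> \<le> B"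
  proof -
    have "compact (g ` cball 0 \<rho>)" by (intro compact_continuous_image continuous_on_subset[OF g]) auto
    then have "bounded (g ` cball 0 \<rho>)" by (rule compact_imp_bounded)
    then obtain B where "\<And>y. y \<in> g ` cball 0 \<rho> \<Longrightarrow> norm y \<le> B" unfolding bounded_iff by blast
    then have "\<bar>g x\<bar> \<le> B" if "norm x \<le> \<rho>" for x using that by simp
    then show ?thesis using that by blast
  qed
  have L2: "(\<lambda>x. of_real (g x)) \<in> L2_space mu"
  proof (rule L2_rap)
    show "rap (\<lambda>x. complex_of_real (g x))"
    proof (rule rapI)
      fix m
      have "(1 + norm x) ^ m * norm (complex_of_real (g x)) \<le> (1 + \<rho>) ^ m * \<bar>B\<bar>" for x
      proof (cases "norm x \<le> \<rho>")
        case True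
        show ?thesis using B[OF True] True \<rho> by (intro mult_mono power_mono zero_le_power) auto
      next
        case False
        then show ?thesis using supp[of x] \<rho> by simp
      qed
      then show "\<exists>C. \<forall>x. (1 + norm x) ^ m * norm (complex_of_real (g x)) \<le> C" by blast
    qed
  qed measurable
  define G1 :: "real ^ 'n \<Rightarrow> real" where "G1 x = exp (- (norm x)\<^sup>2)" for x
  define s0 where "s0 = exp (- \<rho>\<^sup>2)"
  define C where "C x = g x * exp ((norm x)\<^sup>2)" for x
  \<comment> \<open>The point x is recovered by dividing the second component by the first. The
    lower bound s0 / 4 keeps the division continuous. The ramp is 1 where the first component is at
    least s0, which includes all x with norm x \<le> \<rho>, and it is 0 where this component is at
    most s0 / 2, so the altered quotient never matters.\<close>
  define H where "H = (\<lambda>p :: real \<times> (real ^ 'n). max 0 (min 1 (2 * fst p / s0 - 1)) * C (inverse (max (fst p) (s0 / 4)) *\<^sub>R snd p))"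
  have s0: "s0 > 0" by (simp add: s0_def)
  have HG: "H (G1 x, G1 x *\<^sub>R x) = C x" for x
  proof -
    consider "norm x \<le> \<rho>" | "norm x > \<rho>" "s0 / 4 \<le> G1 x" | "norm x > \<rho>" "s0 / 4 > G1 x" by linarith
    then show ?thesis
    proof cases
      case 1
      then have "(norm x)\<^sup>2 \<le> \<rho>\<^sup>2" by (intro power_mono) auto
      then have "s0 \<le> G1 x" by (simp add: s0_def G1_def)
      then have "2 * G1 x / s0 - 1 \<ge> 1" "max (G1 x) (s0 / 4) = G1 x" "G1 x \<noteq> 0" using s0 by (auto simp: pos_le_divide_eq)
      then show ?thesis by (simp add: H_def)
    next
      case 2
      then have "C x = 0" "max (G1 x) (s0 / 4) = G1 x" "G1 x \<noteq> 0" using supp[of x] s0 by (auto simp: C_def)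
      then show ?thesis by (simp add: H_def)
    next
      case 3
      then have "2 * G1 x / s0 - 1 \<le> 0" using s0 by (simp add: pos_divide_le_eq)
      then have "max 0 (min 1 (2 * G1 x / s0 - 1)) = 0" by simp
      moreover have "C x = 0" using 3 supp[of x] by (simp add: C_def)
      ultimately show ?thesis by (simp add: H_def)
    qed
  qed
  have Cc: "continuous_on UNIV C" unfolding C_def by (intro continuous_intros g)
  have Hc: "continuous_on S H" for S
  proof -
    have m: "max (fst p) (s0 / 4) \<noteq> 0" for p :: "real \<times> (real ^ 'n)" using s0 by (auto simp: max_def)
    have "continuous_on S (\<lambda>p. C (inverse (max (fst p) (s0 / 4)) *\<^sub>R snd p))"
      by (rule continuous_on_compose2[OF Cc]) (use m in \<open>auto intro!: continuous_intros\<close>)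
    then show ?thesis unfolding H_def using s0 by (intro continuous_intros) auto
  qed
  have cb: "(G1 x, G1 x *\<^sub>R x) \<in> cball 0 2" for x
  proof -
    have 1: "norm (G1 x) \<le> 1" by (simp add: G1_def)
    have "2 * norm x \<le> 1 + (norm x)\<^sup>2" using sum_squares_bound[of 1 "norm x"] by simp
    then have "norm x \<le> 1 + (norm x)\<^sup>2" using norm_ge_zero[of x] by linarith
    also have "\<dots> \<le> exp ((norm x)\<^sup>2)" by (rule exp_ge_add_one_self)
    finally have "G1 x * norm x \<le> G1 x * exp ((norm x)\<^sup>2)" by (intro mult_left_mono) (simp_all add: G1_def)
    also have "\<dots> = 1" by (simp add: G1_def flip: exp_add)
    finally have 2: "norm (G1 x *\<^sub>R x) \<le> 1" by (simp add: G1_def)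
    have "norm (G1 x, G1 x *\<^sub>R x) \<le> norm (G1 x) + norm (G1 x *\<^sub>R x)" by (rule norm_Pair_le)
    then have "norm (G1 x, G1 x *\<^sub>R x) \<le> 2" using 1 2 by linarith
    then show ?thesis by (simp only: mem_cball_0)
  qed
  have "\<exists>\<phi>\<in>Dcl. sqint mu (\<lambda>x. of_real (g x) - \<phi> x) < \<epsilon>" if e: "\<epsilon> > 0" for \<epsilon>
  proof -
    define J where "J = sqint mu (gauss 1)"
    \<comment> \<open>Chosen so that d^2 * J is at most \<epsilon> / 2; the summand 1 keeps the
      denominator positive.\<close>
    define d where "d = sqrt (\<epsilon> / (2 * (J + 1)))"
    have J: "J \<ge> 0" by (simp add: J_def)
    have d: "d > 0" using J e by (simp add: d_def)
    obtain P where P: "real_polynomial_function P" "\<And>p. p \<in> cball 0 2 \<Longrightarrow> \<bar>H p - P p\<bar> < d"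
      using Stone_Weierstrass_real_polynomial_function[OF compact_cball Hc d, of 0 2] by blast
    define \<phi> where "\<phi> x = of_real (P (exp (- (norm x)\<^sup>2), exp (- (norm x)\<^sup>2) *\<^sub>R x)) * gauss 1 x" for x
    have \<phi>D: "\<phi> \<in> Dcl" unfolding \<phi>_def using Dcl_polynomial[OF P(1)] Dcl_gauss[of 1] by auto
    have \<phi>L: "\<phi> \<in> L2_space mu" using Dcl_L2 \<phi>D by blast
    have gL: "gauss 1 \<in> L2_space mu" using Dcl_L2 Dcl_gauss[of 1] by auto
    have b: "norm (of_real (g x) - \<phi> x) \<le> norm (of_real d * gauss 1 x)" for x :: "real ^ 'n"
    proof -
      have "g x = C x * G1 x" by (simp add: C_def G1_def mult.assoc flip: exp_add)
      then have "of_real (g x) - \<phi> x = of_real (H (G1 x, G1 x *\<^sub>R x) - P (G1 x, G1 x *\<^sub>R x)) * gauss 1 x"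
        unfolding HG by (simp add: \<phi>_def G1_def gauss_def power2_norm_eq_inner algebra_simps)
      also have "norm \<dots> = \<bar>H (G1 x, G1 x *\<^sub>R x) - P (G1 x, G1 x *\<^sub>R x)\<bar> * norm (gauss 1 x)"
        unfolding norm_mult norm_of_real ..
      also have "\<dots> \<le> d * norm (gauss 1 x)" by (intro mult_right_mono less_imp_le[OF P(2)[OF cb]]) simp
      finally show ?thesis using d by (simp add: norm_mult)
    qed
    have "sqint mu (\<lambda>x. of_real (g x) - \<phi> x) \<le> sqint mu (\<lambda>x. of_real d * gauss 1 x)"
      by (intro integral_mono L2_integrable L2_diff L2 \<phi>L L2_cmult gL power_mono b) auto
    also have "\<dots> = d\<^sup>2 * J" unfolding J_def L2_cmult(2)[OF gL] by simp
    also have "d\<^sup>2 = \<epsilon> / (2 * (J + 1))" unfolding d_def using J e by simp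
    also have "\<epsilon> / (2 * (J + 1)) * J \<le> \<epsilon> / (2 * (J + 1)) * (J + 1)" using J e by (intro mult_left_mono) auto
    also have "\<dots> = \<epsilon> / 2"
    proof -
      have "\<epsilon> / (2 * c) * c = \<epsilon> / 2" if "c \<noteq> 0" for c :: real using that by simp
      from this[of "J + 1"] show ?thesis using J by linarith
    qed
    also have "\<dots> < \<epsilon>" using e by simp
    finally show ?thesis using \<phi>D by blast
  qed
  then show ?thesis using L2 by (simp add: L2_closure_def)
qed

lemma integrable_mu_indicator: "integrable mu (\<lambda>x. (c * indicator (cball 0 \<rho>) x :: real)\<^sup>2)"
proof -
  have "rap (\<lambda>x :: real ^ 'n. complex_of_real (indicator (cball 0 \<rho>) x))"
  proof (rule rapI)
    fix m
    have "(1 + norm x) ^ m * norm (complex_of_real (indicator (cball 0 \<rho>) x)) \<le> (1 + \<bar>\<rho>\<bar>) ^ m" for x :: "real ^ 'n"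
      by (auto simp: indicator_def intro!: power_mono)
    then show "\<exists>C. \<forall>x :: real ^ 'n. (1 + norm x) ^ m * norm (complex_of_real (indicator (cball 0 \<rho>) x)) \<le> C" by blast
  qed
  then have L: "(\<lambda>x. complex_of_real (indicator (cball 0 \<rho>) x)) \<in> L2_space mu" by (rule L2_rap) (intro measurable_compose[OF borel_measurable_indicator borel_measurable_of_real] borel_closed closed_cball)
  have "integrable mu (\<lambda>x. c\<^sup>2 * (norm (complex_of_real (indicator (cball 0 \<rho>) x)))\<^sup>2)"
    by (intro integrable_mult_right L2_integrable[OF L])
  then show ?thesis by (simp add: power_mult_distrib norm_of_real)
qed

text \<open>The continuous approximants are truncated in height by m and in space by the ramp
  \<open>ct\<close>. Both operations preserve continuity and the limit, and they supply a common
  majorant.\<close>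

lemma closure_real:
  fixes f :: "real ^ 'n \<Rightarrow> real"
  assumes f [measurable]: "f \<in> borel_measurable borel" and b: "\<And>x. \<bar>f x\<bar> \<le> m"
    and supp: "\<And>x. \<rho> < norm x \<Longrightarrow> f x = 0" and \<rho>: "\<rho> > 0"
  shows "(\<lambda>x. of_real (f x)) \<in> L2_closure mu Dcl"
proof -
  have m: "m \<ge> 0" using order_trans[OF abs_ge_zero b[of 0]] .
  obtain g where g: "\<And>n. continuous_on UNIV (g n)" "AE x in lborel. (\<lambda>n. g n x) \<longlonglongrightarrow> f x"
    using AE_limit_of_continuous[OF f] by blast
  define ct where "ct x = max 0 (min 1 (\<rho> + 1 - norm x))" for x :: "real ^ 'n"
  define h where "h n x = ct x * max (- m) (min m (g n x))" for n x
  have hc: "continuous_on UNIV (h n)" for n unfolding h_def ct_def by (intro continuous_intros g)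
  have [measurable]: "h n \<in> borel_measurable borel" for n by (rule borel_measurable_continuous_onI[OF hc])
  have ct0: "ct x = 0" if "\<rho> + 1 < norm x" for x using that by (simp add: ct_def)
  have hcl: "(\<lambda>x. of_real (h n x)) \<in> L2_closure mu Dcl" for n
    by (rule closure_continuous[OF hc, of "\<rho> + 1"]) (use \<rho> ct0 in \<open>auto simp: h_def\<close>)
  have "L2_tendsto mu (\<lambda>n x. complex_of_real (h n x)) (\<lambda>x. of_real (f x))"
  proof (rule L2_tendsto_dominated[OF _ _ integrable_mu_indicator[of m "\<rho> + 1"]])
    show "AE x in mu. norm (complex_of_real (h n x)) \<le> m * indicator (cball 0 (\<rho> + 1)) x" for n
    proof (rule AE_I2)
      fix x
      have "\<bar>ct x\<bar> \<le> 1" by (simp add: ct_def)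
      moreover have "\<bar>max (- m) (min m (g n x))\<bar> \<le> m" using m by auto
      ultimately have "\<bar>ct x\<bar> * \<bar>max (- m) (min m (g n x))\<bar> \<le> 1 * m" by (intro mult_mono) auto
      then have "\<bar>h n x\<bar> \<le> m" by (simp add: h_def abs_mult)
      moreover have "h n x = 0" if "\<not> norm x \<le> \<rho> + 1" using that ct0[of x] by (simp add: h_def)
      ultimately show "norm (complex_of_real (h n x)) \<le> m * indicator (cball 0 (\<rho> + 1)) x"
        unfolding norm_of_real by (auto simp: indicator_def)
    qed
    have "AE x in lborel. (\<lambda>n. complex_of_real (h n x)) \<longlonglongrightarrow> complex_of_real (f x)"
      using g(2)
    proof eventually_elim
      case (elim x)
      have "(\<lambda>n. h n x) \<longlonglongrightarrow> ct x * max (- m) (min m (f x))"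
        unfolding h_def by (intro tendsto_intros elim)
      also have "ct x * max (- m) (min m (f x)) = f x"
      proof (cases "\<rho> < norm x")
        case True
        then show ?thesis using supp[of x] m by simp
      next
        case False
        then have "ct x = 1" by (simp add: ct_def)
        moreover have "max (- m) (min m (f x)) = f x" using b[of x] by auto
        ultimately show ?thesis by simp
      qed
      finally show ?case by (rule tendsto_of_real)
    qed
    then show "AE x in mu. (\<lambda>n. complex_of_real (h n x)) \<longlonglongrightarrow> complex_of_real (f x)" by (simp only: AE_mu)
  qed measurable
  then show ?thesis by (rule L2_closure_lim[OF Dcl_L2 hcl])
qed

lemma L2_closure_Dcl: assumes f: "f \<in> L2_space mu" shows "f \<in> L2_closure mu Dcl"
proof -
  have fm [measurable]: "f \<in> borel_measurable borel" using L2_measurable[OF f] by simp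
  define h where "h n x = (if norm (f x) \<le> real n \<and> norm x \<le> real (Suc n) then f x else 0)" for n x
  have [measurable]: "h n \<in> borel_measurable borel" for n unfolding h_def by measurable
  have "h n \<in> L2_closure mu Dcl" for n
  proof -
    have b: "\<bar>Re (h n x)\<bar> \<le> real n" "\<bar>Im (h n x)\<bar> \<le> real n" for x
      using abs_Re_le_cmod[of "f x"] abs_Im_le_cmod[of "f x"] by (auto simp: h_def intro: order_trans)
    have z: "h n x = 0" if "real (Suc n) < norm x" for x using that by (auto simp: h_def)
    have "(\<lambda>x. complex_of_real (Re (h n x))) \<in> L2_closure mu Dcl"
      by (rule closure_real[OF _ b(1), where \<rho> = "real (Suc n)"]) (use z in auto)
    moreover have "(\<lambda>x. complex_of_real (Im (h n x))) \<in> L2_closure mu Dcl"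
      by (rule closure_real[OF _ b(2), where \<rho> = "real (Suc n)"]) (use z in auto)
    ultimately have "(\<lambda>x. complex_of_real (Re (h n x)) + \<i> * complex_of_real (Im (h n x))) \<in> L2_closure mu Dcl"
      by (intro L2_closure_add L2_closure_cmult Dcl_L2 Dcl_add Dcl_scale)
    then show ?thesis by (simp flip: complex_eq)
  qed
  moreover have "L2_tendsto mu h f"
  proof (rule L2_tendsto_dominated)
    show "integrable mu (\<lambda>x. (norm (f x))\<^sup>2)" by (rule L2_integrable[OF f])
    show "AE x in mu. norm (h n x) \<le> norm (f x)" for n by (simp add: h_def)
    show "AE x in mu. (\<lambda>n. h n x) \<longlonglongrightarrow> f x"
    proof (rule AE_I2)
      fix x
      obtain N where N: "max (norm (f x)) (norm x) \<le> real N" using real_arch_simple by blast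
      have "\<forall>\<^sub>F n in sequentially. h n x = f x"
        using eventually_ge_at_top[of N]
      proof eventually_elim
        case (elim n)
        then have "norm (f x) \<le> real n" "norm x \<le> real (Suc n)" using N by auto
        then show ?case by (simp add: h_def)
      qed
      then show "(\<lambda>n. h n x) \<longlonglongrightarrow> f x" by (rule tendsto_eventually)
    qed
  qed measurable
  ultimately show ?thesis by (rule L2_closure_lim[OF Dcl_L2])
qed

text \<open>Test functions from the class that converge to the conjugate of f turn the vanishing
  pairings into \<open>sqint mu f = 0\<close>.\<close>

lemma Dcl_total:
  assumes f: "f \<in> L2_space mu" and z: "\<And>\<phi>. \<phi> \<in> Dcl \<Longrightarrow> (\<integral>x. f x * \<phi> x \<partial>mu) = 0"
  shows "AE x in mu. f x = 0"
proof -
  have c: "(\<lambda>x. cnj (f x)) \<in> L2_space mu" by (rule L2_cnj[OF f])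
  obtain \<phi> where \<phi>: "\<And>n. \<phi> n \<in> Dcl" "L2_tendsto mu \<phi> (\<lambda>x. cnj (f x))"
    using L2_closure_seq[OF Dcl_L2 L2_closure_Dcl[OF c]] by blast
  have "(\<lambda>n. \<integral>x. f x * \<phi> n x \<partial>mu) \<longlonglongrightarrow> (\<integral>x. f x * cnj (f x) \<partial>mu)"
    by (rule L2_tendsto_pairing[OF \<phi>(2) f])
  then have "(\<integral>x. f x * cnj (f x) \<partial>mu) = 0" using z[OF \<phi>(1)] by (simp add: LIMSEQ_const_iff)
  moreover have "(\<integral>x. f x * cnj (f x) \<partial>mu) = of_real (sqint mu f)"
    unfolding complex_norm_square[symmetric] by (rule integral_complex_of_real)
  ultimately have "sqint mu f = 0" by simp
  then have "AE x in mu. (norm (f x))\<^sup>2 = 0"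
    by (subst (asm) integral_nonneg_eq_0_iff_AE[OF L2_integrable[OF f]]) auto
  then show ?thesis by simp
qed

end

section \<open>Extension of the Dunkl transform to square integrable functions\<close>

lemma schwartz_rap: assumes "schwartz f" shows "rap f" "f \<in> borel_measurable borel"
proof -
  have f: "\<And>x. f differentiable at x" "\<And>m. bounded (range (\<lambda>x. (1 + norm x) ^ m *\<^sub>R f x))"
    using assms unfolding schwartz_def by (metis iterated_partial.simps(1))+
  show "f \<in> borel_measurable borel" by (rule differentiable_measurable[OF f(1)])
  show "rap f"
  proof (rule rapI)
    fix m
    obtain B where "\<And>y. y \<in> range (\<lambda>x. (1 + norm x) ^ m *\<^sub>R f x) \<Longrightarrow> norm y \<le> B"
      using f(2)[of m] unfolding bounded_iff by blast
    then have "norm ((1 + norm x) ^ m *\<^sub>R f x) \<le> B" for x by blast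
    then have "(1 + norm x) ^ m * norm (f x) \<le> B" for x by (simp add: abs_of_nonneg)
    then show "\<exists>C. \<forall>x. (1 + norm x) ^ m * norm (f x) \<le> C" by blast
  qed
qed

context dunkl
begin

lemma Dcl_fder: "f \<in> Dcl \<Longrightarrow> (\<lambda>x. fder f x h) \<in> Dcl"
proof (induction rule: Dcl_induct)
  case (gauss a)
  have "(\<lambda>x. fder (gauss a) x h) = (\<lambda>x :: real ^ 'n. of_real (- 2 * a) * (of_real (x \<bullet> h) * gauss a x))"
    by (simp add: fun_eq_iff fder_gauss)
  then show ?case by (simp only: Dcl_scale Dcl_coord Dcl_gauss gauss)
next
  case zero
  then show ?case by (simp add: Dcl_zero)
next
  case (add f g)
  then show ?case by (simp add: fder_add Dcl_diff Dcl_add)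
next
  case (scale c f)
  have "fder (\<lambda>x. c * f x) x h = c * fder f x h" for x
    by (subst fder_mult[OF differentiable_const Dcl_diff[OF scale(1)]]) simp
  then show ?case using scale by (simp add: Dcl_scale)
next
  case (coord \<zeta> f)
  then show ?case by (simp add: fder_mult[OF diff_coord Dcl_diff[OF coord(1)]] fder_coord Dcl_add Dcl_scale Dcl_coord)
qed

text \<open>This makes sequences from \<open>Dcl\<close> admissible in the definition of
  \<open>L2_extension\<close>.\<close>

lemma Dcl_schwartz: assumes "f \<in> Dcl" shows "schwartz f"
proof -
  have D: "iterated_partial js f \<in> Dcl" for js
    by (induction js) (simp_all add: assms Dcl_fder)
  have "bounded (range (\<lambda>x. (1 + norm x) ^ m *\<^sub>R f x))" if f: "f \<in> Dcl" for f m
  proof -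
    obtain C where "\<And>x. (1 + norm x) ^ m * norm (f x) \<le> C" using Dcl_rap[OF f] unfolding rap_def by blast
    then have "norm ((1 + norm x) ^ m *\<^sub>R f x) \<le> C" for x by (simp add: abs_of_nonneg)
    then show ?thesis unfolding bounded_iff by blast
  qed
  then show ?thesis unfolding schwartz_def using D Dcl_diff by blast
qed

text \<open>Fubini for a bounded kernel with e (- \<xi>) x = e (- x) \<xi>. Integrability of f and g
  is enough, so the identity is available for every Schwartz function and not only for
  \<open>Dcl\<close>.\<close>

lemma F_pairing:
  assumes f: "integrable mu f" and g: "integrable mu g"
  shows "(\<integral>\<xi>. F f \<xi> * g \<xi> \<partial>mu) = (\<integral>x. f x * F g x \<partial>mu)"
proof -
  interpret P: pair_sigma_finite mu mu ..
  have [measurable]: "f \<in> borel_measurable borel" "g \<in> borel_measurable borel"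
    using borel_measurable_integrable[OF f] borel_measurable_integrable[OF g] by simp_all
  define h where "h \<xi> x = e (- \<xi>) x * f x * g \<xi>" for \<xi> x
  have nh: "norm (h \<xi> x) \<le> cG * (norm (f x) * norm (g \<xi>))" for \<xi> x
    unfolding h_def norm_mult mult.assoc by (intro mult_right_mono e_bound) simp
  have hm: "case_prod h \<in> borel_measurable (mu \<Otimes>\<^sub>M mu)" unfolding h_def by measurable
  have h1 [measurable]: "h \<xi> \<in> borel_measurable borel" for \<xi> unfolding h_def by measurable
  have ih: "integrable mu (h \<xi>)" for \<xi>
    by (rule Bochner_Integration.integrable_bound[of _ "\<lambda>x. cG * (norm (f x) * norm (g \<xi>))"])
       (use f nh cG_pos in \<open>auto simp: abs_mult\<close>)
  have "integrable (mu \<Otimes>\<^sub>M mu) (case_prod h)"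
  proof (rule P.Fubini_integrable[OF hm])
    show "AE \<xi> in mu. integrable mu (\<lambda>x. case_prod h (\<xi>, x))" using ih by simp
    show "integrable mu (\<lambda>\<xi>. \<integral>x. norm (case_prod h (\<xi>, x)) \<partial>mu)"
    proof (rule Bochner_Integration.integrable_bound)
      show "integrable mu (\<lambda>\<xi>. cG * (\<integral>x. norm (f x) \<partial>mu) * norm (g \<xi>))" using g by simp
      show "(\<lambda>\<xi>. \<integral>x. norm (case_prod h (\<xi>, x)) \<partial>mu) \<in> borel_measurable mu"
        using hm by measurable
      have "(\<integral>x. norm (h \<xi> x) \<partial>mu) \<le> cG * (\<integral>x. norm (f x) \<partial>mu) * norm (g \<xi>)" for \<xi>
      proof -
        have "(\<integral>x. norm (h \<xi> x) \<partial>mu) \<le> (\<integral>x. cG * (norm (f x) * norm (g \<xi>)) \<partial>mu)"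
          using f by (intro integral_mono nh integrable_norm ih) auto
        then show ?thesis by (simp add: mult.assoc)
      qed
      then show "AE \<xi> in mu. norm (\<integral>x. norm (case_prod h (\<xi>, x)) \<partial>mu) \<le> norm (cG * (\<integral>x. norm (f x) \<partial>mu) * norm (g \<xi>))"
        using cG_pos by (simp add: abs_mult)
    qed
  qed
  from P.Fubini_integral[OF this] have "(\<integral>x. \<integral>\<xi>. h \<xi> x \<partial>mu \<partial>mu) = (\<integral>\<xi>. \<integral>x. h \<xi> x \<partial>mu \<partial>mu)" .
  moreover have "(\<integral>\<xi>. h \<xi> x \<partial>mu) = of_real ck * (f x * F g x)" for x
  proof -
    have "(\<integral>\<xi>. h \<xi> x \<partial>mu) = (\<integral>\<xi>. f x * (e (- x) \<xi> * g \<xi>) \<partial>mu)"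
      unfolding h_def by (intro Bochner_Integration.integral_cong refl) (simp add: e_symmetric[of "- x"] flip: e_uminus)
    then show ?thesis using ck_pos by (simp add: F_def)
  qed
  moreover have "(\<integral>x. h \<xi> x \<partial>mu) = of_real ck * (F f \<xi> * g \<xi>)" for \<xi>
    using ck_pos by (simp add: h_def F_def)
  ultimately show ?thesis using ck_pos by simp
qed

lemma measurable_F [measurable]: assumes [measurable]: "f \<in> borel_measurable borel" shows "F f \<in> borel_measurable borel"
proof -
  have "(\<lambda>\<xi>. \<integral>x. e (- \<xi>) x * f x \<partial>mu) \<in> borel_measurable borel"
    by (rule mu.borel_measurable_lebesgue_integral) measurable
  then show ?thesis unfolding F_def[abs_def] by measurable
qed

lemma F_uminus: assumes [measurable]: "f \<in> borel_measurable borel" shows "F (\<lambda>x. f (- x)) \<xi> = F f (- \<xi>)"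
  unfolding F_def by (subst (2) integral_mu_uminus[symmetric]) (simp_all add: e_uminus)

lemma F_cnj: "cnj (F f \<xi>) = F (\<lambda>x. cnj (f x)) (- \<xi>)"
  unfolding F_def complex_cnj_mult by (simp add: e_cnj e_uminus flip: Bochner_Integration.integral_cnj)

text \<open>Plancherel's theorem: the conjugate of F f is itself a transform up to reflection, so
  the symmetric pairing applies, and \<open>F_F\<close> removes the two transforms that
  meet.\<close>

lemma F_isometry: assumes f: "f \<in> Dcl" shows "sqint mu (F f) = sqint mu f"
proof -
  note Dc = Dcl_cnj[OF f]
  have "of_real (sqint mu (F f)) = (\<integral>x. F f x * cnj (F f x) \<partial>mu)"
    unfolding complex_norm_square[symmetric] by (rule integral_complex_of_real[symmetric])
  also have "\<dots> = (\<integral>x. F f x * F (\<lambda>x. cnj (f x)) (- x) \<partial>mu)" by (simp add: F_cnj)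
  also have "\<dots> = (\<integral>x. f x * F (\<lambda>x. F (\<lambda>x. cnj (f x)) (- x)) x \<partial>mu)"
    by (intro F_pairing Dcl_integrable f Dcl_uminus F_Dcl Dc)
  also have "\<dots> = (\<integral>x. f x * cnj (f x) \<partial>mu)"
    by (simp add: F_uminus[OF Dcl_measurable[OF F_Dcl[OF Dc]]] F_F[OF Dc])
  also have "\<dots> = of_real (sqint mu f)"
    unfolding complex_norm_square[symmetric] by (rule integral_complex_of_real)
  finally show ?thesis by (simp only: of_real_eq_iff)
qed

text \<open>F and Finv differ by a reflection of the argument only; the predicate allows both
  extensions to be treated at once.\<close>

definition fourier_op :: "((real ^ 'n \<Rightarrow> complex) \<Rightarrow> real ^ 'n \<Rightarrow> complex) \<Rightarrow> bool" where
  "fourier_op A \<longleftrightarrow> A = F \<or> A = Finv"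

lemma Finv_F: "Finv f = (\<lambda>x. F f (- x))" by (simp add: fun_eq_iff Finv_eq)

lemma fourier_op_Dcl: "fourier_op A \<Longrightarrow> f \<in> Dcl \<Longrightarrow> A f \<in> Dcl"
  by (auto simp: fourier_op_def Finv_F F_Dcl Dcl_uminus)

lemma fourier_op_diff: "fourier_op A \<Longrightarrow> f \<in> Dcl \<Longrightarrow> g \<in> Dcl \<Longrightarrow> A (\<lambda>x. f x - g x) x = A f x - A g x"
  using F_add[of f "\<lambda>x. - 1 * g x"] F_cmult[of "- 1" g] Dcl_scale[of g "- 1"]
  by (auto simp: fourier_op_def Finv_F Dcl_rap Dcl_measurable)

lemma fourier_op_isometry: assumes A: "fourier_op A" and f: "f \<in> Dcl" shows "sqint mu (A f) = sqint mu f"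
proof -
  have [measurable]: "F f \<in> borel_measurable borel" by (rule Dcl_measurable[OF F_Dcl[OF f]])
  have "sqint mu (\<lambda>x. F f (- x)) = sqint mu (F f)" by (rule integral_mu_uminus) measurable
  then show ?thesis using A F_isometry[OF f] by (auto simp: fourier_op_def Finv_F)
qed

lemma fourier_op_pairing:
  assumes A: "fourier_op A" and f: "integrable mu f" and g: "integrable mu g"
  shows "(\<integral>\<xi>. A f \<xi> * g \<xi> \<partial>mu) = (\<integral>x. f x * A g x \<partial>mu)"
proof -
  have [measurable]: "f \<in> borel_measurable borel" "g \<in> borel_measurable borel"
    using borel_measurable_integrable[OF f] borel_measurable_integrable[OF g] by simp_all
  have "(\<integral>\<xi>. F f (- \<xi>) * g \<xi> \<partial>mu) = (\<integral>\<xi>. F f \<xi> * g (- \<xi>) \<partial>mu)"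
    by (subst integral_mu_uminus[symmetric]) simp_all
  also have "\<dots> = (\<integral>x. f x * F (\<lambda>x. g (- x)) x \<partial>mu)" by (rule F_pairing[OF f integrable_mu_uminus[OF g]])
  finally have "(\<integral>\<xi>. F f (- \<xi>) * g \<xi> \<partial>mu) = (\<integral>x. f x * F g (- x) \<partial>mu)" by (simp add: F_uminus)
  then show ?thesis using A F_pairing[OF f g] by (auto simp: fourier_op_def Finv_F)
qed

text \<open>The choice in \<open>L2_extension\<close> is meaningful only if some admissible sequence
  exists. Approximants from \<open>Dcl\<close> qualify: by the isometry their transforms form a
  Cauchy sequence.\<close>

lemma fourier_op_ex:
  assumes A: "fourier_op A" and f: "f \<in> L2_space mu"
  shows "\<exists>g \<phi>. (\<forall>n. schwartz (\<phi> n)) \<and> L2_tendsto mu \<phi> f \<and> L2_tendsto mu (\<lambda>n. A (\<phi> n)) g"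
proof -
  obtain \<phi> where \<phi>: "\<And>n. \<phi> n \<in> Dcl" "L2_tendsto mu \<phi> f"
    using L2_closure_seq[OF Dcl_L2 L2_closure_Dcl[OF f]] by blast
  have \<phi>L: "\<phi> n \<in> L2_space mu" for n using \<phi> by (simp add: L2_tendsto_def)
  have "\<exists>g. L2_tendsto mu (\<lambda>n. A (\<phi> n)) g"
  proof (rule L2_complete)
    show "A (\<phi> n) \<in> L2_space mu" for n using fourier_op_Dcl[OF A \<phi>(1)] Dcl_L2 by blast
    fix \<epsilon> :: real assume e: "\<epsilon> > 0"
    have "(\<lambda>n. sqint mu (\<lambda>x. \<phi> n x - f x)) \<longlonglongrightarrow> 0" using \<phi>(2) by (simp add: L2_tendsto_def)
    from LIMSEQ_D[OF this, of "\<epsilon> / 4"] e obtain N where N: "\<And>n. n \<ge> N \<Longrightarrow> sqint mu (\<lambda>x. \<phi> n x - f x) < \<epsilon> / 4" by auto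
    have "sqint mu (\<lambda>x. A (\<phi> m) x - A (\<phi> n) x) < \<epsilon>" if "m \<ge> N" "n \<ge> N" for m n
    proof -
      have d: "(\<lambda>x. \<phi> m x - \<phi> n x) \<in> Dcl"
        using Dcl_add[OF \<phi>(1)[of m] Dcl_scale[OF \<phi>(1)[of n], of "- 1"]] by simp
      have "sqint mu (\<lambda>x. A (\<phi> m) x - A (\<phi> n) x) = sqint mu (\<lambda>x. \<phi> m x - \<phi> n x)"
        using fourier_op_isometry[OF A d] by (simp add: fourier_op_diff[OF A] \<phi>)
      also have "\<dots> \<le> 2 * sqint mu (\<lambda>x. \<phi> m x - f x) + 2 * sqint mu (\<lambda>x. f x - \<phi> n x)"
        by (rule L2_triangle[OF \<phi>L f \<phi>L])
      finally show ?thesis using N[OF that(1)] N[OF that(2)] L2_minus_sym[of mu f "\<phi> n"] by simp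
    qed
    then show "\<exists>N. \<forall>m\<ge>N. \<forall>n\<ge>N. sqint mu (\<lambda>x. A (\<phi> m) x - A (\<phi> n) x) < \<epsilon>" by blast
  qed
  then show ?thesis using \<phi> Dcl_schwartz by blast
qed

abbreviation ext :: "((real ^ 'n \<Rightarrow> complex) \<Rightarrow> real ^ 'n \<Rightarrow> complex) \<Rightarrow> (real ^ 'n \<Rightarrow> complex) \<Rightarrow> real ^ 'n \<Rightarrow> complex" where
  "ext A \<equiv> L2_extension mu A"

lemma ext_seq:
  assumes A: "fourier_op A" and f: "f \<in> L2_space mu"
  shows "\<exists>\<phi>. (\<forall>n. schwartz (\<phi> n)) \<and> L2_tendsto mu \<phi> f \<and> L2_tendsto mu (\<lambda>n. A (\<phi> n)) (ext A f)"
  unfolding L2_extension_def by (rule someI_ex[OF fourier_op_ex[OF A f]])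

lemma ext_L2: "fourier_op A \<Longrightarrow> f \<in> L2_space mu \<Longrightarrow> ext A f \<in> L2_space mu"
  using ext_seq[of A f] by (auto simp: L2_tendsto_def)

text \<open>The sequences behind the two chosen extensions are unknown Schwartz functions. The
  symmetric pairing holds for them, and it is carried to the limit in one factor at a time.\<close>

lemma ext_pairing:
  assumes A: "fourier_op A" and f: "f \<in> L2_space mu" and g: "g \<in> L2_space mu"
  shows "(\<integral>x. ext A f x * g x \<partial>mu) = (\<integral>x. f x * ext A g x \<partial>mu)"
proof -
  obtain \<phi> where \<phi>: "\<And>n. schwartz (\<phi> n)" "L2_tendsto mu \<phi> f" "L2_tendsto mu (\<lambda>n. A (\<phi> n)) (ext A f)"
    using ext_seq[OF A f] by blast
  obtain \<psi> where \<psi>: "\<And>n. schwartz (\<psi> n)" "L2_tendsto mu \<psi> g" "L2_tendsto mu (\<lambda>n. A (\<psi> n)) (ext A g)"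
    using ext_seq[OF A g] by blast
  have \<psi>L: "\<psi> n \<in> L2_space mu" "A (\<psi> n) \<in> L2_space mu" for n using \<psi> by (simp_all add: L2_tendsto_def)
  have i: "integrable mu f" if "schwartz f" for f by (rule integrable_rap[OF schwartz_rap[OF that]])
  have eq: "(\<integral>x. \<psi> n x * ext A f x \<partial>mu) = (\<integral>x. A (\<psi> n) x * f x \<partial>mu)" for n
  proof (rule LIMSEQ_unique)
    show "(\<lambda>m. \<integral>x. \<psi> n x * A (\<phi> m) x \<partial>mu) \<longlonglongrightarrow> (\<integral>x. \<psi> n x * ext A f x \<partial>mu)"
      by (rule L2_tendsto_pairing[OF \<phi>(3) \<psi>L(1)])
    show "(\<lambda>m. \<integral>x. \<psi> n x * A (\<phi> m) x \<partial>mu) \<longlonglongrightarrow> (\<integral>x. A (\<psi> n) x * f x \<partial>mu)"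
      using L2_tendsto_pairing[OF \<phi>(2) \<psi>L(2), of n] by (simp add: fourier_op_pairing[OF A i[OF \<psi>(1)] i[OF \<phi>(1)]])
  qed
  show ?thesis
  proof (rule LIMSEQ_unique)
    show "(\<lambda>n. \<integral>x. ext A f x * \<psi> n x \<partial>mu) \<longlonglongrightarrow> (\<integral>x. ext A f x * g x \<partial>mu)"
      by (rule L2_tendsto_pairing[OF \<psi>(2) ext_L2[OF A f]])
    show "(\<lambda>n. \<integral>x. ext A f x * \<psi> n x \<partial>mu) \<longlonglongrightarrow> (\<integral>x. f x * ext A g x \<partial>mu)"
      using L2_tendsto_pairing[OF \<psi>(3) f] eq by (simp add: mult.commute)
  qed
qed

lemma ext_Dcl_pairing:
  assumes A: "fourier_op A" and f: "f \<in> L2_space mu" and \<psi>: "\<psi> \<in> Dcl"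
  shows "(\<integral>x. ext A f x * \<psi> x \<partial>mu) = (\<integral>x. f x * A \<psi> x \<partial>mu)"
proof -
  obtain \<phi> where \<phi>: "\<And>n. schwartz (\<phi> n)" "L2_tendsto mu \<phi> f" "L2_tendsto mu (\<lambda>n. A (\<phi> n)) (ext A f)"
    using ext_seq[OF A f] by blast
  have L: "\<psi> \<in> L2_space mu" "A \<psi> \<in> L2_space mu" using \<psi> fourier_op_Dcl[OF A \<psi>] Dcl_L2 by blast+
  have i: "integrable mu (\<phi> n)" for n by (rule integrable_rap[OF schwartz_rap[OF \<phi>(1)]])
  have "(\<integral>x. \<psi> x * ext A f x \<partial>mu) = (\<integral>x. A \<psi> x * f x \<partial>mu)"
  proof (rule LIMSEQ_unique)
    show "(\<lambda>m. \<integral>x. \<psi> x * A (\<phi> m) x \<partial>mu) \<longlonglongrightarrow> (\<integral>x. \<psi> x * ext A f x \<partial>mu)"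
      by (rule L2_tendsto_pairing[OF \<phi>(3) L(1)])
    show "(\<lambda>m. \<integral>x. \<psi> x * A (\<phi> m) x \<partial>mu) \<longlonglongrightarrow> (\<integral>x. A \<psi> x * f x \<partial>mu)"
      using L2_tendsto_pairing[OF \<phi>(2) L(2)] by (simp add: fourier_op_pairing[OF A Dcl_integrable[OF \<psi>] i])
  qed
  then show ?thesis by (simp add: mult.commute)
qed

text \<open>Both functions have the same pairings with \<open>Dcl\<close>. As A v is so far known to
  be bounded but not square integrable, the difference is damped by \<open>gauss 1\<close> before
  \<open>Dcl_total\<close> is applied; the factor is absorbed by the test function.\<close>

lemma ext_rap:
  assumes A: "fourier_op A" and v: "rap v" and vm [measurable]: "v \<in> borel_measurable borel"
  shows "AE x in mu. ext A v x = A v x"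
proof -
  have vL: "v \<in> L2_space mu" by (rule L2_rap[OF v vm])
  have iv: "integrable mu v" by (rule integrable_rap[OF v vm])
  note eL = ext_L2[OF A vL]
  have [measurable]: "ext A v \<in> borel_measurable borel" using L2_measurable[OF eL] by simp
  have AvF: "A v = F v \<or> A v = (\<lambda>x. F v (- x))" using A by (auto simp: fourier_op_def Finv_F)
  have Avm [measurable]: "A v \<in> borel_measurable borel" using AvF by (elim disjE) simp_all
  have "norm (F v x) \<le> inverse ck * (cG * (\<integral>x. norm (v x) \<partial>mu))" for x
  proof -
    have "norm (\<integral>y. e (- x) y * v y \<partial>mu) \<le> (\<integral>y. norm (e (- x) y * v y) \<partial>mu)"
      by (rule Bochner_Integration.integral_norm_bound)
    also have "\<dots> \<le> (\<integral>y. cG * norm (v y) \<partial>mu)"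
    proof (rule integral_mono)
      show "norm (e (- x) y * v y) \<le> cG * norm (v y)" for y
        unfolding norm_mult by (intro mult_right_mono e_bound) simp
    qed (use integrable_norm[OF integrable_eint[OF v vm]] iv in auto)
    finally have "norm (\<integral>y. e (- x) y * v y \<partial>mu) \<le> cG * (\<integral>x. norm (v x) \<partial>mu)" by simp
    then show ?thesis unfolding F_def norm_mult norm_inverse norm_of_real using ck_pos by (simp add: mult_left_mono)
  qed
  then obtain B where B: "\<And>x. norm (A v x) \<le> B" using AvF by (metis (no_types, lifting))
  define d where "d x = gauss 1 x * (ext A v x - A v x)" for x
  have AvL: "(\<lambda>x. gauss 1 x * A v x) \<in> L2_space mu"
  proof (rule L2_rap)
    have "rap (\<lambda>x. A v x * gauss 1 x)" by (rule rap_mult_bounded[OF rap_gauss B]) simp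
    then show "rap (\<lambda>x. gauss 1 x * A v x)" by (simp add: mult.commute)
  qed measurable
  have AeL: "(\<lambda>x. gauss 1 x * ext A v x) \<in> L2_space mu"
    by (rule L2_bound[OF _ eL, of _ 1]) (auto simp: norm_mult gauss_def intro!: AE_I2 mult_left_le_one_le)
  have "AE x in mu. d x = 0"
  proof (rule Dcl_total)
    show "d \<in> L2_space mu" unfolding d_def right_diff_distrib by (rule L2_diff[OF AeL AvL])
    fix \<phi> assume \<phi>: "\<phi> \<in> Dcl"
    define \<psi> where "\<psi> x = gauss 1 x * \<phi> x" for x
    have \<psi>: "\<psi> \<in> Dcl" unfolding \<psi>_def by (rule Dcl_gauss_mult[OF \<phi>]) simp
    have \<phi>L: "\<phi> \<in> L2_space mu" using \<phi> Dcl_L2 by blast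
    have eq: "gauss 1 x * u x * \<phi> x = u x * \<psi> x" for u x by (simp add: \<psi>_def)
    have "(\<integral>x. d x * \<phi> x \<partial>mu) = (\<integral>x. ext A v x * \<psi> x - A v x * \<psi> x \<partial>mu)"
      by (simp add: d_def \<psi>_def algebra_simps)
    also have "\<dots> = (\<integral>x. ext A v x * \<psi> x \<partial>mu) - (\<integral>x. A v x * \<psi> x \<partial>mu)"
      using L2_mult(1)[OF AeL \<phi>L] L2_mult(1)[OF AvL \<phi>L] unfolding eq by (rule Bochner_Integration.integral_diff)
    also have "\<dots> = 0" unfolding ext_Dcl_pairing[OF A vL \<psi>] fourier_op_pairing[OF A iv Dcl_integrable[OF \<psi>]] by simp
    finally show "(\<integral>x. d x * \<phi> x \<partial>mu) = 0" .
  qed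
  then show ?thesis by eventually_elim (simp add: d_def gauss_def)
qed

end

section \<open>A vanishing criterion for Laplace transforms\<close>

lemma power_exp_bound:
  fixes d u :: real
  assumes "d > 0"
  shows "\<exists>K\<ge>0. \<forall>u\<ge>0. (1 + u) ^ N * exp (- u * d) \<le> K * exp (- u * d / 2)"
proof -
  \<comment> \<open>Half of the rate d pays for the power: (c * (1 + u)) ^ N is at most exp (c * N *
    (1 + u)), and c * N \<le> d / 2. The summand 1 covers N = 0.\<close>
  define c where "c = d / (2 * (real N + 1))"
  have c: "c > 0" "c * real N \<le> d / 2" using assms by (simp_all add: c_def field_simps)
  have "(1 + u) ^ N * exp (- u * d) \<le> (exp (d / 2) / c ^ N) * exp (- u * d / 2)" if u: "u \<ge> 0" for u
  proof -
    have "c * (1 + u) \<le> exp (c * (1 + u))" using exp_ge_add_one_self[of "c * (1 + u)"] by linarith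
    then have "(c * (1 + u)) ^ N \<le> exp (c * (1 + u)) ^ N" using c u by (intro power_mono) auto
    also have "\<dots> = exp ((c * real N) * (1 + u))" by (simp add: exp_of_nat_mult[symmetric] mult_ac)
    also have "\<dots> \<le> exp (d / 2 * (1 + u))" using mult_right_mono[OF c(2), of "1 + u"] u by simp
    finally have 1: "(1 + u) ^ N \<le> exp (d / 2 * (1 + u)) / c ^ N"
      using c by (simp add: power_mult_distrib pos_le_divide_eq mult.commute)
    have "(1 + u) ^ N * exp (- u * d) \<le> exp (d / 2 * (1 + u)) / c ^ N * exp (- u * d)"
      by (intro mult_right_mono 1) simp
    also have "\<dots> = (exp (d / 2 * (1 + u)) * exp (- u * d)) / c ^ N" by simp
    also have "exp (d / 2 * (1 + u)) * exp (- u * d) = exp (d / 2) * exp (- u * d / 2)"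
      by (simp add: exp_add[symmetric] field_simps)
    finally show ?thesis by simp
  qed
  then show ?thesis using c by (intro exI[of _ "exp (d / 2) / c ^ N"]) auto
qed

text \<open>As \<open>n\<close> grows, \<open>exp (- exp (n * (t - s)))\<close> tends to the indicator of \<open>s > t\<close>. Expanding
  the outer exponential, every term but the first is controlled by the decay of the transform.\<close>

lemma laplace_vanishing:
  fixes k :: "'a \<Rightarrow> complex" and s :: "'a \<Rightarrow> real"
  assumes k: "integrable M k" and s [measurable]: "s \<in> borel_measurable M" and s0: "\<And>x. s x \<ge> 0"
    and b: "\<And>a. a \<ge> 0 \<Longrightarrow> norm (\<integral>x. of_real (exp (- a * s x)) * k x \<partial>M) \<le> C * (1 + a) ^ N * exp (- a * \<rho>)"
    and t: "t < \<rho>" and ae: "AE x in M. s x \<noteq> t"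
  shows "(\<integral>x. of_real (if s x < t then 1 else 0) * k x \<partial>M) = 0"
proof -
  have [measurable]: "k \<in> borel_measurable M" by (rule borel_measurable_integrable[OF k])
  define J where "J n = (\<integral>x. of_real (exp (- exp (real n * (t - s x)))) * k x \<partial>M)" for n :: nat
  have C: "C \<ge> 0" using order_trans[OF norm_ge_zero b[of 0]] by simp
  define d where "d = \<rho> - t"
  have d: "d > 0" using t by (simp add: d_def)
  obtain K where K: "K \<ge> 0" "\<And>u. u \<ge> 0 \<Longrightarrow> (1 + u) ^ N * exp (- u * d) \<le> K * exp (- u * d / 2)"
    using power_exp_bound[OF d] by metis
  have ik: "integrable M (\<lambda>x. of_real (g x) * k x)"
    if [measurable]: "g \<in> borel_measurable M" and g: "\<And>x. \<bar>g x\<bar> \<le> 1" for g :: "'a \<Rightarrow> real"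
  proof (rule Bochner_Integration.integrable_bound[OF k])
    show "AE x in M. norm (complex_of_real (g x) * k x) \<le> norm (k x)"
      unfolding norm_mult norm_of_real by (intro AE_I2 mult_left_le_one_le g) auto
  qed measurable
  have lim1: "J \<longlonglongrightarrow> (\<integral>x. of_real (if s x > t then 1 else 0) * k x \<partial>M)"
    unfolding J_def
  proof (rule integral_dominated_convergence[where w = "\<lambda>x. norm (k x)"])
    show "integrable M (\<lambda>x. norm (k x))" using k by (rule integrable_norm)
    show "AE x in M. norm (complex_of_real (exp (- exp (real n * (t - s x)))) * k x) \<le> norm (k x)" for n
      unfolding norm_mult norm_of_real by (intro AE_I2 mult_left_le_one_le) auto
    show "AE x in M. (\<lambda>n. complex_of_real (exp (- exp (real n * (t - s x)))) * k x)
        \<longlonglongrightarrow> complex_of_real (if s x > t then 1 else 0) * k x"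
      using ae
    proof eventually_elim
      case (elim x)
      \<comment> \<open>At s x = t every term equals exp (- 1); this level set is excluded by
        \<open>ae\<close>.\<close>
      have "(\<lambda>n. exp (- exp (real n * (t - s x)))) \<longlonglongrightarrow> (if s x > t then 1 else 0)"
      proof (cases "s x > t")
        case True
        define c where "c = t - s x"
        have "c < 0" using True by (simp add: c_def)
        then have "(\<lambda>n. exp (- exp (real n * c))) \<longlonglongrightarrow> 1" by real_asymp
        then show ?thesis using True by (simp add: c_def)
      next
        case False
        define c where "c = t - s x"
        have "c > 0" using False elim by (simp add: c_def)
        then have "(\<lambda>n. exp (- exp (real n * c))) \<longlonglongrightarrow> 0" by real_asymp
        then show ?thesis using False by (simp add: c_def)
      qed
      then show ?case by (intro tendsto_intros)
    qed
  qed measurable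
  have Jb: "norm (J n - (\<integral>x. k x \<partial>M)) \<le> C * K * exp 1 * exp (- real n * d / 2)" for n
  proof -
    define f where "f j x = complex_of_real ((- exp (real n * (t - s x))) ^ j / fact j) * k x" for j x
    have nf: "norm (f j x) = exp (real n * (t - s x)) ^ j / fact j * norm (k x)" for j x
      unfolding f_def norm_mult norm_of_real by (simp add: power_abs)
    have le: "exp (real n * (t - s x)) ^ j \<le> exp (real n * t) ^ j" for x j
      using s0[of x] by (intro power_mono) (auto simp: mult_left_mono)
    have nfb: "norm (f j x) \<le> exp (real n * t) ^ j / fact j * norm (k x)" for j x
      unfolding nf by (intro mult_right_mono divide_right_mono le) auto
    have [measurable]: "f j \<in> borel_measurable M" for j unfolding f_def by measurable
    have fi: "integrable M (f j)" for j
    proof (rule Bochner_Integration.integrable_bound)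
      show "integrable M (\<lambda>x. exp (real n * t) ^ j / fact j * norm (k x))" using k by simp
      show "AE x in M. norm (f j x) \<le> norm (exp (real n * t) ^ j / fact j * norm (k x))"
        by (rule AE_I2, rule order_trans[OF nfb]) simp
    qed measurable
    have es: "summable (\<lambda>j. exp (real n * t) ^ j / fact j)"
      using summable_exp_generic[of "exp (real n * t)"] by (simp add: divide_inverse mult.commute)
    have sm: "summable (\<lambda>j. norm (f j x))" for x
      by (rule summable_comparison_test'[OF summable_mult2[OF es, of "norm (k x)"]]) (use nfb in auto)
    have "f j x = (of_real (- exp (real n * (t - s x))) ^ j /\<^sub>R fact j) * k x" for j x
      by (simp add: f_def scaleR_conv_of_real divide_inverse mult.commute)
    then have fs: "(\<lambda>j. f j x) sums (of_real (exp (- exp (real n * (t - s x)))) * k x)" for x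
      using sums_mult2[OF exp_converges[of "complex_of_real (- exp (real n * (t - s x)))"], of "k x"]
      by (simp only: exp_of_real)
    have sn: "summable (\<lambda>j. \<integral>x. norm (f j x) \<partial>M)"
    proof (rule summable_comparison_test'[OF summable_mult2[OF es, of "\<integral>x. norm (k x) \<partial>M"]])
      fix j
      have "(\<integral>x. norm (f j x) \<partial>M) \<le> (\<integral>x. exp (real n * t) ^ j / fact j * norm (k x) \<partial>M)"
        by (rule integral_mono[OF integrable_norm[OF fi]]) (use k nfb in auto)
      then show "norm (\<integral>x. norm (f j x) \<partial>M) \<le> exp (real n * t) ^ j / fact j * (\<integral>x. norm (k x) \<partial>M)" by simp
    qed
    have "J n = (\<integral>x. (\<Sum>j. f j x) \<partial>M)" unfolding J_def by (simp add: sums_unique[OF fs])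
    moreover note sums_integral[OF fi AE_I2[OF sm] sn]
    ultimately have Js: "(\<lambda>j. integral\<^sup>L M (f j)) sums J n" by simp
    have f0: "integral\<^sup>L M (f 0) = (\<integral>x. k x \<partial>M)" 
    proof -
      have "f 0 = k" by (simp add: fun_eq_iff f_def)
      then show ?thesis by simp
    qed
    have bj: "norm (integral\<^sup>L M (f (Suc j))) \<le> C * K * exp (- real n * d / 2) * (inverse (fact j))" for j
    proof -
      \<comment> \<open>Up to its sign, the term of index Suc j is the transform at a = Suc j * n,
        multiplied by exp (a * t) / fact (Suc j). Its exponential size exp (- a * d) tends to 0 with
        n, uniformly in j, and the factorial sums over j.\<close>
      define a where "a = real (Suc j) * real n"
      have "1 * real n \<le> real (Suc j) * real n" by (intro mult_right_mono) auto
      then have a: "a \<ge> real n" "a \<ge> 0" by (simp_all add: a_def)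
      have eq: "exp (real n * (t - s x)) ^ Suc j = exp (a * t) * exp (- a * s x)" for x
        by (simp add: a_def exp_of_nat_mult[symmetric] exp_add[symmetric] algebra_simps del: of_nat_Suc power_Suc)
      have "f (Suc j) x = complex_of_real ((- 1) ^ Suc j * (exp (a * t) / fact (Suc j))) * (of_real (exp (- a * s x)) * k x)" for x
        unfolding f_def power_minus[of "exp _"] eq by (simp add: mult_ac)
      then have "integral\<^sup>L M (f (Suc j)) = complex_of_real ((- 1) ^ Suc j * (exp (a * t) / fact (Suc j))) * (\<integral>x. of_real (exp (- a * s x)) * k x \<partial>M)"
        by (subst integral_mult_right_zero[symmetric]) (rule Bochner_Integration.integral_cong[OF refl])
      also have "norm \<dots> = exp (a * t) / fact (Suc j) * norm (\<integral>x. of_real (exp (- a * s x)) * k x \<partial>M)"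
        unfolding norm_mult norm_of_real abs_mult power_abs by simp
      also have "\<dots> \<le> exp (a * t) / fact (Suc j) * (C * (1 + a) ^ N * exp (- a * \<rho>))"
        by (intro mult_left_mono b a) auto
      also have "\<dots> = C * ((1 + a) ^ N * exp (- a * d)) / fact (Suc j)"
        by (simp add: d_def algebra_simps exp_add[symmetric])
      also have "\<dots> \<le> C * (K * exp (- real n * d / 2)) / fact (Suc j)"
      proof (intro divide_right_mono mult_left_mono)
        have "(1 + a) ^ N * exp (- a * d) \<le> K * exp (- a * d / 2)" by (rule K(2)[OF a(2)])
        also have "\<dots> \<le> K * exp (- real n * d / 2)" using a d K(1) by (intro mult_left_mono) (auto intro: mult_right_mono)
        finally show "(1 + a) ^ N * exp (- a * d) \<le> K * exp (- real n * d / 2)" .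
      qed (use C in auto)
      also have "\<dots> \<le> C * (K * exp (- real n * d / 2)) / fact j"
        using C K(1) by (intro divide_left_mono fact_mono) auto
      also have "\<dots> = C * K * exp (- real n * d / 2) * inverse (fact j)"
        by (simp only: divide_inverse mult.assoc)
      finally show ?thesis .
    qed
    have ei: "summable (\<lambda>j. inverse (fact j) :: real)" "(\<Sum>j. inverse (fact j) :: real) = exp 1"
      using summable_exp[of "1::real"] by (simp_all add: exp_def divide_inverse)
    have "J n - (\<integral>x. k x \<partial>M) = (\<Sum>j. integral\<^sup>L M (f (Suc j)))"
      using suminf_split_head[OF sums_summable[OF Js]] sums_unique[OF Js] f0 by simp
    also have "norm \<dots> \<le> (\<Sum>j. C * K * exp (- real n * d / 2) * (inverse (fact j)))"
      by (rule norm_suminf_le[OF bj summable_mult[OF ei(1)]])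
    also have "\<dots> = C * K * exp (- real n * d / 2) * exp 1" using suminf_mult[OF ei(1)] ei(2) by simp
    finally show ?thesis by (simp add: mult_ac)
  qed
  have lim2: "J \<longlonglongrightarrow> (\<integral>x. k x \<partial>M)"
  proof (rule LIM_zero_cancel, rule Lim_null_comparison)
    show "\<forall>\<^sub>F n in sequentially. norm (J n - (\<integral>x. k x \<partial>M)) \<le> C * K * exp 1 * exp (- real n * d / 2)"
      using Jb by simp
    have "(\<lambda>n. exp (- real n * d / 2)) \<longlonglongrightarrow> 0" using d by real_asymp
    from tendsto_mult_right_zero[OF this] show "(\<lambda>n. C * K * exp 1 * exp (- real n * d / 2)) \<longlonglongrightarrow> 0" .
  qed
  \<comment> \<open>Equality of the two limits says that the part with s > t carries the whole
    integral, so nothing is left for s < t.\<close>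
  have "(\<integral>x. k x \<partial>M) = (\<integral>x. of_real (if s x > t then 1 else 0) * k x \<partial>M)" by (rule LIMSEQ_unique[OF lim2 lim1])
  moreover have "(\<integral>x. k x \<partial>M) = (\<integral>x. of_real (if s x > t then 1 else 0) * k x + of_real (if s x < t then 1 else 0) * k x \<partial>M)"
    by (rule integral_cong_AE) (use ae in \<open>auto elim: eventually_mono\<close>)
  moreover have "\<dots> = (\<integral>x. of_real (if s x > t then 1 else 0) * k x \<partial>M) + (\<integral>x. of_real (if s x < t then 1 else 0) * k x \<partial>M)"
    by (rule Bochner_Integration.integral_add) (rule ik; simp)+
  ultimately show ?thesis by simp
qed

section \<open>Translates of polynomial multiples of Gaussians\<close>

context dunkl
begin

text \<open>For rapidly decreasing \<open>f\<close> this is the translate \<open>\<tau>\<^sub>x f (- y)\<close>.\<close>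

definition Smap :: "(real ^ 'n \<Rightarrow> complex) \<Rightarrow> real ^ 'n \<Rightarrow> real ^ 'n \<Rightarrow> complex" where
  "Smap f x y = inverse (of_real ck) * eint (\<lambda>\<xi>. e \<xi> (- y) * F f \<xi>) x"

lemma Smap_rap: assumes "f \<in> Dcl" shows "rap (\<lambda>\<xi>. e \<xi> y * F f \<xi>)" "(\<lambda>\<xi>. e \<xi> y * F f \<xi>) \<in> borel_measurable borel"
proof -
  have [measurable]: "f \<in> borel_measurable borel" by (rule Dcl_measurable[OF assms])
  show "rap (\<lambda>\<xi>. e \<xi> y * F f \<xi>)" by (rule rap_mult_bounded[OF Dcl_rap[OF F_Dcl[OF assms]] e_bound])
  show "(\<lambda>\<xi>. e \<xi> y * F f \<xi>) \<in> borel_measurable borel" by measurable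
qed

lemma Smap_add: assumes "f \<in> Dcl" "g \<in> Dcl" shows "Smap (\<lambda>x. f x + g x) x y = Smap f x y + Smap g x y"
proof -
  have "eint (\<lambda>\<xi>. e \<xi> (- y) * F (\<lambda>x. f x + g x) \<xi>) x = eint (\<lambda>\<xi>. e \<xi> (- y) * F f \<xi>) x + eint (\<lambda>\<xi>. e \<xi> (- y) * F g \<xi>) x"
    unfolding eint_def F_add[OF Dcl_rap[OF assms(1)] Dcl_measurable[OF assms(1)] Dcl_rap[OF assms(2)] Dcl_measurable[OF assms(2)]] distrib_left
    by (rule Bochner_Integration.integral_add) (intro integrable_eint Smap_rap assms)+
  then show ?thesis by (simp add: Smap_def distrib_left)
qed

lemma Smap_cmult: "Smap (\<lambda>x. c * f x) x y = c * Smap f x y"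
  unfolding Smap_def eint_def F_cmult mult.left_commute[of _ c] by simp

text \<open>On the transform side both operations multiply by \<i> (\<eta> \<bullet> \<xi>). The
  operator T ends up acting on the translation point x, in which \<open>Kern\<close> is
  explicit.\<close>

lemma Smap_T: assumes "f \<in> Dcl" shows "Smap (T \<eta> f) x y = T \<eta> (\<lambda>x. Smap f x y) x"
  unfolding Smap_def T_cmult[OF polyg_diff[OF polyg_eint[OF Smap_rap[OF assms]]]] T_eint[OF Smap_rap[OF assms]]
  by (simp add: F_T[OF Dcl_rapd[OF assms]] mult_ac)

lemma Smap_gauss: assumes a: "a > 0" shows "Smap (gauss a) x y = Kern a x y"
proof -
  have eq: "(\<lambda>\<xi>. e \<xi> (- y) * F (gauss a) \<xi>) = (\<lambda>\<xi>. (Z a / of_real ck) * (e \<xi> (- y) * gauss (1 / (4 * a)) \<xi>))"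
    using a by (simp add: fun_eq_iff F_gauss)
  have "eint (\<lambda>\<xi>. e \<xi> (- y) * F (gauss a) \<xi>) x = (Z a / of_real ck) * eint (\<lambda>\<xi>. e \<xi> (- y) * gauss (1 / (4 * a)) \<xi>) x"
    unfolding eq eint_def by (simp only: mult.left_commute[of "e x _" "Z a / of_real ck"] integral_mult_right_zero)
  also have "\<dots> = (Z a * Z (1 / (4 * a))) / of_real ck * Kern a x y"
    by (subst heat_kernel) (use a in auto)
  finally show ?thesis using ck_pos by (simp add: Smap_def Z_mult[OF a] power2_eq_square)
qed

text \<open>By polarization, 2 (g x \<bullet> y) is the sum of the squared norms of x and y minus
  the squared distance of g x and y. The two Gaussian factors of \<open>Kern\<close> cancel the
  norms, and only the distance from the orbit is left in the exponent.\<close>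

lemma Kern_bound:
  assumes a: "a \<ge> 0" and D: "D \<ge> 0" "\<And>g. g \<in> G \<Longrightarrow> D \<le> norm (g x - y)"
  shows "norm (Kern a x y) \<le> cG * exp (- a * D\<^sup>2)"
proof -
  have "norm (E (complex_vec x) (of_real (2 * a) *s complex_vec y)) \<le> sqrt (card G) * exp (a * (norm x)\<^sup>2 + a * (norm y)\<^sup>2 - a * D\<^sup>2)"
  proof (rule E_growth)
    fix g assume g: "g \<in> G"
    have "Re (cdot (cext g (complex_vec x)) (of_real (2 * a) *s complex_vec y)) = a * (2 * (g x \<bullet> y))"
      using g by (simp add: cext_complex_vec G_linear cdot_scale_right cdot_complex_vec)
    also have "2 * (g x \<bullet> y) = (norm x)\<^sup>2 + (norm y)\<^sup>2 - (norm (g x - y))\<^sup>2"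
      using g by (simp add: power2_norm_eq_inner inner_diff_left inner_diff_right inner_commute G_inner)
    also have "a * \<dots> \<le> a * ((norm x)\<^sup>2 + (norm y)\<^sup>2 - D\<^sup>2)"
      using power_mono[OF D(2)[OF g] D(1), of 2] a by (intro mult_left_mono) auto
    finally show "Re (cdot (cext g (complex_vec x)) (of_real (2 * a) *s complex_vec y)) \<le> a * (norm x)\<^sup>2 + a * (norm y)\<^sup>2 - a * D\<^sup>2"
      by (simp add: algebra_simps)
  qed
  then have "norm (Kern a x y) \<le> exp (- a * (norm x)\<^sup>2) * (exp (- a * (norm y)\<^sup>2) * (cG * exp (a * (norm x)\<^sup>2 + a * (norm y)\<^sup>2 - a * D\<^sup>2)))"
    unfolding Kern_def norm_mult gauss_def norm_of_real abs_exp_cancel cG_def by (intro mult_left_mono) auto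
  also have "\<dots> = cG * exp (- a * D\<^sup>2)"
    by (simp add: mult.left_commute[of _ cG] exp_add[symmetric])
  finally show ?thesis .
qed

definition coefs :: "real \<Rightarrow> real \<Rightarrow> (real \<times> (real ^ 'n) \<Rightarrow> complex) set" where
  "coefs b m = {c. \<exists>C M. \<forall>a y. b \<le> a \<longrightarrow> norm y \<le> m \<longrightarrow> norm (c (a, y)) \<le> C * (1 + a) ^ M}"

text \<open>All copies along the orbit are included because \<open>cspan_props\<close> demands
  stability under the group: T of a coordinate multiple involves reflected copies.\<close>

definition Kbase :: "(real \<times> (real ^ 'n) \<Rightarrow> real ^ 'n \<Rightarrow> complex) set" where
  "Kbase = {(\<lambda>p x. Kern (fst p) (g x) (snd p)) | g. g \<in> G}"

lemma coefs_const: "(\<lambda>_. c) \<in> coefs b m"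
  unfolding coefs_def by (intro CollectI exI[of _ "norm c"] exI[of _ 0]) simp

lemma coefs_linear: assumes "b > 0" shows "(\<lambda>p. of_real (c * fst p)) \<in> coefs b m"
  unfolding coefs_def
proof (intro CollectI exI[of _ "\<bar>c\<bar>"] exI[of _ 1] allI impI)
  fix a y assume "b \<le> a"
  then have "\<bar>a\<bar> \<le> 1 + a" using assms by linarith
  then have "\<bar>c\<bar> * \<bar>a\<bar> \<le> \<bar>c\<bar> * (1 + a)" by (intro mult_left_mono) auto
  then show "norm (complex_of_real (c * fst (a, y))) \<le> \<bar>c\<bar> * (1 + a) ^ 1"
    unfolding norm_of_real by (simp add: abs_mult)
qed

lemma coefs_inner: "(\<lambda>p. of_real (\<eta> \<bullet> snd p)) \<in> coefs b m"
  unfolding coefs_def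
proof (intro CollectI exI[of _ "norm \<eta> * m"] exI[of _ 0] allI impI)
  fix a and y :: "real ^ 'n" assume "norm y \<le> m"
  then have "norm \<eta> * norm y \<le> norm \<eta> * m" by (intro mult_left_mono) auto
  then have "\<bar>\<eta> \<bullet> y\<bar> \<le> norm \<eta> * m" using Cauchy_Schwarz_ineq2[of \<eta> y] by linarith
  then show "norm (complex_of_real (\<eta> \<bullet> snd (a, y))) \<le> norm \<eta> * m * (1 + a) ^ 0"
    unfolding norm_of_real by simp
qed

lemma coefs_inverse: assumes "b > 0" shows "(\<lambda>p. of_real (- 1 / (2 * fst p))) \<in> coefs b m"
  unfolding coefs_def
proof (intro CollectI exI[of _ "1 / (2 * b)"] exI[of _ 0] allI impI)
  fix a y assume "b \<le> a"
  then have "1 / (2 * a) \<le> 1 / (2 * b)" "a > 0" using assms by (auto intro!: divide_left_mono)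
  then have "\<bar>- 1 / (2 * a)\<bar> \<le> 1 / (2 * b)" by simp
  then show "norm (complex_of_real (- 1 / (2 * fst (a, y)))) \<le> 1 / (2 * b) * (1 + a) ^ 0"
    unfolding norm_of_real by simp
qed

lemma Kspan_T: assumes b: "b > 0" and u: "u \<in> cspan (coefs b m) Kbase"
  shows "u p differentiable at x" "(\<lambda>p. T \<eta> (u p)) \<in> cspan (coefs b m) Kbase"
proof -
  have d: "(\<lambda>x. Kern a (g x) y) differentiable at x" if "g \<in> G" for g a x y
    by (rule fder_comp(2)[OF G_linear[OF that] diff_Kern])
  have Bd: "v p differentiable at x" if "v \<in> Kbase" for v p x using that d by (auto simp: Kbase_def)
  have BG: "(\<lambda>p x. v p (g x)) \<in> cspan (coefs b m) Kbase" if "v \<in> Kbase" "g \<in> G" for v g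
  proof -
    obtain h where h: "h \<in> G" "v = (\<lambda>p x. Kern (fst p) (h x) (snd p))" using \<open>v \<in> Kbase\<close> by (auto simp: Kbase_def)
    have "(\<lambda>p x. Kern (fst p) ((h \<circ> g) x) (snd p)) \<in> Kbase" unfolding Kbase_def using G_comp[OF h(1) \<open>g \<in> G\<close>] by blast
    then show ?thesis by (intro cspan.base) (simp add: h(2))
  qed
  have BT: "(\<lambda>p. T \<eta> (v p)) \<in> cspan (coefs b m) Kbase" if v: "v \<in> Kbase" for v \<eta>
  proof -
    obtain h where h: "h \<in> G" "v = (\<lambda>p x. Kern (fst p) (h x) (snd p))" using v by (auto simp: Kbase_def)
    have "T \<eta> (v p) x = of_real (- 2 * fst p) * (of_real (x \<bullet> \<eta>) * v p x) + of_real (2 * fst p) * (of_real (h \<eta> \<bullet> snd p) * v p x)" for p x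
      unfolding h(2) T_comp[OF h(1) diff_Kern] T_Kern by (simp add: G_inner[OF h(1)])
    then have "(\<lambda>p. T \<eta> (v p)) = (\<lambda>p x. of_real (- 2 * fst p) * (of_real (x \<bullet> \<eta>) * v p x) + of_real (2 * fst p) * (of_real (h \<eta> \<bullet> snd p) * v p x))"
      by (simp add: fun_eq_iff)
    also have "\<dots> \<in> cspan (coefs b m) Kbase"
      by (rule cspan.add[OF cspan.scale[OF coefs_linear[OF b] cspan.coord[OF cspan.base[OF v]]]
            cspan.scale[OF coefs_linear[OF b] cspan.scale[OF coefs_inner cspan.base[OF v]]]])
    finally show ?thesis .
  qed
  show "u p differentiable at x"
    by (rule cspan_props(1)[where A = "coefs b m" and B = Kbase and u = u])
       (rule coefs_const, erule Bd, erule (1) BG, erule BT, rule u)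
  show "(\<lambda>p. T \<eta> (u p)) \<in> cspan (coefs b m) Kbase"
    by (rule cspan_props(3)[where A = "coefs b m" and B = Kbase and u = u])
       (rule coefs_const, erule Bd, erule (1) BG, erule BT, rule u)
qed

text \<open>D bounds the distance from the whole orbit of x and is therefore the same for all copies
  in \<open>Kbase\<close>; coefficients and coordinates change only the constant and the power of 1
  + a.\<close>

lemma Kspan_bound: assumes b: "b > 0" and u: "u \<in> cspan (coefs b m) Kbase"
  shows "\<exists>C M. \<forall>a y D. b \<le> a \<longrightarrow> norm y \<le> m \<longrightarrow> D \<ge> 0 \<longrightarrow> (\<forall>g\<in>G. D \<le> norm (g x - y)) \<longrightarrow>
    norm (u (a, y) x) \<le> C * (1 + a) ^ M * exp (- a * D\<^sup>2)"
proof -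
  define P where "P a y D \<longleftrightarrow> b \<le> a \<and> norm y \<le> m \<and> D \<ge> 0 \<and> (\<forall>g\<in>G. D \<le> norm (g x - y))" for a y D
  have "\<exists>C M. C \<ge> 0 \<and> (\<forall>a y D. P a y D \<longrightarrow> norm (u (a, y) x) \<le> C * (1 + a) ^ M * exp (- a * D\<^sup>2))"
    using u
  proof (induction rule: cspan.induct)
    case (base u)
    then obtain h where h: "h \<in> G" "u = (\<lambda>p x. Kern (fst p) (h x) (snd p))" by (auto simp: Kbase_def)
    have "norm (u (a, y) x) \<le> cG * (1 + a) ^ 0 * exp (- a * D\<^sup>2)" if p: "P a y D" for a y D
    proof -
      have "norm (Kern a (h x) y) \<le> cG * exp (- a * D\<^sup>2)"
      proof (rule Kern_bound)
        show "D \<le> norm (g (h x) - y)" if "g \<in> G" for g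
          using p G_comp[OF that h(1)] unfolding P_def by (metis comp_apply)
      qed (use p b in \<open>auto simp: P_def\<close>)
      then show ?thesis by (simp add: h(2))
    qed
    then show ?case using cG_pos by (intro exI[of _ cG] exI[of _ 0]) auto
  next
    case zero
    show ?case by (intro exI[of _ 0]) auto
  next
    case (add u v)
    obtain C1 M1 where 1: "C1 \<ge> 0" "\<And>a y D. P a y D \<Longrightarrow> norm (u (a, y) x) \<le> C1 * (1 + a) ^ M1 * exp (- a * D\<^sup>2)"
      using add.IH(1) by blast
    obtain C2 M2 where 2: "C2 \<ge> 0" "\<And>a y D. P a y D \<Longrightarrow> norm (v (a, y) x) \<le> C2 * (1 + a) ^ M2 * exp (- a * D\<^sup>2)"
      using add.IH(2) by blast
    have "norm (u (a, y) x + v (a, y) x) \<le> (C1 + C2) * (1 + a) ^ (M1 + M2) * exp (- a * D\<^sup>2)" if p: "P a y D" for a y D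
    proof -
      have a: "1 \<le> 1 + a" using p b by (simp add: P_def)
      have "norm (u (a, y) x + v (a, y) x) \<le> C1 * (1 + a) ^ M1 * exp (- a * D\<^sup>2) + C2 * (1 + a) ^ M2 * exp (- a * D\<^sup>2)"
        by (rule order_trans[OF norm_triangle_ineq add_mono[OF 1(2)[OF p] 2(2)[OF p]]])
      also have "\<dots> \<le> C1 * (1 + a) ^ (M1 + M2) * exp (- a * D\<^sup>2) + C2 * (1 + a) ^ (M1 + M2) * exp (- a * D\<^sup>2)"
        using 1(1) 2(1) by (intro add_mono mult_right_mono mult_left_mono power_increasing a) auto
      finally show ?thesis by (simp add: distrib_right)
    qed
    then show ?case using 1(1) 2(1) by (intro exI[of _ "C1 + C2"] exI[of _ "M1 + M2"]) auto
  next
    case (scale c u)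
    obtain C1 M1 where 1: "C1 \<ge> 0" "\<And>a y D. P a y D \<Longrightarrow> norm (u (a, y) x) \<le> C1 * (1 + a) ^ M1 * exp (- a * D\<^sup>2)"
      using scale.IH by blast
    obtain C2 M2 where 2: "\<And>a y. b \<le> a \<Longrightarrow> norm y \<le> m \<Longrightarrow> norm (c (a, y)) \<le> C2 * (1 + a) ^ M2"
      using scale.hyps unfolding coefs_def by blast
    have "norm (c (a, y) * u (a, y) x) \<le> (\<bar>C2\<bar> * C1) * (1 + a) ^ (M2 + M1) * exp (- a * D\<^sup>2)" if p: "P a y D" for a y D
    proof -
      have a: "0 \<le> 1 + a" using p b by (simp add: P_def)
      have "norm (c (a, y)) \<le> C2 * (1 + a) ^ M2" using 2 p by (simp add: P_def)
      also have "\<dots> \<le> \<bar>C2\<bar> * (1 + a) ^ M2" using a by (intro mult_right_mono) auto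
      finally have "norm (c (a, y)) * norm (u (a, y) x) \<le> (\<bar>C2\<bar> * (1 + a) ^ M2) * (C1 * (1 + a) ^ M1 * exp (- a * D\<^sup>2))"
        using a by (intro mult_mono 1(2)[OF p]) auto
      then show ?thesis by (simp add: norm_mult power_add mult_ac)
    qed
    then show ?case using 1(1) by (intro exI[of _ "\<bar>C2\<bar> * C1"] exI[of _ "M2 + M1"]) auto
  next
    case (coord u \<zeta>)
    obtain C1 M1 where 1: "C1 \<ge> 0" "\<And>a y D. P a y D \<Longrightarrow> norm (u (a, y) x) \<le> C1 * (1 + a) ^ M1 * exp (- a * D\<^sup>2)"
      using coord.IH by blast
    have "norm (of_real (x \<bullet> \<zeta>) * u (a, y) x) \<le> (\<bar>x \<bullet> \<zeta>\<bar> * C1) * (1 + a) ^ M1 * exp (- a * D\<^sup>2)" if p: "P a y D" for a y D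
      using mult_left_mono[OF 1(2)[OF p], of "\<bar>x \<bullet> \<zeta>\<bar>"] unfolding norm_mult norm_of_real by (simp add: mult.assoc)
    then show ?case using 1(1) by (intro exI[of _ "\<bar>x \<bullet> \<zeta>\<bar> * C1"] exI[of _ M1]) auto
  qed
  then show ?thesis unfolding P_def by blast
qed

text \<open>Polynomials filtered by degree. Since T lowers the degree, this index is what the
  induction for \<open>Kgood\<close> descends on.\<close>

inductive PN :: "nat \<Rightarrow> (real ^ 'n \<Rightarrow> complex) \<Rightarrow> bool" where
  PN_one: "PN n (\<lambda>x. 1)"
| PN_zero: "PN n (\<lambda>x. 0)"
| PN_add: "PN n f \<Longrightarrow> PN n g \<Longrightarrow> PN n (\<lambda>x. f x + g x)"
| PN_scale: "PN n f \<Longrightarrow> PN n (\<lambda>x. c * f x)"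
| PN_coord: "PN n f \<Longrightarrow> PN (Suc n) (\<lambda>x. of_real (x \<bullet> \<zeta>) * f x)"

lemma PN_sum: "(\<And>i. i \<in> I \<Longrightarrow> PN n (f i)) \<Longrightarrow> PN n (\<lambda>x. \<Sum>i\<in>I. f i x)"
  by (induction I rule: infinite_finite_induct) (auto intro: PN.intros)

lemma PN_diff: "PN n f \<Longrightarrow> f differentiable at x"
  by (induction rule: PN.induct) (auto intro!: differentiable_mult diff_coord)

lemma PN_G: "PN n f \<Longrightarrow> g \<in> G \<Longrightarrow> PN n (\<lambda>x. f (g x))"
proof (induction rule: PN.induct)
  case (PN_coord n f \<zeta>)
  obtain h where h: "h \<in> G" "h \<circ> g = id" using G_inverse[OF PN_coord.prems] by blast
  have "g x \<bullet> \<zeta> = x \<bullet> h \<zeta>" for x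
    using G_inner[OF h(1), of "g x" \<zeta>] h(2) by (metis comp_apply id_apply)
  then show ?case using PN_coord by (auto intro: PN.intros)
qed (auto intro: PN.intros)

text \<open>Constants have no lower degree to fall to, hence the case distinction: for n = 0 the
  result is the zero function, so the index always drops strictly or the function
  disappears.\<close>

lemma PN_T: "PN n f \<Longrightarrow> (case n of 0 \<Rightarrow> T \<eta> f = (\<lambda>x. 0) | Suc n' \<Rightarrow> PN n' (T \<eta> f))"
proof (induction rule: PN.induct)
  case (PN_one n)
  then show ?case by (auto split: nat.split intro: PN_zero)
next
  case (PN_zero n)
  then show ?case by (auto split: nat.split intro: PN.PN_zero)
next
  case (PN_add n f g)
  have "T \<eta> (\<lambda>x. f x + g x) = (\<lambda>x. T \<eta> f x + T \<eta> g x)"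
    using PN_add by (simp add: fun_eq_iff T_add PN_diff)
  then show ?case using PN_add by (auto split: nat.splits intro: PN.intros)
next
  case (PN_scale n f c)
  have "T \<eta> (\<lambda>x. c * f x) = (\<lambda>x. c * T \<eta> f x)" using PN_scale by (simp add: fun_eq_iff T_cmult PN_diff)
  then show ?case using PN_scale by (auto split: nat.splits intro: PN.intros)
next
  case (PN_coord n f \<zeta>)
  have "T \<eta> (\<lambda>x. of_real (x \<bullet> \<zeta>) * f x) = (\<lambda>x. (of_real (x \<bullet> \<zeta>) * T \<eta> f x + of_real (\<eta> \<bullet> \<zeta>) * f x)
    + (\<Sum>\<alpha>\<in>R. of_real (kp \<alpha> * (\<alpha> \<bullet> \<eta>) * (\<alpha> \<bullet> \<zeta>)) * f (\<sigma> \<alpha> x)))"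
    using PN_coord by (simp add: fun_eq_iff T_coord PN_diff)
  moreover have "PN n (\<lambda>x. of_real (x \<bullet> \<zeta>) * T \<eta> f x)"
    using PN_coord.IH by (cases n) (auto intro: PN.intros)
  moreover have "PN n (\<lambda>x. \<Sum>\<alpha>\<in>R. of_real (kp \<alpha> * (\<alpha> \<bullet> \<eta>) * (\<alpha> \<bullet> \<zeta>)) * f (\<sigma> \<alpha> x))"
    by (intro PN_sum PN.PN_scale PN_G[OF PN_coord.hyps s_in_G])
  ultimately show ?case
    by (simp only: nat.case) (rule PN.PN_add[OF PN.PN_add[OF _ PN.PN_scale[OF PN_coord.hyps]]])
qed

lemma PN_Dcl: "PN n q \<Longrightarrow> \<phi> \<in> Dcl \<Longrightarrow> (\<lambda>x. \<phi> x * q x) \<in> Dcl"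
proof (induction rule: PN.induct)
  case (PN_scale n f c)
  then show ?case unfolding mult.left_commute[of _ c] by (intro Dcl_scale) auto
next
  case (PN_coord n f \<zeta>)
  then show ?case unfolding mult.left_commute[of _ "of_real (_ \<bullet> \<zeta>)"] by (intro Dcl_coord) auto
qed (auto simp: distrib_left intro: Dcl_add Dcl_zero)

text \<open>A single element of the span has to represent the translates for all a \<ge> b
  simultaneously; the Laplace criterion needs bounds that are uniform in a.\<close>

definition Kgood :: "real \<Rightarrow> real \<Rightarrow> (real ^ 'n \<Rightarrow> complex) \<Rightarrow> bool" where
  "Kgood b m q \<longleftrightarrow> (\<exists>u\<in>cspan (coefs b m) Kbase. \<forall>a\<ge>b. \<forall>x y. Smap (\<lambda>z. gauss a z * q z) x y = u (a, y) x)"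

lemma Kgood_zero: "Kgood b m (\<lambda>x. 0)"
  unfolding Kgood_def using Smap_cmult[of 0 "\<lambda>_. 0"]
  by (intro bexI[of _ "\<lambda>p x. 0"] cspan.zero) simp

text \<open>The step raising the degree rests on
  \<open>2 a \<langle>z, \<zeta>\<rangle> gauss a q = gauss a (T \<zeta> q) - T \<zeta> (gauss a q)\<close>.\<close>

lemma Kgood_step: "PN n q \<Longrightarrow> b > 0 \<Longrightarrow> \<forall>i<n. \<forall>f. PN i f \<longrightarrow> Kgood b m f \<Longrightarrow> Kgood b m q"
proof (induction rule: PN.induct)
  case (PN_one n)
  have "(\<lambda>p x. Kern (fst p) (id x) (snd p)) \<in> cspan (coefs b m) Kbase"
    unfolding Kbase_def by (intro cspan.base CollectI exI[of _ id] conjI refl id_in_G)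
  then show ?case unfolding Kgood_def
    by (rule bexI[rotated]) (use PN_one in \<open>auto simp: Smap_gauss\<close>)
next
  case (PN_zero n)
  show ?case by (rule Kgood_zero)
next
  case (PN_add n f g)
  obtain u v where uv: "u \<in> cspan (coefs b m) Kbase" "v \<in> cspan (coefs b m) Kbase"
    "\<And>a x y. a \<ge> b \<Longrightarrow> Smap (\<lambda>z. gauss a z * f z) x y = u (a, y) x"
    "\<And>a x y. a \<ge> b \<Longrightarrow> Smap (\<lambda>z. gauss a z * g z) x y = v (a, y) x"
    using PN_add.IH(1)[OF PN_add.prems] PN_add.IH(2)[OF PN_add.prems] unfolding Kgood_def by blast
  have "Smap (\<lambda>z. gauss a z * (f z + g z)) x y = u (a, y) x + v (a, y) x" if "a \<ge> b" for a x y
  proof -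
    have "a > 0" using that PN_add.prems(1) by linarith
    then show ?thesis unfolding distrib_left
      by (subst Smap_add) (auto simp: uv that intro: PN_Dcl[OF PN_add.hyps(1)] PN_Dcl[OF PN_add.hyps(2)] Dcl_gauss)
  qed
  then show ?case unfolding Kgood_def using cspan.add[OF uv(1,2)] by (intro bexI[of _ "\<lambda>p x. u p x + v p x"]) auto
next
  case (PN_scale n f c)
  obtain u where u: "u \<in> cspan (coefs b m) Kbase"
    "\<And>a x y. a \<ge> b \<Longrightarrow> Smap (\<lambda>z. gauss a z * f z) x y = u (a, y) x"
    using PN_scale.IH[OF PN_scale.prems] unfolding Kgood_def by blast
  have "Smap (\<lambda>z. gauss a z * (c * f z)) x y = c * u (a, y) x" if "a \<ge> b" for a x y
    unfolding mult.left_commute[of _ c] by (simp add: Smap_cmult u that)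
  then show ?case unfolding Kgood_def using cspan.scale[OF coefs_const u(1)] by (intro bexI[of _ "\<lambda>p x. c * u p x"]) auto
next
  case (PN_coord n q \<zeta>)
  note b = PN_coord.prems(1)
  have "Kgood b m q" using PN_coord.prems(2) PN_coord.hyps by blast
  then obtain u where u: "u \<in> cspan (coefs b m) Kbase"
    "\<And>a x y. a \<ge> b \<Longrightarrow> Smap (\<lambda>z. gauss a z * q z) x y = u (a, y) x" unfolding Kgood_def by blast
  have "Kgood b m (T \<zeta> q)"
  proof (cases n)
    case 0
    then show ?thesis using PN_T[OF PN_coord.hyps, of \<zeta>] Kgood_zero by simp
  next
    case (Suc i)
    then show ?thesis using PN_T[OF PN_coord.hyps, of \<zeta>] PN_coord.prems(2)[rule_format, of i] by simp
  qed
  then obtain v where v: "v \<in> cspan (coefs b m) Kbase"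
    "\<And>a x y. a \<ge> b \<Longrightarrow> Smap (\<lambda>z. gauss a z * T \<zeta> q z) x y = v (a, y) x" unfolding Kgood_def by blast
  have TD: "\<phi> \<in> Dcl \<Longrightarrow> (\<lambda>x. \<phi> x * T \<zeta> q x) \<in> Dcl" for \<phi>
    using PN_T[OF PN_coord.hyps, of \<zeta>] PN_Dcl[of _ "T \<zeta> q"] by (cases n) (auto simp: Dcl_zero)
  have "Smap (\<lambda>z. gauss a z * (of_real (z \<bullet> \<zeta>) * q z)) x y
      = of_real (- 1 / (2 * a)) * (T \<zeta> (u (a, y)) x + (- 1) * v (a, y) x)" if a: "a \<ge> b" for a x y
  proof -
    have a0: "a > 0" using a b by linarith
    note gD = Dcl_gauss[OF a0]
    have qD: "(\<lambda>z. gauss a z * q z) \<in> Dcl" by (rule PN_Dcl[OF PN_coord.hyps gD])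
    have "gauss a z * (of_real (z \<bullet> \<zeta>) * q z)
      = of_real (- 1 / (2 * a)) * (T \<zeta> (\<lambda>z. gauss a z * q z) z + (- 1) * (gauss a z * T \<zeta> q z))" for z
      unfolding T_gauss_mult[OF PN_diff[OF PN_coord.hyps]] using a0 by (simp add: field_simps)
    then have "Smap (\<lambda>z. gauss a z * (of_real (z \<bullet> \<zeta>) * q z)) x y
      = of_real (- 1 / (2 * a)) * (Smap (T \<zeta> (\<lambda>z. gauss a z * q z)) x y + (- 1) * Smap (\<lambda>z. gauss a z * T \<zeta> q z) x y)"
      by (simp only: Smap_cmult Smap_add[OF Dcl_T[OF qD] Dcl_scale[OF TD[OF gD]]])
    then show ?thesis by (simp only: Smap_T[OF qD] u(2)[OF a] v(2)[OF a])
  qed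
  moreover have "(\<lambda>p x. of_real (- 1 / (2 * fst p)) * (T \<zeta> (u p) x + (- 1) * v p x)) \<in> cspan (coefs b m) Kbase"
    by (rule cspan.scale[OF coefs_inverse[OF b] cspan.add[OF Kspan_T(2)[OF b u(1)] cspan.scale[OF coefs_const v(1)]]])
  ultimately show ?case unfolding Kgood_def by (intro bexI) auto
qed

lemma Kgood: "PN n q \<Longrightarrow> b > 0 \<Longrightarrow> Kgood b m q"
proof (induction n arbitrary: q rule: less_induct)
  case (less n)
  show ?case by (rule Kgood_step[OF less.prems]) (use less in auto)
qed

lemma Smap_decay: assumes "PN n q" "b > 0"
  shows "\<exists>C M. \<forall>a y D. b \<le> a \<longrightarrow> norm y \<le> m \<longrightarrow> D \<ge> 0 \<longrightarrow> (\<forall>g\<in>G. D \<le> norm (g x - y)) \<longrightarrow>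
    norm (Smap (\<lambda>z. gauss a z * q z) x y) \<le> C * (1 + a) ^ M * exp (- a * D\<^sup>2)"
proof -
  obtain u where u: "u \<in> cspan (coefs b m) Kbase" "\<And>a x y. a \<ge> b \<Longrightarrow> Smap (\<lambda>z. gauss a z * q z) x y = u (a, y) x"
    using Kgood[OF assms] unfolding Kgood_def by blast
  obtain C M where "\<And>a y D. b \<le> a \<Longrightarrow> norm y \<le> m \<Longrightarrow> D \<ge> 0 \<Longrightarrow> (\<forall>g\<in>G. D \<le> norm (g x - y)) \<Longrightarrow>
    norm (u (a, y) x) \<le> C * (1 + a) ^ M * exp (- a * D\<^sup>2)" using Kspan_bound[OF assms(2) u(1)] by blast
  then show ?thesis using u(2) by (intro exI[of _ C] exI[of _ M]) simp
qed

end

section \<open>The support of a translate\<close>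

text \<open>The complement of the support is a union of possibly uncountably many open sets on which
  f vanishes almost everywhere; Lindelof's theorem reduces it to countably many of them.\<close>

lemma AE_ess_support:
  fixes f :: "'a::second_countable_topology \<Rightarrow> complex"
  shows "AE x in M. x \<notin> ess_support M f \<longrightarrow> f x = 0"
proof -
  define \<U> where "\<U> = {U. open U \<and> (AE x in M. x \<in> U \<longrightarrow> f x = 0)}"
  obtain \<V> where \<V>: "\<V> \<subseteq> \<U>" "countable \<V>" "\<Union>\<V> = \<Union>\<U>"
    using Lindelof[of \<U>] by (auto simp: \<U>_def)
  have "AE x in M. \<forall>U\<in>\<V>. x \<in> U \<longrightarrow> f x = 0"
    using \<V>(1) by (subst AE_ball_countable[OF \<V>(2)]) (auto simp: \<U>_def)
  then show ?thesis
  proof eventually_elim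
    case (elim x)
    have "ess_support M f = - \<Union>\<V>" unfolding ess_support_def \<V>(3) by (simp add: \<U>_def)
    then show ?case using elim by blast
  qed
qed

lemma AE_norm_neq: "AE x in (lborel :: 'a::euclidean_space measure). (norm x)\<^sup>2 \<noteq> t"
proof -
  have "{x :: 'a. \<not> (norm x)\<^sup>2 \<noteq> t} \<subseteq> sphere 0 (sqrt t)"
    by (auto simp: real_sqrt_unique)
  then have "AE x :: 'a in lebesgue. (norm x)\<^sup>2 \<noteq> t"
    unfolding eventually_ae_filter_negligible by (intro exI[of _ "sphere 0 (sqrt t)"] conjI negligible_sphere) assumption
  then show ?thesis unfolding AE_completion_iff .
qed

context dunkl
begin

lemma Finv_translate:
  "Finv (\<lambda>\<xi>. e \<xi> x * F \<phi> \<xi>) y = Smap \<phi> x (- y)"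
  unfolding Finv_eq F_def[of _ "- y"] Smap_def eint_def
  by (simp add: e_symmetric[of y] e_symmetric[of x] mult.left_commute)

text \<open>The Laplace variable is \<open>(norm z)\<^sup>2\<close>, so the rate is
  \<open>\<rho>\<^sup>2\<close>. The fixed Gaussian with parameter b makes the integrand integrable
  at a = 0 and keeps the total parameter a + b at least b, as the estimate of the translates
  requires.\<close>

lemma vanishing_near_0:
  assumes h: "h \<in> L2_space mu" and v: "integrable mu v"
    and hv: "\<And>\<phi>. \<phi> \<in> Dcl \<Longrightarrow> (\<integral>z. h z * \<phi> z \<partial>mu) = (\<integral>y. v y * Smap \<phi> x (- y) \<partial>mu)"
    and supp: "\<And>y g. v y \<noteq> 0 \<Longrightarrow> g \<in> G \<Longrightarrow> \<rho> \<le> norm (g x - (- y))" "\<And>y. v y \<noteq> 0 \<Longrightarrow> norm y \<le> m"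
    and \<rho>: "\<rho> > 0" and t: "t < \<rho>\<^sup>2"
  shows "AE z in mu. (norm z)\<^sup>2 < t \<longrightarrow> h z = 0"
proof -
  have [measurable]: "h \<in> borel_measurable borel" using L2_measurable[OF h] by simp
  define ht where "ht z = of_real (if (norm z)\<^sup>2 < t then 1 else 0) * h z" for z
  have htL: "ht \<in> L2_space mu"
  proof (rule L2_bound[OF _ h, of _ 1])
    show "ht \<in> borel_measurable mu" unfolding ht_def by measurable
  qed (auto simp: ht_def)
  have vm [measurable]: "v \<in> borel_measurable borel" using borel_measurable_integrable[OF v] by simp
  have base: "(\<integral>z. ht z * (gauss b z * q z) \<partial>mu) = 0" if q: "PN n q" and b: "b > 0" for n q b
  proof -
    obtain C M where CM: "\<And>a y D. b \<le> a \<Longrightarrow> norm y \<le> m \<Longrightarrow> D \<ge> 0 \<Longrightarrow> (\<forall>g\<in>G. D \<le> norm (g x - y)) \<Longrightarrow>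
      norm (Smap (\<lambda>z. gauss a z * q z) x y) \<le> C * (1 + a) ^ M * exp (- a * D\<^sup>2)"
      using Smap_decay[OF q b, of m x] by blast
    define V where "V = (\<integral>y. norm (v y) \<partial>mu)"
    have gq: "(\<lambda>z. gauss a z * q z) \<in> Dcl" if "a > 0" for a by (rule PN_Dcl[OF q Dcl_gauss[OF that]])
    have gqL: "(\<lambda>z. gauss b z * q z) \<in> L2_space mu" using gq[OF b] Dcl_L2 by blast
    have "(\<integral>z. of_real (if (norm z)\<^sup>2 < t then 1 else 0) * (h z * (gauss b z * q z)) \<partial>mu) = 0"
    \<comment> \<open>The constant contains (1 + b) ^ M because 1 + (a + b) \<le> (1 + b) * (1 + a)
      splits off the shift by b.\<close>
    proof (rule laplace_vanishing[where C = "V * (\<bar>C\<bar> * (1 + b) ^ M)" and N = M and \<rho> = "\<rho>\<^sup>2"])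
      show "integrable mu (\<lambda>z. h z * (gauss b z * q z))" by (rule L2_mult(1)[OF h gqL])
      show "AE z in mu. (norm z)\<^sup>2 \<noteq> t" unfolding AE_mu by (rule AE_norm_neq)
      show "t < \<rho>\<^sup>2" by fact
      fix a :: real assume a: "a \<ge> 0"
      have ab: "a + b > 0" "b \<le> a + b" using a b by auto
      have "of_real (exp (- a * (norm z)\<^sup>2)) * (h z * (gauss b z * q z)) = h z * (gauss (a + b) z * q z)" for z
        unfolding gauss_mult[symmetric] gauss_def[of a] by (simp add: mult.left_commute mult.assoc)
      then have "(\<integral>z. of_real (exp (- a * (norm z)\<^sup>2)) * (h z * (gauss b z * q z)) \<partial>mu)
        = (\<integral>y. v y * Smap (\<lambda>z. gauss (a + b) z * q z) x (- y) \<partial>mu)"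
        by (simp only: hv[OF gq[OF ab(1)]])
      also have "norm \<dots> \<le> (\<integral>y. norm (v y) * (\<bar>C\<bar> * (1 + b) ^ M * (1 + a) ^ M * exp (- a * \<rho>\<^sup>2)) \<partial>mu)"
      proof (rule order_trans[OF Bochner_Integration.integral_norm_bound integral_mono'])
        show "integrable mu (\<lambda>y. norm (v y) * (\<bar>C\<bar> * (1 + b) ^ M * (1 + a) ^ M * exp (- a * \<rho>\<^sup>2)))"
          using v by simp
        fix y
        show "norm (v y * Smap (\<lambda>z. gauss (a + b) z * q z) x (- y)) \<le> norm (v y) * (\<bar>C\<bar> * (1 + b) ^ M * (1 + a) ^ M * exp (- a * \<rho>\<^sup>2))"
        proof (cases "v y = 0")
          case False
          have "norm (Smap (\<lambda>z. gauss (a + b) z * q z) x (- y)) \<le> C * (1 + (a + b)) ^ M * exp (- (a + b) * \<rho>\<^sup>2)"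
            using False supp \<rho> by (intro CM ab) auto
          also have "\<dots> \<le> \<bar>C\<bar> * ((1 + b) * (1 + a)) ^ M * exp (- a * \<rho>\<^sup>2)"
          proof (intro mult_mono power_mono)
            show "1 + (a + b) \<le> (1 + b) * (1 + a)" using a b by (simp add: algebra_simps)
            show "exp (- (a + b) * \<rho>\<^sup>2) \<le> exp (- a * \<rho>\<^sup>2)" using b by (simp add: left_diff_distrib)
          qed (use a b in auto)
          finally show ?thesis unfolding norm_mult by (intro mult_left_mono) (simp_all add: power_mult_distrib mult_ac)
        qed simp
        show "0 \<le> norm (v y) * (\<bar>C\<bar> * (1 + b) ^ M * (1 + a) ^ M * exp (- a * \<rho>\<^sup>2))" using a b by simp
      qed
      also have "\<dots> = V * (\<bar>C\<bar> * (1 + b) ^ M * (1 + a) ^ M * exp (- a * \<rho>\<^sup>2))"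
        unfolding V_def by (rule integral_mult_left_zero)
      finally show "norm (\<integral>z. of_real (exp (- a * (norm z)\<^sup>2)) * (h z * (gauss b z * q z)) \<partial>mu)
          \<le> V * (\<bar>C\<bar> * (1 + b) ^ M) * (1 + a) ^ M * exp (- a * \<rho>\<^sup>2)" by (simp add: mult.assoc)
    qed auto
    then show ?thesis by (simp add: ht_def mult.assoc)
  qed
  \<comment> \<open>With the polynomial factor q universally quantified, the coordinate case of the
    induction can move its coordinate into q, and everything reduces to a single Gaussian times a
    polynomial.\<close>
  have all: "\<forall>n q. PN n q \<longrightarrow> (\<integral>z. ht z * (\<phi> z * q z) \<partial>mu) = 0" if "\<phi> \<in> Dcl" for \<phi>
    using that
  proof (induction rule: Dcl_induct)
    case (gauss b)
    then show ?case using base by blast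
  next
    case (add f g)
    have L: "(\<lambda>z. f z * q z) \<in> L2_space mu" "(\<lambda>z. g z * q z) \<in> L2_space mu" if "PN n q" for n q
      using PN_Dcl[OF that add.hyps(1)] PN_Dcl[OF that add.hyps(2)] Dcl_L2 by blast+
    show ?case
    proof (intro allI impI)
      fix n q assume q: "PN n q"
      have "(\<integral>z. ht z * ((f z + g z) * q z) \<partial>mu) = (\<integral>z. ht z * (f z * q z) + ht z * (g z * q z) \<partial>mu)"
        by (simp add: distrib_left distrib_right)
      also have "\<dots> = (\<integral>z. ht z * (f z * q z) \<partial>mu) + (\<integral>z. ht z * (g z * q z) \<partial>mu)"
        by (rule Bochner_Integration.integral_add[OF L2_mult(1)[OF htL L(1)[OF q]] L2_mult(1)[OF htL L(2)[OF q]]])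
      finally show "(\<integral>z. ht z * ((f z + g z) * q z) \<partial>mu) = 0" using add.IH q by simp
    qed
  next
    case (scale c f)
    have "ht z * (c * f z * q z) = c * (ht z * (f z * q z))" for z q by (simp add: mult_ac)
    then show ?case using scale.IH by (simp only: integral_mult_right_zero) simp
  next
    case (coord \<zeta> f)
    show ?case
    proof (intro allI impI)
      fix n q assume "PN n q"
      then have "(\<integral>z. ht z * (f z * (of_real (z \<bullet> \<zeta>) * q z)) \<partial>mu) = 0" using coord.IH PN_coord by blast
      then show "(\<integral>z. ht z * (of_real (z \<bullet> \<zeta>) * f z * q z) \<partial>mu) = 0" by (simp add: mult_ac)
    qed
  qed simp
  have "AE z in mu. ht z = 0"
  proof (rule Dcl_total[OF htL])
    fix \<phi> assume "\<phi> \<in> Dcl"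
    from all[OF this] PN_one[of 0] have "(\<integral>z. ht z * (\<phi> z * 1) \<partial>mu) = 0" by blast
    then show "(\<integral>z. ht z * \<phi> z \<partial>mu) = 0" by simp
  qed
  then show ?thesis by eventually_elim (simp add: ht_def split: if_splits)
qed

lemma L2_e_mult: assumes u: "u \<in> L2_space mu" shows "(\<lambda>\<xi>. e \<xi> x * u \<xi>) \<in> L2_space mu"
proof (rule L2_bound[OF _ u])
  have [measurable]: "u \<in> borel_measurable borel" using L2_measurable[OF u] by simp
  show "(\<lambda>\<xi>. e \<xi> x * u \<xi>) \<in> borel_measurable mu" by measurable
  show "AE \<xi> in mu. norm (e \<xi> x * u \<xi>) \<le> cG * norm (u \<xi>)"
    unfolding norm_mult by (intro AE_I2 mult_right_mono e_bound) simp
qed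

lemma translation_vanishes:
  fixes x :: "real ^ 'n"
  assumes f: "f \<in> L2_space mu" and supp: "AE z in mu. r < norm z \<longrightarrow> f z = 0"
    and r: "r > 0" "r < \<rho>"
  defines "H \<equiv> ext Finv (\<lambda>\<xi>. e \<xi> x * ext F f \<xi>)"
  shows "AE y in mu. norm y \<le> m \<longrightarrow> (\<forall>g\<in>G. \<rho> \<le> norm (g x - y)) \<longrightarrow> H (- y) = 0"
proof -
  have FF: "fourier_op F" "fourier_op Finv" by (simp_all add: fourier_op_def)
  define S where "S = cball 0 m \<inter> (\<Inter>g\<in>G. {y. \<rho> \<le> norm (g x - y)})"
  have "closed {y. \<rho> \<le> norm (g x - y)}" for g by (intro closed_Collect_le continuous_intros)
  then have "closed S" unfolding S_def by (intro closed_Int closed_INT closed_cball ballI)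
  then have [measurable]: "S \<in> sets borel" by (rule borel_closed)
  have H: "H \<in> L2_space mu" unfolding H_def by (intro ext_L2 FF L2_e_mult f)
  have Hm [measurable]: "H \<in> borel_measurable borel" using L2_measurable[OF H] by simp
  have cHm [measurable]: "(\<lambda>y. cnj (H y)) \<in> borel_measurable borel" using L2_measurable[OF L2_cnj[OF H]] by simp
  \<comment> \<open>The claim concerns H (- y) for y in S, hence the sign. The bound m on S makes v
    integrable and not merely square integrable.\<close>
  define v where "v y = (if - y \<in> S then cnj (H y) else 0)" for y
  have vm [measurable]: "v \<in> borel_measurable borel" unfolding v_def by measurable
  have vL: "v \<in> L2_space mu"
    by (rule L2_bound[OF _ H, of _ 1]) (auto simp: v_def)
  have vS: "v y \<noteq> 0 \<Longrightarrow> - y \<in> S" for y by (simp add: v_def split: if_splits)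
  have v1: "integrable mu v"
  proof -
    have "(\<lambda>y. complex_of_real (indicator (cball 0 m) y)) \<in> L2_space mu"
      using integrable_mu_indicator[of 1 m] unfolding L2_space_def
      by (auto simp: norm_of_real intro!: measurable_compose[OF borel_measurable_indicator borel_measurable_of_real])
    from L2_mult(1)[OF vL this] have "integrable mu (\<lambda>y. v y * complex_of_real (indicator (cball 0 m) y))" .
    moreover have "v y * complex_of_real (indicator (cball 0 m) y) = v y" for y
      using vS[of y] by (cases "v y = 0") (auto simp: S_def)
    ultimately show ?thesis by simp
  qed
  define h where "h = ext F (\<lambda>\<xi>. e \<xi> x * ext Finv v \<xi>)"
  have eF: "(\<lambda>\<xi>. e \<xi> x * ext F f \<xi>) \<in> L2_space mu" and eFv: "(\<lambda>\<xi>. e \<xi> x * ext Finv v \<xi>) \<in> L2_space mu"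
    by (intro L2_e_mult ext_L2 FF f vL)+
  have hL: "h \<in> L2_space mu" unfolding h_def by (rule ext_L2[OF FF(1) eFv])
  have "(\<integral>y. H y * v y \<partial>mu) = (\<integral>\<xi>. (e \<xi> x * ext F f \<xi>) * ext Finv v \<xi> \<partial>mu)"
    unfolding H_def by (rule ext_pairing[OF FF(2) eF vL])
  also have "\<dots> = (\<integral>\<xi>. ext F f \<xi> * (e \<xi> x * ext Finv v \<xi>) \<partial>mu)" by (simp add: mult_ac)
  also have "\<dots> = (\<integral>z. f z * h z \<partial>mu)" unfolding h_def by (rule ext_pairing[OF FF(1) f eFv])
  finally have Hv: "(\<integral>y. H y * v y \<partial>mu) = (\<integral>z. f z * h z \<partial>mu)" .
  have h\<phi>: "(\<integral>z. h z * \<phi> z \<partial>mu) = (\<integral>y. v y * Smap \<phi> x (- y) \<partial>mu)" if \<phi>: "\<phi> \<in> Dcl" for \<phi>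
  proof -
    define w where "w \<xi> = e \<xi> x * F \<phi> \<xi>" for \<xi>
    have w: "rap w" "w \<in> borel_measurable borel" unfolding w_def by (rule Smap_rap[OF \<phi>])+
    have "(\<integral>z. h z * \<phi> z \<partial>mu) = (\<integral>\<xi>. (e \<xi> x * ext Finv v \<xi>) * F \<phi> \<xi> \<partial>mu)"
      unfolding h_def by (rule ext_Dcl_pairing[OF FF(1) eFv \<phi>])
    also have "\<dots> = (\<integral>\<xi>. ext Finv v \<xi> * w \<xi> \<partial>mu)" by (simp add: w_def mult_ac)
    also have "\<dots> = (\<integral>y. v y * ext Finv w y \<partial>mu)" by (rule ext_pairing[OF FF(2) vL L2_rap[OF w]])
    also have "\<dots> = (\<integral>y. v y * Finv w y \<partial>mu)"
    proof (rule integral_cong_AE)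
      have [measurable]: "w \<in> borel_measurable borel" by (rule w)
      have [measurable]: "ext Finv w \<in> borel_measurable borel" using L2_measurable[OF ext_L2[OF FF(2) L2_rap[OF w]]] by simp
      show "(\<lambda>y. v y * ext Finv w y) \<in> borel_measurable mu" "(\<lambda>y. v y * Finv w y) \<in> borel_measurable mu"
        by (measurable, simp add: Finv_F, measurable)
      show "AE y in mu. v y * ext Finv w y = v y * Finv w y"
        using ext_rap[OF FF(2) w] by eventually_elim simp
    qed
    finally show ?thesis unfolding w_def Finv_translate .
  qed
  \<comment> \<open>Any level strictly between the squares of r and \<rho> serves: below it h
    vanishes, and it leaves room for all points of norm at most r.\<close>
  define t where "t = (r\<^sup>2 + \<rho>\<^sup>2) / 2"
  have "r\<^sup>2 < \<rho>\<^sup>2" using r by (intro power_strict_mono) auto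
  then have t: "r\<^sup>2 < t" "t < \<rho>\<^sup>2" by (simp_all add: t_def)
  have "AE z in mu. (norm z)\<^sup>2 < t \<longrightarrow> h z = 0"
  proof (rule vanishing_near_0[where x = x and m = m, OF hL v1 h\<phi> _ _ _ t(2)])
    show "\<rho> \<le> norm (g x - (- y))" if "v y \<noteq> 0" "g \<in> G" for y g using vS[OF that(1)] that(2) unfolding S_def by blast
    show "norm y \<le> m" if "v y \<noteq> 0" for y using vS[OF that] by (simp add: S_def)
    show "\<rho> > 0" using r by simp
  qed
  then have "AE z in mu. f z * h z = 0"
    using supp
  proof eventually_elim
    case (elim z)
    show ?case
    proof (cases "r < norm z")
      case True
      then show ?thesis using elim by simp
    next
      case False
      then have "(norm z)\<^sup>2 \<le> r\<^sup>2" by (intro power_mono) auto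
      then show ?thesis using elim t by simp
    qed
  qed
  then have "(\<integral>z. f z * h z \<partial>mu) = 0" by (rule integral_eq_zero_AE)
  moreover have "(\<integral>y. H y * v y \<partial>mu) = of_real (sqint mu v)"
  proof -
    have "H y * v y = of_real ((norm (v y))\<^sup>2)" for y unfolding complex_norm_square by (simp add: v_def)
    then show ?thesis by (simp only: integral_complex_of_real)
  qed
  ultimately have "sqint mu v = 0" using Hv by simp
  then have "AE y in mu. (norm (v y))\<^sup>2 = 0"
    by (subst (asm) integral_nonneg_eq_0_iff_AE[OF L2_integrable[OF vL]]) auto
  then have "AE y in mu. v (- y) = 0"
    by (intro AE_mu_uminus) (simp_all)
  then show ?thesis
    by eventually_elim (auto simp: v_def S_def split: if_splits)
qed

text \<open>\<open>translation_vanishes\<close> needs a bound on y and a positive gap beyond r. As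
  the orbit is finite, each point outside the union of the balls has such a gap, and the countably
  many choices of a bound i and a gap 1 / Suc j exhaust the complement, so the exceptional null sets
  can be united.\<close>

lemma translation_support:
  assumes f: "f \<in> L2_space mu" and r: "r > 0" and supp: "ess_support mu f \<subseteq> cball 0 r"
  shows "ess_support mu (\<lambda>y. dunkl_translation R k x f (- y)) \<subseteq> (\<Union>g\<in>G. cball (g x) r)"
proof -
  define H where "H = ext Finv (\<lambda>\<xi>. e \<xi> x * ext F f \<xi>)"
  have H: "dunkl_translation R k x f = H"
    unfolding dunkl_translation_def H_def dunkl_kernel_e ..
  have f0: "AE z in mu. r < norm z \<longrightarrow> f z = 0"
    using AE_ess_support[of mu f]
  proof eventually_elim
    case (elim z)
    show ?case
    proof
      assume "r < norm z"
      then have "z \<notin> ess_support mu f" using supp by auto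
      then show "f z = 0" using elim by blast
    qed
  qed
  define U where "U = - (\<Union>g\<in>G. cball (g x) r)"
  have "closed (\<Union>g\<in>G. cball (g x) r)" by (intro closed_UN finite_G closed_cball ballI)
  then have "open U" unfolding U_def by (rule open_Compl)
  moreover have "AE y in mu. y \<in> U \<longrightarrow> H (- y) = 0"
  proof -
    have "AE y in mu. norm y \<le> real i \<longrightarrow> (\<forall>g\<in>G. r + 1 / real (Suc j) \<le> norm (g x - y)) \<longrightarrow> H (- y) = 0" for i j
      unfolding H_def by (rule translation_vanishes[OF f f0 r]) simp
    then have "AE y in mu. \<forall>i j. norm y \<le> real i \<longrightarrow> (\<forall>g\<in>G. r + 1 / real (Suc j) \<le> norm (g x - y)) \<longrightarrow> H (- y) = 0"
      by (simp only: AE_all_countable) blast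
    then show ?thesis
    proof eventually_elim
      case (elim y)
      show ?case
      proof
        assume y: "y \<in> U"
        define d where "d = Min ((\<lambda>g. norm (g x - y)) ` G)"
        have fin: "finite ((\<lambda>g. norm (g x - y)) ` G)" "(\<lambda>g. norm (g x - y)) ` G \<noteq> {}"
          using finite_G id_in_G by (auto simp del: id_in_G)
        have "d \<in> (\<lambda>g. norm (g x - y)) ` G" unfolding d_def by (rule Min_in[OF fin])
        then have "r < d" using y by (auto simp: U_def dist_norm)
        then obtain j where j: "1 / real (Suc j) < d - r" using reals_Archimedean[of "d - r"] by (auto simp: inverse_eq_divide)
        obtain i where "norm y \<le> real i" using real_arch_simple by blast
        moreover have "\<forall>g\<in>G. r + 1 / real (Suc j) \<le> norm (g x - y)"
        proof
          fix g assume "g \<in> G"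
          then have "d \<le> norm (g x - y)" unfolding d_def by (intro Min_le fin) auto
          then show "r + 1 / real (Suc j) \<le> norm (g x - y)" using j by linarith
        qed
        ultimately show "H (- y) = 0" using elim by blast
      qed
    qed
  qed
  ultimately have "U \<subseteq> - ess_support mu (\<lambda>y. H (- y))" unfolding ess_support_def by blast
  then show ?thesis unfolding H U_def by blast
qed

end

theorem theorem1p5:
  fixes R :: "(real ^ 'n) set"
    and k :: "real ^ 'n \<Rightarrow> real"
    and r :: real
    and f :: "real ^ 'n \<Rightarrow> complex"
    and x :: "real ^ 'n"
  assumes "normalized_reduced_root_system R"
    and "multiplicity_function R k"
    and "r > 0"
    and "f \<in> L2_space (dunkl_measure R k)"
    and "ess_support (dunkl_measure R k) f \<subseteq> cball 0 r"
  shows "ess_support (dunkl_measure R k) (\<lambda>y. dunkl_translation R k x f (- y))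
           \<subseteq> (\<Union>\<sigma>\<in>reflection_group R. cball (\<sigma> x) r)"
proof -
  interpret dunkl R k by standard (rule assms)+
  show ?thesis by (rule translation_support[OF assms(4,3,5)])
qed

end
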